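(* Let $\mathsf{k}$ be a field, let $E$ and $F$ be finite directed graphs and let $\phi:K_0^{\mathrm{gr}}(L_{\mathsf{k}}(E))\to K_0^{\mathrm{gr}}(L_{\mathsf{k}}(F))$ be a preordered (i.e. order preserving) $\mathbb Z[x,x^{-1}]$-module homomorphism with $\phi([L_{\mathsf{k}}(E)])=[L_{\mathsf{k}}(F)]$. Then there exists a unital $\mathbb Z$-graded $\mathsf{k}$-algebra homomorphism $\psi:L_{\mathsf{k}}(E)\to L_{\mathsf{k}}(F)$ such that $K_0^{\mathrm{gr}}(\psi)=\phi$. Furthermore, if $\phi$ is injective, so is $\psi$.
   Context: $E=(E^0,E^1,r,s)$ is a directed graph with vertices $E^0$, edges $E^1$, range and source maps $r,s$. The Leavitt path algebra $L_{\mathsf{k}}(E)$ of a finite graph $E$ is the $\mathsf{k}$-algebra generated by $\{v,e,e^*\mid v\in E^0,e\in E^1\}$ with relations: $uv=\delta_{uv}u$; $s(e)e=e=e\,r(e)$, $r(e)e^*=e^*=e^*s(e)$; $\sum_{e\in s^{-1}(v)}ee^*=v$ for every $v$ with $s^{-1}(v)\neq\emptyset$; $e^*f=\delta_{ef}r(e)$ for $e,f\in E^1$. It is $\mathbb Z$-graded by $\deg v=0$, $\deg e=1$, $\deg e^*=-1$. For a $\mathbb Z$-graded unital ring $R$, $\mathcal V^{\mathrm{gr}}(R)$ is the monoid of graded isomorphism classes of graded finitely generated projective left $R$-modules under $\oplus$, and $K_0^{\mathrm{gr}}(R)$ is its group completion; it is a $\mathbb Z[x,x^{-1}]$-module via $x^n[P]=[P(n)]$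 where $P(n)_k=P_{n+k}$. It is preordered with positive cone the image of $\mathcal V^{\mathrm{gr}}(R)$; a homomorphism is preordered (order preserving) if it maps the positive cone into the positive cone. A graded homomorphism $\psi:R\to S$ induces $K_0^{\mathrm{gr}}(\psi)$ by $[P]\mapsto[S\otimes_RP]$. *)

theory Defs
  imports
    "HOL-Algebra.QuotRing"
    "HOL-Algebra.Module"
    "HOL-Algebra.Generated_Groups"
    "HOL-Algebra.Free_Abelian_Groups"
    "Graph_Theory.Digraph"
begin

section \<open>Graded rings, algebras and left modules\<close>

text \<open>
  The same record serves for a graded algebra (scalars from the base field) and for a graded left
  module over a graded ring (scalars from that ring; the fields \<open>mult\<close> and \<open>one\<close> are then junk).
\<close>

record ('s, 'a) gmodule = "('s, 'a) module" +
  grade :: "int \<Rightarrow> 'a set"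

text \<open>The library's \<^locale>\<open>module\<close> is restricted to commutative rings.\<close>

locale left_module = R?: ring R + M?: abelian_group M for R (structure) and M (structure) +
  assumes smult_closed: "\<lbrakk>a \<in> carrier R; x \<in> carrier M\<rbrakk> \<Longrightarrow> a \<odot>\<^bsub>M\<^esub> x \<in> carrier M"
    and smult_l_distr: "\<lbrakk>a \<in> carrier R; b \<in> carrier R; x \<in> carrier M\<rbrakk> \<Longrightarrow>
      (a \<oplus>\<^bsub>R\<^esub> b) \<odot>\<^bsub>M\<^esub> x = a \<odot>\<^bsub>M\<^esub> x \<oplus>\<^bsub>M\<^esub> b \<odot>\<^bsub>M\<^esub> x"
    and smult_r_distr: "\<lbrakk>a \<in> carrier R; x \<in> carrier M; y \<in> carrier M\<rbrakk> \<Longrightarrow>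
      a \<odot>\<^bsub>M\<^esub> (x \<oplus>\<^bsub>M\<^esub> y) = a \<odot>\<^bsub>M\<^esub> x \<oplus>\<^bsub>M\<^esub> a \<odot>\<^bsub>M\<^esub> y"
    and smult_assoc: "\<lbrakk>a \<in> carrier R; b \<in> carrier R; x \<in> carrier M\<rbrakk> \<Longrightarrow>
      (a \<otimes>\<^bsub>R\<^esub> b) \<odot>\<^bsub>M\<^esub> x = a \<odot>\<^bsub>M\<^esub> (b \<odot>\<^bsub>M\<^esub> x)"
    and smult_one: "x \<in> carrier M \<Longrightarrow> \<one>\<^bsub>R\<^esub> \<odot>\<^bsub>M\<^esub> x = x"

locale graded_left_module = left_module R M for R (structure) and M (structure) +
  assumes grade_subgroup: "subgroup (grade M n) (add_monoid M)"
    and grade_decomp: "x \<in> carrier M \<Longrightarrow>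
      \<exists>!f. (\<forall>n. f n \<in> grade M n) \<and> finite {n. f n \<noteq> \<zero>\<^bsub>M\<^esub>} \<and>
           x = (\<Oplus>\<^bsub>M\<^esub>n \<in> {n. f n \<noteq> \<zero>\<^bsub>M\<^esub>}. f n)"
    and grade_smult: "\<lbrakk>a \<in> grade R m; x \<in> grade M n\<rbrakk> \<Longrightarrow> a \<odot>\<^bsub>M\<^esub> x \<in> grade M (m + n)"

definition gr_hom ::
  "('k, 'r, 'm) gmodule_scheme \<Rightarrow> ('r, 'a, 'n) gmodule_scheme \<Rightarrow> ('r, 'b, 'o) gmodule_scheme \<Rightarrow> ('a \<Rightarrow> 'b) set"
  where "gr_hom R M N = {f. f \<in> carrier M \<rightarrow> carrier N \<and>
    (\<forall>x \<in> carrier M. \<forall>y \<in> carrier M. f (x \<oplus>\<^bsub>M\<^esub> y) = f x \<oplus>\<^bsub>N\<^esub> f y) \<and>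
    (\<forall>a \<in> carrier R. \<forall>x \<in> carrier M. f (a \<odot>\<^bsub>M\<^esub> x) = a \<odot>\<^bsub>N\<^esub> f x) \<and>
    (\<forall>n. f ` grade M n \<subseteq> grade N n)}"

definition gr_iso ::
  "('k, 'r, 'm) gmodule_scheme \<Rightarrow> ('r, 'a, 'n) gmodule_scheme \<Rightarrow> ('r, 'b, 'o) gmodule_scheme \<Rightarrow> bool"
  where "gr_iso R M N \<longleftrightarrow>
    (\<exists>f \<in> gr_hom R M N. bij_betw f (carrier M) (carrier N) \<and>
       inv_into (carrier M) f \<in> gr_hom R N M)"

definition gr_alg_hom ::
  "('k, 'c) ring_scheme \<Rightarrow> ('k, 'r, 'm) gmodule_scheme \<Rightarrow> ('k, 's, 'n) gmodule_scheme \<Rightarrow> ('r \<Rightarrow> 's) set"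
  where "gr_alg_hom K R S = {\<psi> \<in> ring_hom R S.
    (\<forall>c \<in> carrier K. \<forall>a \<in> carrier R. \<psi> (c \<odot>\<^bsub>R\<^esub> a) = c \<odot>\<^bsub>S\<^esub> \<psi> a) \<and>
    (\<forall>n. \<psi> ` grade R n \<subseteq> grade S n)}"

definition gr_regular :: "('k, 'r, 'm) gmodule_scheme \<Rightarrow> ('r, 'r) gmodule"
  where "gr_regular R = \<lparr>carrier = carrier R, monoid.mult = monoid.mult R,
    monoid.one = monoid.one R, ring.zero = ring.zero R, add = add R, smult = monoid.mult R, grade = grade R\<rparr>"

text \<open>\<open>P(n)\<close>\<close>

definition gr_shift :: "int \<Rightarrow> ('r, 'a) gmodule \<Rightarrow> ('r, 'a) gmodule"
  where "gr_shift n P = P\<lparr>grade := \<lambda>k. grade P (n + k)\<rparr>"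

definition gr_dsum :: "('r, 'a) gmodule \<Rightarrow> ('r, 'b) gmodule \<Rightarrow> ('r, 'a \<times> 'b) gmodule"
  where "gr_dsum M N = \<lparr>carrier = carrier M \<times> carrier N, monoid.mult = undefined, monoid.one = undefined,
    ring.zero = (\<zero>\<^bsub>M\<^esub>, \<zero>\<^bsub>N\<^esub>),
    add = (\<lambda>(x, y) (x', y'). (x \<oplus>\<^bsub>M\<^esub> x', y \<oplus>\<^bsub>N\<^esub> y')),
    smult = (\<lambda>a (x, y). (a \<odot>\<^bsub>M\<^esub> x, a \<odot>\<^bsub>N\<^esub> y)),
    grade = (\<lambda>n. grade M n \<times> grade N n)\<rparr>"

text \<open>The graded free module \<open>\<Oplus>\<^sub>j\<^sub>\<in>\<^sub>J R(\<alpha> j)\<close>\<close>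

definition gr_free :: "('k, 'r, 'm) gmodule_scheme \<Rightarrow> 'j set \<Rightarrow> ('j \<Rightarrow> int) \<Rightarrow> ('r, 'j \<Rightarrow> 'r) gmodule"
  where "gr_free R J \<alpha> = \<lparr>
    carrier = {f. (\<forall>j. f j \<in> carrier R) \<and> finite {j. f j \<noteq> \<zero>\<^bsub>R\<^esub>} \<and> {j. f j \<noteq> \<zero>\<^bsub>R\<^esub>} \<subseteq> J},
    monoid.mult = undefined, monoid.one = undefined, ring.zero = (\<lambda>_. \<zero>\<^bsub>R\<^esub>),
    add = (\<lambda>f g j. f j \<oplus>\<^bsub>R\<^esub> g j), smult = (\<lambda>a f j. a \<otimes>\<^bsub>R\<^esub> f j),
    grade = (\<lambda>n. {f. (\<forall>j. f j \<in> grade R (\<alpha> j + n)) \<and>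
                     finite {j. f j \<noteq> \<zero>\<^bsub>R\<^esub>} \<and> {j. f j \<noteq> \<zero>\<^bsub>R\<^esub>} \<subseteq> J})\<rparr>"

definition fin_generated :: "('k, 'r, 'm) gmodule_scheme \<Rightarrow> ('r, 'a) gmodule \<Rightarrow> bool"
  where "fin_generated R M \<longleftrightarrow> (\<exists>S \<subseteq> carrier M. finite S \<and>
    (\<forall>x \<in> carrier M. \<exists>c \<in> S \<rightarrow> carrier R. x = (\<Oplus>\<^bsub>M\<^esub>s \<in> S. c s \<odot>\<^bsub>M\<^esub> s)))"

text \<open>
  Graded projective: a graded retract (equivalently, direct summand) of a graded free module. Taking
  the index set of the basis inside the type of elements of \<open>M\<close> is no restriction, since \<open>M\<close> is
  always a quotient of the graded free module on its nonzero homogeneous elements.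
\<close>

definition gr_projective :: "('k, 'r, 'm) gmodule_scheme \<Rightarrow> ('r, 'a) gmodule \<Rightarrow> bool"
  where "gr_projective R M \<longleftrightarrow> (\<exists>(J :: 'a set) \<alpha>.
    \<exists>\<iota> \<in> gr_hom R M (gr_free R J \<alpha>). \<exists>\<pi> \<in> gr_hom R (gr_free R J \<alpha>) M.
      \<forall>x \<in> carrier M. \<pi> (\<iota> x) = x)"

definition gr_fgp :: "('k, 'r, 'm) gmodule_scheme \<Rightarrow> ('r, 'a) gmodule \<Rightarrow> bool"
  where "gr_fgp R M \<longleftrightarrow> graded_left_module R M \<and> fin_generated R M \<and> gr_projective R M"

text \<open>
  \<open>S \<otimes>\<^sub>R P\<close>, where \<open>S\<close> is a right \<open>R\<close>-module through \<open>\<psi>\<close>: the free abelian group on \<open>S \<times> P\<close> modulo the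
  subgroup generated by the biadditivity and balancing relators. The component of degree \<open>n\<close> is
  additively generated by the \<open>s \<otimes> p\<close> with \<open>s\<close>, \<open>p\<close> homogeneous and \<open>deg s + deg p = n\<close>.
\<close>

definition tensor_relators ::
  "('k, 'r, 'm) gmodule_scheme \<Rightarrow> ('k, 's, 'n) gmodule_scheme \<Rightarrow> ('r \<Rightarrow> 's) \<Rightarrow> ('r, 'a) gmodule \<Rightarrow>
   ('s \<times> 'a \<Rightarrow>\<^sub>0 int) set"
  where "tensor_relators R S \<psi> P =
    {frag_of (s \<oplus>\<^bsub>S\<^esub> s', p) - frag_of (s, p) - frag_of (s', p) | s s' p.
       s \<in> carrier S \<and> s' \<in> carrier S \<and> p \<in> carrier P} \<union>
    {frag_of (s, p \<oplus>\<^bsub>P\<^esub> p') - frag_of (s, p) - frag_of (s, p') | s p p'.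
       s \<in> carrier S \<and> p \<in> carrier P \<and> p' \<in> carrier P} \<union>
    {frag_of (s \<otimes>\<^bsub>S\<^esub> \<psi> r, p) - frag_of (s, r \<odot>\<^bsub>P\<^esub> p) | s r p.
       s \<in> carrier S \<and> r \<in> carrier R \<and> p \<in> carrier P}"

definition gr_tensor ::
  "('k, 'r, 'm) gmodule_scheme \<Rightarrow> ('k, 's, 'n) gmodule_scheme \<Rightarrow> ('r \<Rightarrow> 's) \<Rightarrow> ('r, 'a) gmodule \<Rightarrow>
   ('s, ('s \<times> 'a \<Rightarrow>\<^sub>0 int) set) gmodule"
  where "gr_tensor R S \<psi> P =
    (let G = free_Abelian_group (carrier S \<times> carrier P);
         N = generate G (tensor_relators R S \<psi> P)
     in \<lparr>carrier = carrier (G Mod N), monoid.mult = undefined, monoid.one = undefined,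
         ring.zero = \<one>\<^bsub>G Mod N\<^esub>, add = monoid.mult (G Mod N),
         smult = (\<lambda>t X. \<Union>x \<in> X. N #>\<^bsub>G\<^esub> frag_extend (\<lambda>(s, p). frag_of (t \<otimes>\<^bsub>S\<^esub> s, p)) x),
         grade = (\<lambda>n. generate (G Mod N)
           {N #>\<^bsub>G\<^esub> frag_of (s, p) | s p i j. s \<in> grade S i \<and> p \<in> grade P j \<and> i + j = n})\<rparr>)"


section \<open>Graded K-theory\<close>

text \<open>
  Every finitely generated graded projective left \<open>R\<close>-module is a graded direct summand of some
  \<open>\<Oplus>\<^sub>i\<^sub><\<^sub>n R(\<alpha>\<^sub>i)\<close>, hence isomorphic to one with elements in the type \<^typ>\<open>nat \<Rightarrow> 'r\<close>.
  So the isomorphism classes of modules on this type exhaust all isomorphism classes, and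
  \<open>gr_class R M\<close> represents the class of a module \<open>M\<close> on an arbitrary type.
\<close>

type_synonym 'r fgp = "('r, nat \<Rightarrow> 'r) gmodule"

definition gr_class :: "('k, 'r, 'm) gmodule_scheme \<Rightarrow> ('r, 'a) gmodule \<Rightarrow> 'r fgp set"
  where "gr_class R M = {N. gr_fgp R N \<and> gr_iso R M N}"

definition Vgr :: "('k, 'r, 'm) gmodule_scheme \<Rightarrow> 'r fgp set monoid"
  where "Vgr R = \<lparr>carrier = gr_class R ` {P :: 'r fgp. gr_fgp R P},
    monoid.mult = (\<lambda>A B. \<Union>P \<in> A. \<Union>Q \<in> B. gr_class R (gr_dsum P Q)),
    monoid.one = gr_class R (gr_free R ({} :: nat set) (\<lambda>_. 0))\<rparr>"

definition Vgr_shift :: "('k, 'r, 'm) gmodule_scheme \<Rightarrow> int \<Rightarrow> 'r fgp set \<Rightarrow> 'r fgp set"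
  where "Vgr_shift R n A = (\<Union>P \<in> A. gr_class R (gr_shift n P))"

definition Vgr_map ::
  "('k, 'r, 'm) gmodule_scheme \<Rightarrow> ('k, 's, 'n) gmodule_scheme \<Rightarrow> ('r \<Rightarrow> 's) \<Rightarrow> 'r fgp set \<Rightarrow> 's fgp set"
  where "Vgr_map R S \<psi> A = (\<Union>P \<in> A. gr_class S (gr_tensor R S \<psi> P))"

text \<open>Group completion of a commutative monoid; \<open>gc_class M a b\<close> is the formal difference \<open>a - b\<close>.\<close>

definition gc_rel :: "('a, 'm) monoid_scheme \<Rightarrow> (('a \<times> 'a) \<times> ('a \<times> 'a)) set"
  where "gc_rel M = {((a, b), (c, d)). a \<in> carrier M \<and> b \<in> carrier M \<and> c \<in> carrier M \<and> d \<in> carrier M \<and>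
    (\<exists>t \<in> carrier M. a \<otimes>\<^bsub>M\<^esub> d \<otimes>\<^bsub>M\<^esub> t = c \<otimes>\<^bsub>M\<^esub> b \<otimes>\<^bsub>M\<^esub> t)}"

definition gc_class :: "('a, 'm) monoid_scheme \<Rightarrow> 'a \<Rightarrow> 'a \<Rightarrow> ('a \<times> 'a) set"
  where "gc_class M a b = gc_rel M `` {(a, b)}"

definition group_completion :: "('a, 'm) monoid_scheme \<Rightarrow> ('a \<times> 'a) set monoid"
  where "group_completion M = \<lparr>carrier = (carrier M \<times> carrier M) // gc_rel M,
    monoid.mult = (\<lambda>X Y. \<Union>(a, b) \<in> X. \<Union>(c, d) \<in> Y. gc_class M (a \<otimes>\<^bsub>M\<^esub> c) (b \<otimes>\<^bsub>M\<^esub> d)),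
    monoid.one = gc_class M \<one>\<^bsub>M\<^esub> \<one>\<^bsub>M\<^esub>\<rparr>"

text \<open>
  \<open>\<int>[x,x\<^sup>-\<^sup>1]\<close> is the ring \<^typ>\<open>int \<Rightarrow>\<^sub>0 int\<close> of finitely supported functions with the convolution
  product; \<open>x\<^sup>n\<close> is \<^term>\<open>Poly_Mapping.single n 1\<close>.
\<close>

type_synonym laurent = "int \<Rightarrow>\<^sub>0 int"

type_synonym 'r K0_elem = "('r fgp set \<times> 'r fgp set) set"

definition K0gr_shift :: "('k, 'r, 'm) gmodule_scheme \<Rightarrow> int \<Rightarrow> 'r K0_elem \<Rightarrow> 'r K0_elem"
  where "K0gr_shift R n X = (\<Union>(A, B) \<in> X. gc_class (Vgr R) (Vgr_shift R n A) (Vgr_shift R n B))"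

definition K0gr :: "('k, 'r, 'm) gmodule_scheme \<Rightarrow> (laurent, 'r K0_elem) module"
  where "K0gr R = (let G = group_completion (Vgr R) in
    \<lparr>carrier = carrier G, monoid.mult = undefined, monoid.one = undefined, ring.zero = \<one>\<^bsub>G\<^esub>, add = monoid.mult G,
     smult = (\<lambda>q X. finprod G (\<lambda>n. K0gr_shift R n X [^]\<^bsub>G\<^esub> Poly_Mapping.lookup q n) (Poly_Mapping.keys q))\<rparr>)"

definition K0gr_class :: "('k, 'r, 'm) gmodule_scheme \<Rightarrow> ('r, 'a) gmodule \<Rightarrow> 'r K0_elem"
  where "K0gr_class R P = gc_class (Vgr R) (gr_class R P) \<one>\<^bsub>Vgr R\<^esub>"

definition K0gr_pos :: "('k, 'r, 'm) gmodule_scheme \<Rightarrow> 'r K0_elem set"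
  where "K0gr_pos R = (\<lambda>A. gc_class (Vgr R) A \<one>\<^bsub>Vgr R\<^esub>) ` carrier (Vgr R)"

definition K0gr_map ::
  "('k, 'r, 'm) gmodule_scheme \<Rightarrow> ('k, 's, 'n) gmodule_scheme \<Rightarrow> ('r \<Rightarrow> 's) \<Rightarrow> 'r K0_elem \<Rightarrow> 's K0_elem"
  where "K0gr_map R S \<psi> X = (\<Union>(A, B) \<in> X. gc_class (Vgr S) (Vgr_map R S \<psi> A) (Vgr_map R S \<psi> B))"

definition laurent_module_hom ::
  "(laurent, 'a, 'm) module_scheme \<Rightarrow> (laurent, 'b, 'n) module_scheme \<Rightarrow> ('a \<Rightarrow> 'b) set"
  where "laurent_module_hom M N = {\<phi>. \<phi> \<in> carrier M \<rightarrow> carrier N \<and>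
    (\<forall>X \<in> carrier M. \<forall>Y \<in> carrier M. \<phi> (X \<oplus>\<^bsub>M\<^esub> Y) = \<phi> X \<oplus>\<^bsub>N\<^esub> \<phi> Y) \<and>
    (\<forall>q. \<forall>X \<in> carrier M. \<phi> (q \<odot>\<^bsub>M\<^esub> X) = q \<odot>\<^bsub>N\<^esub> \<phi> X)}"


section \<open>Leavitt path algebras\<close>

text \<open>The free unital associative \<open>K\<close>-algebra on \<open>X\<close>: finitely supported functions on words over \<open>X\<close>.\<close>

definition free_algebra :: "('k, 'c) ring_scheme \<Rightarrow> 'g set \<Rightarrow> ('k, 'g list \<Rightarrow> 'k) module"
  where "free_algebra K X = \<lparr>
    carrier = {f. (\<forall>w. f w \<in> carrier K) \<and> finite {w. f w \<noteq> \<zero>\<^bsub>K\<^esub>} \<and> {w. f w \<noteq> \<zero>\<^bsub>K\<^esub>} \<subseteq> lists X},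
    monoid.mult = (\<lambda>f g w. \<Oplus>\<^bsub>K\<^esub>i \<in> {..length w}. f (take i w) \<otimes>\<^bsub>K\<^esub> g (drop i w)),
    monoid.one = (\<lambda>w. if w = [] then \<one>\<^bsub>K\<^esub> else \<zero>\<^bsub>K\<^esub>),
    ring.zero = (\<lambda>_. \<zero>\<^bsub>K\<^esub>),
    add = (\<lambda>f g w. f w \<oplus>\<^bsub>K\<^esub> g w),
    smult = (\<lambda>c f w. c \<otimes>\<^bsub>K\<^esub> f w)\<rparr>"

definition word_monom :: "('k, 'c) ring_scheme \<Rightarrow> 'g list \<Rightarrow> 'g list \<Rightarrow> 'k"
  where "word_monom K u = (\<lambda>w. if w = u then \<one>\<^bsub>K\<^esub> else \<zero>\<^bsub>K\<^esub>)"

datatype ('v, 'e) lpa_gen = Vert 'v | Edge 'e | Ghost 'e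

fun gen_deg :: "('v, 'e) lpa_gen \<Rightarrow> int" where
  "gen_deg (Vert v) = 0"
| "gen_deg (Edge e) = 1"
| "gen_deg (Ghost e) = - 1"

definition lpa_gens :: "('v, 'e) pre_digraph \<Rightarrow> ('v, 'e) lpa_gen set"
  where "lpa_gens E = Vert ` verts E \<union> Edge ` arcs E \<union> Ghost ` arcs E"

text \<open>The source of an edge is its \<^const>\<open>tail\<close>, the range is its \<^const>\<open>head\<close>.\<close>

definition lpa_relators ::
  "('k, 'c) ring_scheme \<Rightarrow> ('v, 'e) pre_digraph \<Rightarrow> (('v, 'e) lpa_gen list \<Rightarrow> 'k) set"
  where "lpa_relators K E = (let A = free_algebra K (lpa_gens E); w = word_monom K in
    {w [Vert u, Vert v] \<ominus>\<^bsub>A\<^esub> (if u = v then w [Vert u] else \<zero>\<^bsub>A\<^esub>) | u v. u \<in> verts E \<and> v \<in> verts E} \<union>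
    {w [Vert (tail E e), Edge e] \<ominus>\<^bsub>A\<^esub> w [Edge e] | e. e \<in> arcs E} \<union>
    {w [Edge e, Vert (head E e)] \<ominus>\<^bsub>A\<^esub> w [Edge e] | e. e \<in> arcs E} \<union>
    {w [Vert (head E e), Ghost e] \<ominus>\<^bsub>A\<^esub> w [Ghost e] | e. e \<in> arcs E} \<union>
    {w [Ghost e, Vert (tail E e)] \<ominus>\<^bsub>A\<^esub> w [Ghost e] | e. e \<in> arcs E} \<union>
    {(\<Oplus>\<^bsub>A\<^esub>e \<in> {e \<in> arcs E. tail E e = v}. w [Edge e, Ghost e]) \<ominus>\<^bsub>A\<^esub> w [Vert v] | v.
       v \<in> verts E \<and> {e \<in> arcs E. tail E e = v} \<noteq> {}} \<union>
    {w [Ghost e, Edge f] \<ominus>\<^bsub>A\<^esub> (if e = f then w [Vert (head E e)] else \<zero>\<^bsub>A\<^esub>) | e f.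
       e \<in> arcs E \<and> f \<in> arcs E})"

text \<open>
  The generators and relations present a possibly non-unital algebra, namely the image in
  \<open>A Quot I\<close> of the augmentation ideal \<open>Ap\<close>, the elements of \<open>A\<close> without constant term (all
  relators lie in \<open>Ap\<close>, and the ideal of \<open>Ap\<close> they generate is that of \<open>A\<close>). For a finite graph this
  algebra is unital, but its unit is the sum of the vertices, not the class of the empty word.
\<close>

definition leavitt_path_algebra ::
  "('k, 'c) ring_scheme \<Rightarrow> ('v, 'e) pre_digraph \<Rightarrow> ('k, (('v, 'e) lpa_gen list \<Rightarrow> 'k) set) gmodule"
  where "leavitt_path_algebra K E =
    (let A = free_algebra K (lpa_gens E);
         Ap = {f \<in> carrier A. f [] = \<zero>\<^bsub>K\<^esub>};
         I = Idl\<^bsub>A\<^esub> (lpa_relators K E)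
     in \<lparr>carrier = (\<lambda>f. I +>\<^bsub>A\<^esub> f) ` Ap,
         monoid.mult = monoid.mult (A Quot I),
         monoid.one = I +>\<^bsub>A\<^esub> (\<Oplus>\<^bsub>A\<^esub>v \<in> verts E. word_monom K [Vert v]),
         ring.zero = \<zero>\<^bsub>A Quot I\<^esub>,
         add = add (A Quot I),
         smult = (\<lambda>c X. \<Union>f \<in> X. I +>\<^bsub>A\<^esub> (c \<odot>\<^bsub>A\<^esub> f)),
         grade = (\<lambda>n. (\<lambda>f. I +>\<^bsub>A\<^esub> f) `
           {f \<in> Ap. \<forall>w. f w \<noteq> \<zero>\<^bsub>K\<^esub> \<longrightarrow> sum_list (map gen_deg w) = n})\<rparr>)"

end

theory Submission
  imports Defs "HOL-Library.Multiset"
begin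

text \<open>
  Every finitely generated graded projective module over \<open>L(E)\<close> is a sum of modules \<open>L(E) v (- d)\<close>
  with \<open>v\<close> a vertex, and these sums cancel: with respect to the bases of long ghost paths all
  homogeneous maps have scalar matrices, so both facts reduce to linear algebra over the field.
  A class in \<open>K\<^sub>0\<close> is thus a difference of multisets of pairs \<open>(v, d)\<close>.

  By positivity \<open>\<phi>\<close> sends \<open>[L(E) v]\<close> to the class of some \<open>P\<^sub>v = \<Oplus> L(F) w (- d)\<close>, and \<open>\<phi> [L(E)] = [L(F)]\<close> together
  with cancellation gives \<open>L(F) \<cong> \<Oplus>\<^sub>v P\<^sub>v\<close>, that is, orthogonal idempotents \<open>f\<^sub>v\<close> with sum \<open>1\<close> and \<open>L(F) f\<^sub>v \<cong> P\<^sub>v\<close>.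
  The relation \<open>[L(E) v] = \<Sum> [L(E) r(e) (1)]\<close>, summed over the edges \<open>e\<close> with source \<open>v\<close>, becomes
  \<open>P\<^sub>v \<cong> \<Oplus> P\<^bsub>r(e)\<^esub> (1)\<close>. The components of this isomorphism and of its inverse are right multiplications
  by elements that satisfy the relations of \<open>e\<close> and \<open>e*\<close>; this defines \<open>\<psi>\<close>. Since \<open>\<psi> v = f\<^sub>v\<close>, it induces \<open>\<phi>\<close>.

  If \<open>\<phi>\<close> is injective, then \<open>\<psi> v \<noteq> 0\<close> for every vertex \<open>v \<noteq> 0\<close>. For \<open>a\<close> homogeneous and \<open>p\<close> a long path, \<open>p* a\<close> is a
  scalar combination of ghost paths \<open>q*\<close>; if \<open>\<psi> a = 0\<close>, multiplication by \<open>q\<close> isolates a scalar multiple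
  of a vertex killed by \<open>\<psi>\<close>, so \<open>p* a = 0\<close> for all such \<open>p\<close>, hence \<open>a = 0\<close>.
\<close>

section \<open>Graded rings and modules\<close>

text \<open>Scalar matrices come from a cancellation: if a path a is at least as long as p, or ends
  in a sink, then a* p is zero or the ghost of the rest of a, so multiplying p q* on the left by a*
  leaves at most one ghost path. A homogeneous element is a finite sum of such monomials, hence one
  length suffices for it, but this length depends on the element; such statements are therefore made
  for all large N and combined by \<open>eventually\<close>. The ghost paths that occur have the end
  vertex and the degree of the product, so the linear algebra splits by type (idempotent, degree),
  and the basis elements of one type can be counted like a dimension. These counts are additive in
  the module, which gives cancellation. Whether a vertex is nonzero in the algebra is left open;
  types with zero idempotent are removed before counting. Modules occur on many carrier types,
  whereas the K-group contains only classes on one type. Bases, unlike these classes, make sense on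
  every type and carry all transfers between modules.\<close>

lemma finsum_hom:
  assumes "abelian_group G" "abelian_group H" and h: "h \<in> carrier G \<rightarrow> carrier H"
    and add: "\<And>x y. x \<in> carrier G \<Longrightarrow> y \<in> carrier G \<Longrightarrow> h (x \<oplus>\<^bsub>G\<^esub> y) = h x \<oplus>\<^bsub>H\<^esub> h y"
    and f: "f \<in> A \<rightarrow> carrier G"
  shows "h (finsum G f A) = finsum H (\<lambda>i. h (f i)) A"
proof -
  interpret G: abelian_group G by fact
  interpret H: abelian_group H by fact
  have "h \<zero>\<^bsub>G\<^esub> \<oplus>\<^bsub>H\<^esub> h \<zero>\<^bsub>G\<^esub> = h \<zero>\<^bsub>G\<^esub>" using add[of "\<zero>\<^bsub>G\<^esub>" "\<zero>\<^bsub>G\<^esub>"] by simp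
  then have h0: "h \<zero>\<^bsub>G\<^esub> = \<zero>\<^bsub>H\<^esub>"
    using h by (metis H.add.l_cancel_one' G.zero_closed funcset_mem)
  show ?thesis
    using f
  proof (induction A rule: infinite_finite_induct)
    case (insert a F)
    then have "f \<in> F \<rightarrow> carrier G" "f a \<in> carrier G" by auto
    moreover have "(\<lambda>i. h (f i)) \<in> F \<rightarrow> carrier H" "h (f a) \<in> carrier H" using h insert.prems by auto
    ultimately show ?case using insert.IH insert.hyps by (simp add: add)
  qed (simp_all add: h0)
qed

lemma (in abelian_group) finsum_in_subgroup:
  assumes H: "subgroup H (add_monoid G)" and f: "f \<in> A \<rightarrow> H"
  shows "finsum G f A \<in> H"
proof -
  have HG: "H \<subseteq> carrier G" using subgroup.subset[OF H] by simp
  show ?thesis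
    using f
  proof (induction A rule: infinite_finite_induct)
    case (insert a F)
    then have "f \<in> F \<rightarrow> carrier G" "f a \<in> carrier G" using HG by auto
    then show ?case using insert subgroup.m_closed[OF H] by simp
  qed (use subgroup.one_closed[OF H] in simp_all)
qed

section \<open>Double sums and sums with a single nonzero term\<close>

context abelian_monoid
begin

lemma finsum_Sigma:
  assumes "finite I" "\<And>i. i \<in> I \<Longrightarrow> finite (J i)"
    and "\<And>i j. i \<in> I \<Longrightarrow> j \<in> J i \<Longrightarrow> f i j \<in> carrier G"
  shows "(\<Oplus>i\<in>I. \<Oplus>j\<in>J i. f i j) = (\<Oplus>p\<in>Sigma I J. f (fst p) (snd p))"
  using assms
proof (induction I rule: finite_induct)
  case (insert a F)
  have eq: "Sigma (insert a F) J = Pair a ` J a \<union> Sigma F J" by auto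
  have inner: "(\<Oplus>p\<in>Pair a ` J a. f (fst p) (snd p)) = (\<Oplus>j\<in>J a. f a j)"
    by (subst finsum_reindex) (use insert in \<open>auto simp: inj_on_def\<close>)
  have "(\<Oplus>p\<in>Sigma (insert a F) J. f (fst p) (snd p))
      = (\<Oplus>p\<in>Pair a ` J a. f (fst p) (snd p)) \<oplus> (\<Oplus>p\<in>Sigma F J. f (fst p) (snd p))"
    unfolding eq by (rule finsum_Un_disjoint) (use insert in auto)
  moreover have "(\<Oplus>i\<in>insert a F. \<Oplus>j\<in>J i. f i j) = (\<Oplus>j\<in>J a. f a j) \<oplus> (\<Oplus>i\<in>F. \<Oplus>j\<in>J i. f i j)"
    by (rule finsum_insert) (use insert in \<open>auto intro!: finsum_closed\<close>)
  ultimately show ?case using insert inner by simp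
qed simp

lemma finsum_swap:
  assumes "finite I" "finite J" and f: "\<And>i j. i \<in> I \<Longrightarrow> j \<in> J \<Longrightarrow> f i j \<in> carrier G"
  shows "(\<Oplus>i\<in>I. \<Oplus>j\<in>J. f i j) = (\<Oplus>j\<in>J. \<Oplus>i\<in>I. f i j)"
proof -
  have "(\<Oplus>i\<in>I. \<Oplus>j\<in>J. f i j) = (\<Oplus>p\<in>I \<times> J. f (fst p) (snd p))"
    by (rule finsum_Sigma) (use assms in auto)
  also have "I \<times> J = prod.swap ` (J \<times> I)" by auto
  also have "(\<Oplus>p\<in>prod.swap ` (J \<times> I). f (fst p) (snd p)) = (\<Oplus>p\<in>J \<times> I. f (snd p) (fst p))"
    by (subst finsum_reindex) (use f in auto)
  also have "\<dots> = (\<Oplus>j\<in>J. \<Oplus>i\<in>I. f i j)"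
    using finsum_Sigma[of J "\<lambda>_. I" "\<lambda>j i. f i j"] assms by simp
  finally show ?thesis .
qed

lemma finsum_delta:
  assumes "finite J" "i \<in> J" "f i \<in> carrier G"
  shows "(\<Oplus>j\<in>J. if j = i then f j else \<zero>) = f i"
proof -
  have "(\<Oplus>j\<in>J. if j = i then f j else \<zero>) = (\<Oplus>j\<in>J. if i = j then f i else \<zero>)"
    by (rule finsum_cong') (use assms in auto)
  then show ?thesis using finsum_singleton[of i J "\<lambda>_. f i"] assms by simp
qed

lemma finsum_eq_single:
  assumes "finite J" "i \<in> J" "f i \<in> carrier G" "\<And>j. j \<in> J \<Longrightarrow> j \<noteq> i \<Longrightarrow> f j = \<zero>"
  shows "finsum G f J = f i"
proof -
  have "finsum G f J = (\<Oplus>j\<in>J. if j = i then f j else \<zero>)"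
    by (rule finsum_cong') (use assms in auto)
  then show ?thesis using finsum_delta[of J i f] assms by simp
qed

lemma finsum_eq_zero:
  assumes "\<And>j. j \<in> J \<Longrightarrow> f j = \<zero>" shows "finsum G f J = \<zero>"
  using finsum_cong'[of J J "\<lambda>_. \<zero>" f] assms by simp

end

section \<open>Graded rings and homogeneous components\<close>

locale grring = ring R for R :: "('k, 'r, 'm) gmodule_scheme" (structure) +
  assumes grade_sub: "subgroup (grade R n) (add_monoid R)"
    and grade_mult: "\<lbrakk>a \<in> grade R m; b \<in> grade R n\<rbrakk> \<Longrightarrow> a \<otimes> b \<in> grade R (m + n)"
    and grade_one: "\<one> \<in> grade R 0"
    and grade_decomp: "x \<in> carrier R \<Longrightarrow>
      \<exists>!f. (\<forall>n. f n \<in> grade R n) \<and> finite {n. f n \<noteq> \<zero>} \<and>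
           x = (\<Oplus>n \<in> {n. f n \<noteq> \<zero>}. f n)"
begin

lemma grade_carrier: "a \<in> grade R n \<Longrightarrow> a \<in> carrier R"
  using subgroup.subset[OF grade_sub] by auto

lemma grade_add: "a \<in> grade R n \<Longrightarrow> b \<in> grade R n \<Longrightarrow> a \<oplus> b \<in> grade R n"
  using subgroup.m_closed[OF grade_sub] by simp

lemma grade_zero [simp]: "\<zero> \<in> grade R n"
  using subgroup.one_closed[OF grade_sub] by simp

lemma grade_neg: "a \<in> grade R n \<Longrightarrow> \<ominus> a \<in> grade R n"
  using subgroup.m_inv_closed[OF grade_sub] by (simp add: a_inv_def)

lemma grade_mult': "a \<in> grade R m \<Longrightarrow> b \<in> grade R n \<Longrightarrow> k = m + n \<Longrightarrow> a \<otimes> b \<in> grade R k"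
  using grade_mult by simp

lemma grade_finsum: "f \<in> A \<rightarrow> grade R n \<Longrightarrow> finsum R f A \<in> grade R n"
  by (rule finsum_in_subgroup[OF grade_sub])

definition proj :: "int \<Rightarrow> 'r \<Rightarrow> 'r" where
  "proj n x = (THE f. (\<forall>n. f n \<in> grade R n) \<and> finite {n. f n \<noteq> \<zero>} \<and> x = (\<Oplus>n \<in> {n. f n \<noteq> \<zero>}. f n)) n"

lemma proj_props:
  assumes "x \<in> carrier R"
  shows "proj n x \<in> grade R n" "finite {n. proj n x \<noteq> \<zero>}" "x = (\<Oplus>n \<in> {n. proj n x \<noteq> \<zero>}. proj n x)"
  using theI'[OF grade_decomp[OF assms]] unfolding proj_def by auto

text \<open>Uniqueness of the decomposition, in a form where the sum may run over any finite set
  that contains the support.\<close>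

lemma proj_eqI:
  assumes "\<And>n. f n \<in> grade R n" "finite A" "\<And>n. n \<notin> A \<Longrightarrow> f n = \<zero>" "x = (\<Oplus>n\<in>A. f n)"
  shows "proj n x = f n"
proof -
  have fc: "f n \<in> carrier R" for n using assms(1) grade_carrier by auto
  have x: "x \<in> carrier R" unfolding assms(4) by (rule finsum_closed) (use fc in auto)
  have sub: "{n. f n \<noteq> \<zero>} \<subseteq> A" using assms(3) by auto
  have "x = (\<Oplus>n \<in> {n. f n \<noteq> \<zero>}. f n)"
    unfolding assms(4) by (rule add.finprod_mono_neutral_cong_right) (use assms sub fc in auto)
  then have P: "(\<forall>n. f n \<in> grade R n) \<and> finite {n. f n \<noteq> \<zero>} \<and> x = (\<Oplus>n \<in> {n. f n \<noteq> \<zero>}. f n)"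
    using assms(1,2) sub finite_subset by blast
  have Q: "(\<forall>n. (\<lambda>n. proj n x) n \<in> grade R n) \<and> finite {n. (\<lambda>n. proj n x) n \<noteq> \<zero>} \<and> x = (\<Oplus>n \<in> {n. (\<lambda>n. proj n x) n \<noteq> \<zero>}. (\<lambda>n. proj n x) n)"
    using proj_props[OF x] by blast
  have "(\<lambda>n. proj n x) = f" by (rule ex1E[OF grade_decomp[OF x]]) (metis P Q)
  then show ?thesis by metis
qed

lemma proj_closed: "x \<in> carrier R \<Longrightarrow> proj n x \<in> carrier R"
  using proj_props(1) grade_carrier by blast

lemma proj_sum:
  assumes "x \<in> carrier R" "finite A" "\<And>n. n \<notin> A \<Longrightarrow> proj n x = \<zero>"
  shows "x = (\<Oplus>n\<in>A. proj n x)"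
proof -
  have "(\<Oplus>n \<in> {n. proj n x \<noteq> \<zero>}. proj n x) = (\<Oplus>n\<in>A. proj n x)"
    by (rule add.finprod_mono_neutral_cong_left) (use assms proj_closed in auto)
  then show ?thesis using proj_props(3)[OF assms(1)] by simp
qed

lemma proj_grade:
  assumes "x \<in> grade R m" shows "proj n x = (if n = m then x else \<zero>)"
  by (rule proj_eqI[where A="{m}"]) (use assms grade_carrier in auto)

lemma proj_add:
  assumes x: "x \<in> carrier R" and y: "y \<in> carrier R"
  shows "proj n (x \<oplus> y) = proj n x \<oplus> proj n y"
proof (rule proj_eqI[where A="{n. proj n x \<noteq> \<zero>} \<union> {n. proj n y \<noteq> \<zero>}"])
  let ?A = "{n. proj n x \<noteq> \<zero>} \<union> {n. proj n y \<noteq> \<zero>}"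
  show fin: "finite ?A" using proj_props x y by simp
  have "x = (\<Oplus>n\<in>?A. proj n x)" by (rule proj_sum[OF x fin]) auto
  moreover have "y = (\<Oplus>n\<in>?A. proj n y)" by (rule proj_sum[OF y fin]) auto
  ultimately show "x \<oplus> y = (\<Oplus>n\<in>?A. proj n x \<oplus> proj n y)"
    using finsum_addf[of "\<lambda>n. proj n x" ?A "\<lambda>n. proj n y"] proj_closed x y by auto
qed (use x y proj_props grade_add in auto)

text \<open>By uniqueness, the components of x e are the components of x times e. For an idempotent
  e of degree 0 this shows that the equation x e = x passes to every component of x.\<close>

lemma proj_mult_right:
  assumes x: "x \<in> carrier R" and e: "e \<in> grade R m"
  shows "proj (n + m) (x \<otimes> e) = proj n x \<otimes> e"
proof -
  have ec: "e \<in> carrier R" using e grade_carrier by auto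
  have "proj (n + m) (x \<otimes> e) = (\<lambda>k. proj (k - m) x \<otimes> e) (n + m)"
  proof (rule proj_eqI[where A="(\<lambda>k. k + m) ` {n. proj n x \<noteq> \<zero>}"])
    show "proj (k - m) x \<otimes> e \<in> grade R k" for k
      using grade_mult[OF proj_props(1)[OF x] e, of "k - m"] by simp
    show "finite ((\<lambda>k. k + m) ` {n. proj n x \<noteq> \<zero>})" using proj_props(2)[OF x] by simp
    show "proj (k - m) x \<otimes> e = \<zero>" if "k \<notin> (\<lambda>k. k + m) ` {n. proj n x \<noteq> \<zero>}" for k
    proof -
      have "proj (k - m) x = \<zero>"
      proof (rule ccontr)
        assume "proj (k - m) x \<noteq> \<zero>"
        then have "k - m \<in> {n. proj n x \<noteq> \<zero>}" by simp
        then have "(k - m) + m \<in> (\<lambda>k. k + m) ` {n. proj n x \<noteq> \<zero>}" by blast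
        then show False using that by simp
      qed
      then show ?thesis using ec by simp
    qed
    have "x \<otimes> e = (\<Oplus>n\<in>{n. proj n x \<noteq> \<zero>}. proj n x) \<otimes> e" using proj_props(3)[OF x] by simp
    also have "\<dots> = (\<Oplus>n\<in>{n. proj n x \<noteq> \<zero>}. proj n x \<otimes> e)"
      by (rule finsum_ldistr) (use proj_props(2)[OF x] proj_closed x ec in auto)
    also have "\<dots> = (\<Oplus>k\<in>(\<lambda>k. k + m) ` {n. proj n x \<noteq> \<zero>}. proj (k - m) x \<otimes> e)"
      by (subst finsum_reindex) (use proj_closed x ec in \<open>auto simp: inj_on_def\<close>)
    finally show "x \<otimes> e = (\<Oplus>k\<in>(\<lambda>k. k + m) ` {n. proj n x \<noteq> \<zero>}. proj (k - m) x \<otimes> e)" .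
  qed
  then show ?thesis by simp
qed

end

text \<open>
  The grading of a \<open>gmod\<close> is only required to generate the module; the decomposition of elements
  into homogeneous components then follows for modules with a basis in the sense below.
\<close>

locale gmod = R?: grring R + M?: left_module R M
  for R :: "('k, 'r, 'm) gmodule_scheme" (structure) and M :: "('r, 'a) gmodule" (structure) +
  assumes mgrade_sub: "subgroup (grade M n) (add_monoid M)"
    and mgrade_smult: "\<lbrakk>a \<in> grade R m; x \<in> grade M n\<rbrakk> \<Longrightarrow> a \<odot>\<^bsub>M\<^esub> x \<in> grade M (m + n)"
    and homgen: "\<lbrakk>subgroup H (add_monoid M); \<And>n. grade M n \<subseteq> H\<rbrakk> \<Longrightarrow> carrier M \<subseteq> H"
begin

lemma mgrade_carrier: "a \<in> grade M n \<Longrightarrow> a \<in> carrier M"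
  using subgroup.subset[OF mgrade_sub] by auto

lemma mgrade_add: "a \<in> grade M n \<Longrightarrow> b \<in> grade M n \<Longrightarrow> a \<oplus>\<^bsub>M\<^esub> b \<in> grade M n"
  using subgroup.m_closed[OF mgrade_sub] by simp

lemma mgrade_zero [simp]: "\<zero>\<^bsub>M\<^esub> \<in> grade M n"
  using subgroup.one_closed[OF mgrade_sub] by simp

lemma mgrade_finsum: "f \<in> A \<rightarrow> grade M n \<Longrightarrow> finsum M f A \<in> grade M n"
  by (rule M.finsum_in_subgroup[OF mgrade_sub])

lemma mgrade_smult': "a \<in> grade R m \<Longrightarrow> x \<in> grade M n \<Longrightarrow> k = m + n \<Longrightarrow> a \<odot>\<^bsub>M\<^esub> x \<in> grade M k"
  using mgrade_smult by simp

end

context left_module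
begin

lemma smult_zero_r [simp]: "a \<in> carrier R \<Longrightarrow> a \<odot>\<^bsub>M\<^esub> \<zero>\<^bsub>M\<^esub> = \<zero>\<^bsub>M\<^esub>"
  by (metis M.add.l_cancel_one' M.zero_closed M.r_zero smult_closed smult_r_distr)

lemma smult_zero_l [simp]: "x \<in> carrier M \<Longrightarrow> \<zero> \<odot>\<^bsub>M\<^esub> x = \<zero>\<^bsub>M\<^esub>"
  by (metis M.add.l_cancel_one' R.zero_closed R.r_zero smult_closed smult_l_distr)

lemma smult_neg_l: "a \<in> carrier R \<Longrightarrow> x \<in> carrier M \<Longrightarrow> (\<ominus> a) \<odot>\<^bsub>M\<^esub> x = \<ominus>\<^bsub>M\<^esub> (a \<odot>\<^bsub>M\<^esub> x)"
  by (metis M.minus_equality R.a_inv_closed R.l_neg smult_closed smult_l_distr smult_zero_l)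

lemma smult_finsum_r:
  assumes "a \<in> carrier R" "f \<in> A \<rightarrow> carrier M"
  shows "a \<odot>\<^bsub>M\<^esub> finsum M f A = (\<Oplus>\<^bsub>M\<^esub>i\<in>A. a \<odot>\<^bsub>M\<^esub> f i)"
  by (rule finsum_hom[where G=M and H=M])
    (use assms smult_r_distr M.abelian_group_axioms in \<open>auto intro: smult_closed\<close>)

lemma smult_finsum_l:
  assumes "x \<in> carrier M" "f \<in> A \<rightarrow> carrier R"
  shows "finsum R f A \<odot>\<^bsub>M\<^esub> x = (\<Oplus>\<^bsub>M\<^esub>i\<in>A. f i \<odot>\<^bsub>M\<^esub> x)"
  by (rule finsum_hom[where G=R and H=M and h="\<lambda>a. a \<odot>\<^bsub>M\<^esub> x"])
    (use assms smult_l_distr M.abelian_group_axioms R.abelian_group_axioms in \<open>auto intro: smult_closed\<close>)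

end

lemma (in grring) gmod_of_graded:
  assumes "graded_left_module R M" shows "gmod R M"
proof -
  interpret M: graded_left_module R M by fact
  show ?thesis
  proof (intro gmod.intro gmod_axioms.intro grring_axioms M.left_module_axioms)
    fix n show "subgroup (grade M n) (add_monoid M)" by (rule M.grade_subgroup)
  next
    fix a m x n assume "a \<in> grade R m" "x \<in> grade M n"
    then show "a \<odot>\<^bsub>M\<^esub> x \<in> grade M (m + n)" by (rule M.grade_smult)
  next
    fix H assume H: "subgroup H (add_monoid M)" "\<And>n. grade M n \<subseteq> H"
    show "carrier M \<subseteq> H"
    proof
      fix x assume "x \<in> carrier M"
      then obtain f where f: "\<And>n. f n \<in> grade M n" "x = (\<Oplus>\<^bsub>M\<^esub>n \<in> {n. f n \<noteq> \<zero>\<^bsub>M\<^esub>}. f n)"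
        using M.grade_decomp by metis
      show "x \<in> H" unfolding f(2) by (rule M.M.finsum_in_subgroup[OF H(1)]) (use f H in auto)
    qed
  qed
qed

definition gidem :: "('k, 'r, 'm) gmodule_scheme \<Rightarrow> 'r \<Rightarrow> bool"
  where "gidem R e \<longleftrightarrow> e \<in> grade R 0 \<and> e \<otimes>\<^bsub>R\<^esub> e = e"

text \<open>
  Such a basis is an isomorphism \<open>M \<cong> \<Oplus>\<^sub>i R e\<^sub>i (- d\<^sub>i)\<close>, the element \<open>x\<^sub>i\<close> of degree \<open>d\<^sub>i\<close> corresponding to \<open>e\<^sub>i\<close>.
\<close>

definition gbasis :: "('k, 'r, 'm) gmodule_scheme \<Rightarrow> ('r, 'a) gmodule \<Rightarrow>
    'i set \<Rightarrow> ('i \<Rightarrow> 'a) \<Rightarrow> ('i \<Rightarrow> 'r) \<Rightarrow> ('i \<Rightarrow> int) \<Rightarrow> bool"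
  where "gbasis R M I x e d \<longleftrightarrow> finite I \<and>
    (\<forall>i\<in>I. gidem R (e i) \<and> x i \<in> grade M (d i) \<and> e i \<odot>\<^bsub>M\<^esub> x i = x i) \<and>
    (\<forall>n. \<forall>m\<in>grade M n. \<exists>r. (\<forall>i\<in>I. r i \<in> grade R (n - d i)) \<and> m = (\<Oplus>\<^bsub>M\<^esub>i\<in>I. r i \<odot>\<^bsub>M\<^esub> x i)) \<and>
    (\<forall>r\<in>I \<rightarrow> carrier R. (\<Oplus>\<^bsub>M\<^esub>i\<in>I. r i \<odot>\<^bsub>M\<^esub> x i) = \<zero>\<^bsub>M\<^esub> \<longrightarrow> (\<forall>i\<in>I. r i \<otimes>\<^bsub>R\<^esub> e i = \<zero>\<^bsub>R\<^esub>))"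

lemma gbasisI:
  assumes "finite I"
    and "\<And>i. i \<in> I \<Longrightarrow> gidem R (e i)"
    and "\<And>i. i \<in> I \<Longrightarrow> x i \<in> grade M (d i)"
    and "\<And>i. i \<in> I \<Longrightarrow> e i \<odot>\<^bsub>M\<^esub> x i = x i"
    and "\<And>n m. m \<in> grade M n \<Longrightarrow>
      \<exists>r. (\<forall>i\<in>I. r i \<in> grade R (n - d i)) \<and> m = (\<Oplus>\<^bsub>M\<^esub>i\<in>I. r i \<odot>\<^bsub>M\<^esub> x i)"
    and "\<And>r i. r \<in> I \<rightarrow> carrier R \<Longrightarrow> (\<Oplus>\<^bsub>M\<^esub>i\<in>I. r i \<odot>\<^bsub>M\<^esub> x i) = \<zero>\<^bsub>M\<^esub> \<Longrightarrow> i \<in> I \<Longrightarrow> r i \<otimes>\<^bsub>R\<^esub> e i = \<zero>\<^bsub>R\<^esub>"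
  shows "gbasis R M I x e d"
  unfolding gbasis_def using assms by simp

lemma gbasis_typeD:
  assumes "gbasis R M I x e d"
  shows "finite I" "\<And>i. i \<in> I \<Longrightarrow> gidem R (e i)" "\<And>i. i \<in> I \<Longrightarrow> x i \<in> grade M (d i)"
    "\<And>i. i \<in> I \<Longrightarrow> e i \<odot>\<^bsub>M\<^esub> x i = x i"
  using assms unfolding gbasis_def by auto

lemma gbasis_spanD:
  assumes "gbasis R M I x e d" "m \<in> grade M n"
  obtains r where "\<And>i. i \<in> I \<Longrightarrow> r i \<in> grade R (n - d i)" "m = (\<Oplus>\<^bsub>M\<^esub>i\<in>I. r i \<odot>\<^bsub>M\<^esub> x i)"
  using assms unfolding gbasis_def by blast

lemma gbasis_indepD:
  assumes "gbasis R M I x e d" "r \<in> I \<rightarrow> carrier R" "(\<Oplus>\<^bsub>M\<^esub>i\<in>I. r i \<odot>\<^bsub>M\<^esub> x i) = \<zero>\<^bsub>M\<^esub>" "i \<in> I"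
  shows "r i \<otimes>\<^bsub>R\<^esub> e i = \<zero>\<^bsub>R\<^esub>"
  using assms unfolding gbasis_def by blast

lemma (in grring) gidemD:
  assumes "gidem R e" shows "e \<in> carrier R" "e \<in> grade R 0" "e \<otimes> e = e"
  using assms grade_carrier unfolding gidem_def by auto

lemma gr_homD:
  assumes "f \<in> gr_hom R M N"
  shows "f \<in> carrier M \<rightarrow> carrier N"
    "\<And>x y. x \<in> carrier M \<Longrightarrow> y \<in> carrier M \<Longrightarrow> f (x \<oplus>\<^bsub>M\<^esub> y) = f x \<oplus>\<^bsub>N\<^esub> f y"
    "\<And>a x. a \<in> carrier R \<Longrightarrow> x \<in> carrier M \<Longrightarrow> f (a \<odot>\<^bsub>M\<^esub> x) = a \<odot>\<^bsub>N\<^esub> f x"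
    "\<And>n x. x \<in> grade M n \<Longrightarrow> f x \<in> grade N n"
  using assms unfolding gr_hom_def by (simp_all add: image_subset_iff)

lemma gr_homI:
  assumes "\<And>x. x \<in> carrier M \<Longrightarrow> f x \<in> carrier N"
    "\<And>x y. x \<in> carrier M \<Longrightarrow> y \<in> carrier M \<Longrightarrow> f (x \<oplus>\<^bsub>M\<^esub> y) = f x \<oplus>\<^bsub>N\<^esub> f y"
    "\<And>a x. a \<in> carrier R \<Longrightarrow> x \<in> carrier M \<Longrightarrow> f (a \<odot>\<^bsub>M\<^esub> x) = a \<odot>\<^bsub>N\<^esub> f x"
    "\<And>n x. x \<in> grade M n \<Longrightarrow> f x \<in> grade N n"
  shows "f \<in> gr_hom R M N"
  using assms unfolding gr_hom_def by auto

lemma gr_hom_lin: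
  assumes "gmod R M" "gmod R N" and f: "f \<in> gr_hom R M N"
    and "r \<in> I \<rightarrow> carrier R" "x \<in> I \<rightarrow> carrier M"
  shows "f (\<Oplus>\<^bsub>M\<^esub>i\<in>I. r i \<odot>\<^bsub>M\<^esub> x i) = (\<Oplus>\<^bsub>N\<^esub>i\<in>I. r i \<odot>\<^bsub>N\<^esub> f (x i))"
proof -
  interpret M: gmod R M by fact
  interpret N: gmod R N by fact
  have "f (\<Oplus>\<^bsub>M\<^esub>i\<in>I. r i \<odot>\<^bsub>M\<^esub> x i) = (\<Oplus>\<^bsub>N\<^esub>i\<in>I. f (r i \<odot>\<^bsub>M\<^esub> x i))"
    by (rule finsum_hom[OF M.M.abelian_group_axioms N.M.abelian_group_axioms gr_homD(1)[OF f]])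
      (use assms gr_homD(2)[OF f] M.smult_closed in \<open>auto simp: Pi_iff\<close>)
  also have "\<dots> = (\<Oplus>\<^bsub>N\<^esub>i\<in>I. r i \<odot>\<^bsub>N\<^esub> f (x i))"
    by (rule N.M.finsum_cong') (use assms gr_homD[OF f] N.smult_closed in \<open>auto simp: Pi_iff\<close>)
  finally show ?thesis .
qed

lemma gr_hom_zero:
  assumes "gmod R M" "gmod R N" "f \<in> gr_hom R M N"
  shows "f \<zero>\<^bsub>M\<^esub> = \<zero>\<^bsub>N\<^esub>"
proof -
  interpret M: gmod R M by fact
  interpret N: gmod R N by fact
  show ?thesis using gr_hom_lin[OF assms, of "\<lambda>_. \<zero>\<^bsub>R\<^esub>" "{}" "\<lambda>_. \<zero>\<^bsub>M\<^esub>"] by simp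
qed

locale based = gmod R M
  for R :: "('k, 'r, 'm) gmodule_scheme" (structure) and M :: "('r, 'a) gmodule" (structure) +
  fixes I :: "'i set" and x :: "'i \<Rightarrow> 'a" and e :: "'i \<Rightarrow> 'r" and d :: "'i \<Rightarrow> int"
  assumes gbasis: "gbasis R M I x e d"
begin

lemma fin: "finite I"
  and idem: "i \<in> I \<Longrightarrow> gidem R (e i)"
  and x_grade: "i \<in> I \<Longrightarrow> x i \<in> grade M (d i)"
  and e_x: "i \<in> I \<Longrightarrow> e i \<odot>\<^bsub>M\<^esub> x i = x i"
  using gbasis_typeD[OF gbasis] by auto

lemma x_carrier: "i \<in> I \<Longrightarrow> x i \<in> carrier M"
  using x_grade mgrade_carrier by auto

lemma e_carrier: "i \<in> I \<Longrightarrow> e i \<in> carrier R"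
  using idem gidemD by auto

lemma e_idem: "i \<in> I \<Longrightarrow> e i \<otimes> e i = e i"
  using idem gidemD by auto

definition lin :: "('i \<Rightarrow> 'r) \<Rightarrow> 'a" where
  "lin r = (\<Oplus>\<^bsub>M\<^esub>i\<in>I. r i \<odot>\<^bsub>M\<^esub> x i)"

lemma lin_closed: "r \<in> I \<rightarrow> carrier R \<Longrightarrow> lin r \<in> carrier M"
  unfolding lin_def by (rule M.finsum_closed) (auto intro: smult_closed x_carrier)

lemma lin_cong: "(\<And>i. i \<in> I \<Longrightarrow> r i = s i) \<Longrightarrow> s \<in> I \<rightarrow> carrier R \<Longrightarrow> lin r = lin s"
  unfolding lin_def by (rule M.finsum_cong') (auto intro: smult_closed x_carrier)

lemma lin_add:
  assumes "r \<in> I \<rightarrow> carrier R" "s \<in> I \<rightarrow> carrier R"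
  shows "lin (\<lambda>i. r i \<oplus> s i) = lin r \<oplus>\<^bsub>M\<^esub> lin s"
proof -
  have "lin (\<lambda>i. r i \<oplus> s i) = (\<Oplus>\<^bsub>M\<^esub>i\<in>I. r i \<odot>\<^bsub>M\<^esub> x i \<oplus>\<^bsub>M\<^esub> s i \<odot>\<^bsub>M\<^esub> x i)"
    unfolding lin_def by (rule M.finsum_cong') (use assms in \<open>auto simp: Pi_iff smult_l_distr x_carrier intro!: smult_closed M.a_closed\<close>)
  also have "\<dots> = lin r \<oplus>\<^bsub>M\<^esub> lin s"
    unfolding lin_def by (rule M.finsum_addf) (use assms in \<open>auto simp: Pi_iff x_carrier intro!: smult_closed\<close>)
  finally show ?thesis .
qed

lemma lin_smult:
  assumes "r \<in> I \<rightarrow> carrier R" "a \<in> carrier R"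
  shows "lin (\<lambda>i. a \<otimes> r i) = a \<odot>\<^bsub>M\<^esub> lin r"
proof -
  have "a \<odot>\<^bsub>M\<^esub> lin r = (\<Oplus>\<^bsub>M\<^esub>i\<in>I. a \<odot>\<^bsub>M\<^esub> (r i \<odot>\<^bsub>M\<^esub> x i))"
    unfolding lin_def by (rule smult_finsum_r) (use assms in \<open>auto simp: Pi_iff x_carrier intro!: smult_closed\<close>)
  also have "\<dots> = lin (\<lambda>i. a \<otimes> r i)"
    unfolding lin_def by (rule M.finsum_cong') (use assms in \<open>auto simp: Pi_iff smult_assoc x_carrier intro!: smult_closed\<close>)
  finally show ?thesis by simp
qed

lemma lin_zero: "lin (\<lambda>i. \<zero>) = \<zero>\<^bsub>M\<^esub>"
  unfolding lin_def by (rule M.finsum_eq_zero) (simp add: x_carrier)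

text \<open>A coefficient r of \<open>x i\<close> acts as r \<open>e i\<close>, so only the products
  with \<open>e i\<close> can be recovered from a combination.\<close>

lemma lin_eq_iff:
  assumes "r \<in> I \<rightarrow> carrier R" "s \<in> I \<rightarrow> carrier R" "lin r = lin s" "i \<in> I"
  shows "r i \<otimes> e i = s i \<otimes> e i"
proof -
  let ?t = "\<lambda>i. r i \<oplus> \<ominus> s i"
  have t: "?t \<in> I \<rightarrow> carrier R" using assms by auto
  have "lin (\<lambda>i. ?t i \<oplus> s i) = lin ?t \<oplus>\<^bsub>M\<^esub> lin s" by (rule lin_add) (use t assms in auto)
  moreover have "lin (\<lambda>i. ?t i \<oplus> s i) = lin r"
    by (rule lin_cong) (use assms in \<open>auto simp: Pi_iff R.a_assoc R.l_neg\<close>)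
  ultimately have "lin ?t \<oplus>\<^bsub>M\<^esub> lin s = lin s" using assms by simp
  then have "lin ?t = \<zero>\<^bsub>M\<^esub>" using lin_closed[OF t] lin_closed[OF assms(2)] by simp
  then have "?t i \<otimes> e i = \<zero>" using gbasis_indepD[OF gbasis t _ assms(4)] unfolding lin_def by simp
  then have "r i \<otimes> e i \<oplus> \<ominus> (s i \<otimes> e i) = \<zero>"
    using assms e_carrier by (auto simp: Pi_iff R.l_distr R.l_minus)
  then show ?thesis
    using assms e_carrier by (metis (no_types, lifting) Pi_iff R.a_inv_closed R.m_closed R.minus_equality R.minus_minus)
qed

text \<open>The basis condition expresses homogeneous elements only. The combinations form a
  subgroup that contains them, and the homogeneous elements generate the module.\<close>

lemma span: "m \<in> carrier M \<Longrightarrow> \<exists>r\<in>I \<rightarrow> carrier R. m = lin r"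
proof -
  have "carrier M \<subseteq> lin ` (I \<rightarrow> carrier R)"
  proof (rule homgen)
    show "subgroup (lin ` (I \<rightarrow> carrier R)) (add_monoid M)"
    proof (rule M.add.subgroupI)
      show "lin ` (I \<rightarrow> carrier R) \<subseteq> carrier M" using lin_closed by auto
      show "lin ` (I \<rightarrow> carrier R) \<noteq> {}" by auto
    next
      fix a assume "a \<in> lin ` (I \<rightarrow> carrier R)"
      then obtain r where r: "r \<in> I \<rightarrow> carrier R" "a = lin r" by auto
      have "lin (\<lambda>i. \<ominus> r i) \<oplus>\<^bsub>M\<^esub> lin r = lin (\<lambda>i. \<zero>)"
        by (subst lin_add[symmetric]) (use r in \<open>auto simp: Pi_iff R.l_neg intro!: lin_cong\<close>)
      then have "\<ominus>\<^bsub>M\<^esub> a = lin (\<lambda>i. \<ominus> r i)"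
        using M.minus_equality r lin_closed lin_zero by (auto simp: Pi_iff)
      then show "\<ominus>\<^bsub>M\<^esub> a \<in> lin ` (I \<rightarrow> carrier R)" using r by auto
    next
      fix a b assume "a \<in> lin ` (I \<rightarrow> carrier R)" "b \<in> lin ` (I \<rightarrow> carrier R)"
      then obtain r s where r: "r \<in> I \<rightarrow> carrier R" "a = lin r" "s \<in> I \<rightarrow> carrier R" "b = lin s" by auto
      then have "a \<oplus>\<^bsub>M\<^esub> b = lin (\<lambda>i. r i \<oplus> s i)" by (simp add: lin_add)
      then show "a \<oplus>\<^bsub>M\<^esub> b \<in> lin ` (I \<rightarrow> carrier R)" using r by auto
    qed
    show "grade M n \<subseteq> lin ` (I \<rightarrow> carrier R)" for n
    proof
      fix m assume "m \<in> grade M n"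
      then obtain r where "\<And>i. i \<in> I \<Longrightarrow> r i \<in> grade R (n - d i)" "m = lin r"
        using gbasis_spanD[OF gbasis] unfolding lin_def by blast
      then show "m \<in> lin ` (I \<rightarrow> carrier R)" using grade_carrier by blast
    qed
  qed
  then show "m \<in> carrier M \<Longrightarrow> \<exists>r\<in>I \<rightarrow> carrier R. m = lin r" by auto
qed

text \<open>The chosen coefficients are not unique; the factor \<open>e i\<close> makes the
  coordinate independent of the choice (\<open>co_lin\<close>) and puts it into R
  \<open>e i\<close>.\<close>

definition co :: "'a \<Rightarrow> 'i \<Rightarrow> 'r" where
  "co m i = (SOME r. r \<in> I \<rightarrow> carrier R \<and> m = lin r) i \<otimes> e i"

lemma co_lin:
  assumes "r \<in> I \<rightarrow> carrier R" "i \<in> I"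
  shows "co (lin r) i = r i \<otimes> e i"
proof -
  let ?s = "SOME s. s \<in> I \<rightarrow> carrier R \<and> lin r = lin s"
  have "?s \<in> I \<rightarrow> carrier R \<and> lin r = lin ?s"
    by (rule someI[of _ r]) (use assms in auto)
  then show ?thesis unfolding co_def using lin_eq_iff[of ?s r i] assms by auto
qed

lemma co_closed: "m \<in> carrier M \<Longrightarrow> i \<in> I \<Longrightarrow> co m i \<in> carrier R"
  using span[of m] co_lin e_carrier by fastforce

lemma co_e: "m \<in> carrier M \<Longrightarrow> i \<in> I \<Longrightarrow> co m i \<otimes> e i = co m i"
  using span[of m] by (auto simp: co_lin R.m_assoc e_carrier e_idem Pi_iff)

lemma lin_e: "r \<in> I \<rightarrow> carrier R \<Longrightarrow> lin (\<lambda>i. r i \<otimes> e i) = lin r"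
  unfolding lin_def
  by (rule M.finsum_cong') (auto simp: Pi_iff smult_assoc e_carrier x_carrier e_x intro!: smult_closed)

lemma lin_co:
  assumes "m \<in> carrier M" shows "lin (co m) = m"
proof -
  obtain r where r: "r \<in> I \<rightarrow> carrier R" "m = lin r" using span[OF assms] by auto
  have "lin (co m) = lin (\<lambda>i. r i \<otimes> e i)" by (rule lin_cong) (use r e_carrier in \<open>auto simp: co_lin\<close>)
  then show ?thesis using r lin_e by simp
qed

lemma co_grade:
  assumes "m \<in> grade M n" "i \<in> I" shows "co m i \<in> grade R (n - d i)"
proof -
  obtain r where r: "\<And>i. i \<in> I \<Longrightarrow> r i \<in> grade R (n - d i)" "m = lin r"
    using gbasis_spanD[OF gbasis assms(1)] unfolding lin_def by blast
  then have "co m i = r i \<otimes> e i" using co_lin grade_carrier assms(2) by blast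
  then show ?thesis using grade_mult[OF r(1)[OF assms(2)] gidemD(2)[OF idem[OF assms(2)]]] by simp
qed

lemma co_add:
  assumes "m \<in> carrier M" "n \<in> carrier M" "i \<in> I"
  shows "co (m \<oplus>\<^bsub>M\<^esub> n) i = co m i \<oplus> co n i"
proof -
  have "m \<oplus>\<^bsub>M\<^esub> n = lin (\<lambda>i. co m i \<oplus> co n i)"
    using assms by (subst lin_add) (auto simp: lin_co co_closed)
  then have "co (m \<oplus>\<^bsub>M\<^esub> n) i = (co m i \<oplus> co n i) \<otimes> e i"
    using assms by (simp add: co_lin co_closed)
  then show ?thesis using assms by (simp add: R.l_distr co_closed e_carrier co_e)
qed

lemma co_smult:
  assumes "m \<in> carrier M" "a \<in> carrier R" "i \<in> I"
  shows "co (a \<odot>\<^bsub>M\<^esub> m) i = a \<otimes> co m i"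
proof -
  have "a \<odot>\<^bsub>M\<^esub> m = lin (\<lambda>i. a \<otimes> co m i)"
    using assms by (subst lin_smult) (auto simp: lin_co co_closed)
  then have "co (a \<odot>\<^bsub>M\<^esub> m) i = a \<otimes> co m i \<otimes> e i"
    using assms by (simp add: co_lin co_closed)
  then show ?thesis using assms by (simp add: R.m_assoc co_closed e_carrier co_e)
qed

lemma co_x:
  assumes "i \<in> I" "j \<in> I" shows "co (x j) i = (if i = j then e i else \<zero>)"
proof -
  have "lin (\<lambda>i. if i = j then e i else \<zero>) = e j \<odot>\<^bsub>M\<^esub> x j"
    unfolding lin_def
    by (subst M.finsum_eq_single[where i=j]) (use assms fin e_carrier x_carrier smult_closed in auto)
  then have "x j = lin (\<lambda>i. if i = j then e i else \<zero>)" using e_x assms by simp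
  then have "co (x j) i = (if i = j then e i else \<zero>) \<otimes> e i"
    using co_lin[of "\<lambda>i. if i = j then e i else \<zero>" i] assms e_carrier by auto
  then show ?thesis using assms e_idem e_carrier by auto
qed

text \<open>The homomorphism sends \<open>x i\<close> to the product of \<open>e i\<close> and
  \<open>y i\<close>: the coordinate of \<open>x i\<close> at i is \<open>e i\<close>, and its other
  coordinates vanish.\<close>

lemma extend_hom:
  assumes "gmod R N" and y: "\<And>i. i \<in> I \<Longrightarrow> y i \<in> grade N (d i)"
  shows "(\<lambda>m. \<Oplus>\<^bsub>N\<^esub>i\<in>I. co m i \<odot>\<^bsub>N\<^esub> y i) \<in> gr_hom R M N"
proof -
  interpret N: gmod R N by fact
  have yc: "\<And>i. i \<in> I \<Longrightarrow> y i \<in> carrier N" using y N.mgrade_carrier by auto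
  show ?thesis
  proof (rule gr_homI)
    fix m assume "m \<in> carrier M"
    then show "(\<Oplus>\<^bsub>N\<^esub>i\<in>I. co m i \<odot>\<^bsub>N\<^esub> y i) \<in> carrier N"
      by (intro N.M.finsum_closed) (auto intro!: N.smult_closed co_closed yc)
  next
    fix m n assume mn: "m \<in> carrier M" "n \<in> carrier M"
    have "(\<Oplus>\<^bsub>N\<^esub>i\<in>I. co (m \<oplus>\<^bsub>M\<^esub> n) i \<odot>\<^bsub>N\<^esub> y i) = (\<Oplus>\<^bsub>N\<^esub>i\<in>I. co m i \<odot>\<^bsub>N\<^esub> y i \<oplus>\<^bsub>N\<^esub> co n i \<odot>\<^bsub>N\<^esub> y i)"
      by (rule N.M.finsum_cong')
        (use mn in \<open>auto simp: co_add N.smult_l_distr co_closed yc intro!: N.smult_closed N.M.a_closed\<close>)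
    also have "\<dots> = (\<Oplus>\<^bsub>N\<^esub>i\<in>I. co m i \<odot>\<^bsub>N\<^esub> y i) \<oplus>\<^bsub>N\<^esub> (\<Oplus>\<^bsub>N\<^esub>i\<in>I. co n i \<odot>\<^bsub>N\<^esub> y i)"
      by (rule N.M.finsum_addf) (use mn in \<open>auto intro!: N.smult_closed co_closed yc\<close>)
    finally show "(\<Oplus>\<^bsub>N\<^esub>i\<in>I. co (m \<oplus>\<^bsub>M\<^esub> n) i \<odot>\<^bsub>N\<^esub> y i)
        = (\<Oplus>\<^bsub>N\<^esub>i\<in>I. co m i \<odot>\<^bsub>N\<^esub> y i) \<oplus>\<^bsub>N\<^esub> (\<Oplus>\<^bsub>N\<^esub>i\<in>I. co n i \<odot>\<^bsub>N\<^esub> y i)" .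
  next
    fix a m assume am: "a \<in> carrier R" "m \<in> carrier M"
    have "a \<odot>\<^bsub>N\<^esub> (\<Oplus>\<^bsub>N\<^esub>i\<in>I. co m i \<odot>\<^bsub>N\<^esub> y i) = (\<Oplus>\<^bsub>N\<^esub>i\<in>I. a \<odot>\<^bsub>N\<^esub> (co m i \<odot>\<^bsub>N\<^esub> y i))"
      by (rule N.smult_finsum_r) (use am in \<open>auto intro!: N.smult_closed co_closed yc\<close>)
    also have "\<dots> = (\<Oplus>\<^bsub>N\<^esub>i\<in>I. co (a \<odot>\<^bsub>M\<^esub> m) i \<odot>\<^bsub>N\<^esub> y i)"
      by (rule N.M.finsum_cong') (use am in \<open>auto simp: co_smult N.smult_assoc co_closed yc intro!: N.smult_closed\<close>)
    finally show "(\<Oplus>\<^bsub>N\<^esub>i\<in>I. co (a \<odot>\<^bsub>M\<^esub> m) i \<odot>\<^bsub>N\<^esub> y i) = a \<odot>\<^bsub>N\<^esub> (\<Oplus>\<^bsub>N\<^esub>i\<in>I. co m i \<odot>\<^bsub>N\<^esub> y i)" by simp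
  next
    fix n m assume m: "m \<in> grade M n"
    show "(\<Oplus>\<^bsub>N\<^esub>i\<in>I. co m i \<odot>\<^bsub>N\<^esub> y i) \<in> grade N n"
      by (rule N.mgrade_finsum) (auto intro!: N.mgrade_smult'[OF co_grade[OF m] y])
  qed
qed

end

text \<open>\<open>gr_iso\<close> speaks of \<open>inv_into\<close>, which agrees with g on the
  carrier of N only. The closure conditions on N keep all arguments inside that carrier.\<close>

lemma gr_isoI:
  assumes "f \<in> gr_hom R M N" "g \<in> gr_hom R N M"
    and gf: "\<And>x. x \<in> carrier M \<Longrightarrow> g (f x) = x" and fg: "\<And>y. y \<in> carrier N \<Longrightarrow> f (g y) = y"
    and Nc: "\<And>n. grade N n \<subseteq> carrier N"
    and Na: "\<And>x y. x \<in> carrier N \<Longrightarrow> y \<in> carrier N \<Longrightarrow> x \<oplus>\<^bsub>N\<^esub> y \<in> carrier N"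
    and Ns: "\<And>a y. a \<in> carrier R \<Longrightarrow> y \<in> carrier N \<Longrightarrow> a \<odot>\<^bsub>N\<^esub> y \<in> carrier N"
  shows "gr_iso R M N"
proof -
  have b: "bij_betw f (carrier M) (carrier N)"
    using gf fg gr_homD(1)[OF assms(1)] gr_homD(1)[OF assms(2)]
    by (intro bij_betw_byWitness[where f'=g]) (auto simp: Pi_iff)
  have inv: "inv_into (carrier M) f y = g y" if "y \<in> carrier N" for y
    by (rule inv_into_f_eq) (use that b fg gr_homD(1)[OF assms(2)] in \<open>auto simp: bij_betw_def\<close>)
  have "inv_into (carrier M) f \<in> gr_hom R N M"
    using assms(2) inv Na Ns Nc unfolding gr_hom_def by (auto simp: Pi_iff subset_iff)
  then show ?thesis unfolding gr_iso_def using assms(1) b by blast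
qed

lemma gr_isoE:
  assumes "gr_iso R M N"
  obtains f g where "f \<in> gr_hom R M N" "g \<in> gr_hom R N M"
    "\<And>x. x \<in> carrier M \<Longrightarrow> g (f x) = x" "\<And>y. y \<in> carrier N \<Longrightarrow> f (g y) = y"
proof -
  obtain f where f: "f \<in> gr_hom R M N" "bij_betw f (carrier M) (carrier N)" "inv_into (carrier M) f \<in> gr_hom R N M"
    using assms unfolding gr_iso_def by auto
  show ?thesis
    by (rule that[OF f(1,3)]) (use f(2) in \<open>auto simp: bij_betw_def f_inv_into_f\<close>)
qed

text \<open>Matching the basis elements gives homomorphisms in both directions. They are mutually
  inverse because coordinates have already absorbed the factor \<open>e i\<close>.\<close>

lemma gbasis_imp_iso:
  assumes M: "gmod R M" and N: "gmod R N" and bM: "gbasis R M I x e d" and bN: "gbasis R N I y e d"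
  shows "gr_iso R M N"
proof -
  interpret M: based R M I x e d by (intro based.intro M based_axioms.intro bM)
  interpret N: based R N I y e d by (intro based.intro N based_axioms.intro bN)
  have yx: "N.lin (M.co m) \<in> carrier N" "M.lin (N.co n) \<in> carrier M" if "m \<in> carrier M" "n \<in> carrier N" for m n
    using that by (auto intro!: M.lin_closed N.lin_closed M.co_closed N.co_closed)
  show ?thesis
  proof (rule gr_isoI)
    show "(\<lambda>m. N.lin (M.co m)) \<in> gr_hom R M N"
      unfolding N.lin_def by (rule M.extend_hom[OF N N.x_grade])
    show "(\<lambda>m. M.lin (N.co m)) \<in> gr_hom R N M"
      unfolding M.lin_def by (rule N.extend_hom[OF M M.x_grade])
    show "M.lin (N.co (N.lin (M.co m))) = m" if "m \<in> carrier M" for m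
    proof -
      have "M.lin (N.co (N.lin (M.co m))) = M.lin (M.co m)"
        by (rule M.lin_cong) (use that in \<open>auto simp: N.co_lin M.co_closed M.co_e\<close>)
      then show ?thesis using M.lin_co that by simp
    qed
    show "N.lin (M.co (M.lin (N.co m))) = m" if "m \<in> carrier N" for m
    proof -
      have "N.lin (M.co (M.lin (N.co m))) = N.lin (N.co m)"
        by (rule N.lin_cong) (use that in \<open>auto simp: M.co_lin N.co_closed N.co_e\<close>)
      then show ?thesis using N.lin_co that by simp
    qed
  qed (use N.mgrade_carrier N.smult_closed in auto)
qed

text \<open>The images of the basis elements form the new basis; the inverse isomorphism provides
  coordinates and independence.\<close>

lemma gbasis_iso:
  assumes M: "gmod R M" and N: "gmod R N" and b: "gbasis R M I x e d" and iso: "gr_iso R M N"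
  obtains y where "gbasis R N I y e d"
proof -
  interpret M: based R M I x e d by (intro based.intro M based_axioms.intro b)
  interpret N: gmod R N by fact
  obtain f g where f: "f \<in> gr_hom R M N" and g: "g \<in> gr_hom R N M"
    and gf: "\<And>x. x \<in> carrier M \<Longrightarrow> g (f x) = x" and fg: "\<And>y. y \<in> carrier N \<Longrightarrow> f (g y) = y"
    using gr_isoE[OF iso] by metis
  have lin: "f (M.lin r) = (\<Oplus>\<^bsub>N\<^esub>i\<in>I. r i \<odot>\<^bsub>N\<^esub> f (x i))" if "r \<in> I \<rightarrow> carrier R" for r
    unfolding M.lin_def by (rule gr_hom_lin[OF M N f]) (use that M.x_carrier in auto)
  show ?thesis
  proof (rule that[of "\<lambda>i. f (x i)"], rule gbasisI)
    show "e i \<odot>\<^bsub>N\<^esub> f (x i) = f (x i)" if "i \<in> I" for i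
      using gr_homD(3)[OF f M.e_carrier[OF that] M.x_carrier[OF that]] M.e_x[OF that] by simp
    show "\<exists>r. (\<forall>i\<in>I. r i \<in> grade R (n - d i)) \<and> m = (\<Oplus>\<^bsub>N\<^esub>i\<in>I. r i \<odot>\<^bsub>N\<^esub> f (x i))" if m: "m \<in> grade N n" for n m
    proof (intro exI conjI ballI)
      have gm: "g m \<in> grade M n" using gr_homD(4)[OF g m] .
      show "M.co (g m) i \<in> grade R (n - d i)" if "i \<in> I" for i using M.co_grade[OF gm that] .
      show "m = (\<Oplus>\<^bsub>N\<^esub>i\<in>I. M.co (g m) i \<odot>\<^bsub>N\<^esub> f (x i))"
        using lin[of "M.co (g m)"] M.lin_co[of "g m"] M.co_closed M.mgrade_carrier[OF gm] fg[of m] N.mgrade_carrier[OF m] by auto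
    qed
    show "r i \<otimes>\<^bsub>R\<^esub> e i = \<zero>\<^bsub>R\<^esub>" if r: "r \<in> I \<rightarrow> carrier R" "(\<Oplus>\<^bsub>N\<^esub>i\<in>I. r i \<odot>\<^bsub>N\<^esub> f (x i)) = \<zero>\<^bsub>N\<^esub>" "i \<in> I" for r i
    proof -
      have "M.lin r = g (f (M.lin r))" using gf M.lin_closed[OF r(1)] by simp
      also have "\<dots> = \<zero>\<^bsub>M\<^esub>" using lin[OF r(1)] r(2) gr_hom_zero[OF N M g] by simp
      finally show ?thesis using gbasis_indepD[OF b r(1) _ r(3)] unfolding M.lin_def by simp
    qed
  qed (use M.fin M.idem gr_homD(4)[OF f] M.x_grade in auto)
qed

lemma (in gmod) gbasis_reindex:
  assumes b: "gbasis R M I x e d" and h: "bij_betw h J I"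
  shows "gbasis R M J (\<lambda>j. x (h j)) (\<lambda>j. e (h j)) (\<lambda>j. d (h j))"
proof -
  interpret M: based R M I x e d by (intro based.intro gmod_axioms based_axioms.intro b)
  have hJ: "h ` J = I" and inj: "inj_on h J" using h by (auto simp: bij_betw_def)
  have sum: "(\<Oplus>\<^bsub>M\<^esub>i\<in>I. r i \<odot>\<^bsub>M\<^esub> x i) = (\<Oplus>\<^bsub>M\<^esub>j\<in>J. r (h j) \<odot>\<^bsub>M\<^esub> x (h j))" if "r \<in> I \<rightarrow> carrier R" for r
    unfolding hJ[symmetric]
    by (rule M.finsum_reindex[OF _ inj]) (use that hJ M.x_carrier in \<open>auto intro!: smult_closed\<close>)
  show ?thesis
  proof (rule gbasisI)
    show "finite J" using h M.fin bij_betw_finite by blast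
    show "\<exists>r. (\<forall>i\<in>J. r i \<in> grade R (n - d (h i))) \<and> m = (\<Oplus>\<^bsub>M\<^esub>i\<in>J. r i \<odot>\<^bsub>M\<^esub> x (h i))" if mn: "m \<in> grade M n" for n m
    proof -
      obtain r where r: "\<And>i. i \<in> I \<Longrightarrow> r i \<in> grade R (n - d i)" "m = (\<Oplus>\<^bsub>M\<^esub>i\<in>I. r i \<odot>\<^bsub>M\<^esub> x i)"
        using gbasis_spanD[OF b mn] by blast
      then have "r \<in> I \<rightarrow> carrier R" using grade_carrier by blast
      then show ?thesis using r sum hJ by (intro exI[of _ "\<lambda>j. r (h j)"]) auto
    qed
    show "r i \<otimes>\<^bsub>R\<^esub> e (h i) = \<zero>\<^bsub>R\<^esub>" if r: "r \<in> J \<rightarrow> carrier R" "(\<Oplus>\<^bsub>M\<^esub>i\<in>J. r i \<odot>\<^bsub>M\<^esub> x (h i)) = \<zero>\<^bsub>M\<^esub>" "i \<in> J" for r i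
    proof -
      let ?r = "\<lambda>i. r (the_inv_into J h i)"
      have rh: "?r (h j) = r j" if "j \<in> J" for j using that inj by (simp add: the_inv_into_f_f)
      have rc: "?r \<in> I \<rightarrow> carrier R" using r(1) hJ rh by auto
      have "(\<Oplus>\<^bsub>M\<^esub>j\<in>J. ?r (h j) \<odot>\<^bsub>M\<^esub> x (h j)) = (\<Oplus>\<^bsub>M\<^esub>j\<in>J. r j \<odot>\<^bsub>M\<^esub> x (h j))"
        by (rule M.finsum_cong') (use rh r(1) hJ M.x_carrier in \<open>auto intro!: smult_closed\<close>)
      then have "(\<Oplus>\<^bsub>M\<^esub>i\<in>I. ?r i \<odot>\<^bsub>M\<^esub> x i) = \<zero>\<^bsub>M\<^esub>" using sum[OF rc] r(2) by simp
      then have "?r (h i) \<otimes>\<^bsub>R\<^esub> e (h i) = \<zero>\<^bsub>R\<^esub>" using gbasis_indepD[OF b rc, of "h i"] hJ r(3) by auto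
      then show ?thesis using rh r(3) by simp
    qed
  qed (use hJ M.idem M.x_grade M.e_x in auto)
qed

lemma (in gmod) gbasis_cong:
  assumes b: "gbasis R M I x e d" and "\<And>i. i \<in> I \<Longrightarrow> e i = e' i" "\<And>i. i \<in> I \<Longrightarrow> d i = d' i"
  shows "gbasis R M I x e' d'"
  using assms unfolding gbasis_def by simp

section \<open>Bases up to indexing: multisets of types\<close>

lemma image_mset_bij:
  assumes "finite I" "finite J" "image_mset t (mset_set I) = image_mset s (mset_set J)"
  shows "\<exists>h. bij_betw h I J \<and> (\<forall>i\<in>I. s (h i) = t i)"
  using assms
proof (induction I arbitrary: J rule: finite_induct)
  case empty
  then have "J = {}" by (metis image_mset_is_empty_iff mset_set_empty_iff image_mset_empty mset_set.empty)
  then show ?case by (auto simp: bij_betw_def)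
next
  case (insert i F)
  have "t i \<in># image_mset t (mset_set (insert i F))" using insert.hyps by simp
  then have "t i \<in># image_mset s (mset_set J)" unfolding insert.prems(2) .
  \<comment> \<open>Any j in J with the value of i will do; removing i and j keeps the two multisets
    equal.\<close>
  then obtain j where j: "j \<in> J" "s j = t i" using insert.prems(1) by auto
  have "image_mset s (mset_set J) = add_mset (s j) (image_mset s (mset_set (J - {j})))"
    using j insert.prems(1) by (metis image_mset_add_mset mset_set.remove)
  then have "image_mset t (mset_set F) = image_mset s (mset_set (J - {j}))"
    using insert j by simp
  then obtain h where h: "bij_betw h F (J - {j})" "\<forall>i\<in>F. s (h i) = t i"
    using insert.IH[of "J - {j}"] insert.prems(1) by auto
  have "bij_betw (h(i := j)) (insert i F) (insert j (J - {j}))"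
    using h(1) insert.hyps unfolding bij_betw_def inj_on_def by auto
  moreover have "insert j (J - {j}) = J" using j by auto
  moreover have "\<forall>a\<in>insert i F. s ((h(i := j)) a) = t a" using h j insert.hyps by auto
  ultimately have "bij_betw (h(i := j)) (insert i F) J \<and> (\<forall>a\<in>insert i F. s ((h(i := j)) a) = t a)" by metis
  then show ?case by blast
qed

text \<open>The multiset of types forgets the index set, so it can be compared across modules. Index
  sets of natural numbers suffice because bases are finite (\<open>hbasI\<close>).\<close>

definition hbas :: "('k, 'r, 'm) gmodule_scheme \<Rightarrow> ('r, 'a) gmodule \<Rightarrow> ('r \<times> int) multiset \<Rightarrow> bool"
  where "hbas R M T \<longleftrightarrow> (\<exists>(I :: nat set) x e d. gbasis R M I x e d \<and>
    T = image_mset (\<lambda>i. (e i, d i)) (mset_set I))"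

lemma (in gmod) hbasI:
  assumes "gbasis R M I x e d" shows "hbas R M (image_mset (\<lambda>i. (e i, d i)) (mset_set I))"
proof -
  have fin: "finite I" using assms gbasis_typeD by blast
  obtain h where h: "bij_betw h {0..<card I} I" using ex_bij_betw_nat_finite[OF fin] by auto
  have "mset_set I = image_mset h (mset_set {0..<card I})"
    using h image_mset_mset_set[of h "{0..<card I}"] by (simp add: bij_betw_def)
  then show ?thesis
    unfolding hbas_def using gbasis_reindex[OF assms h]
    by (intro exI[of _ "{0..<card I}"] exI conjI) (assumption, simp add: image_mset.compositionality comp_def)
qed

text \<open>Two indexings of the same multiset differ by a bijection. In this way an index set
  adapted to a later construction is imposed on a basis that is only known to exist.\<close>

lemma (in gmod) hbasE:
  assumes "hbas R M T" "finite I" "T = image_mset (\<lambda>i. (e i, d i)) (mset_set I)"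
  obtains x where "gbasis R M I x e d"
proof -
  obtain J :: "nat set" and y e' d' where y: "gbasis R M J y e' d'"
    and T: "T = image_mset (\<lambda>i. (e' i, d' i)) (mset_set J)"
    using assms(1) unfolding hbas_def by blast
  have "finite J" using y gbasis_typeD by blast
  then obtain h where h: "bij_betw h I J" "\<forall>i\<in>I. (e' (h i), d' (h i)) = (e i, d i)"
    using image_mset_bij[OF assms(2), of J "\<lambda>i. (e i, d i)" "\<lambda>i. (e' i, d' i)"] T assms(3) by auto
  show ?thesis by (rule that[OF gbasis_cong[OF gbasis_reindex[OF y h(1)]]]) (use h in auto)
qed

lemma finite_mset_index:
  obtains I :: "nat set" and t where "finite I" "T = image_mset t (mset_set I)"
proof -
  obtain xs where "mset xs = T" using ex_mset by blast
  then have "T = image_mset ((!) xs) (mset_set {..<length xs})"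
    by (metis map_nth mset_map mset_upt atLeast0LessThan)
  then show ?thesis using that by blast
qed

text \<open>
  The data of an isomorphism \<open>R e \<cong> \<Oplus>\<^sub>j R u\<^sub>j (- g\<^sub>j)\<close>: the \<open>b\<^sub>j\<close> form a basis of \<open>R e\<close>, the \<open>a\<^sub>j\<close> are the coordinates of \<open>e\<close>.
\<close>

definition idec :: "('k, 'r, 'm) gmodule_scheme \<Rightarrow> 'r \<Rightarrow> 'j set \<Rightarrow> ('j \<Rightarrow> 'r) \<Rightarrow> ('j \<Rightarrow> 'r) \<Rightarrow> ('j \<Rightarrow> 'r) \<Rightarrow> ('j \<Rightarrow> int) \<Rightarrow> bool"
  where "idec R e J a b u g \<longleftrightarrow> finite J \<and> e = (\<Oplus>\<^bsub>R\<^esub>j\<in>J. a j \<otimes>\<^bsub>R\<^esub> b j) \<and>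
    (\<forall>j\<in>J. a j \<in> grade R (- g j) \<and> b j \<in> grade R (g j) \<and> gidem R (u j) \<and>
      a j \<otimes>\<^bsub>R\<^esub> u j = a j \<and> u j \<otimes>\<^bsub>R\<^esub> b j = b j \<and>
      (\<forall>k\<in>J. b j \<otimes>\<^bsub>R\<^esub> a k = (if j = k then u j else \<zero>\<^bsub>R\<^esub>)))"

locale dec = grring R for R :: "('k, 'r, 'm) gmodule_scheme" (structure) +
  fixes e :: 'r and J :: "'j set" and a b u :: "'j \<Rightarrow> 'r" and g :: "'j \<Rightarrow> int"
  assumes idec: "idec R e J a b u g"
begin

lemma fin: "finite J"
  and e_eq: "e = (\<Oplus>j\<in>J. a j \<otimes> b j)"
  and a_grade: "j \<in> J \<Longrightarrow> a j \<in> grade R (- g j)"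
  and b_grade: "j \<in> J \<Longrightarrow> b j \<in> grade R (g j)"
  and u_idem: "j \<in> J \<Longrightarrow> gidem R (u j)"
  and a_u: "j \<in> J \<Longrightarrow> a j \<otimes> u j = a j"
  and u_b: "j \<in> J \<Longrightarrow> u j \<otimes> b j = b j"
  and b_a: "j \<in> J \<Longrightarrow> k \<in> J \<Longrightarrow> b j \<otimes> a k = (if j = k then u j else \<zero>)"
  using idec unfolding idec_def by auto

lemma a_closed: "j \<in> J \<Longrightarrow> a j \<in> carrier R"
  and b_closed: "j \<in> J \<Longrightarrow> b j \<in> carrier R"
  and u_closed: "j \<in> J \<Longrightarrow> u j \<in> carrier R"
  using a_grade b_grade u_idem gidemD grade_carrier by blast+

lemma e_closed: "e \<in> carrier R"
  unfolding e_eq by (rule finsum_closed) (use a_closed b_closed in auto)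

lemma e_a: assumes "k \<in> J" shows "e \<otimes> a k = a k"
proof -
  have "e \<otimes> a k = (\<Oplus>j\<in>J. a j \<otimes> b j \<otimes> a k)"
    unfolding e_eq by (rule finsum_ldistr) (use fin a_closed b_closed assms in auto)
  also have "\<dots> = a k \<otimes> b k \<otimes> a k"
    by (rule finsum_eq_single) (use fin a_closed b_closed u_closed assms in \<open>auto simp: m_assoc b_a\<close>)
  finally show ?thesis using a_closed b_closed assms by (simp add: m_assoc b_a a_u)
qed

lemma b_e: assumes "k \<in> J" shows "b k \<otimes> e = b k"
proof -
  have "b k \<otimes> e = (\<Oplus>j\<in>J. b k \<otimes> (a j \<otimes> b j))"
    unfolding e_eq by (rule finsum_rdistr) (use fin a_closed b_closed assms in auto)
  also have "\<dots> = b k \<otimes> (a k \<otimes> b k)"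
    by (rule finsum_eq_single) (use fin a_closed b_closed u_closed assms in \<open>auto simp: m_assoc[symmetric] b_a\<close>)
  finally show ?thesis using a_closed b_closed assms by (simp add: m_assoc[symmetric] b_a u_b)
qed

lemma e_gidem: "gidem R e"
proof -
  have "e \<in> grade R 0"
    unfolding e_eq by (rule grade_finsum) (auto intro!: grade_mult'[OF a_grade b_grade])
  moreover have "e \<otimes> e = e"
  proof -
    have "e \<otimes> e = (\<Oplus>j\<in>J. a j \<otimes> b j \<otimes> e)"
      by (subst (1) e_eq) (rule finsum_ldistr, use fin a_closed b_closed e_closed in auto)
    also have "\<dots> = (\<Oplus>j\<in>J. a j \<otimes> b j)"
      by (rule finsum_cong') (use a_closed b_closed e_closed in \<open>auto simp: m_assoc b_e\<close>)
    finally show ?thesis using e_eq by simp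
  qed
  ultimately show ?thesis unfolding gidem_def by simp
qed

end

text \<open>Each summand R \<open>e i\<close> is replaced by its own decomposition. Degrees add
  because the basis elements b of R \<open>e i\<close> are applied to \<open>x i\<close>.\<close>

lemma (in gmod) gbasis_refine:
  assumes b: "gbasis R M I x e d"
    and dec: "\<And>i. i \<in> I \<Longrightarrow> idec R (e i) (J i) (a i) (b i) (u i) (g i)"
  shows "gbasis R M (Sigma I J) (\<lambda>p. b (fst p) (snd p) \<odot>\<^bsub>M\<^esub> x (fst p)) (\<lambda>p. u (fst p) (snd p))
    (\<lambda>p. g (fst p) (snd p) + d (fst p))"
proof -
  interpret M: based R M I x e d by (intro based.intro gmod_axioms based_axioms.intro b)
  have D: "dec R (e i) (J i) (a i) (b i) (u i) (g i)" if "i \<in> I" for i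
    by (intro dec.intro dec_axioms.intro R.grring_axioms dec that)
  note Df = dec.fin[OF D] and Dc = dec.a_closed[OF D] dec.b_closed[OF D] dec.u_closed[OF D]
  have sum: "(\<Oplus>\<^bsub>M\<^esub>p\<in>Sigma I J. r p \<odot>\<^bsub>M\<^esub> (b (fst p) (snd p) \<odot>\<^bsub>M\<^esub> x (fst p)))
     = M.lin (\<lambda>i. \<Oplus>j\<in>J i. r (i, j) \<otimes> b i j)" if r: "r \<in> Sigma I J \<rightarrow> carrier R" for r
  proof -
    have "M.lin (\<lambda>i. \<Oplus>j\<in>J i. r (i, j) \<otimes> b i j) = (\<Oplus>\<^bsub>M\<^esub>i\<in>I. \<Oplus>\<^bsub>M\<^esub>j\<in>J i. r (i, j) \<odot>\<^bsub>M\<^esub> (b i j \<odot>\<^bsub>M\<^esub> x i))"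
      unfolding M.lin_def
    proof (rule M.finsum_cong')
      fix i assume i: "i \<in> I"
      have "(\<Oplus>j\<in>J i. r (i, j) \<otimes> b i j) \<odot>\<^bsub>M\<^esub> x i = (\<Oplus>\<^bsub>M\<^esub>j\<in>J i. (r (i, j) \<otimes> b i j) \<odot>\<^bsub>M\<^esub> x i)"
        by (rule smult_finsum_l) (use r i M.x_carrier Dc in auto)
      also have "\<dots> = (\<Oplus>\<^bsub>M\<^esub>j\<in>J i. r (i, j) \<odot>\<^bsub>M\<^esub> (b i j \<odot>\<^bsub>M\<^esub> x i))"
        by (rule M.finsum_cong') (use r i M.x_carrier Dc in \<open>auto simp: Pi_iff smult_assoc intro!: smult_closed\<close>)
      finally show "(\<Oplus>j\<in>J i. r (i, j) \<otimes> b i j) \<odot>\<^bsub>M\<^esub> x i = (\<Oplus>\<^bsub>M\<^esub>j\<in>J i. r (i, j) \<odot>\<^bsub>M\<^esub> (b i j \<odot>\<^bsub>M\<^esub> x i))" .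
    qed (use r M.x_carrier Dc in \<open>auto intro!: smult_closed M.finsum_closed\<close>)
    also have "\<dots> = (\<Oplus>\<^bsub>M\<^esub>p\<in>Sigma I J. r (fst p, snd p) \<odot>\<^bsub>M\<^esub> (b (fst p) (snd p) \<odot>\<^bsub>M\<^esub> x (fst p)))"
      by (rule M.finsum_Sigma) (use r M.x_carrier M.fin Df Dc in \<open>auto intro!: smult_closed\<close>)
    finally show ?thesis by simp
  qed
  show ?thesis
  proof (rule gbasisI)
    show "finite (Sigma I J)" using M.fin Df by auto
    show "gidem R (u (fst p) (snd p))" if "p \<in> Sigma I J" for p using that dec.u_idem[OF D] by auto
    show "b (fst p) (snd p) \<odot>\<^bsub>M\<^esub> x (fst p) \<in> grade M (g (fst p) (snd p) + d (fst p))" if "p \<in> Sigma I J" for p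
      using that dec.b_grade[OF D] M.x_grade by (auto intro!: mgrade_smult)
    show "u (fst p) (snd p) \<odot>\<^bsub>M\<^esub> (b (fst p) (snd p) \<odot>\<^bsub>M\<^esub> x (fst p)) = b (fst p) (snd p) \<odot>\<^bsub>M\<^esub> x (fst p)"
      if "p \<in> Sigma I J" for p
      using that Dc M.x_carrier dec.u_b[OF D] by (auto simp: smult_assoc[symmetric])
  next
    fix n m assume "m \<in> grade M n"
    then obtain r where r: "\<And>i. i \<in> I \<Longrightarrow> r i \<in> grade R (n - d i)" "m = M.lin r"
      using gbasis_spanD[OF b] unfolding M.lin_def by blast
    \<comment> \<open>Since \<open>e i\<close> is the sum of the products a b, a coefficient r of
      \<open>x i\<close> becomes the coefficient r a of b \<open>x i\<close>.\<close>
    let ?s = "\<lambda>p. r (fst p) \<otimes> a (fst p) (snd p)"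
    have rc: "r i \<in> carrier R" if "i \<in> I" for i using r(1)[OF that] grade_carrier by auto
    have "(\<Oplus>\<^bsub>M\<^esub>p\<in>Sigma I J. ?s p \<odot>\<^bsub>M\<^esub> (b (fst p) (snd p) \<odot>\<^bsub>M\<^esub> x (fst p)))
        = M.lin (\<lambda>i. \<Oplus>j\<in>J i. ?s (i, j) \<otimes> b i j)"
      by (rule sum) (use rc Dc in auto)
    also have "\<dots> = M.lin (\<lambda>i. r i \<otimes> e i)"
    proof (rule M.lin_cong)
      fix i assume i: "i \<in> I"
      have "r i \<otimes> e i = (\<Oplus>j\<in>J i. r i \<otimes> (a i j \<otimes> b i j))"
        unfolding dec.e_eq[OF D[OF i]] by (rule R.finsum_rdistr) (use i rc Dc Df in auto)
      also have "\<dots> = (\<Oplus>j\<in>J i. ?s (i, j) \<otimes> b i j)"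
        by (rule R.finsum_cong') (use i rc Dc in \<open>auto simp: R.m_assoc\<close>)
      finally show "(\<Oplus>j\<in>J i. ?s (i, j) \<otimes> b i j) = r i \<otimes> e i" by simp
    qed (use rc M.e_carrier in auto)
    also have "\<dots> = m" using M.lin_e[of r] rc r(2) by auto
    finally have "m = (\<Oplus>\<^bsub>M\<^esub>p\<in>Sigma I J. ?s p \<odot>\<^bsub>M\<^esub> (b (fst p) (snd p) \<odot>\<^bsub>M\<^esub> x (fst p)))" by simp
    moreover have "\<forall>p\<in>Sigma I J. ?s p \<in> grade R (n - (g (fst p) (snd p) + d (fst p)))"
      by (auto intro!: R.grade_mult'[OF r(1) dec.a_grade[OF D]])
    ultimately show "\<exists>s. (\<forall>p\<in>Sigma I J. s p \<in> grade R (n - (g (fst p) (snd p) + d (fst p)))) \<and>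
        m = (\<Oplus>\<^bsub>M\<^esub>p\<in>Sigma I J. s p \<odot>\<^bsub>M\<^esub> (b (fst p) (snd p) \<odot>\<^bsub>M\<^esub> x (fst p)))"
      by (intro exI[of _ ?s] conjI)
  next
    fix r p assume r: "r \<in> Sigma I J \<rightarrow> carrier R" and p: "p \<in> Sigma I J"
      and 0: "(\<Oplus>\<^bsub>M\<^esub>p\<in>Sigma I J. r p \<odot>\<^bsub>M\<^esub> (b (fst p) (snd p) \<odot>\<^bsub>M\<^esub> x (fst p))) = \<zero>\<^bsub>M\<^esub>"
    obtain i k where ik: "i \<in> I" "k \<in> J i" "p = (i, k)" using p by auto
    let ?s = "\<lambda>i. \<Oplus>j\<in>J i. r (i, j) \<otimes> b i j"
    have sc: "?s \<in> I \<rightarrow> carrier R" using r Dc by (auto intro!: R.finsum_closed)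
    have "?s i \<otimes> e i = \<zero>"
      using gbasis_indepD[OF b sc _ ik(1)] 0 sum[OF r] unfolding M.lin_def by simp
    have rc: "r (i, j) \<in> carrier R" if "j \<in> J i" for j using r that ik by auto
    \<comment> \<open>Right multiplication by \<open>a i k\<close> singles out the coefficient at k,
      because the products b a form a diagonal matrix with entries u.\<close>
    have "\<zero> = ?s i \<otimes> e i \<otimes> a i k" using \<open>?s i \<otimes> e i = \<zero>\<close> Dc ik by simp
    also have "\<dots> = ?s i \<otimes> a i k"
      using sc ik Dc M.e_carrier by (simp add: R.m_assoc Pi_iff dec.e_a[OF D])
    also have "\<dots> = (\<Oplus>j\<in>J i. r (i, j) \<otimes> b i j \<otimes> a i k)"
      by (rule R.finsum_ldistr) (use ik Df Dc rc in auto)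
    also have "\<dots> = r (i, k) \<otimes> b i k \<otimes> a i k"
      by (rule R.finsum_eq_single) (use ik Df Dc rc in \<open>auto simp: R.m_assoc dec.b_a[OF D]\<close>)
    also have "\<dots> = r (i, k) \<otimes> u i k" using ik Dc rc by (simp add: R.m_assoc dec.b_a[OF D])
    finally show "r p \<otimes>\<^bsub>R\<^esub> u (fst p) (snd p) = \<zero>\<^bsub>R\<^esub>" using ik by simp
  qed
qed

text \<open>The graded left ideal R e, obtained from the regular module by restricting two fields,
  so that R 1 is literally \<open>gr_regular R\<close>.\<close>

definition corner :: "('k, 'r, 'm) gmodule_scheme \<Rightarrow> 'r \<Rightarrow> ('r, 'r) gmodule"
  where "corner R e = (gr_regular R)\<lparr>carrier := {a \<in> carrier R. a \<otimes>\<^bsub>R\<^esub> e = a},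
    grade := \<lambda>n. {a \<in> grade R n. a \<otimes>\<^bsub>R\<^esub> e = a}\<rparr>"

lemma corner_simps [simp]:
  "carrier (corner R e) = {a \<in> carrier R. a \<otimes>\<^bsub>R\<^esub> e = a}"
  "grade (corner R e) n = {a \<in> grade R n. a \<otimes>\<^bsub>R\<^esub> e = a}"
  "ring.zero (corner R e) = \<zero>\<^bsub>R\<^esub>" "add (corner R e) = add R" "smult (corner R e) = monoid.mult R"
  by (simp_all add: corner_def gr_regular_def)

context grring
begin

lemma gr_regular_corner: "gr_regular R = corner R \<one>"
proof -
  have "{a \<in> carrier R. a \<otimes> \<one> = a} = carrier R" by auto
  moreover have "{a \<in> grade R n. a \<otimes> \<one> = a} = grade R n" for n using grade_carrier by auto
  ultimately show ?thesis unfolding corner_def gr_regular_def by simp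
qed

lemma one_gidem: "gidem R \<one>"
  unfolding gidem_def using grade_one by simp

lemma abelian_corner:
  assumes "e \<in> carrier R" shows "abelian_group (corner R e)"
proof (rule abelian_groupI)
  fix a assume a: "a \<in> carrier (corner R e)"
  show "\<exists>b\<in>carrier (corner R e). b \<oplus>\<^bsub>corner R e\<^esub> a = \<zero>\<^bsub>corner R e\<^esub>"
    by (rule bexI[of _ "\<ominus> a"]) (use a assms in \<open>auto simp: l_neg l_minus\<close>)
qed (use assms in \<open>auto simp: l_distr a_ac\<close>)

lemma gmod_corner:
  assumes e: "gidem R e" shows "gmod R (corner R e)"
proof -
  have ec: "e \<in> carrier R" using e gidemD by auto
  show ?thesis
  proof (intro gmod.intro gmod_axioms.intro grring_axioms left_module.intro left_module_axioms.intro ring_axioms abelian_corner[OF ec])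
    show "subgroup (grade (corner R e) n) (add_monoid (corner R e))" for n
    proof (rule group.subgroupI)
      show "group (add_monoid (corner R e))" using abelian_group.a_group[OF abelian_corner[OF ec]] .
      have "\<zero> \<in> grade (corner R e) n" using ec by simp
      then show "grade (corner R e) n \<noteq> {}" by blast
      fix a assume a: "a \<in> grade (corner R e) n"
      have "inv\<^bsub>add_monoid (corner R e)\<^esub> a = \<ominus> a"
      proof (rule group.inv_equality[OF abelian_group.a_group[OF abelian_corner[OF ec]]])
      qed (use a ec grade_carrier in \<open>auto simp: l_neg l_minus\<close>)
      then show "inv\<^bsub>add_monoid (corner R e)\<^esub> a \<in> grade (corner R e) n"
        using a ec grade_carrier grade_neg by (auto simp: l_minus)
    qed (use ec grade_carrier grade_add in \<open>auto simp: l_distr\<close>)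
  next
    fix H assume H: "subgroup H (add_monoid (corner R e))" "\<And>n. grade (corner R e) n \<subseteq> H"
    show "carrier (corner R e) \<subseteq> H"
    proof
      fix m assume m: "m \<in> carrier (corner R e)"
      then have mc: "m \<in> carrier R" "m \<otimes> e = m" by auto
      let ?A = "{n. proj n m \<noteq> \<zero>}"
      \<comment> \<open>As e has degree 0, the components of m = m e lie in R e as well.\<close>
      have p: "proj n m \<in> grade (corner R e) n" for n
        using proj_mult_right[OF mc(1) gidemD(2)[OF e], of n] mc proj_props(1) by simp
      have "finsum (corner R e) (\<lambda>n. proj n m) ?A = finsum R (\<lambda>n. proj n m) ?A"
        by (rule finsum_hom[where h="\<lambda>a. a", OF abelian_corner[OF ec] abelian_group_axioms])
          (use p grade_carrier in auto)
      then have "m = finsum (corner R e) (\<lambda>n. proj n m) ?A" using proj_props(3)[OF mc(1)] by simp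
      moreover have "finsum (corner R e) (\<lambda>n. proj n m) ?A \<in> H"
        by (rule abelian_group.finsum_in_subgroup[OF abelian_corner[OF ec] H(1)]) (use p H(2) in auto)
      ultimately show "m \<in> H" by simp
    qed
  qed (use ec grade_carrier in \<open>auto simp: l_distr r_distr m_assoc intro: grade_mult\<close>)
qed

lemma finsum_corner:
  assumes "e \<in> carrier R" "f \<in> A \<rightarrow> carrier (corner R e)"
  shows "finsum (corner R e) f A = finsum R f A"
  by (rule finsum_hom[where h="\<lambda>a. a", OF abelian_corner[OF assms(1)] abelian_group_axioms])
    (use assms in auto)

text \<open>The a are the coordinates of the generator e. Since \<open>b j\<close> e =
  \<open>b j\<close>, multiplying the k-th coordinate of e by \<open>b j\<close> gives the k-th
  coordinate of \<open>b j\<close>; this is the orthogonality relation.\<close>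

lemma gbasis_corner_idec:
  assumes e: "gidem R e" and b: "gbasis R (corner R e) J b u g"
  obtains a where "idec R e J a b u g"
proof -
  interpret M: based R "corner R e" J b u g
    by (intro based.intro based_axioms.intro b gmod_corner e)
  have ec: "e \<in> carrier (corner R e)" and ec': "e \<in> carrier R" and e0: "e \<in> grade (corner R e) 0" using e gidemD by auto
  have bc: "b j \<in> carrier R" "b j \<otimes> e = b j" if "j \<in> J" for j using M.x_carrier that by auto
  have cc: "M.co e j \<in> carrier R" if "j \<in> J" for j using M.co_closed ec that by auto
  show ?thesis
  proof (rule that[of "M.co e"], unfold idec_def, intro conjI ballI)
    have "e = finsum (corner R e) (\<lambda>j. M.co e j \<otimes> b j) J" using M.lin_co[OF ec] unfolding M.lin_def by simp
    also have "\<dots> = (\<Oplus>j\<in>J. M.co e j \<otimes> b j)"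
      by (rule finsum_corner[OF ec']) (use cc bc ec' in \<open>auto simp: m_assoc\<close>)
    finally show "e = (\<Oplus>j\<in>J. M.co e j \<otimes> b j)" .
  next
    fix j k assume jk: "j \<in> J" "k \<in> J"
    have "b j \<otimes> M.co e k = M.co (b j \<otimes> e) k" using M.co_smult[OF ec bc(1)[OF jk(1)] jk(2)] by simp
    then show "b j \<otimes> M.co e k = (if j = k then u j else \<zero>)"
      using M.co_x[OF jk(2,1)] bc[OF jk(1)] by auto
  next
    fix j assume "j \<in> J"
    then show "M.co e j \<in> grade R (- g j)" "b j \<in> grade R (g j)" "gidem R (u j)"
      "M.co e j \<otimes> u j = M.co e j" "u j \<otimes> b j = b j"
      using M.co_grade[OF e0] M.x_grade M.idem M.co_e[OF ec] M.e_x by auto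
  qed (rule M.fin)
qed

text \<open>An element m = m e is the sum of the terms (m a) b, so its coefficients are the m a.
  Right multiplication by \<open>a k\<close> proves independence.\<close>

lemma idec_gbasis_corner:
  assumes "idec R e J a b u g"
  shows "gbasis R (corner R e) J b u g"
proof -
  interpret D: dec R e J a b u g by (intro dec.intro dec_axioms.intro grring_axioms assms)
  have fc: "finsum (corner R e) (\<lambda>j. r j \<otimes> b j) J = (\<Oplus>j\<in>J. r j \<otimes> b j)" if "r \<in> J \<rightarrow> carrier R" for r
    by (rule finsum_corner[OF D.e_closed]) (use that D.b_closed D.e_closed in \<open>auto simp: Pi_iff m_assoc D.b_e\<close>)
  show ?thesis
  proof (rule gbasisI)
    fix n m assume m: "m \<in> grade (corner R e) n"
    have mc: "m \<in> carrier R" using m grade_carrier by auto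
    have "m = m \<otimes> e" using m by simp
    also have "\<dots> = (\<Oplus>j\<in>J. m \<otimes> (a j \<otimes> b j))"
      by (subst D.e_eq) (rule finsum_rdistr, use mc D.fin D.a_closed D.b_closed in auto)
    also have "\<dots> = (\<Oplus>j\<in>J. (m \<otimes> a j) \<otimes> b j)"
      by (rule finsum_cong') (use mc D.a_closed D.b_closed in \<open>auto simp: m_assoc\<close>)
    also have "\<dots> = finsum (corner R e) (\<lambda>j. (m \<otimes> a j) \<otimes> b j) J"
      by (rule fc[symmetric]) (use mc D.a_closed in auto)
    finally show "\<exists>r. (\<forall>j\<in>J. r j \<in> grade R (n - g j)) \<and> m = (\<Oplus>\<^bsub>corner R e\<^esub>j\<in>J. r j \<odot>\<^bsub>corner R e\<^esub> b j)"
      using m D.a_grade by (intro exI[of _ "\<lambda>j. m \<otimes> a j"]) (auto intro!: grade_mult')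
  next
    fix r k assume r: "r \<in> J \<rightarrow> carrier R" "(\<Oplus>\<^bsub>corner R e\<^esub>j\<in>J. r j \<odot>\<^bsub>corner R e\<^esub> b j) = \<zero>\<^bsub>corner R e\<^esub>" "k \<in> J"
    have rc: "r j \<in> carrier R" if "j \<in> J" for j using r that by auto
    have "(\<Oplus>j\<in>J. r j \<otimes> b j) = \<zero>" using r(2) fc[OF r(1)] by simp
    then have "\<zero> = (\<Oplus>j\<in>J. r j \<otimes> b j) \<otimes> a k" using D.a_closed r(3) by simp
    also have "\<dots> = (\<Oplus>j\<in>J. r j \<otimes> b j \<otimes> a k)"
      by (rule finsum_ldistr) (use r(3) D.fin D.a_closed D.b_closed rc in auto)
    also have "\<dots> = r k \<otimes> b k \<otimes> a k"
      by (rule finsum_eq_single) (use r(3) D.fin D.a_closed D.b_closed D.u_closed rc in \<open>auto simp: m_assoc D.b_a\<close>)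
    also have "\<dots> = r k \<otimes> u k" using r(3) D.a_closed D.b_closed rc by (simp add: m_assoc D.b_a)
    finally show "r k \<otimes> u k = \<zero>" by simp
  qed (use D.fin D.u_idem D.b_grade D.b_e D.u_b in auto)
qed

lemma gbasis_corner_single: "gidem R e \<Longrightarrow> gbasis R (corner R e) {i} (\<lambda>_. e) (\<lambda>_. e) (\<lambda>_. 0)"
  by (rule idec_gbasis_corner[where a="\<lambda>_. e"]) (auto simp: idec_def gidemD)

end

section \<open>Subgroups, direct sums, shifts and standard modules\<close>

lemma add_subgroupI:
  assumes "abelian_group G" "S \<subseteq> carrier G" "\<zero>\<^bsub>G\<^esub> \<in> S"
    and "\<And>x y. x \<in> S \<Longrightarrow> y \<in> S \<Longrightarrow> x \<oplus>\<^bsub>G\<^esub> y \<in> S" "\<And>x. x \<in> S \<Longrightarrow> \<exists>y\<in>S. y \<oplus>\<^bsub>G\<^esub> x = \<zero>\<^bsub>G\<^esub>"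
  shows "subgroup S (add_monoid G)"
proof -
  interpret abelian_group G by fact
  show ?thesis
  proof (rule add.subgroupI)
    fix a assume "a \<in> S"
    then obtain y where "y \<in> S" "y \<oplus>\<^bsub>G\<^esub> a = \<zero>\<^bsub>G\<^esub>" using assms(5) by blast
    then show "\<ominus>\<^bsub>G\<^esub> a \<in> S" using minus_equality[of y a] assms(2) \<open>a \<in> S\<close> by auto
  qed (use assms in auto)
qed

lemma add_subgroupD:
  assumes "subgroup S (add_monoid G)" "abelian_group G"
  shows "S \<subseteq> carrier G" "\<zero>\<^bsub>G\<^esub> \<in> S" "\<And>x y. x \<in> S \<Longrightarrow> y \<in> S \<Longrightarrow> x \<oplus>\<^bsub>G\<^esub> y \<in> S"
    "\<And>x. x \<in> S \<Longrightarrow> \<ominus>\<^bsub>G\<^esub> x \<in> S"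
  using subgroup.subset[OF assms(1)] subgroup.one_closed[OF assms(1)] subgroup.m_closed[OF assms(1)]
    subgroup.m_inv_closed[OF assms(1)] by (auto simp: a_inv_def)

text \<open>Allows identities between additive maps to be checked on additive generators.\<close>

lemma additive_eq_subgroup:
  assumes A: "abelian_group A" and B: "abelian_group B"
    and F: "\<And>a. a \<in> carrier A \<Longrightarrow> F a \<in> carrier B"
      "\<And>a b. a \<in> carrier A \<Longrightarrow> b \<in> carrier A \<Longrightarrow> F (a \<oplus>\<^bsub>A\<^esub> b) = F a \<oplus>\<^bsub>B\<^esub> F b"
    and G: "\<And>a. a \<in> carrier A \<Longrightarrow> G a \<in> carrier B"
      "\<And>a b. a \<in> carrier A \<Longrightarrow> b \<in> carrier A \<Longrightarrow> G (a \<oplus>\<^bsub>A\<^esub> b) = G a \<oplus>\<^bsub>B\<^esub> G b"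
  shows "subgroup {a \<in> carrier A. F a = G a} (add_monoid A)"
proof (rule add_subgroupI[OF A])
  interpret A: abelian_group A by (rule A)
  interpret B: abelian_group B by (rule B)
  have 0: "F' \<zero>\<^bsub>A\<^esub> = \<zero>\<^bsub>B\<^esub>" if "F' \<zero>\<^bsub>A\<^esub> \<in> carrier B" "F' (\<zero>\<^bsub>A\<^esub> \<oplus>\<^bsub>A\<^esub> \<zero>\<^bsub>A\<^esub>) = F' \<zero>\<^bsub>A\<^esub> \<oplus>\<^bsub>B\<^esub> F' \<zero>\<^bsub>A\<^esub>" for F'
    using that by simp
  have F0: "F \<zero>\<^bsub>A\<^esub> = \<zero>\<^bsub>B\<^esub>" by (rule 0) (simp_all add: F(1) F(2)[symmetric])
  have G0: "G \<zero>\<^bsub>A\<^esub> = \<zero>\<^bsub>B\<^esub>" by (rule 0) (simp_all add: G(1) G(2)[symmetric])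
  show "\<zero>\<^bsub>A\<^esub> \<in> {a \<in> carrier A. F a = G a}" using F0 G0 by simp
  show "{a \<in> carrier A. F a = G a} \<subseteq> carrier A" by blast
  fix a assume a: "a \<in> {a \<in> carrier A. F a = G a}"
  then have aA: "a \<in> carrier A" "\<ominus>\<^bsub>A\<^esub> a \<in> carrier A" by auto
  have "F (\<ominus>\<^bsub>A\<^esub> a) \<oplus>\<^bsub>B\<^esub> F a = \<zero>\<^bsub>B\<^esub>" using F(2)[OF aA(2,1)] F0 aA by (simp add: A.l_neg)
  then have 1: "\<ominus>\<^bsub>B\<^esub> F a = F (\<ominus>\<^bsub>A\<^esub> a)" by (rule B.minus_equality) (use F(1) aA in auto)
  have "G (\<ominus>\<^bsub>A\<^esub> a) \<oplus>\<^bsub>B\<^esub> G a = \<zero>\<^bsub>B\<^esub>" using G(2)[OF aA(2,1)] G0 aA by (simp add: A.l_neg)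
  then have 2: "\<ominus>\<^bsub>B\<^esub> G a = G (\<ominus>\<^bsub>A\<^esub> a)" by (rule B.minus_equality) (use G(1) aA in auto)
  show "\<exists>g\<in>{a \<in> carrier A. F a = G a}. g \<oplus>\<^bsub>A\<^esub> a = \<zero>\<^bsub>A\<^esub>"
    using a 1 2 by (intro bexI[of _ "\<ominus>\<^bsub>A\<^esub> a"]) (auto simp: A.l_neg)
next
  interpret A: abelian_group A by (rule A)
  fix a b assume "a \<in> {a \<in> carrier A. F a = G a}" "b \<in> {a \<in> carrier A. F a = G a}"
  then show "a \<oplus>\<^bsub>A\<^esub> b \<in> {a \<in> carrier A. F a = G a}" using F(2) G(2) by simp
qed

lemma gmodI:
  assumes "grring R" "abelian_group M"
    and "\<And>a x. a \<in> carrier R \<Longrightarrow> x \<in> carrier M \<Longrightarrow> a \<odot>\<^bsub>M\<^esub> x \<in> carrier M"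
    and "\<And>a b x. \<lbrakk>a \<in> carrier R; b \<in> carrier R; x \<in> carrier M\<rbrakk> \<Longrightarrow>
      (a \<oplus>\<^bsub>R\<^esub> b) \<odot>\<^bsub>M\<^esub> x = a \<odot>\<^bsub>M\<^esub> x \<oplus>\<^bsub>M\<^esub> b \<odot>\<^bsub>M\<^esub> x"
    and "\<And>a x y. \<lbrakk>a \<in> carrier R; x \<in> carrier M; y \<in> carrier M\<rbrakk> \<Longrightarrow>
      a \<odot>\<^bsub>M\<^esub> (x \<oplus>\<^bsub>M\<^esub> y) = a \<odot>\<^bsub>M\<^esub> x \<oplus>\<^bsub>M\<^esub> a \<odot>\<^bsub>M\<^esub> y"
    and "\<And>a b x. \<lbrakk>a \<in> carrier R; b \<in> carrier R; x \<in> carrier M\<rbrakk> \<Longrightarrow>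
      (a \<otimes>\<^bsub>R\<^esub> b) \<odot>\<^bsub>M\<^esub> x = a \<odot>\<^bsub>M\<^esub> (b \<odot>\<^bsub>M\<^esub> x)"
    and "\<And>x. x \<in> carrier M \<Longrightarrow> \<one>\<^bsub>R\<^esub> \<odot>\<^bsub>M\<^esub> x = x"
    and "\<And>n. subgroup (grade M n) (add_monoid M)"
    and "\<And>a m x n. \<lbrakk>a \<in> grade R m; x \<in> grade M n\<rbrakk> \<Longrightarrow> a \<odot>\<^bsub>M\<^esub> x \<in> grade M (m + n)"
    and "\<And>H. \<lbrakk>subgroup H (add_monoid M); \<And>n. grade M n \<subseteq> H\<rbrakk> \<Longrightarrow> carrier M \<subseteq> H"
  shows "gmod R M"
  using assms grring.axioms(1)[OF assms(1)]
  by (intro gmod.intro gmod_axioms.intro left_module.intro left_module_axioms.intro) auto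

text \<open>\<open>fin_generated\<close> uses a set of generators, not a family, so repetitions
  among the \<open>x i\<close> matter. If \<open>x i\<close> = \<open>x j\<close> for distinct
  indices, then comparing coordinates gives \<open>e i\<close> = 0 and hence \<open>x i\<close> = 0;
  the nonzero basis elements are therefore distinct.\<close>

lemma (in based) fin_generated: "fin_generated R M"
  unfolding fin_generated_def
proof (intro exI[of _ "x ` {i \<in> I. x i \<noteq> \<zero>\<^bsub>M\<^esub>}"] conjI ballI)
  let ?I = "{i \<in> I. x i \<noteq> \<zero>\<^bsub>M\<^esub>}"
  show "x ` ?I \<subseteq> carrier M" using x_carrier by auto
  show "finite (x ` ?I)" using fin by simp
  fix m assume m: "m \<in> carrier M"
  have inj: "inj_on x ?I"
  proof (rule inj_onI, rule ccontr)
    fix i j assume ij: "i \<in> ?I" "j \<in> ?I" "x i = x j" "i \<noteq> j"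
    then have "e i = \<zero>" using co_x[of i i] co_x[of i j] by auto
    then show False using ij e_x[of i] x_carrier[of i] by simp
  qed
  let ?c = "\<lambda>s. co m (the_inv_into ?I x s)"
  have c: "?c (x i) = co m i" if "i \<in> ?I" for i using the_inv_into_f_f[OF inj that] by simp
  have cx: "co m i \<odot>\<^bsub>M\<^esub> x i \<in> carrier M" if "i \<in> I" for i
    using co_closed[OF m that] x_carrier[OF that] by (rule smult_closed)
  have "m = (\<Oplus>\<^bsub>M\<^esub>i\<in>I. co m i \<odot>\<^bsub>M\<^esub> x i)" using lin_co[OF m] unfolding lin_def by simp
  also have "\<dots> = (\<Oplus>\<^bsub>M\<^esub>i\<in>?I. co m i \<odot>\<^bsub>M\<^esub> x i)"
    by (rule M.add.finprod_mono_neutral_cong_right) (use fin cx co_closed[OF m] in auto)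
  also have "\<dots> = (\<Oplus>\<^bsub>M\<^esub>i\<in>?I. ?c (x i) \<odot>\<^bsub>M\<^esub> x i)"
    by (rule M.finsum_cong') (use cx c in \<open>simp_all add: Pi_iff\<close>)
  also have "\<dots> = (\<Oplus>\<^bsub>M\<^esub>s\<in>x ` ?I. ?c s \<odot>\<^bsub>M\<^esub> s)"
    by (rule M.finsum_reindex[symmetric, OF _ inj]) (use cx c in \<open>simp add: Pi_iff\<close>)
  finally have "m = (\<Oplus>\<^bsub>M\<^esub>s\<in>x ` ?I. ?c s \<odot>\<^bsub>M\<^esub> s)" .
  moreover have "?c \<in> x ` ?I \<rightarrow> carrier R" using c co_closed[OF m] by (simp add: Pi_iff)
  ultimately show "\<exists>c\<in>x ` ?I \<rightarrow> carrier R. m = (\<Oplus>\<^bsub>M\<^esub>s\<in>x ` ?I. c s \<odot>\<^bsub>M\<^esub> s)"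
    by (rule bexI[of _ ?c])
qed

lemma gr_dsum_simps [simp]:
  "carrier (gr_dsum M N) = carrier M \<times> carrier N"
  "ring.zero (gr_dsum M N) = (\<zero>\<^bsub>M\<^esub>, \<zero>\<^bsub>N\<^esub>)"
  "(x, y) \<oplus>\<^bsub>gr_dsum M N\<^esub> (x', y') = (x \<oplus>\<^bsub>M\<^esub> x', y \<oplus>\<^bsub>N\<^esub> y')"
  "a \<odot>\<^bsub>gr_dsum M N\<^esub> (x, y) = (a \<odot>\<^bsub>M\<^esub> x, a \<odot>\<^bsub>N\<^esub> y)"
  "grade (gr_dsum M N) n = grade M n \<times> grade N n"
  by (simp_all add: gr_dsum_def)

lemma gmod_dsum:
  assumes "gmod R M" "gmod R N"
  shows "gmod R (gr_dsum M N)"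
proof -
  interpret M: gmod R M by fact
  interpret N: gmod R N by fact
  have ab: "abelian_group (gr_dsum M N)"
  proof (rule abelian_groupI)
    fix p assume "p \<in> carrier (gr_dsum M N)"
    then show "\<exists>q\<in>carrier (gr_dsum M N). q \<oplus>\<^bsub>gr_dsum M N\<^esub> p = \<zero>\<^bsub>gr_dsum M N\<^esub>"
      by (intro bexI[of _ "(\<ominus>\<^bsub>M\<^esub> fst p, \<ominus>\<^bsub>N\<^esub> snd p)"]) (auto simp: M.M.l_neg N.M.l_neg)
  qed (auto simp: M.M.a_ac N.M.a_ac)
  show ?thesis
  proof (rule gmodI[OF M.R.grring_axioms ab])
    show "subgroup (grade (gr_dsum M N) n) (add_monoid (gr_dsum M N))" for n
    proof (rule add_subgroupI[OF ab])
      fix p assume "p \<in> grade (gr_dsum M N) n"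
      then show "\<exists>q\<in>grade (gr_dsum M N) n. q \<oplus>\<^bsub>gr_dsum M N\<^esub> p = \<zero>\<^bsub>gr_dsum M N\<^esub>"
        using add_subgroupD(4)[OF M.mgrade_sub M.M.abelian_group_axioms] add_subgroupD(4)[OF N.mgrade_sub N.M.abelian_group_axioms]
        by (intro bexI[of _ "(\<ominus>\<^bsub>M\<^esub> fst p, \<ominus>\<^bsub>N\<^esub> snd p)"])
          (auto simp: M.M.l_neg N.M.l_neg M.mgrade_carrier N.mgrade_carrier)
    qed (auto simp: M.mgrade_carrier N.mgrade_carrier M.mgrade_add N.mgrade_add)
  next
    fix H assume H: "subgroup H (add_monoid (gr_dsum M N))" "\<And>n. grade (gr_dsum M N) n \<subseteq> H"
    note HD = add_subgroupD[OF H(1) ab]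
    have neg: "(\<ominus>\<^bsub>M\<^esub> x, \<ominus>\<^bsub>N\<^esub> y) \<in> H" if "(x, y) \<in> H" for x y
    proof -
      have xy: "x \<in> carrier M" "y \<in> carrier N" using HD(1) that by auto
      have "\<ominus>\<^bsub>gr_dsum M N\<^esub> (x, y) = (\<ominus>\<^bsub>M\<^esub> x, \<ominus>\<^bsub>N\<^esub> y)"
        by (rule abelian_group.minus_equality[OF ab]) (use xy in \<open>auto simp: M.M.l_neg N.M.l_neg\<close>)
      then show ?thesis using HD(4)[OF that] by simp
    qed
    have [simp]: "\<ominus>\<^bsub>M\<^esub> \<zero>\<^bsub>M\<^esub> = \<zero>\<^bsub>M\<^esub>" "\<ominus>\<^bsub>N\<^esub> \<zero>\<^bsub>N\<^esub> = \<zero>\<^bsub>N\<^esub>"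
      by (rule M.M.minus_equality N.M.minus_equality; simp)+
    \<comment> \<open>The preimage of H under the inclusion of a summand is a subgroup that contains
      all homogeneous elements of this summand, hence the whole summand.\<close>
    have 1: "carrier M \<subseteq> {x \<in> carrier M. (x, \<zero>\<^bsub>N\<^esub>) \<in> H}"
    proof (rule M.homgen)
      show "subgroup {x \<in> carrier M. (x, \<zero>\<^bsub>N\<^esub>) \<in> H} (add_monoid M)"
      proof (rule add_subgroupI[OF M.M.abelian_group_axioms])
        fix x assume "x \<in> {x \<in> carrier M. (x, \<zero>\<^bsub>N\<^esub>) \<in> H}"
        then show "\<exists>y\<in>{x \<in> carrier M. (x, \<zero>\<^bsub>N\<^esub>) \<in> H}. y \<oplus>\<^bsub>M\<^esub> x = \<zero>\<^bsub>M\<^esub>"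
          using neg[of x "\<zero>\<^bsub>N\<^esub>"] by (intro bexI[of _ "\<ominus>\<^bsub>M\<^esub> x"]) (auto simp: M.M.l_neg)
      qed (use HD(2) HD(3)[of "(_, \<zero>\<^bsub>N\<^esub>)" "(_, \<zero>\<^bsub>N\<^esub>)"] in auto)
      show "grade M n \<subseteq> {x \<in> carrier M. (x, \<zero>\<^bsub>N\<^esub>) \<in> H}" for n using H(2)[of n] M.mgrade_carrier by auto
    qed
    have 2: "carrier N \<subseteq> {x \<in> carrier N. (\<zero>\<^bsub>M\<^esub>, x) \<in> H}"
    proof (rule N.homgen)
      show "subgroup {x \<in> carrier N. (\<zero>\<^bsub>M\<^esub>, x) \<in> H} (add_monoid N)"
      proof (rule add_subgroupI[OF N.M.abelian_group_axioms])
        fix x assume "x \<in> {x \<in> carrier N. (\<zero>\<^bsub>M\<^esub>, x) \<in> H}"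
        then show "\<exists>y\<in>{x \<in> carrier N. (\<zero>\<^bsub>M\<^esub>, x) \<in> H}. y \<oplus>\<^bsub>N\<^esub> x = \<zero>\<^bsub>N\<^esub>"
          using neg[of "\<zero>\<^bsub>M\<^esub>" x] by (intro bexI[of _ "\<ominus>\<^bsub>N\<^esub> x"]) (auto simp: N.M.l_neg)
      qed (use HD(2) HD(3)[of "(\<zero>\<^bsub>M\<^esub>, _)" "(\<zero>\<^bsub>M\<^esub>, _)"] in auto)
      show "grade N n \<subseteq> {x \<in> carrier N. (\<zero>\<^bsub>M\<^esub>, x) \<in> H}" for n using H(2)[of n] N.mgrade_carrier by auto
    qed
    show "carrier (gr_dsum M N) \<subseteq> H"
    proof
      fix p assume p: "p \<in> carrier (gr_dsum M N)"
      obtain x y where xy: "p = (x, y)" by fastforce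
      have "(x, \<zero>\<^bsub>N\<^esub>) \<in> H" "(\<zero>\<^bsub>M\<^esub>, y) \<in> H" using p xy 1 2 by auto
      then have "(x, \<zero>\<^bsub>N\<^esub>) \<oplus>\<^bsub>gr_dsum M N\<^esub> (\<zero>\<^bsub>M\<^esub>, y) \<in> H" by (rule HD(3))
      then show "p \<in> H" using p xy by simp
    qed
  qed (auto simp: M.smult_closed N.smult_closed M.smult_l_distr N.smult_l_distr M.smult_r_distr
      N.smult_r_distr M.smult_assoc N.smult_assoc M.smult_one N.smult_one M.mgrade_smult N.mgrade_smult)
qed

lemma gbasis_dsum:
  assumes M: "gmod R M" and N: "gmod R N" and bM: "gbasis R M I x e d" and bN: "gbasis R N J y e' d'"
  shows "gbasis R (gr_dsum M N) (I <+> J) (case_sum (\<lambda>i. (x i, \<zero>\<^bsub>N\<^esub>)) (\<lambda>j. (\<zero>\<^bsub>M\<^esub>, y j)))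
    (case_sum e e') (case_sum d d')"
proof -
  interpret M: based R M I x e d by (intro based.intro M based_axioms.intro bM)
  interpret N: based R N J y e' d' by (intro based.intro N based_axioms.intro bN)
  interpret D: gmod R "gr_dsum M N" by (rule gmod_dsum[OF M N])
  let ?z = "case_sum (\<lambda>i. (x i, \<zero>\<^bsub>N\<^esub>)) (\<lambda>j. (\<zero>\<^bsub>M\<^esub>, y j))"
  have sum: "(\<Oplus>\<^bsub>gr_dsum M N\<^esub>p\<in>I <+> J. r p \<odot>\<^bsub>gr_dsum M N\<^esub> ?z p) = (M.lin (\<lambda>i. r (Inl i)), N.lin (\<lambda>j. r (Inr j)))"
    if r: "r \<in> I <+> J \<rightarrow> carrier R" for r
  proof -
    have rc: "i \<in> I \<Longrightarrow> r (Inl i) \<in> carrier R" "j \<in> J \<Longrightarrow> r (Inr j) \<in> carrier R" for i j using r by auto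
    have "(\<Oplus>\<^bsub>gr_dsum M N\<^esub>p\<in>I <+> J. r p \<odot>\<^bsub>gr_dsum M N\<^esub> ?z p)
       = (\<Oplus>\<^bsub>gr_dsum M N\<^esub>p\<in>Inl ` I. r p \<odot>\<^bsub>gr_dsum M N\<^esub> ?z p) \<oplus>\<^bsub>gr_dsum M N\<^esub> (\<Oplus>\<^bsub>gr_dsum M N\<^esub>p\<in>Inr ` J. r p \<odot>\<^bsub>gr_dsum M N\<^esub> ?z p)"
      unfolding Plus_def by (rule D.M.finsum_Un_disjoint)
        (use M.fin N.fin rc M.x_carrier N.x_carrier in \<open>auto simp: M.smult_closed N.smult_closed\<close>)
    also have "(\<Oplus>\<^bsub>gr_dsum M N\<^esub>p\<in>Inl ` I. r p \<odot>\<^bsub>gr_dsum M N\<^esub> ?z p) = (\<Oplus>\<^bsub>gr_dsum M N\<^esub>i\<in>I. (r (Inl i) \<odot>\<^bsub>M\<^esub> x i, \<zero>\<^bsub>N\<^esub>))"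
      by (subst D.M.finsum_reindex)
        (use rc M.x_carrier in \<open>auto simp: M.smult_closed inj_on_def intro!: D.M.finsum_cong'\<close>)
    also have "\<dots> = (M.lin (\<lambda>i. r (Inl i)), \<zero>\<^bsub>N\<^esub>)"
      unfolding M.lin_def
      by (rule finsum_hom[symmetric, OF M.M.abelian_group_axioms D.M.abelian_group_axioms])
        (use rc M.x_carrier in \<open>auto simp: M.smult_closed\<close>)
    also have "(\<Oplus>\<^bsub>gr_dsum M N\<^esub>p\<in>Inr ` J. r p \<odot>\<^bsub>gr_dsum M N\<^esub> ?z p) = (\<Oplus>\<^bsub>gr_dsum M N\<^esub>i\<in>J. (\<zero>\<^bsub>M\<^esub>, r (Inr i) \<odot>\<^bsub>N\<^esub> y i))"
      by (subst D.M.finsum_reindex)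
        (use rc N.x_carrier in \<open>auto simp: N.smult_closed inj_on_def intro!: D.M.finsum_cong'\<close>)
    also have "\<dots> = (\<zero>\<^bsub>M\<^esub>, N.lin (\<lambda>j. r (Inr j)))"
      unfolding N.lin_def
      by (rule finsum_hom[symmetric, OF N.M.abelian_group_axioms D.M.abelian_group_axioms])
        (use rc N.x_carrier in \<open>auto simp: N.smult_closed\<close>)
    finally show ?thesis using rc by (simp add: M.lin_closed N.lin_closed)
  qed
  show ?thesis
  proof (rule gbasisI)
    show "finite (I <+> J)" using M.fin N.fin by simp
    fix n m assume m: "m \<in> grade (gr_dsum M N) n"
    obtain m1 m2 where mm: "m = (m1, m2)" "m1 \<in> grade M n" "m2 \<in> grade N n" using m by auto
    let ?r = "case_sum (M.co m1) (N.co m2)"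
    have "m1 \<in> carrier M" "m2 \<in> carrier N" using mm M.mgrade_carrier N.mgrade_carrier by auto
    then have "(\<Oplus>\<^bsub>gr_dsum M N\<^esub>p\<in>I <+> J. ?r p \<odot>\<^bsub>gr_dsum M N\<^esub> ?z p) = (m1, m2)"
      by (subst sum) (auto simp: M.co_closed N.co_closed M.lin_co N.lin_co)
    then show "\<exists>r. (\<forall>i\<in>I <+> J. r i \<in> grade R (n - case_sum d d' i)) \<and>
      m = (\<Oplus>\<^bsub>gr_dsum M N\<^esub>p\<in>I <+> J. r p \<odot>\<^bsub>gr_dsum M N\<^esub> ?z p)"
      using mm M.co_grade N.co_grade by (intro exI[of _ ?r]) auto
  next
    fix r p assume r: "r \<in> I <+> J \<rightarrow> carrier R" "(\<Oplus>\<^bsub>gr_dsum M N\<^esub>p\<in>I <+> J. r p \<odot>\<^bsub>gr_dsum M N\<^esub> ?z p) = \<zero>\<^bsub>gr_dsum M N\<^esub>"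
      and p: "p \<in> I <+> J"
    have "M.lin (\<lambda>i. r (Inl i)) = \<zero>\<^bsub>M\<^esub>" "N.lin (\<lambda>j. r (Inr j)) = \<zero>\<^bsub>N\<^esub>" using r(2) sum[OF r(1)] by auto
    moreover have "(\<lambda>i. r (Inl i)) \<in> I \<rightarrow> carrier R" "(\<lambda>j. r (Inr j)) \<in> J \<rightarrow> carrier R" using r(1) by auto
    ultimately have "\<And>i. i \<in> I \<Longrightarrow> r (Inl i) \<otimes>\<^bsub>R\<^esub> e i = \<zero>\<^bsub>R\<^esub>" "\<And>j. j \<in> J \<Longrightarrow> r (Inr j) \<otimes>\<^bsub>R\<^esub> e' j = \<zero>\<^bsub>R\<^esub>"
      using gbasis_indepD[OF bM] gbasis_indepD[OF bN] unfolding M.lin_def N.lin_def by auto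
    then show "r p \<otimes>\<^bsub>R\<^esub> case_sum e e' p = \<zero>\<^bsub>R\<^esub>" using p by auto
  qed (use M.idem N.idem M.x_grade N.x_grade M.e_x N.e_x M.e_carrier N.e_carrier in auto)
qed

lemma mset_set_Plus:
  assumes "finite I" "finite J"
  shows "mset_set (I <+> J) = image_mset Inl (mset_set I) + image_mset Inr (mset_set J)"
proof -
  have "mset_set (I <+> J) = mset_set (Inl ` I) + mset_set (Inr ` J)"
    unfolding Plus_def by (rule mset_set_Union) (use assms in auto)
  then show ?thesis by (simp add: image_mset_mset_set)
qed

lemma hbas_dsum:
  assumes M: "gmod R M" and N: "gmod R N" and "hbas R M T" "hbas R N U"
  shows "hbas R (gr_dsum M N) (T + U)"
proof -
  obtain I :: "nat set" and x e d where b: "gbasis R M I x e d" "T = image_mset (\<lambda>i. (e i, d i)) (mset_set I)"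
    using assms(3) unfolding hbas_def by blast
  obtain J :: "nat set" and y e' d' where b': "gbasis R N J y e' d'" "U = image_mset (\<lambda>i. (e' i, d' i)) (mset_set J)"
    using assms(4) unfolding hbas_def by blast
  have "finite I" "finite J" using b b' gbasis_typeD by blast+
  then show ?thesis
    using gmod.hbasI[OF gmod_dsum[OF M N] gbasis_dsum[OF M N b(1) b'(1)]] b(2) b'(2)
    by (simp add: mset_set_Plus image_mset.compositionality comp_def)
qed

lemma gr_shift_simps [simp]:
  "carrier (gr_shift n M) = carrier M" "ring.zero (gr_shift n M) = \<zero>\<^bsub>M\<^esub>" "add (gr_shift n M) = add M"
  "smult (gr_shift n M) = smult M" "grade (gr_shift n M) k = grade M (n + k)"
  by (simp_all add: gr_shift_def)

lemma finsum_shift [simp]: "finsum (gr_shift n M) = finsum M"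
  unfolding finsum_def by simp

lemma abelian_group_shift [simp]: "abelian_group (gr_shift n M) \<longleftrightarrow> abelian_group M"
  by (simp add: abelian_group_def abelian_monoid_def abelian_group_axioms_def)

lemma gmod_shift:
  assumes "gmod R M" shows "gmod R (gr_shift n M)"
proof -
  interpret M: gmod R M by fact
  have ab: "abelian_group (gr_shift n M)" using M.M.abelian_group_axioms by simp
  show ?thesis
  proof (rule gmodI[OF M.R.grring_axioms ab])
    show "subgroup (grade (gr_shift n M) k) (add_monoid (gr_shift n M))" for k
      using M.mgrade_sub[of "n + k"] by simp
    show "a \<odot>\<^bsub>gr_shift n M\<^esub> x \<in> grade (gr_shift n M) (m + k)" if "a \<in> grade R m" "x \<in> grade (gr_shift n M) k" for a m x k
      using that by (auto intro: M.mgrade_smult')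
    fix H assume H: "subgroup H (add_monoid (gr_shift n M))" "\<And>k. grade (gr_shift n M) k \<subseteq> H"
    have "grade M k \<subseteq> H" for k using H(2)[of "k - n"] by simp
    then show "carrier (gr_shift n M) \<subseteq> H" using M.homgen[of H] H(1) by simp
  qed (auto simp: M.smult_closed M.smult_l_distr M.smult_r_distr M.smult_assoc M.smult_one)
qed

text \<open>By the convention M(n)_k = M_(n+k), an element of degree d in M has degree d - n in
  M(n).\<close>

lemma gbasis_shift:
  assumes "gbasis R M I x e d" shows "gbasis R (gr_shift n M) I x e (\<lambda>i. d i - n)"
proof (rule gbasisI)
  fix k m assume "m \<in> grade (gr_shift n M) k"
  then obtain r where "\<And>i. i \<in> I \<Longrightarrow> r i \<in> grade R (n + k - d i)" "m = (\<Oplus>\<^bsub>M\<^esub>i\<in>I. r i \<odot>\<^bsub>M\<^esub> x i)"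
    using gbasis_spanD[OF assms] by (metis gr_shift_simps(5))
  then show "\<exists>r. (\<forall>i\<in>I. r i \<in> grade R (k - (d i - n))) \<and> m = (\<Oplus>\<^bsub>gr_shift n M\<^esub>i\<in>I. r i \<odot>\<^bsub>gr_shift n M\<^esub> x i)"
    by (intro exI[of _ r]) (simp add: algebra_simps)
qed (use gbasis_typeD[OF assms] gbasis_indepD[OF assms] in auto)

lemma hbas_shift:
  assumes "gmod R M" "hbas R M T"
  shows "hbas R (gr_shift n M) (image_mset (\<lambda>t. (fst t, snd t - n)) T)"
proof -
  obtain I :: "nat set" and x e d where b: "gbasis R M I x e d" "T = image_mset (\<lambda>i. (e i, d i)) (mset_set I)"
    using assms(2) unfolding hbas_def by blast
  show ?thesis
    using gmod.hbasI[OF gmod_shift[OF assms(1)] gbasis_shift[OF b(1)], of n] b(2)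
    by (simp add: image_mset.compositionality comp_def)
qed

text \<open>A concrete model of the direct sum of the R \<open>e i\<close> shifted by -
  \<open>d i\<close>, on functions that vanish outside I. With I a set of natural numbers it has the
  carrier type on which \<open>Vgr\<close> is built.\<close>

definition std :: "('k, 'r, 'm) gmodule_scheme \<Rightarrow> 'i set \<Rightarrow> ('i \<Rightarrow> 'r) \<Rightarrow> ('i \<Rightarrow> int) \<Rightarrow> ('r, 'i \<Rightarrow> 'r) gmodule"
  where "std R I e d = \<lparr>
    carrier = {f. (\<forall>i\<in>I. f i \<in> carrier R \<and> f i \<otimes>\<^bsub>R\<^esub> e i = f i) \<and> (\<forall>i. i \<notin> I \<longrightarrow> f i = \<zero>\<^bsub>R\<^esub>)},
    monoid.mult = undefined, monoid.one = undefined, ring.zero = (\<lambda>_. \<zero>\<^bsub>R\<^esub>),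
    add = (\<lambda>f g j. f j \<oplus>\<^bsub>R\<^esub> g j), smult = (\<lambda>a f j. a \<otimes>\<^bsub>R\<^esub> f j),
    grade = (\<lambda>n. {f. (\<forall>i\<in>I. f i \<in> grade R (n - d i) \<and> f i \<otimes>\<^bsub>R\<^esub> e i = f i) \<and> (\<forall>i. i \<notin> I \<longrightarrow> f i = \<zero>\<^bsub>R\<^esub>)})\<rparr>"

lemma std_simps [simp]:
  "carrier (std R I e d) = {f. (\<forall>i\<in>I. f i \<in> carrier R \<and> f i \<otimes>\<^bsub>R\<^esub> e i = f i) \<and> (\<forall>i. i \<notin> I \<longrightarrow> f i = \<zero>\<^bsub>R\<^esub>)}"
  "ring.zero (std R I e d) = (\<lambda>_. \<zero>\<^bsub>R\<^esub>)"
  "add (std R I e d) = (\<lambda>f g j. f j \<oplus>\<^bsub>R\<^esub> g j)"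
  "smult (std R I e d) = (\<lambda>a f j. a \<otimes>\<^bsub>R\<^esub> f j)"
  "grade (std R I e d) n = {f. (\<forall>i\<in>I. f i \<in> grade R (n - d i) \<and> f i \<otimes>\<^bsub>R\<^esub> e i = f i) \<and> (\<forall>i. i \<notin> I \<longrightarrow> f i = \<zero>\<^bsub>R\<^esub>)}"
  by (simp_all add: std_def)

text \<open>The projections p provide a decomposition; it is unique because applying
  \<open>p m\<close> to an arbitrary decomposition leaves its m-th term.\<close>

lemma ex1_grade_decompI:
  assumes ab: "abelian_group M" and sub: "\<And>n. subgroup (grade M n) (add_monoid M)"
    and p: "\<And>n x. x \<in> carrier M \<Longrightarrow> p n x \<in> grade M n"
    and add: "\<And>n x y. x \<in> carrier M \<Longrightarrow> y \<in> carrier M \<Longrightarrow> p n (x \<oplus>\<^bsub>M\<^esub> y) = p n x \<oplus>\<^bsub>M\<^esub> p n y"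
    and gr: "\<And>n m x. x \<in> grade M m \<Longrightarrow> p n x = (if n = m then x else \<zero>\<^bsub>M\<^esub>)"
    and fin: "finite {n. p n x \<noteq> \<zero>\<^bsub>M\<^esub>}" and sum: "x = (\<Oplus>\<^bsub>M\<^esub>n\<in>{n. p n x \<noteq> \<zero>\<^bsub>M\<^esub>}. p n x)" and x: "x \<in> carrier M"
  shows "\<exists>!f. (\<forall>n. f n \<in> grade M n) \<and> finite {n. f n \<noteq> \<zero>\<^bsub>M\<^esub>} \<and> x = (\<Oplus>\<^bsub>M\<^esub>n \<in> {n. f n \<noteq> \<zero>\<^bsub>M\<^esub>}. f n)"
proof (rule ex1I[of _ "\<lambda>n. p n x"])
  show "(\<forall>n. p n x \<in> grade M n) \<and> finite {n. p n x \<noteq> \<zero>\<^bsub>M\<^esub>} \<and> x = (\<Oplus>\<^bsub>M\<^esub>n \<in> {n. p n x \<noteq> \<zero>\<^bsub>M\<^esub>}. p n x)"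
    using assms by blast
next
  interpret abelian_group M by fact
  fix f assume f: "(\<forall>n. f n \<in> grade M n) \<and> finite {n. f n \<noteq> \<zero>\<^bsub>M\<^esub>} \<and> x = (\<Oplus>\<^bsub>M\<^esub>n \<in> {n. f n \<noteq> \<zero>\<^bsub>M\<^esub>}. f n)"
  let ?A = "{n. f n \<noteq> \<zero>\<^bsub>M\<^esub>}"
  have gc: "grade M n \<subseteq> carrier M" for n using add_subgroupD(1)[OF sub ab] .
  have fc: "f n \<in> carrier M" for n using f gc by blast
  show "f = (\<lambda>n. p n x)"
  proof
    fix m
    have pf: "p m (f n) = (if m = n then f n else \<zero>\<^bsub>M\<^esub>)" for n using gr f by blast
    have "p m x = p m (\<Oplus>\<^bsub>M\<^esub>n \<in> ?A. f n)" using f by simp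
    also have "\<dots> = (\<Oplus>\<^bsub>M\<^esub>n \<in> ?A. p m (f n))"
      by (rule finsum_hom[OF ab ab]) (use p gc add fc in auto)
    also have "\<dots> = (\<Oplus>\<^bsub>M\<^esub>n \<in> ?A. if n = m then f n else \<zero>\<^bsub>M\<^esub>)"
      by (rule finsum_cong') (use pf fc in auto)
    also have "\<dots> = f m"
    proof (cases "m \<in> ?A")
      case True then show ?thesis using finsum_delta[of ?A m f] f fc by auto
    next
      case False
      then have "(\<Oplus>\<^bsub>M\<^esub>n \<in> ?A. if n = m then f n else \<zero>\<^bsub>M\<^esub>) = \<zero>\<^bsub>M\<^esub>" by (intro finsum_eq_zero) auto
      then show ?thesis using False by simp
    qed
    finally show "f m = p m x" by simp
  qed
qed

context grring
begin

context
  fixes I :: "'i set" and e :: "'i \<Rightarrow> 'r" and d :: "'i \<Rightarrow> int"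
  assumes I: "finite I" and e: "\<And>i. i \<in> I \<Longrightarrow> gidem R (e i)"
begin

lemma abelian_std: "abelian_group (std R I e d)"
proof (rule abelian_groupI)
  fix f assume f: "f \<in> carrier (std R I e d)"
  show "\<exists>g\<in>carrier (std R I e d). g \<oplus>\<^bsub>std R I e d\<^esub> f = \<zero>\<^bsub>std R I e d\<^esub>"
  proof (rule bexI[of _ "\<lambda>i. if i \<in> I then \<ominus> f i else \<zero>"])
  qed (use f gidemD[OF e] in \<open>auto simp: l_neg l_minus fun_eq_iff\<close>)
next
  fix f g assume "f \<in> carrier (std R I e d)" "g \<in> carrier (std R I e d)"
  then show "f \<oplus>\<^bsub>std R I e d\<^esub> g \<in> carrier (std R I e d)" "f \<oplus>\<^bsub>std R I e d\<^esub> g = g \<oplus>\<^bsub>std R I e d\<^esub> f"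
    using gidemD[OF e] by (auto simp: l_distr fun_eq_iff) (metis a_comm zero_closed)
next
  fix f g h assume "f \<in> carrier (std R I e d)" "g \<in> carrier (std R I e d)" "h \<in> carrier (std R I e d)"
  then show "f \<oplus>\<^bsub>std R I e d\<^esub> g \<oplus>\<^bsub>std R I e d\<^esub> h = f \<oplus>\<^bsub>std R I e d\<^esub> (g \<oplus>\<^bsub>std R I e d\<^esub> h)"
    by (auto simp: fun_eq_iff) (metis a_assoc zero_closed)
next
  fix f assume "f \<in> carrier (std R I e d)"
  then show "\<zero>\<^bsub>std R I e d\<^esub> \<oplus>\<^bsub>std R I e d\<^esub> f = f" by (auto simp: fun_eq_iff) (metis l_zero zero_closed)
qed (use gidemD[OF e] in auto)

lemma std_subgroup: "subgroup (grade (std R I e d) n) (add_monoid (std R I e d))"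
proof (rule add_subgroupI[OF abelian_std])
  fix f assume f: "f \<in> grade (std R I e d) n"
  show "\<exists>g\<in>grade (std R I e d) n. g \<oplus>\<^bsub>std R I e d\<^esub> f = \<zero>\<^bsub>std R I e d\<^esub>"
  proof (rule bexI[of _ "\<lambda>i. if i \<in> I then \<ominus> f i else \<zero>"])
  qed (use f gidemD[OF e] in \<open>auto simp: l_neg l_minus grade_carrier grade_neg fun_eq_iff\<close>)
next
  fix f g assume fg: "f \<in> grade (std R I e d) n" "g \<in> grade (std R I e d) n"
  have "f i \<in> carrier R" "g i \<in> carrier R" if "i \<in> I" for i using that fg grade_carrier by auto
  then show "f \<oplus>\<^bsub>std R I e d\<^esub> g \<in> grade (std R I e d) n"
    using fg gidemD[OF e] by (auto simp: grade_add l_distr)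
qed (use gidemD[OF e] in \<open>auto simp: grade_carrier\<close>)

lemma finsum_std:
  assumes "F \<in> A \<rightarrow> carrier (std R I e d)" "i \<in> I"
  shows "finsum (std R I e d) F A i = (\<Oplus>a\<in>A. F a i)"
  by (rule finsum_hom[where h="\<lambda>f. f i", OF abelian_std abelian_group_axioms]) (use assms in auto)

lemma finsum_std_closed:
  assumes "F \<in> A \<rightarrow> carrier (std R I e d)" shows "finsum (std R I e d) F A \<in> carrier (std R I e d)"
  by (rule abelian_monoid.finsum_closed[OF abelian_group.axioms(1)[OF abelian_std] assms])

lemma std_eqI:
  assumes "f \<in> carrier (std R I e d)" "g \<in> carrier (std R I e d)" "\<And>i. i \<in> I \<Longrightarrow> f i = g i"
  shows "f = g"
proof
  fix i show "f i = g i" by (cases "i \<in> I") (use assms in auto)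
qed

lemma graded_std: "graded_left_module R (std R I e d)"
proof (intro graded_left_module.intro left_module.intro left_module_axioms.intro graded_left_module_axioms.intro ring_axioms abelian_std std_subgroup)
  fix a b x y assume "a \<in> carrier R" "b \<in> carrier R" "x \<in> carrier (std R I e d)"
  then show "(a \<oplus> b) \<odot>\<^bsub>std R I e d\<^esub> x = a \<odot>\<^bsub>std R I e d\<^esub> x \<oplus>\<^bsub>std R I e d\<^esub> b \<odot>\<^bsub>std R I e d\<^esub> x"
    "a \<otimes> b \<odot>\<^bsub>std R I e d\<^esub> x = a \<odot>\<^bsub>std R I e d\<^esub> (b \<odot>\<^bsub>std R I e d\<^esub> x)"
    by (auto simp: fun_eq_iff) (metis l_distr zero_closed, metis m_assoc zero_closed)
next
  fix a x y assume "a \<in> carrier R" "x \<in> carrier (std R I e d)" "y \<in> carrier (std R I e d)"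
  then show "a \<odot>\<^bsub>std R I e d\<^esub> (x \<oplus>\<^bsub>std R I e d\<^esub> y) = a \<odot>\<^bsub>std R I e d\<^esub> x \<oplus>\<^bsub>std R I e d\<^esub> a \<odot>\<^bsub>std R I e d\<^esub> y"
    by (auto simp: fun_eq_iff) (metis r_distr zero_closed)
next
  fix x assume "x \<in> carrier (std R I e d)"
  then show "\<one> \<odot>\<^bsub>std R I e d\<^esub> x = x" by (auto simp: fun_eq_iff) (metis l_one zero_closed)
next
  fix a m x n assume "a \<in> grade R m" "x \<in> grade (std R I e d) n"
  then show "a \<odot>\<^bsub>std R I e d\<^esub> x \<in> grade (std R I e d) (m + n)"
    using gidemD[OF e] by (auto simp: grade_carrier m_assoc intro!: grade_mult')
next
  fix x assume x: "x \<in> carrier (std R I e d)"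
  \<comment> \<open>Components are taken coordinatewise; degree n of the module is degree n -
    \<open>d i\<close> in the i-th coordinate.\<close>
  define p where "p = (\<lambda>n f i. if i \<in> I then proj (n - d i) (f i) else \<zero>)"
  have pg: "p n f \<in> grade (std R I e d) n" if "f \<in> carrier (std R I e d)" for n f
    using that proj_props(1) proj_mult_right[OF _ gidemD(2)[OF e]] unfolding p_def by auto (metis add.right_neutral)
  have pc: "p n f \<in> carrier (std R I e d)" if "f \<in> carrier (std R I e d)" for n f
    using pg[OF that, of n] grade_carrier unfolding std_simps by blast
  let ?A = "{n. p n x \<noteq> \<zero>\<^bsub>std R I e d\<^esub>}"
  have xc: "x i \<in> carrier R" if "i \<in> I" for i using x that by auto
  have fin: "finite ?A"
  proof (rule finite_subset)
    show "?A \<subseteq> (\<Union>i\<in>I. (\<lambda>k. k + d i) ` {k. proj k (x i) \<noteq> \<zero>})"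
    proof
      fix n assume "n \<in> ?A"
      then obtain i where "i \<in> I" "proj (n - d i) (x i) \<noteq> \<zero>" unfolding p_def std_simps by (auto simp: fun_eq_iff split: if_splits)
      then show "n \<in> (\<Union>i\<in>I. (\<lambda>k. k + d i) ` {k. proj k (x i) \<noteq> \<zero>})"
        by (intro UN_I[of i] image_eqI[of _ _ "n - d i"]) auto
    qed
    show "finite (\<Union>i\<in>I. (\<lambda>k. k + d i) ` {k. proj k (x i) \<noteq> \<zero>})"
      using I proj_props(2)[OF xc] by blast
  qed
  show "\<exists>!f. (\<forall>n. f n \<in> grade (std R I e d) n) \<and> finite {n. f n \<noteq> \<zero>\<^bsub>std R I e d\<^esub>} \<and>
    x = (\<Oplus>\<^bsub>std R I e d\<^esub>n\<in>{n. f n \<noteq> \<zero>\<^bsub>std R I e d\<^esub>}. f n)"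
  proof (rule ex1_grade_decompI[where p=p, OF abelian_std std_subgroup pg _ _ fin _ x])
    fix n f g assume "f \<in> carrier (std R I e d)" "g \<in> carrier (std R I e d)"
    then show "p n (f \<oplus>\<^bsub>std R I e d\<^esub> g) = p n f \<oplus>\<^bsub>std R I e d\<^esub> p n g"
      unfolding p_def by (auto simp: fun_eq_iff proj_add)
  next
    fix n m f assume "f \<in> grade (std R I e d) m"
    then show "p n f = (if n = m then f else \<zero>\<^bsub>std R I e d\<^esub>)"
      unfolding p_def by (auto simp: fun_eq_iff proj_grade)
  next
    show "x = (\<Oplus>\<^bsub>std R I e d\<^esub>n\<in>?A. p n x)"
    proof (rule std_eqI[OF x finsum_std_closed])
      fix i assume i: "i \<in> I"
      have "x i = (\<Oplus>k\<in>(\<lambda>n. n - d i) ` ?A. proj k (x i))"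
      proof (rule proj_sum[OF xc[OF i]])
        show "finite ((\<lambda>n. n - d i) ` ?A)" using fin by simp
        fix k assume k: "k \<notin> (\<lambda>n. n - d i) ` ?A"
        show "proj k (x i) = \<zero>"
        proof (rule ccontr)
          assume "proj k (x i) \<noteq> \<zero>"
          then have "p (k + d i) x i \<noteq> \<zero>" using i unfolding p_def by simp
          then have "k + d i \<in> ?A" by auto
          then have "(k + d i) - d i \<in> (\<lambda>n. n - d i) ` ?A" by blast
          then show False using k by simp
        qed
      qed
      also have "\<dots> = (\<Oplus>n\<in>?A. p n x i)"
        by (subst finsum_reindex) (use i xc proj_closed in \<open>auto simp: inj_on_def p_def\<close>)
      also have "\<dots> = finsum (std R I e d) (\<lambda>n. p n x) ?A i"
        by (rule finsum_std[symmetric]) (use pc[OF x] i in auto)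
      finally show "x i = (\<Oplus>\<^bsub>std R I e d\<^esub>n\<in>?A. p n x) i" .
    qed (use pc[OF x] in auto)
  qed
qed (use gidemD[OF e] in \<open>auto simp: m_assoc\<close>)

lemma gmod_std: "gmod R (std R I e d)"
  by (rule gmod_of_graded[OF graded_std])

lemma gbasis_std: "gbasis R (std R I e d) I (\<lambda>i j. if j = i then e i else \<zero>) e d"
proof -
  let ?x = "\<lambda>i j. if j = i then e i else \<zero>"
  note eD = gidemD[OF e]
  have xc: "?x i \<in> carrier (std R I e d)" if "i \<in> I" for i using that eD by auto
  have rx: "(\<lambda>i. r i \<odot>\<^bsub>std R I e d\<^esub> ?x i) \<in> I \<rightarrow> carrier (std R I e d)" if "r \<in> I \<rightarrow> carrier R" for r
    using that eD by (auto simp: m_assoc Pi_iff)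
  have sum: "(\<Oplus>\<^bsub>std R I e d\<^esub>i\<in>I. r i \<odot>\<^bsub>std R I e d\<^esub> ?x i) j = r j \<otimes> e j" if r: "r \<in> I \<rightarrow> carrier R" and j: "j \<in> I" for r j
  proof -
    have "(\<Oplus>\<^bsub>std R I e d\<^esub>i\<in>I. r i \<odot>\<^bsub>std R I e d\<^esub> ?x i) j = (\<Oplus>i\<in>I. (r i \<odot>\<^bsub>std R I e d\<^esub> ?x i) j)"
      by (rule finsum_std[OF rx[OF r] j])
    also have "\<dots> = r j \<otimes> e j"
      by (subst finsum_eq_single[where i=j]) (use I j r eD in \<open>auto simp: Pi_iff\<close>)
    finally show ?thesis .
  qed
  show ?thesis
  proof (rule gbasisI[OF I e])
    fix n m assume m: "m \<in> grade (std R I e d) n"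
    have mI: "m \<in> I \<rightarrow> carrier R" using m grade_carrier by auto
    have "m = (\<Oplus>\<^bsub>std R I e d\<^esub>i\<in>I. m i \<odot>\<^bsub>std R I e d\<^esub> ?x i)"
      by (rule std_eqI[OF _ finsum_std_closed[OF rx[OF mI]]]) (use sum[OF mI] m grade_carrier in auto)
    then show "\<exists>r. (\<forall>i\<in>I. r i \<in> grade R (n - d i)) \<and> m = (\<Oplus>\<^bsub>std R I e d\<^esub>i\<in>I. r i \<odot>\<^bsub>std R I e d\<^esub> ?x i)"
      using m by (intro exI[of _ m]) auto
  next
    fix r i assume r: "r \<in> I \<rightarrow> carrier R" "(\<Oplus>\<^bsub>std R I e d\<^esub>i\<in>I. r i \<odot>\<^bsub>std R I e d\<^esub> ?x i) = \<zero>\<^bsub>std R I e d\<^esub>" "i \<in> I"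
    show "r i \<otimes> e i = \<zero>" using sum[OF r(1,3)] r(2) by simp
  qed (use eD in \<open>auto simp: fun_eq_iff\<close>)
qed

end

text \<open>In \<open>gr_projective\<close> the index set of the free module consists of elements of
  the module's type. Two distinct elements of the ring's type, possibly outside the carrier, embed
  the natural numbers into that type by two-valued functions.\<close>

lemma fgp_std:
  assumes I: "finite (I :: nat set)" and e: "\<And>i. i \<in> I \<Longrightarrow> gidem R (e i)" and ab: "(a :: 'r) \<noteq> b"
  shows "gr_fgp R (std R I e d)"
  unfolding gr_fgp_def
proof (intro conjI graded_std[OF I e])
  note eD = gidemD[OF e]
  show "fin_generated R (std R I e d)"
    by (rule based.fin_generated[OF based.intro[OF gmod_std[OF I e] based_axioms.intro[OF gbasis_std[OF I e]]]])
  show "gr_projective R (std R I e d)"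
  proof -
    define enc :: "nat \<Rightarrow> nat \<Rightarrow> 'r" where "enc = (\<lambda>i j. if j = i then a else b)"
    have inj: "inj enc" using ab unfolding enc_def inj_def by (metis (full_types))
    define J where "J = enc ` I"
    define \<alpha> where "\<alpha> = (\<lambda>j. - d (the_inv enc j))"
    define \<iota> where "\<iota> = (\<lambda>f j. if j \<in> J then f (the_inv enc j) else \<zero>)"
    \<comment> \<open>The free module is projected onto the sum of the R \<open>e i\<close> by right
      multiplication with \<open>e i\<close> in each coordinate.\<close>
    define \<pi> where "\<pi> = (\<lambda>g i. if i \<in> I then g (enc i) \<otimes> e i else \<zero>)"
    have enc: "the_inv enc (enc i) = i" for i by (rule the_inv_f_f[OF inj])
    have encJ: "enc i \<in> J \<longleftrightarrow> i \<in> I" for i using inj unfolding J_def by (auto simp: inj_def)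
    have finJ: "finite J" using I unfolding J_def by simp
    have sup: "finite {j. \<iota> f j \<noteq> \<zero>}" "{j. \<iota> f j \<noteq> \<zero>} \<subseteq> J" for f
      using finite_subset[OF _ finJ] unfolding \<iota>_def by (auto split: if_splits)
    have 1: "\<iota> \<in> gr_hom R (std R I e d) (gr_free R J \<alpha>)"
    proof (rule gr_homI)
      show "\<iota> f \<in> carrier (gr_free R J \<alpha>)" if "f \<in> carrier (std R I e d)" for f
        using that sup unfolding gr_free_def by (auto simp: \<iota>_def J_def enc)
      show "\<iota> f \<in> grade (gr_free R J \<alpha>) n" if "f \<in> grade (std R I e d) n" for f n
        using that sup unfolding gr_free_def by (auto simp: \<iota>_def \<alpha>_def J_def enc)
    qed (auto simp: gr_free_def \<iota>_def fun_eq_iff)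
    have 2: "\<pi> \<in> gr_hom R (gr_free R J \<alpha>) (std R I e d)"
    proof (rule gr_homI)
      show "\<pi> g \<in> carrier (std R I e d)" if "g \<in> carrier (gr_free R J \<alpha>)" for g
        using that eD by (auto simp: gr_free_def \<pi>_def m_assoc)
      show "\<pi> g \<in> grade (std R I e d) n" if g: "g \<in> grade (gr_free R J \<alpha>) n" for g n
      proof -
        have gg: "g (enc i) \<in> grade R (n - d i)" for i
        proof -
          have "g (enc i) \<in> grade R (\<alpha> (enc i) + n)" using g by (simp add: gr_free_def)
          then show ?thesis by (simp add: \<alpha>_def enc)
        qed
        then show ?thesis using eD grade_carrier[OF gg] by (auto simp: \<pi>_def m_assoc intro!: grade_mult'[OF gg eD(2)])
      qed
    qed (use eD in \<open>auto simp: gr_free_def \<pi>_def fun_eq_iff l_distr m_assoc\<close>)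
    have 3: "\<pi> (\<iota> f) = f" if "f \<in> carrier (std R I e d)" for f
    proof
      fix i show "\<pi> (\<iota> f) i = f i"
        using that encJ[of i] enc[of i] unfolding \<pi>_def \<iota>_def by (cases "i \<in> I") simp_all
    qed
    show ?thesis unfolding gr_projective_def
      by (rule exI[of _ J], rule exI[of _ \<alpha>], rule bexI[OF _ 1], rule bexI[OF _ 2], rule ballI, rule 3)
  qed
qed

end

section \<open>Isomorphism classes described by basis types\<close>

definition Cls :: "('k, 'r, 'm) gmodule_scheme \<Rightarrow> ('r \<times> int) multiset \<Rightarrow> 'r fgp set"
  where "Cls R T = {N. gr_fgp R N \<and> hbas R N T}"

text \<open>Modules with bases of equal type are isomorphic, and isomorphisms transport bases. Hence
  the class of M, whatever its carrier type, is described by T alone, although different T can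
  describe the same class.\<close>

lemma (in grring) gr_class_eq_Cls:
  assumes M: "gmod R M" and T: "hbas R M T"
  shows "gr_class R M = Cls R T"
proof -
  obtain I :: "nat set" and x e d where b: "gbasis R M I x e d" and Te: "T = image_mset (\<lambda>i. (e i, d i)) (mset_set I)"
    using T unfolding hbas_def by blast
  have N: "gmod R N" if "gr_fgp R N" for N :: "'r fgp" using that gmod_of_graded unfolding gr_fgp_def by blast
  have "hbas R N T" if "gr_fgp R N" "gr_iso R M N" for N :: "'r fgp"
    using gbasis_iso[OF M N[OF that(1)] b that(2)] Te unfolding hbas_def by metis
  moreover have "gr_iso R M N" if fN: "gr_fgp R N" "hbas R N T" for N :: "'r fgp"
  proof -
    have "finite I" using b gbasis_typeD by blast
    then obtain y where "gbasis R N I y e d" using gmod.hbasE[OF N[OF fN(1)] fN(2) _ Te] by metis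
    then show ?thesis using gbasis_imp_iso[OF M N[OF fN(1)] b] by blast
  qed
  ultimately show ?thesis unfolding gr_class_def Cls_def by blast
qed

text \<open>The operations on \<open>Vgr\<close> are unions over representatives and would yield the
  empty set on an empty class; a standard module provides a representative.\<close>

lemma (in grring) Cls_nonempty:
  assumes ab: "(a :: 'r) \<noteq> b" and T: "\<And>t. t \<in># T \<Longrightarrow> gidem R (fst t)"
  shows "Cls R T \<noteq> {}"
proof -
  obtain I :: "nat set" and t where I: "finite I" "T = image_mset t (mset_set I)"
    using finite_mset_index by blast
  have e: "gidem R ((fst \<circ> t) i)" if "i \<in> I" for i using T[of "t i"] I that by auto
  have "std R I (fst \<circ> t) (snd \<circ> t) \<in> Cls R T"
    unfolding Cls_def
    using fgp_std[of I "fst \<circ> t" a b "snd \<circ> t", OF I(1) e ab] I(2)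
      gmod.hbasI[OF gmod_std[of I "fst \<circ> t" "snd \<circ> t", OF I(1) e] gbasis_std[of I "fst \<circ> t" "snd \<circ> t", OF I(1) e]]
    by simp
  then show ?thesis by blast
qed

lemma (in grring) Cls_gmod: "N \<in> Cls R T \<Longrightarrow> gmod R N \<and> hbas R N T"
  unfolding Cls_def gr_fgp_def using gmod_of_graded by blast

lemma (in grring) Vgr_mult_Cls:
  assumes "Cls R T \<noteq> {}" "Cls R U \<noteq> {}"
  shows "monoid.mult (Vgr R) (Cls R T) (Cls R U) = Cls R (T + U)"
proof -
  have "gr_class R (gr_dsum P Q) = Cls R (T + U)" if "P \<in> Cls R T" "Q \<in> Cls R U" for P Q
    using that gr_class_eq_Cls[OF gmod_dsum hbas_dsum] Cls_gmod by blast
  then show ?thesis unfolding Vgr_def using assms by auto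
qed

lemma (in grring) Vgr_shift_Cls:
  assumes "Cls R T \<noteq> {}"
  shows "Vgr_shift R n (Cls R T) = Cls R (image_mset (\<lambda>t. (fst t, snd t - n)) T)"
proof -
  have "gr_class R (gr_shift n P) = Cls R (image_mset (\<lambda>t. (fst t, snd t - n)) T)" if "P \<in> Cls R T" for P
    using that gr_class_eq_Cls[OF gmod_shift hbas_shift] Cls_gmod by blast
  then show ?thesis unfolding Vgr_shift_def using assms by auto
qed

lemma (in grring) Vgr_one_Cls: "monoid.one (Vgr R) = Cls R {#}"
proof -
  have e: "{j. f j \<noteq> \<zero>} = {} \<longleftrightarrow> f = (\<lambda>_. \<zero>)" for f :: "nat \<Rightarrow> 'r" by auto
  have eq: "gr_free R ({} :: nat set) (\<lambda>_. 0) = std R ({} :: nat set) (\<lambda>_. \<zero>) (\<lambda>_. 0)"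
    unfolding gr_free_def std_def by (auto simp: e)
  have g: "gmod R (std R ({} :: nat set) (\<lambda>_. \<zero>) (\<lambda>_. 0))" by (rule gmod_std) auto
  have "hbas R (std R ({} :: nat set) (\<lambda>_. \<zero>) (\<lambda>_. 0)) {#}"
    using gmod.hbasI[OF g gbasis_std] by simp
  then show ?thesis unfolding Vgr_def using eq gr_class_eq_Cls[OF g] by simp
qed

section \<open>Scalar linear algebra on typed bases\<close>

text \<open>Z is a central copy of the base field in degree 0. \<open>Z_inv\<close> speaks of
  nonzero elements only, which leaves room for the zero ring, the algebra of the graph without
  vertices.\<close>

locale zring = grring R for R :: "('k, 'r, 'm) gmodule_scheme" (structure) +
  fixes Z :: "'r set"
  assumes Z_grade: "Z \<subseteq> grade R 0"
    and Z_zero: "\<zero> \<in> Z" and Z_one: "\<one> \<in> Z"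
    and Z_add: "a \<in> Z \<Longrightarrow> b \<in> Z \<Longrightarrow> a \<oplus> b \<in> Z"
    and Z_neg: "a \<in> Z \<Longrightarrow> \<ominus> a \<in> Z"
    and Z_mult: "a \<in> Z \<Longrightarrow> b \<in> Z \<Longrightarrow> a \<otimes> b \<in> Z"
    and Z_central: "a \<in> Z \<Longrightarrow> b \<in> carrier R \<Longrightarrow> a \<otimes> b = b \<otimes> a"
    and Z_inv: "a \<in> Z \<Longrightarrow> a \<noteq> \<zero> \<Longrightarrow> \<exists>b\<in>Z. a \<otimes> b = \<one>"
begin

lemma Z_carrier: "a \<in> Z \<Longrightarrow> a \<in> carrier R"
  using Z_grade grade_carrier by blast

end

text \<open>
  The combinations with coefficients in the field \<open>Z\<close> of those basis elements whose type
  (idempotent, degree) is \<open>\<theta>\<close>. On these spans Steinitz exchange is available.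
\<close>

definition zsp :: "('k, 'r, 'm) gmodule_scheme \<Rightarrow> 'r set \<Rightarrow> ('r, 'a) gmodule \<Rightarrow> 'i set \<Rightarrow> ('i \<Rightarrow> 'a) \<Rightarrow> ('i \<Rightarrow> 't) \<Rightarrow> 't \<Rightarrow> 'a set"
  where "zsp R Z M I x t \<theta> = {(\<Oplus>\<^bsub>M\<^esub>i\<in>I. c i \<odot>\<^bsub>M\<^esub> x i) | c. \<forall>i\<in>I. c i \<in> Z \<and> (c i \<noteq> \<zero>\<^bsub>R\<^esub> \<longrightarrow> t i = \<theta>)}"

lemma zspE:
  assumes "m \<in> zsp R Z M I x t \<theta>"
  obtains c where "\<And>i. i \<in> I \<Longrightarrow> c i \<in> Z" "\<And>i. i \<in> I \<Longrightarrow> c i \<noteq> \<zero>\<^bsub>R\<^esub> \<Longrightarrow> t i = \<theta>" "m = (\<Oplus>\<^bsub>M\<^esub>i\<in>I. c i \<odot>\<^bsub>M\<^esub> x i)"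
  using assms unfolding zsp_def by blast

lemma zspI:
  assumes "\<And>i. i \<in> I \<Longrightarrow> c i \<in> Z" "\<And>i. i \<in> I \<Longrightarrow> c i \<noteq> \<zero>\<^bsub>R\<^esub> \<Longrightarrow> t i = \<theta>"
  shows "(\<Oplus>\<^bsub>M\<^esub>i\<in>I. c i \<odot>\<^bsub>M\<^esub> x i) \<in> zsp R Z M I x t \<theta>"
  using assms unfolding zsp_def by blast

locale zbased = R?: zring R Z + based R M I x "\<lambda>i. fst (t i)" "\<lambda>i. snd (t i)"
  for R :: "('k, 'r, 'm) gmodule_scheme" (structure) and Z and M :: "('r, 'a) gmodule" (structure)
    and I :: "'i set" and x :: "'i \<Rightarrow> 'a" and t :: "'i \<Rightarrow> 'r \<times> int"
begin

abbreviation "zs \<equiv> zsp R Z M I x t"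

lemma zlin_closed: "(\<And>i. i \<in> I \<Longrightarrow> c i \<in> Z) \<Longrightarrow> c \<in> I \<rightarrow> carrier R"
  using Z_carrier by auto

lemma zsE:
  assumes "m \<in> zs \<theta>"
  obtains c where "\<And>i. i \<in> I \<Longrightarrow> c i \<in> Z" "\<And>i. i \<in> I \<Longrightarrow> c i \<noteq> \<zero> \<Longrightarrow> t i = \<theta>" "m = lin c"
  using zspE[OF assms, folded lin_def] by blast

lemma zs_closed: "m \<in> zs \<theta> \<Longrightarrow> m \<in> carrier M"
proof -
  assume "m \<in> zs \<theta>"
  then obtain c where "\<And>i. i \<in> I \<Longrightarrow> c i \<in> Z" "m = lin c" using zsE by blast
  then show ?thesis using lin_closed[OF zlin_closed] by simp
qed

lemma zsp_add:
  assumes "a \<in> zs \<theta>" "b \<in> zs \<theta>" shows "a \<oplus>\<^bsub>M\<^esub> b \<in> zs \<theta>"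
proof -
  obtain c where c: "\<And>i. i \<in> I \<Longrightarrow> c i \<in> Z" "\<And>i. i \<in> I \<Longrightarrow> c i \<noteq> \<zero> \<Longrightarrow> t i = \<theta>" "a = lin c"
    using zsE[OF assms(1)] by blast
  obtain c' where c': "\<And>i. i \<in> I \<Longrightarrow> c' i \<in> Z" "\<And>i. i \<in> I \<Longrightarrow> c' i \<noteq> \<zero> \<Longrightarrow> t i = \<theta>" "b = lin c'"
    using zsE[OF assms(2)] by blast
  have "a \<oplus>\<^bsub>M\<^esub> b = lin (\<lambda>i. c i \<oplus> c' i)"
    unfolding c(3) c'(3) by (rule lin_add[symmetric]) (use zlin_closed c(1) c'(1) in blast)+
  also have "\<dots> \<in> zs \<theta>"
    unfolding lin_def
  proof (rule zspI)
    fix i assume i: "i \<in> I"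
    show "c i \<oplus> c' i \<in> Z" using c(1) c'(1) i Z_add by blast
    assume "c i \<oplus> c' i \<noteq> \<zero>"
    then have "c i \<noteq> \<zero> \<or> c' i \<noteq> \<zero>" by auto
    then show "t i = \<theta>" using c(2) c'(2) i by blast
  qed
  finally show ?thesis .
qed

lemma zsp_smult:
  assumes "a \<in> zs \<theta>" "z \<in> Z" shows "z \<odot>\<^bsub>M\<^esub> a \<in> zs \<theta>"
proof -
  obtain c where c: "\<And>i. i \<in> I \<Longrightarrow> c i \<in> Z" "\<And>i. i \<in> I \<Longrightarrow> c i \<noteq> \<zero> \<Longrightarrow> t i = \<theta>" "a = lin c"
    using zsE[OF assms(1)] by blast
  have "z \<odot>\<^bsub>M\<^esub> a = lin (\<lambda>i. z \<otimes> c i)"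
    unfolding c(3) by (rule lin_smult[symmetric]) (use zlin_closed c(1) Z_carrier assms in blast)+
  also have "\<dots> \<in> zs \<theta>"
    unfolding lin_def
  proof (rule zspI)
    fix i assume i: "i \<in> I"
    show "z \<otimes> c i \<in> Z" using c(1)[OF i] assms Z_mult by blast
    assume "z \<otimes> c i \<noteq> \<zero>"
    then have "c i \<noteq> \<zero>" using Z_carrier[OF assms(2)] by auto
    then show "t i = \<theta>" using c(2) i by blast
  qed
  finally show ?thesis .
qed

lemma zsp_zero: "\<zero>\<^bsub>M\<^esub> \<in> zs \<theta>"
  unfolding lin_zero[symmetric] lin_def by (rule zspI) (use Z_zero in auto)

lemma zsp_x:
  assumes "j \<in> I" shows "x j \<in> zs (t j)"
proof -
  have "lin (\<lambda>i. if i = j then \<one> else \<zero>) = \<one> \<odot>\<^bsub>M\<^esub> x j"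
    unfolding lin_def
    by (subst M.finsum_eq_single[where i=j]) (use assms fin x_carrier smult_closed in auto)
  then have "x j = lin (\<lambda>i. if i = j then \<one> else \<zero>)" using smult_one x_carrier assms by simp
  moreover have "lin (\<lambda>i. if i = j then \<one> else \<zero>) \<in> zs (t j)"
    unfolding lin_def by (rule zspI) (use Z_one Z_zero in \<open>auto split: if_splits\<close>)
  ultimately show ?thesis by simp
qed

context
  fixes j c y
  assumes j: "j \<in> I" and cZ: "\<And>i. i \<in> I \<Longrightarrow> c i \<in> Z" and ct: "\<And>i. i \<in> I \<Longrightarrow> c i \<noteq> \<zero> \<Longrightarrow> t i = t j"
    and y: "y = lin c" and cj: "c j \<noteq> \<zero>"
begin

private lemma cc: "i \<in> I \<Longrightarrow> c i \<in> carrier R"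
  using cZ Z_carrier by blast

private lemma yM: "y \<in> carrier M"
  unfolding y by (rule lin_closed) (use cc in auto)

text \<open>Substitutes y = \<open>lin c\<close> for the new j-th element and collects the
  coefficients in the old basis.\<close>

private lemma exchange_lin:
  assumes s: "s \<in> I \<rightarrow> carrier R"
  shows "(\<Oplus>\<^bsub>M\<^esub>i\<in>I. s i \<odot>\<^bsub>M\<^esub> (x(j := y)) i) = lin (\<lambda>i. (if i = j then \<zero> else s i) \<oplus> s j \<otimes> c i)"
proof -
  have sc: "i \<in> I \<Longrightarrow> s i \<in> carrier R" for i using s by auto
  have xs: "s i \<odot>\<^bsub>M\<^esub> x i \<in> carrier M" if "i \<in> I" for i using sc x_carrier that smult_closed by auto
  have I: "insert j (I - {j}) = I" using j by auto
  have "(\<Oplus>\<^bsub>M\<^esub>i\<in>insert j (I - {j}). s i \<odot>\<^bsub>M\<^esub> (x(j := y)) i)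
      = s j \<odot>\<^bsub>M\<^esub> y \<oplus>\<^bsub>M\<^esub> (\<Oplus>\<^bsub>M\<^esub>i\<in>I - {j}. s i \<odot>\<^bsub>M\<^esub> (x(j := y)) i)"
    by (subst M.finsum_insert) (use fin xs sc[OF j] yM smult_closed in auto)
  also have "(\<Oplus>\<^bsub>M\<^esub>i\<in>I - {j}. s i \<odot>\<^bsub>M\<^esub> (x(j := y)) i) = (\<Oplus>\<^bsub>M\<^esub>i\<in>I - {j}. s i \<odot>\<^bsub>M\<^esub> x i)"
    by (rule M.finsum_cong') (use xs in auto)
  also have "\<dots> = lin (\<lambda>i. if i = j then \<zero> else s i)"
    unfolding lin_def
    by (rule M.add.finprod_mono_neutral_cong_left) (use fin xs x_carrier j in auto)
  also have "s j \<odot>\<^bsub>M\<^esub> y = lin (\<lambda>i. s j \<otimes> c i)"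
    unfolding y by (rule lin_smult[symmetric]) (use cc sc j in auto)
  also have "lin (\<lambda>i. s j \<otimes> c i) \<oplus>\<^bsub>M\<^esub> lin (\<lambda>i. if i = j then \<zero> else s i)
      = lin (\<lambda>i. if i = j then \<zero> else s i) \<oplus>\<^bsub>M\<^esub> lin (\<lambda>i. s j \<otimes> c i)"
    by (rule M.a_comm) (use sc cc j in \<open>auto intro!: lin_closed\<close>)
  also have "\<dots> = lin (\<lambda>i. (if i = j then \<zero> else s i) \<oplus> s j \<otimes> c i)"
    by (rule lin_add[symmetric]) (use sc cc j in auto)
  finally show ?thesis unfolding I .
qed

private lemma exchange_inverse:
  obtains b where "b \<in> Z" "c j \<otimes> b = \<one>"
  using Z_inv[OF cZ[OF j] cj] by blast

text \<open>Solves y = \<open>lin c\<close> for \<open>x j\<close>, with b the inverse of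
  \<open>c j\<close>: the j-th coefficient is multiplied by b, and the others are corrected by the
  part of y that is not in direction \<open>x j\<close>.\<close>

private lemma exchange_coeff:
  assumes b: "b \<in> Z" "c j \<otimes> b = \<one>" and r: "r \<in> I \<rightarrow> carrier R"
    and s_def: "s = (\<lambda>i. if i = j then r j \<otimes> b else r i \<oplus> \<ominus> (r j \<otimes> b \<otimes> c i))"
  shows "lin r = (\<Oplus>\<^bsub>M\<^esub>i\<in>I. s i \<odot>\<^bsub>M\<^esub> (x(j := y)) i)"
proof -
  have bc: "b \<in> carrier R" using b Z_carrier by blast
  have rc: "i \<in> I \<Longrightarrow> r i \<in> carrier R" for i using r by auto
  have sI: "s \<in> I \<rightarrow> carrier R" using rc bc cc j unfolding s_def by auto
  have "(if i = j then \<zero> else s i) \<oplus> s j \<otimes> c i = r i" if i: "i \<in> I" for i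
  proof (cases "i = j")
    case True
    have "r j \<otimes> b \<otimes> c j = r j \<otimes> (c j \<otimes> b)" using rc bc cc j Z_central[OF b(1)] by (simp add: R.m_assoc)
    then show ?thesis using True b rc j bc cc by (simp add: s_def)
  next
    case False
    then show ?thesis using rc bc cc j i by (simp add: s_def R.a_assoc R.l_neg)
  qed
  then have "lin (\<lambda>i. (if i = j then \<zero> else s i) \<oplus> s j \<otimes> c i) = lin r"
    by (intro lin_cong r)
  then show ?thesis using exchange_lin[OF sI] by simp
qed

text \<open>Steinitz exchange. All basis elements that occur in y have the type of
  \<open>x j\<close>, so y has the same idempotent and degree and takes over the index j without
  changing the family of types.\<close>

lemma exchange_gbasis: "gbasis R M I (x(j := y)) (\<lambda>i. fst (t i)) (\<lambda>i. snd (t i))"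
proof -
  obtain b where b: "b \<in> Z" "c j \<otimes> b = \<one>" by (rule exchange_inverse)
  have bc: "b \<in> carrier R" using b Z_carrier by blast
  show ?thesis
  proof (rule gbasisI[OF fin])
    show "gidem R (fst (t i))" if "i \<in> I" for i using idem[OF that] .
  next
    fix i assume i: "i \<in> I"
    have "c k \<odot>\<^bsub>M\<^esub> x k \<in> grade M (snd (t j))" if k: "k \<in> I" for k
    proof (cases "c k = \<zero>")
      case False
      have "c k \<odot>\<^bsub>M\<^esub> x k \<in> grade M (0 + snd (t k))" using Z_grade cZ k x_grade by (intro mgrade_smult) auto
      then show ?thesis using ct[OF k False] by simp
    qed (use x_carrier k in simp)
    then have "y \<in> grade M (snd (t j))" unfolding y lin_def by (intro mgrade_finsum) auto
    then show "(x(j := y)) i \<in> grade M (snd (t i))" using x_grade i by auto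
    have "fst (t j) \<odot>\<^bsub>M\<^esub> y = lin (\<lambda>i. fst (t j) \<otimes> c i)"
      unfolding y by (rule lin_smult[symmetric]) (use cc e_carrier j in auto)
    \<comment> \<open>The coefficients are central, and the nonzero ones belong to indices of type
      \<open>t j\<close>.\<close>
    also have "\<dots> = lin (\<lambda>i. c i \<otimes> fst (t i))"
    proof (rule lin_cong)
      fix k assume k: "k \<in> I"
      show "fst (t j) \<otimes> c k = c k \<otimes> fst (t k)"
        by (cases "c k = \<zero>") (use Z_central[OF cZ[OF k]] ct[OF k] e_carrier j k in auto)
    qed (use cc e_carrier in auto)
    also have "\<dots> = y" unfolding y by (rule lin_e) (use cc in auto)
    finally show "fst (t i) \<odot>\<^bsub>M\<^esub> (x(j := y)) i = (x(j := y)) i" using e_x i by auto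
  next
    fix n m assume m: "m \<in> grade M n"
    let ?s = "\<lambda>i. if i = j then co m j \<otimes> b else co m i \<oplus> \<ominus> (co m j \<otimes> b \<otimes> c i)"
    have mc: "m \<in> carrier M" using m mgrade_carrier by auto
    have "m = (\<Oplus>\<^bsub>M\<^esub>i\<in>I. ?s i \<odot>\<^bsub>M\<^esub> (x(j := y)) i)"
      using exchange_coeff[OF b, of "co m" ?s] lin_co[OF mc] co_closed[OF mc] by auto
    moreover have "?s i \<in> grade R (n - snd (t i))" if i: "i \<in> I" for i
    proof -
      have 1: "co m j \<otimes> b \<in> grade R (n - snd (t j))"
        by (rule grade_mult'[OF co_grade[OF m j]]) (use b Z_grade in auto)
      have 2: "co m j \<otimes> b \<otimes> c i \<in> grade R (n - snd (t i))"
      proof (cases "c i = \<zero>")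
        case False
        then show ?thesis using ct[OF i] by (intro grade_mult'[OF 1]) (use cZ[OF i] Z_grade in auto)
      qed (use 1 grade_carrier in auto)
      show ?thesis using 1 2 co_grade[OF m i] grade_add grade_neg by auto
    qed
    ultimately show "\<exists>s. (\<forall>i\<in>I. s i \<in> grade R (n - snd (t i))) \<and> m = (\<Oplus>\<^bsub>M\<^esub>i\<in>I. s i \<odot>\<^bsub>M\<^esub> (x(j := y)) i)"
      by (intro exI[of _ ?s] conjI ballI)
  next
    fix s i assume s: "s \<in> I \<rightarrow> carrier R" and 0: "(\<Oplus>\<^bsub>M\<^esub>i\<in>I. s i \<odot>\<^bsub>M\<^esub> (x(j := y)) i) = \<zero>\<^bsub>M\<^esub>" and i: "i \<in> I"
    have sc: "i \<in> I \<Longrightarrow> s i \<in> carrier R" for i using s by auto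
    let ?r = "\<lambda>i. (if i = j then \<zero> else s i) \<oplus> s j \<otimes> c i"
    have rI: "?r \<in> I \<rightarrow> carrier R" using sc cc j by auto
    have r0: "?r k \<otimes> fst (t k) = \<zero>" if "k \<in> I" for k
      using gbasis_indepD[OF gbasis rI _ that] 0 exchange_lin[OF s] unfolding lin_def by simp
    \<comment> \<open>Inserting 1 = \<open>c j\<close> b exposes the coefficient of
      \<open>x j\<close> in the old basis, which vanishes after multiplication by the
      idempotent.\<close>
    have "s j \<otimes> fst (t j) = s j \<otimes> (c j \<otimes> b) \<otimes> fst (t j)" using b sc j by simp
    also have "\<dots> = s j \<otimes> c j \<otimes> fst (t j) \<otimes> b"
      using sc cc bc e_carrier j Z_central[OF b(1), of "fst (t j)"] by (simp add: R.m_assoc)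
    also have "\<dots> = \<zero>" using r0[OF j] sc cc bc j by simp
    finally have sj: "s j \<otimes> fst (t j) = \<zero>" .
    show "s i \<otimes> fst (t i) = \<zero>"
    proof (cases "i = j")
      case False
      have "s j \<otimes> c i \<otimes> fst (t i) = \<zero>"
      proof (cases "c i = \<zero>")
        case False
        then have "s j \<otimes> c i \<otimes> fst (t i) = s j \<otimes> fst (t j) \<otimes> c i"
          using ct[OF i] Z_central[OF cZ[OF i], of "fst (t j)"] sc cc e_carrier i j by (simp add: R.m_assoc)
        then show ?thesis using sj cc i by simp
      qed (use sc e_carrier i j in simp)
      then show ?thesis using r0[OF i] False sc cc e_carrier i j by (simp add: R.l_distr)
    qed (use sj in simp)
  qed
qed

text \<open>A correction term is nonzero only if both its index and \<theta> have the type of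
  \<open>x j\<close>, so no foreign type enters. As the spans do not shrink, the next vector can
  again be expressed after the exchange.\<close>

lemma exchange_zsp: "zs \<theta> \<subseteq> zsp R Z M I (x(j := y)) t \<theta>"
proof
  obtain b where b: "b \<in> Z" "c j \<otimes> b = \<one>" by (rule exchange_inverse)
  fix m assume m: "m \<in> zs \<theta>"
  obtain r where r: "\<And>i. i \<in> I \<Longrightarrow> r i \<in> Z" "\<And>i. i \<in> I \<Longrightarrow> r i \<noteq> \<zero> \<Longrightarrow> t i = \<theta>" "m = lin r"
    using zsE[OF m] by blast
  let ?s = "\<lambda>i. if i = j then r j \<otimes> b else r i \<oplus> \<ominus> (r j \<otimes> b \<otimes> c i)"
  have "m = (\<Oplus>\<^bsub>M\<^esub>i\<in>I. ?s i \<odot>\<^bsub>M\<^esub> (x(j := y)) i)"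
    unfolding r(3) by (rule exchange_coeff[OF b _ refl]) (use r(1) Z_carrier in auto)
  also have "\<dots> \<in> zsp R Z M I (x(j := y)) t \<theta>"
  proof (rule zspI)
    fix i assume i: "i \<in> I"
    show "?s i \<in> Z" using r(1) b(1) cZ i j Z_mult Z_add Z_neg by simp
    assume s: "?s i \<noteq> \<zero>"
    have bc: "b \<in> carrier R" using b Z_carrier by blast
    show "t i = \<theta>"
    proof (cases "r i = \<zero>")
      case True
      then have "r j \<noteq> \<zero> \<and> c i \<noteq> \<zero> \<or> i = j \<and> r j \<noteq> \<zero>"
        using s bc cc[OF i] Z_carrier[OF r(1)[OF j]] by (auto split: if_splits)
      then show ?thesis using ct[OF i] r(2)[OF j] by auto
    qed (use r(2) i in auto)
  qed
  finally show "m \<in> zsp R Z M I (x(j := y)) t \<theta>" .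
qed

end

text \<open>The y k are treated one at a time: if y k involves a basis element that has not been
  replaced, it takes its place; otherwise it is a scalar combination of y inserted earlier. S
  collects the inserted indices, \<sigma> records the positions taken, and the inclusion of spans is
  the invariant that keeps the remaining y expressible.\<close>

lemma replacement_ex:
  assumes "finite J" and "\<And>k. k \<in> J \<Longrightarrow> y k \<in> zs (\<tau> k)"
  shows "\<exists>S \<sigma> x'. S \<subseteq> J \<and> inj_on \<sigma> S \<and> \<sigma> ` S \<subseteq> I \<and> (\<forall>k\<in>S. t (\<sigma> k) = \<tau> k \<and> x' (\<sigma> k) = y k) \<and>
    gbasis R M I x' (\<lambda>i. fst (t i)) (\<lambda>i. snd (t i)) \<and> (\<forall>\<theta>. zs \<theta> \<subseteq> zsp R Z M I x' t \<theta>) \<and>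
    (\<forall>k\<in>J. y k \<in> zsp R Z M S y \<tau> (\<tau> k))"
  using assms
proof (induction J rule: finite_induct)
  case empty
  then show ?case using gbasis by (intro exI[of _ "{}"] exI[of _ x]) auto
next
  case (insert k J)
  then obtain S \<sigma> x' where S: "S \<subseteq> J" "inj_on \<sigma> S" "\<sigma> ` S \<subseteq> I" "\<forall>k\<in>S. t (\<sigma> k) = \<tau> k \<and> x' (\<sigma> k) = y k"
    and x': "gbasis R M I x' (\<lambda>i. fst (t i)) (\<lambda>i. snd (t i))" "\<forall>\<theta>. zs \<theta> \<subseteq> zsp R Z M I x' t \<theta>"
    and sp: "\<forall>k\<in>J. y k \<in> zsp R Z M S y \<tau> (\<tau> k)" by blast
  interpret B: zbased R Z M I x' t
    by (intro zbased.intro based.intro based_axioms.intro x' zring_axioms gmod_axioms)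
  have yM: "y l \<in> carrier M" if "l \<in> insert k J" for l
    using insert.prems[OF that] zs_closed by simp
  have finS: "finite S" using S(1) insert.hyps(1) finite_subset by blast
  obtain c where c: "\<And>i. i \<in> I \<Longrightarrow> c i \<in> Z" "\<And>i. i \<in> I \<Longrightarrow> c i \<noteq> \<zero> \<Longrightarrow> t i = \<tau> k" "y k = B.lin c"
    using zspE[of "y k" R Z M I x' t "\<tau> k"] x'(2) insert.prems[of k] unfolding B.lin_def by blast
  show ?case
  proof (cases "\<exists>j\<in>I - \<sigma> ` S. c j \<noteq> \<zero>")
    case True
    then obtain j where j: "j \<in> I" "j \<notin> \<sigma> ` S" "c j \<noteq> \<zero>" by auto
    have tj: "t j = \<tau> k" using c(2) j by blast
    have ct: "\<And>i. i \<in> I \<Longrightarrow> c i \<noteq> \<zero> \<Longrightarrow> t i = t j" using c(2) tj by simp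
    have kS: "k \<notin> S" using S(1) insert.hyps by auto
    let ?S = "insert k S" and ?\<sigma> = "\<sigma>(k := j)" and ?x = "x'(j := y k)"
    have "?S \<subseteq> insert k J" "?\<sigma> ` ?S \<subseteq> I" using S j by auto
    moreover have "inj_on ?\<sigma> ?S" using S(2) j(2) kS by (auto simp: inj_on_def)
    moreover have "\<forall>l\<in>?S. t (?\<sigma> l) = \<tau> l \<and> ?x (?\<sigma> l) = y l" using S(4) tj kS j(2) by auto
    moreover have "gbasis R M I ?x (\<lambda>i. fst (t i)) (\<lambda>i. snd (t i))"
      by (rule B.exchange_gbasis[OF j(1) c(1) ct c(3) j(3)])
    moreover have "\<forall>\<theta>. zs \<theta> \<subseteq> zsp R Z M I ?x t \<theta>"
      using B.exchange_zsp[OF j(1) c(1) ct c(3) j(3)] x'(2) by blast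
    moreover have "\<forall>l\<in>insert k J. y l \<in> zsp R Z M ?S y \<tau> (\<tau> l)"
    proof
      fix l assume l: "l \<in> insert k J"
      show "y l \<in> zsp R Z M ?S y \<tau> (\<tau> l)"
      proof (cases "l = k")
        case True
        have "(\<Oplus>\<^bsub>M\<^esub>s\<in>?S. (if s = k then \<one> else \<zero>) \<odot>\<^bsub>M\<^esub> y s) = \<one> \<odot>\<^bsub>M\<^esub> y k"
          by (subst M.finsum_eq_single[where i=k]) (use finS yM S(1) smult_closed in auto)
        also have "\<dots> = y k" using smult_one yM by simp
        finally have "y k = (\<Oplus>\<^bsub>M\<^esub>s\<in>?S. (if s = k then \<one> else \<zero>) \<odot>\<^bsub>M\<^esub> y s)" by simp
        also have "\<dots> \<in> zsp R Z M ?S y \<tau> (\<tau> k)"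
          by (rule zspI) (use Z_one Z_zero in \<open>auto split: if_splits\<close>)
        finally show ?thesis using True by simp
      next
        case False
        then have yl: "y l \<in> zsp R Z M S y \<tau> (\<tau> l)" using sp l by blast
        obtain a where a: "\<And>i. i \<in> S \<Longrightarrow> a i \<in> Z" "\<And>i. i \<in> S \<Longrightarrow> a i \<noteq> \<zero> \<Longrightarrow> \<tau> i = \<tau> l" "y l = (\<Oplus>\<^bsub>M\<^esub>i\<in>S. a i \<odot>\<^bsub>M\<^esub> y i)"
          using zspE[OF yl] by blast
        have ac: "a s \<odot>\<^bsub>M\<^esub> y s \<in> carrier M" if "s \<in> S" for s
          by (rule smult_closed) (use a(1) Z_carrier yM S(1) that in auto)
        have "y l = (\<Oplus>\<^bsub>M\<^esub>s\<in>?S. (if s = k then \<zero> else a s) \<odot>\<^bsub>M\<^esub> y s)"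
          unfolding a(3) by (rule M.add.finprod_mono_neutral_cong_left) (use finS ac kS yM in auto)
        also have "\<dots> \<in> zsp R Z M ?S y \<tau> (\<tau> l)"
          by (rule zspI) (use a Z_zero in \<open>auto split: if_splits\<close>)
        finally show ?thesis .
      qed
    qed
    ultimately show ?thesis by blast
  next
    case False
    then have c0: "c i = \<zero>" if "i \<in> I" "i \<notin> \<sigma> ` S" for i using that by auto
    have cx: "c i \<odot>\<^bsub>M\<^esub> x' i \<in> carrier M" if "i \<in> I" for i
      by (rule smult_closed) (use c(1) Z_carrier B.x_carrier that in auto)
    have "y k = (\<Oplus>\<^bsub>M\<^esub>i\<in>\<sigma> ` S. c i \<odot>\<^bsub>M\<^esub> x' i)"
      unfolding c(3) B.lin_def
      by (rule M.add.finprod_mono_neutral_cong_right) (use fin cx c0 B.x_carrier S(3) in auto)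
    also have "\<dots> = (\<Oplus>\<^bsub>M\<^esub>s\<in>S. c (\<sigma> s) \<odot>\<^bsub>M\<^esub> x' (\<sigma> s))"
      by (rule M.finsum_reindex[OF _ S(2)]) (use cx S(3) in auto)
    also have "\<dots> = (\<Oplus>\<^bsub>M\<^esub>s\<in>S. c (\<sigma> s) \<odot>\<^bsub>M\<^esub> y s)"
    proof (rule M.finsum_cong'[OF refl])
      show "(\<lambda>s. c (\<sigma> s) \<odot>\<^bsub>M\<^esub> y s) \<in> S \<rightarrow> carrier M"
      proof
        fix i assume "i \<in> S"
        then show "c (\<sigma> i) \<odot>\<^bsub>M\<^esub> y i \<in> carrier M" using cx[of "\<sigma> i"] S(3,4) by auto
      qed
    qed (use S(4) in simp)
    also have "\<dots> \<in> zsp R Z M S y \<tau> (\<tau> k)"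
    proof (rule zspI)
      fix i assume i: "i \<in> S"
      show "c (\<sigma> i) \<in> Z" using c(1) S(3) i by blast
      show "c (\<sigma> i) \<noteq> \<zero> \<Longrightarrow> \<tau> i = \<tau> k" using c(2)[of "\<sigma> i"] S(3,4) i by auto
    qed
    finally have "\<forall>l\<in>insert k J. y l \<in> zsp R Z M S y \<tau> (\<tau> l)" using sp by blast
    then show ?thesis using S x' by (intro exI[of _ S] exI[of _ \<sigma>] exI[of _ x']) auto
  qed
qed

lemma replacement:
  assumes "finite J" and "\<And>k. k \<in> J \<Longrightarrow> y k \<in> zs (\<tau> k)"
  obtains S \<sigma> x' where "S \<subseteq> J" "inj_on \<sigma> S" "\<sigma> ` S \<subseteq> I" "\<forall>k\<in>S. t (\<sigma> k) = \<tau> k \<and> x' (\<sigma> k) = y k"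
    "gbasis R M I x' (\<lambda>i. fst (t i)) (\<lambda>i. snd (t i))" "\<forall>k\<in>J. y k \<in> zsp R Z M S y \<tau> (\<tau> k)"
  by (rule replacement_ex[THEN exE, OF assms(1)], erule assms(2), elim exE conjE, rule that)

text \<open>By independence no y k with nonzero idempotent is a combination of the others, so
  replacement inserts all of them, each into a position of the same type. With a zero idempotent the
  basis element itself is zero, and independence says nothing.\<close>

lemma card_type_le:
  assumes "gbasis R M J y (\<lambda>i. fst (\<tau> i)) (\<lambda>i. snd (\<tau> i))"
    and sp: "\<And>k. k \<in> J \<Longrightarrow> y k \<in> zs (\<tau> k)" and nz: "fst \<theta> \<noteq> \<zero>"
  shows "card {j \<in> J. \<tau> j = \<theta>} \<le> card {i \<in> I. t i = \<theta>}"
proof -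
  interpret Y: zbased R Z M J y \<tau>
    by (intro zbased.intro based.intro based_axioms.intro assms(1) zring_axioms gmod_axioms)
  obtain S \<sigma> x' where S: "S \<subseteq> J" "inj_on \<sigma> S" "\<sigma> ` S \<subseteq> I" "\<forall>k\<in>S. t (\<sigma> k) = \<tau> k \<and> x' (\<sigma> k) = y k"
    and "gbasis R M I x' (\<lambda>i. fst (t i)) (\<lambda>i. snd (t i))" and sp: "\<forall>k\<in>J. y k \<in> zsp R Z M S y \<tau> (\<tau> k)"
    by (rule replacement[OF Y.fin sp])
  have "k \<in> S" if k: "k \<in> J" "\<tau> k = \<theta>" for k
  proof (rule ccontr)
    assume kS: "k \<notin> S"
    obtain c where c: "\<And>i. i \<in> S \<Longrightarrow> c i \<in> Z" "y k = (\<Oplus>\<^bsub>M\<^esub>i\<in>S. c i \<odot>\<^bsub>M\<^esub> y i)"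
      using zspE[OF sp[rule_format, OF k(1)]] by blast
    have cy: "c i \<odot>\<^bsub>M\<^esub> y i \<in> carrier M" if "i \<in> S" for i
      by (rule smult_closed) (use c(1) Z_carrier Y.x_carrier S(1) that in auto)
    have "y k = Y.lin (\<lambda>i. if i \<in> S then c i else \<zero>)"
      unfolding c(2) Y.lin_def
      by (rule M.add.finprod_mono_neutral_cong_left) (use Y.fin S(1) cy Y.x_carrier in auto)
    then have "Y.co (y k) k = \<zero> \<otimes> fst (\<tau> k)"
      using Y.co_lin[of "\<lambda>i. if i \<in> S then c i else \<zero>" k] c(1) Z_carrier k(1) kS by auto
    then have "fst (\<tau> k) = \<zero>" using Y.co_x[OF k(1) k(1)] Y.e_carrier k(1) by simp
    then show False using nz k(2) by simp
  qed
  then have "{j \<in> J. \<tau> j = \<theta>} \<subseteq> S" by blast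
  then have "inj_on \<sigma> {j \<in> J. \<tau> j = \<theta>}" "\<sigma> ` {j \<in> J. \<tau> j = \<theta>} \<subseteq> {i \<in> I. t i = \<theta>}"
    using S inj_on_subset by (blast, auto)
  then show ?thesis using fin by (intro card_inj_on_le) auto
qed

text \<open>The idempotent endomorphism \<iota> \<pi> of M has scalar entries. Among the vectors
  \<iota> (\<pi> (\<open>x i\<close>)) replacement selects a subfamily S that is part of a basis of
  M and has the others as scalar combinations; as \<iota> is injective, the corresponding \<pi>
  (\<open>x i\<close>) form a basis of P.\<close>

lemma retract_gbasis:
  assumes P: "gmod R P" and \<iota>: "\<iota> \<in> gr_hom R P M" and \<pi>: "\<pi> \<in> gr_hom R M P"
    and r: "\<And>p. p \<in> carrier P \<Longrightarrow> \<pi> (\<iota> p) = p"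
    and sp: "\<And>i. i \<in> I \<Longrightarrow> \<iota> (\<pi> (x i)) \<in> zs (t i)"
  obtains S where "S \<subseteq> I" "gbasis R P S (\<lambda>i. \<pi> (x i)) (\<lambda>i. fst (t i)) (\<lambda>i. snd (t i))"
proof -
  interpret P: gmod R P by fact
  let ?y = "\<lambda>i. \<iota> (\<pi> (x i))"
  obtain S \<sigma> x' where S: "S \<subseteq> I" "inj_on \<sigma> S" "\<sigma> ` S \<subseteq> I" "\<forall>k\<in>S. t (\<sigma> k) = t k \<and> x' (\<sigma> k) = ?y k"
    and x': "gbasis R M I x' (\<lambda>i. fst (t i)) (\<lambda>i. snd (t i))"
    and ys: "\<forall>k\<in>I. ?y k \<in> zsp R Z M S ?y t (t k)"
    by (rule replacement[OF fin sp])
  have finS: "finite S" using S(1) fin finite_subset by blast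
  have px: "\<pi> (x i) \<in> carrier P" if "i \<in> I" for i using gr_homD(1)[OF \<pi>] x_carrier that by auto
  have yM: "?y i \<in> carrier M" if "i \<in> I" for i using gr_homD(1)[OF \<iota>] px that by auto
  have "\<forall>k\<in>I. \<exists>c. (\<forall>i\<in>S. c i \<in> Z \<and> (c i \<noteq> \<zero> \<longrightarrow> t i = t k)) \<and> ?y k = (\<Oplus>\<^bsub>M\<^esub>i\<in>S. c i \<odot>\<^bsub>M\<^esub> ?y i)"
    using ys unfolding zsp_def by blast
  then obtain c where c: "\<And>k i. k \<in> I \<Longrightarrow> i \<in> S \<Longrightarrow> c k i \<in> Z"
    "\<And>k i. k \<in> I \<Longrightarrow> i \<in> S \<Longrightarrow> c k i \<noteq> \<zero> \<Longrightarrow> t i = t k"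
    "\<And>k. k \<in> I \<Longrightarrow> ?y k = (\<Oplus>\<^bsub>M\<^esub>i\<in>S. c k i \<odot>\<^bsub>M\<^esub> ?y i)" by metis
  have cc: "c k i \<in> carrier R" if "k \<in> I" "i \<in> S" for k i using c(1) Z_carrier that by auto
  have pc: "\<pi> (x k) = (\<Oplus>\<^bsub>P\<^esub>i\<in>S. c k i \<odot>\<^bsub>P\<^esub> \<pi> (x i))" if k: "k \<in> I" for k
  proof -
    have "\<pi> (x k) = \<pi> (\<Oplus>\<^bsub>M\<^esub>i\<in>S. c k i \<odot>\<^bsub>M\<^esub> ?y i)" using r px k c(3) by metis
    also have "\<dots> = (\<Oplus>\<^bsub>P\<^esub>i\<in>S. c k i \<odot>\<^bsub>P\<^esub> \<pi> (?y i))"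
      by (rule gr_hom_lin[OF gmod_axioms P \<pi>]) (use cc k yM S(1) in auto)
    also have "\<dots> = (\<Oplus>\<^bsub>P\<^esub>i\<in>S. c k i \<odot>\<^bsub>P\<^esub> \<pi> (x i))"
      by (rule P.M.finsum_cong') (use r px S(1) cc k in \<open>auto simp: Pi_iff intro!: P.smult_closed\<close>)
    finally show ?thesis .
  qed
  show ?thesis
  proof (rule that[OF S(1)], rule gbasisI[OF finS])
    fix i assume i: "i \<in> S"
    then have iI: "i \<in> I" using S(1) by auto
    show "gidem R (fst (t i))" "\<pi> (x i) \<in> grade P (snd (t i))"
      using idem iI gr_homD(4)[OF \<pi>] x_grade by auto
    show "fst (t i) \<odot>\<^bsub>P\<^esub> \<pi> (x i) = \<pi> (x i)"
      using gr_homD(3)[OF \<pi>, of "fst (t i)" "x i"] e_carrier x_carrier e_x iI by auto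
  next
    fix n p assume p: "p \<in> grade P n"
    then have ip: "\<iota> p \<in> grade M n" and pP: "p \<in> carrier P" using gr_homD(4)[OF \<iota>] P.mgrade_carrier by auto
    then have iM: "\<iota> p \<in> carrier M" using mgrade_carrier by auto
    let ?a = "co (\<iota> p)"
    have ac: "?a k \<in> carrier R" if "k \<in> I" for k using co_closed[OF iM that] .
    have trm: "?a k \<odot>\<^bsub>P\<^esub> (c k i \<odot>\<^bsub>P\<^esub> \<pi> (x i)) \<in> carrier P" if "k \<in> I" "i \<in> S" for k i
      using that ac cc px S(1) by (intro P.smult_closed) auto
    \<comment> \<open>The element \<iota> p is expanded in the basis of M and mapped back by \<pi>;
      then each \<pi> (\<open>x k\<close>) is rewritten through the indices in S, and the double sum
      is exchanged.\<close>
    have "p = \<pi> (lin ?a)" using r[OF pP] lin_co[OF iM] by simp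
    also have "\<dots> = (\<Oplus>\<^bsub>P\<^esub>k\<in>I. ?a k \<odot>\<^bsub>P\<^esub> \<pi> (x k))"
      unfolding lin_def by (rule gr_hom_lin[OF gmod_axioms P \<pi>]) (use ac x_carrier in auto)
    also have "\<dots> = (\<Oplus>\<^bsub>P\<^esub>k\<in>I. \<Oplus>\<^bsub>P\<^esub>i\<in>S. ?a k \<odot>\<^bsub>P\<^esub> (c k i \<odot>\<^bsub>P\<^esub> \<pi> (x i)))"
    proof (rule P.M.finsum_cong'[OF refl])
      show "?a k \<odot>\<^bsub>P\<^esub> \<pi> (x k) = (\<Oplus>\<^bsub>P\<^esub>i\<in>S. ?a k \<odot>\<^bsub>P\<^esub> (c k i \<odot>\<^bsub>P\<^esub> \<pi> (x i)))" if k: "k \<in> I" for k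
        by (subst pc[OF k], rule P.smult_finsum_r[OF ac[OF k]])
          (use cc k px S(1) in \<open>auto intro!: P.smult_closed\<close>)
    qed (use trm in \<open>auto intro!: P.M.finsum_closed\<close>)
    also have "\<dots> = (\<Oplus>\<^bsub>P\<^esub>i\<in>S. \<Oplus>\<^bsub>P\<^esub>k\<in>I. ?a k \<odot>\<^bsub>P\<^esub> (c k i \<odot>\<^bsub>P\<^esub> \<pi> (x i)))"
      by (rule P.M.finsum_swap) (use fin finS trm in auto)
    also have "\<dots> = (\<Oplus>\<^bsub>P\<^esub>i\<in>S. (\<Oplus>k\<in>I. ?a k \<otimes> c k i) \<odot>\<^bsub>P\<^esub> \<pi> (x i))"
    proof (rule P.M.finsum_cong'[OF refl])
      fix i assume i: "i \<in> S"
      have "(\<Oplus>k\<in>I. ?a k \<otimes> c k i) \<odot>\<^bsub>P\<^esub> \<pi> (x i) = (\<Oplus>\<^bsub>P\<^esub>k\<in>I. (?a k \<otimes> c k i) \<odot>\<^bsub>P\<^esub> \<pi> (x i))"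
        by (rule P.smult_finsum_l) (use i S(1) px ac cc in auto)
      also have "\<dots> = (\<Oplus>\<^bsub>P\<^esub>k\<in>I. ?a k \<odot>\<^bsub>P\<^esub> (c k i \<odot>\<^bsub>P\<^esub> \<pi> (x i)))"
        by (rule P.M.finsum_cong'[OF refl]) (use i S(1) px ac cc trm in \<open>auto intro!: P.smult_assoc\<close>)
      finally show "(\<Oplus>\<^bsub>P\<^esub>k\<in>I. ?a k \<odot>\<^bsub>P\<^esub> (c k i \<odot>\<^bsub>P\<^esub> \<pi> (x i))) = (\<Oplus>k\<in>I. ?a k \<otimes> c k i) \<odot>\<^bsub>P\<^esub> \<pi> (x i)" by simp
    qed (use S(1) px ac cc in \<open>auto intro!: P.smult_closed R.finsum_closed\<close>)
    finally have "p = (\<Oplus>\<^bsub>P\<^esub>i\<in>S. (\<Oplus>k\<in>I. ?a k \<otimes> c k i) \<odot>\<^bsub>P\<^esub> \<pi> (x i))" .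
    moreover have "(\<Oplus>k\<in>I. ?a k \<otimes> c k i) \<in> grade R (n - snd (t i))" if i: "i \<in> S" for i
    proof (rule grade_finsum, rule Pi_I)
      fix k assume k: "k \<in> I"
      show "?a k \<otimes> c k i \<in> grade R (n - snd (t i))"
      proof (cases "c k i = \<zero>")
        case False
        have "c k i \<in> grade R 0" using c(1)[OF k i] Z_grade by auto
        then show ?thesis using c(2)[OF k i False] by (intro grade_mult'[OF co_grade[OF ip k]]) auto
      qed (use ac k in simp)
    qed
    ultimately show "\<exists>s. (\<forall>i\<in>S. s i \<in> grade R (n - snd (t i))) \<and> p = (\<Oplus>\<^bsub>P\<^esub>i\<in>S. s i \<odot>\<^bsub>P\<^esub> \<pi> (x i))"
      by (intro exI[of _ "\<lambda>i. \<Oplus>k\<in>I. ?a k \<otimes> c k i"]) auto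
  next
    fix s k assume s: "s \<in> S \<rightarrow> carrier R" "(\<Oplus>\<^bsub>P\<^esub>i\<in>S. s i \<odot>\<^bsub>P\<^esub> \<pi> (x i)) = \<zero>\<^bsub>P\<^esub>" "k \<in> S"
    interpret X: based R M I x' "\<lambda>i. fst (t i)" "\<lambda>i. snd (t i)"
      by (intro based.intro based_axioms.intro x' gmod_axioms)
    \<comment> \<open>A relation in P is carried to M by \<iota> and padded with zeros outside the
      positions \<sigma> S, so that independence of the basis \<open>x'\<close> applies.\<close>
    let ?r = "\<lambda>i. if i \<in> \<sigma> ` S then s (the_inv_into S \<sigma> i) else \<zero>"
    have rs: "?r (\<sigma> i) = s i" if "i \<in> S" for i using that the_inv_into_f_f[OF S(2) that] by simp
    have sc: "s i \<in> carrier R" if "i \<in> S" for i using s(1) that by auto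
    have rI: "?r i \<in> carrier R" if "i \<in> I" for i using rs sc by (cases "i \<in> \<sigma> ` S") auto
    have sy: "s i \<odot>\<^bsub>M\<^esub> ?y i \<in> carrier M" if "i \<in> S" for i using that sc yM S(1) by (intro smult_closed) auto
    have "(\<Oplus>\<^bsub>M\<^esub>i\<in>I. ?r i \<odot>\<^bsub>M\<^esub> x' i) = (\<Oplus>\<^bsub>M\<^esub>i\<in>\<sigma> ` S. ?r i \<odot>\<^bsub>M\<^esub> x' i)"
    proof (rule M.add.finprod_mono_neutral_cong_right[OF fin S(3)])
      show "\<And>i. i \<in> I - \<sigma> ` S \<Longrightarrow> ?r i \<odot>\<^bsub>M\<^esub> x' i = \<zero>\<^bsub>M\<^esub>" using X.x_carrier by simp
      show "(\<lambda>i. ?r i \<odot>\<^bsub>M\<^esub> x' i) \<in> I \<rightarrow> carrier M"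
        by (rule Pi_I, rule smult_closed[OF rI X.x_carrier])
    qed simp
    also have "\<dots> = (\<Oplus>\<^bsub>M\<^esub>i\<in>S. ?r (\<sigma> i) \<odot>\<^bsub>M\<^esub> x' (\<sigma> i))"
      by (rule M.finsum_reindex[OF _ S(2)], rule Pi_I, rule smult_closed[OF rI X.x_carrier]) (use S(3) in auto)
    also have "\<dots> = (\<Oplus>\<^bsub>M\<^esub>i\<in>S. s i \<odot>\<^bsub>M\<^esub> ?y i)"
      by (rule M.finsum_cong'[OF refl]) (use rs S(4) sy in \<open>auto simp: Pi_iff\<close>)
    also have "\<dots> = \<iota> (\<Oplus>\<^bsub>P\<^esub>i\<in>S. s i \<odot>\<^bsub>P\<^esub> \<pi> (x i))"
      by (rule gr_hom_lin[OF P gmod_axioms \<iota>, symmetric]) (use sc px S(1) in auto)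
    also have "\<dots> = \<zero>\<^bsub>M\<^esub>" using s(2) gr_hom_zero[OF P gmod_axioms \<iota>] by simp
    finally have "?r (\<sigma> k) \<otimes> fst (t (\<sigma> k)) = \<zero>"
      using gbasis_indepD[OF x', of ?r "\<sigma> k"] rI s(3) S(3) by blast
    then show "s k \<otimes> fst (t k) = \<zero>" using rs s(3) S(4) by simp
  qed
qed

end

section \<open>Modules over Leavitt path algebras\<close>

text \<open>
  Paths from \<open>v\<close> of length \<open>n\<close>, together with the shorter ones that end in a sink.
\<close>

primrec paths :: "('v, 'e) pre_digraph \<Rightarrow> nat \<Rightarrow> 'v \<Rightarrow> 'e list set" where
  "paths E 0 v = {[]}"
| "paths E (Suc n) v = (if out_arcs E v = {} then {[]} else (\<Union>e\<in>out_arcs E v. (#) e ` paths E n (head E e)))"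

primrec rng :: "('v, 'e) pre_digraph \<Rightarrow> 'v \<Rightarrow> 'e list \<Rightarrow> 'v" where
  "rng E v [] = v"
| "rng E v (e # p) = rng E (head E e) p"

primrec vpath :: "('v, 'e) pre_digraph \<Rightarrow> 'v \<Rightarrow> 'e list \<Rightarrow> bool" where
  "vpath E v [] = (v \<in> verts E)"
| "vpath E v (e # p) = (e \<in> arcs E \<and> tail E e = v \<and> vpath E (head E e) p)"

lemma rng_append: "rng E v (p @ q) = rng E (rng E v p) q"
  by (induction p arbitrary: v) auto

lemma vpath_append: "vpath E v (p @ q) \<longleftrightarrow> vpath E v p \<and> vpath E (rng E v p) q"
  if "wf_digraph E"
proof (induction p arbitrary: v)
  case Nil
  have "vpath E v q \<Longrightarrow> v \<in> verts E" for q v using that by (cases q) (auto simp: wf_digraph_def)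
  then show ?case by auto
qed auto

lemma (in fin_digraph) vpath_rng: "vpath G v p \<Longrightarrow> v \<in> verts G \<and> rng G v p \<in> verts G"
  by (induction p arbitrary: v) auto

lemma (in fin_digraph) finite_paths: "finite (paths G n v)"
  by (induction n arbitrary: v) auto

lemma (in fin_digraph) paths_iff:
  assumes "v \<in> verts G"
  shows "p \<in> paths G n v \<longleftrightarrow>
    vpath G v p \<and> (length p = n \<or> length p < n \<and> out_arcs G (rng G v p) = {})"
  using assms
proof (induction n arbitrary: v p)
  case (Suc n)
  show ?case
  proof (cases p)
    case Nil
    then show ?thesis using Suc.prems by auto
  next
    case (Cons e q)
    show ?thesis
    proof (cases "e \<in> out_arcs G v")
      case True
      then have "head G e \<in> verts G" by auto
      have "out_arcs G v \<noteq> {}" using True by blast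
      then have "p \<in> paths G (Suc n) v \<longleftrightarrow> q \<in> paths G n (head G e)"
        using True Cons by auto
      then show ?thesis using Suc.IH[OF \<open>head G e \<in> verts G\<close>] True Cons by auto
    next
      case False
      then show ?thesis using Cons by auto
    qed
  qed
qed auto

text \<open>An interface for the module theory: the Leavitt relations, and the fact that every
  homogeneous component is additively spanned by scalar multiples of words of that degree. The words
  are nonempty because the presentation has no unit; its role is taken by the sum of the
  vertices.\<close>

locale lpa = R?: zring R Z + E?: fin_digraph E
  for R :: "('k, 'r, 'm) gmodule_scheme" (structure) and Z and E :: "('v, 'e) pre_digraph" +
  fixes gm :: "('v, 'e) lpa_gen \<Rightarrow> 'r"
  assumes gm_grade: "g \<in> lpa_gens E \<Longrightarrow> gm g \<in> grade R (gen_deg g)"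
    and vt_vt: "\<lbrakk>u \<in> verts E; v \<in> verts E\<rbrakk> \<Longrightarrow> gm (Vert u) \<otimes> gm (Vert v) = (if u = v then gm (Vert u) else \<zero>)"
    and vt_ed: "e \<in> arcs E \<Longrightarrow> gm (Vert (tail E e)) \<otimes> gm (Edge e) = gm (Edge e)"
    and ed_vt: "e \<in> arcs E \<Longrightarrow> gm (Edge e) \<otimes> gm (Vert (head E e)) = gm (Edge e)"
    and vt_gh: "e \<in> arcs E \<Longrightarrow> gm (Vert (head E e)) \<otimes> gm (Ghost e) = gm (Ghost e)"
    and gh_vt: "e \<in> arcs E \<Longrightarrow> gm (Ghost e) \<otimes> gm (Vert (tail E e)) = gm (Ghost e)"
    and ck2: "\<lbrakk>v \<in> verts E; out_arcs E v \<noteq> {}\<rbrakk> \<Longrightarrow>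
      (\<Oplus>e\<in>out_arcs E v. gm (Edge e) \<otimes> gm (Ghost e)) = gm (Vert v)"
    and ck1: "\<lbrakk>e \<in> arcs E; f \<in> arcs E\<rbrakk> \<Longrightarrow> gm (Ghost e) \<otimes> gm (Edge f) = (if e = f then gm (Vert (head E e)) else \<zero>)"
    and one_vt: "\<one> = (\<Oplus>v\<in>verts E. gm (Vert v))"
    and words_span: "\<lbrakk>subgroup H (add_monoid R);
      \<And>z w. \<lbrakk>z \<in> Z; w \<in> lists (lpa_gens E); w \<noteq> []; sum_list (map gen_deg w) = n\<rbrakk> \<Longrightarrow>
        z \<otimes> foldr (\<lambda>g a. gm g \<otimes> a) w \<one> \<in> H\<rbrakk> \<Longrightarrow> grade R n \<subseteq> H"
begin

abbreviation "vt v \<equiv> gm (Vert v)"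
abbreviation "ed v \<equiv> gm (Edge v)"
abbreviation "gh v \<equiv> gm (Ghost v)"

lemma vt_grade: "v \<in> verts E \<Longrightarrow> vt v \<in> grade R 0"
  and ed_grade: "e \<in> arcs E \<Longrightarrow> ed e \<in> grade R 1"
  and gh_grade: "e \<in> arcs E \<Longrightarrow> gh e \<in> grade R (- 1)"
  using gm_grade[of "Vert v"] gm_grade[of "Edge e"] gm_grade[of "Ghost e"] by (auto simp: lpa_gens_def)

lemma vt_closed [simp]: "v \<in> verts E \<Longrightarrow> vt v \<in> carrier R"
  and ed_closed [simp]: "e \<in> arcs E \<Longrightarrow> ed e \<in> carrier R"
  and gh_closed [simp]: "e \<in> arcs E \<Longrightarrow> gh e \<in> carrier R"
  using vt_grade ed_grade gh_grade grade_carrier by blast+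

lemma vt_gidem: "v \<in> verts E \<Longrightarrow> gidem R (vt v)"
  unfolding gidem_def using vt_grade vt_vt by simp

primrec pe :: "'v \<Rightarrow> 'e list \<Rightarrow> 'r" where
  "pe v [] = vt v"
| "pe v (e # p) = ed e \<otimes> pe (head E e) p"

text \<open>The ghost of the path p, written p* below: its letters occur in reverse order, from the
  range of p back to v.\<close>

primrec gp :: "'v \<Rightarrow> 'e list \<Rightarrow> 'r" where
  "gp v [] = vt v"
| "gp v (e # p) = gp (head E e) p \<otimes> gh e"

lemma pe_grade: "vpath E v p \<Longrightarrow> pe v p \<in> grade R (int (length p))"
proof (induction p arbitrary: v)
  case (Cons e p)
  then show ?case by (auto intro!: grade_mult'[OF ed_grade])
qed (auto intro: vt_grade)

lemma gp_grade: "vpath E v p \<Longrightarrow> gp v p \<in> grade R (- int (length p))"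
proof (induction p arbitrary: v)
  case (Cons e p)
  then show ?case by (auto intro!: grade_mult'[OF _ gh_grade])
qed (auto intro: vt_grade)

lemma pe_closed [simp]: "vpath E v p \<Longrightarrow> pe v p \<in> carrier R"
  and gp_closed [simp]: "vpath E v p \<Longrightarrow> gp v p \<in> carrier R"
  using pe_grade gp_grade grade_carrier by blast+

lemma vt_pe: "vpath E v p \<Longrightarrow> vt v \<otimes> pe v p = pe v p"
  by (cases p) (auto simp: vt_vt m_assoc[symmetric] vt_ed)

lemma gp_vt: "vpath E v p \<Longrightarrow> gp v p \<otimes> vt v = gp v p"
  by (cases p) (auto simp: vt_vt m_assoc gh_vt)

lemma pe_vt: "vpath E v p \<Longrightarrow> pe v p \<otimes> vt (rng E v p) = pe v p"
  by (induction p arbitrary: v) (auto simp: vt_vt m_assoc vpath_rng)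

lemma vt_gp: "vpath E v p \<Longrightarrow> vt (rng E v p) \<otimes> gp v p = gp v p"
  by (induction p arbitrary: v) (auto simp: vt_vt m_assoc[symmetric] vpath_rng)

lemma gp_append: "vpath E v (p @ q) \<Longrightarrow> gp v (p @ q) = gp (rng E v p) q \<otimes> gp v p"
proof (induction p arbitrary: v)
  case Nil
  then show ?case by (simp add: gp_vt)
next
  case (Cons e p)
  then have "vpath E (head E e) p" "vpath E (rng E (head E e) p) q"
    using vpath_append[OF wf_digraph] by auto
  then show ?case using Cons by (simp add: m_assoc)
qed

text \<open>In a* p the edges cancel from the inside, and the first mismatch gives 0 by
  \<open>ck1\<close>. The length condition ensures that if a is used up before p, the product
  vanishes anyway.\<close>

lemma gp_pe:
  assumes "vpath E w a" "vpath E u p" "length p \<le> length a \<or> out_arcs E (rng E w a) = {}"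
  shows "gp w a \<otimes> pe u p = \<zero> \<or>
    w = u \<and> (\<exists>a'. a = p @ a' \<and> gp w a \<otimes> pe u p = gp (rng E u p) a')"
  using assms
proof (induction p arbitrary: u w a)
  case Nil
  show ?case
  proof (cases "w = u")
    case False
    have "gp w a \<otimes> vt u = gp w a \<otimes> (vt w \<otimes> vt u)" using gp_vt Nil vpath_rng by (simp add: m_assoc[symmetric])
    then show ?thesis using False Nil vt_vt vpath_rng by simp
  qed (use Nil gp_vt in auto)
next
  case (Cons e p)
  show ?case
  proof (cases a)
    case Nil
    \<comment> \<open>Here a is empty but p is not, so w is a sink and p starts elsewhere.\<close>
    then have "w \<noteq> u" using Cons.prems by (auto simp: out_arcs_def)
    then have "vt w \<otimes> vt u = \<zero>" using vt_vt Cons.prems Nil by auto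
    have "vt w \<otimes> pe u (e # p) = vt w \<otimes> (vt u \<otimes> pe u (e # p))" using vt_pe[OF Cons.prems(2)] by simp
    also have "\<dots> = vt w \<otimes> vt u \<otimes> pe u (e # p)"
      using Cons.prems Nil pe_closed[OF Cons.prems(2)] by (subst m_assoc) auto
    finally show ?thesis
      using \<open>vt w \<otimes> vt u = \<zero>\<close> pe_closed[OF Cons.prems(2)] Nil by simp
  next
    case a: (Cons f b)
    have c: "gp (head E f) b \<in> carrier R" "pe (head E e) p \<in> carrier R" "e \<in> arcs E" "f \<in> arcs E"
      "tail E e = u" "tail E f = w" "vpath E (head E f) b" "vpath E (head E e) p"
      using Cons.prems a by auto
    have *: "gp w a \<otimes> pe u (e # p) = gp (head E f) b \<otimes> (gh f \<otimes> ed e) \<otimes> pe (head E e) p"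
      using c a by (simp add: m_assoc)
    show ?thesis
    proof (cases "e = f")
      case True
      have "gp w a \<otimes> pe u (e # p) = gp (head E e) b \<otimes> pe (head E e) p"
        unfolding * using True c by (simp add: ck1 gp_vt)
      then show ?thesis using Cons.IH[of "head E e" b "head E e"] Cons.prems a True c by auto
    next
      case False
      then show ?thesis using * c by (simp add: ck1)
    qed
  qed
qed

lemma gp_pe_same: "vpath E v p \<Longrightarrow> gp v p \<otimes> pe v p = vt (rng E v p)"
proof (induction p arbitrary: v)
  case (Cons e p)
  then have c: "gp (head E e) p \<in> carrier R" "pe (head E e) p \<in> carrier R" "e \<in> arcs E" "vpath E (head E e) p"
    by auto
  have "gp v (e # p) \<otimes> pe v (e # p) = gp (head E e) p \<otimes> (gh e \<otimes> ed e) \<otimes> pe (head E e) p"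
    using c by (simp add: m_assoc)
  then show ?case using c Cons.IH by (simp add: ck1 gp_vt)
qed (simp add: vt_vt)

text \<open>No member of \<open>paths E n v\<close> is a proper prefix of another, since a member
  shorter than n ends in a sink and cannot be prolonged.\<close>

lemma gp_pe_paths:
  assumes v: "v \<in> verts E" and "p \<in> paths E n v" "q \<in> paths E n v"
  shows "gp v p \<otimes> pe v q = (if p = q then vt (rng E v p) else \<zero>)"
proof (cases "p = q")
  case False
  have p: "vpath E v p" "length p = n \<or> length p < n \<and> out_arcs E (rng E v p) = {}"
    and q: "vpath E v q" "length q = n \<or> length q < n \<and> out_arcs E (rng E v q) = {}"
    using assms paths_iff by auto
  have no: False if a: "p = q @ a" for a
  proof (cases a)
    case (Cons e b)
    then have "length q < n" using p(2) a by auto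
    then have "out_arcs E (rng E v q) = {}" using q(2) by auto
    moreover have "e \<in> out_arcs E (rng E v q)"
      using p(1) a Cons by (auto simp: vpath_append[OF wf_digraph])
    ultimately show False by auto
  qed (use a False in simp)
  have "length q \<le> length p \<or> out_arcs E (rng E v p) = {}" using p(2) q(2) by linarith
  from gp_pe[OF p(1) q(1) this] no have "gp v p \<otimes> pe v q = \<zero>" by blast
  then show ?thesis using False by simp
qed (use assms paths_iff gp_pe_same in auto)

text \<open>Iteration of \<open>ck2\<close>: in the expansion of v into the products e e*, the range
  of e is inserted between the two factors and expanded by induction; sinks stay as they
  are.\<close>

lemma vt_paths: "v \<in> verts E \<Longrightarrow> vt v = (\<Oplus>p\<in>paths E n v. pe v p \<otimes> gp v p)"
proof (induction n arbitrary: v)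
  case 0
  then show ?case by (simp add: vt_vt)
next
  case (Suc n)
  show ?case
  proof (cases "out_arcs E v = {}")
    case True then show ?thesis using Suc.prems by (simp add: vt_vt)
  next
    case False
    have vp: "vpath E (head E e) p" if "e \<in> out_arcs E v" "p \<in> paths E n (head E e)" for e p
      using that paths_iff[of "head E e" p n] by auto
    have c: "pe (head E e) p \<in> carrier R" "gp (head E e) p \<in> carrier R" "ed e \<in> carrier R" "gh e \<in> carrier R"
      if "e \<in> out_arcs E v" "p \<in> paths E n (head E e)" for e p
      using vp[OF that] that by auto
    let ?S = "Sigma (out_arcs E v) (\<lambda>e. paths E n (head E e))"
    have img: "paths E (Suc n) v = (\<lambda>x. fst x # snd x) ` ?S" using False by force
    have fo: "finite (out_arcs E v)" by (simp add: out_arcs_def)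
    have "vt v = (\<Oplus>e\<in>out_arcs E v. ed e \<otimes> gh e)" using ck2[OF Suc.prems False] by simp
    also have "\<dots> = (\<Oplus>e\<in>out_arcs E v. \<Oplus>p\<in>paths E n (head E e). ed e \<otimes> (pe (head E e) p \<otimes> gp (head E e) p) \<otimes> gh e)"
    proof (rule finsum_cong'[OF refl])
      fix e assume e: "e \<in> out_arcs E v"
      have "ed e \<otimes> gh e = ed e \<otimes> vt (head E e) \<otimes> gh e" using e ed_vt by auto
      also have "\<dots> = ed e \<otimes> (\<Oplus>p\<in>paths E n (head E e). pe (head E e) p \<otimes> gp (head E e) p) \<otimes> gh e"
        by (subst Suc.IH) (use e in auto)
      also have "\<dots> = (\<Oplus>p\<in>paths E n (head E e). ed e \<otimes> (pe (head E e) p \<otimes> gp (head E e) p)) \<otimes> gh e"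
        by (subst finsum_rdistr) (use e c[OF e] finite_paths in auto)
      also have "\<dots> = (\<Oplus>p\<in>paths E n (head E e). ed e \<otimes> (pe (head E e) p \<otimes> gp (head E e) p) \<otimes> gh e)"
        by (rule finsum_ldistr) (use e c[OF e] finite_paths in auto)
      finally show "ed e \<otimes> gh e = (\<Oplus>p\<in>paths E n (head E e). ed e \<otimes> (pe (head E e) p \<otimes> gp (head E e) p) \<otimes> gh e)" .
    qed (use c in \<open>auto intro!: finsum_closed\<close>)
    also have "\<dots> = (\<Oplus>x\<in>?S. ed (fst x) \<otimes> (pe (head E (fst x)) (snd x) \<otimes> gp (head E (fst x)) (snd x)) \<otimes> gh (fst x))"
      by (rule finsum_Sigma) (use fo finite_paths c in auto)
    also have "\<dots> = (\<Oplus>x\<in>?S. pe v (fst x # snd x) \<otimes> gp v (fst x # snd x))"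
      by (rule finsum_cong'[OF refl]) (use c in \<open>auto simp: m_assoc\<close>)
    also have "\<dots> = (\<Oplus>p\<in>paths E (Suc n) v. pe v p \<otimes> gp v p)"
      unfolding img by (rule finsum_reindex[symmetric]) (use c in \<open>auto simp: inj_on_def\<close>)
    finally show ?thesis .
  qed
qed

text \<open>The isomorphism of R v with the sum of the R r(p) shifted by |p|: the ghost paths are
  the basis, and the paths are the coordinates of v.\<close>

lemma idec_paths:
  assumes v: "v \<in> verts E"
  shows "idec R (vt v) (paths E n v) (pe v) (gp v) (\<lambda>p. vt (rng E v p)) (\<lambda>p. - int (length p))"
  unfolding idec_def
proof (intro conjI ballI finite_paths vt_paths[OF v] gp_pe_paths[OF v])
  fix p assume "p \<in> paths E n v"
  then have p: "vpath E v p" using paths_iff[OF v] by blast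
  show "pe v p \<in> grade R (- (- int (length p)))" "gp v p \<in> grade R (- int (length p))"
    "gidem R (vt (rng E v p))" "pe v p \<otimes> vt (rng E v p) = pe v p" "vt (rng E v p) \<otimes> gp v p = gp v p"
    using pe_grade[OF p] gp_grade[OF p] vt_gidem vpath_rng[OF p] pe_vt[OF p] vt_gp[OF p] by auto
qed

lemma idec_out:
  assumes v: "v \<in> verts E" and "out_arcs E v \<noteq> {}"
  shows "idec R (vt v) (out_arcs E v) ed gh (\<lambda>e. vt (head E e)) (\<lambda>e. - 1)"
  unfolding idec_def
  using ck2[OF assms] ed_grade gh_grade vt_gidem ed_vt vt_gh ck1 by auto

lemma idec_one: "idec R \<one> (verts E) vt vt vt (\<lambda>_. 0)"
proof -
  have "(\<Oplus>j\<in>verts E. vt j \<otimes> vt j) = \<one>"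
    unfolding one_vt by (rule finsum_cong') (use vt_vt in auto)
  then show ?thesis unfolding idec_def using vt_gidem vt_grade vt_vt by auto
qed

text \<open>Left multiplication by a generator sends a monomial p q* to a monomial or to 0: a vertex
  fixes or kills p, an edge prolongs p, and a ghost edge removes the first edge of p or, if p is
  trivial, prolongs q.\<close>

lemma gen_monomial:
  assumes g: "g \<in> lpa_gens E" and p: "vpath E u p" and q: "vpath E v q" and r: "rng E u p = rng E v q"
  shows "gm g \<otimes> (pe u p \<otimes> gp v q) = \<zero> \<or>
    (\<exists>u' p' v' q'. vpath E u' p' \<and> vpath E v' q' \<and> rng E u' p' = rng E v' q' \<and>
      gm g \<otimes> (pe u p \<otimes> gp v q) = pe u' p' \<otimes> gp v' q' \<and>
      int (length p') - int (length q') = gen_deg g + int (length p) - int (length q))"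
proof (cases g)
  case (Vert x)
  then have x: "x \<in> verts E" using g by (auto simp: lpa_gens_def)
  have "gm g \<otimes> (pe u p \<otimes> gp v q) = vt x \<otimes> vt u \<otimes> (pe u p \<otimes> gp v q)"
    using Vert p q x vpath_rng by (simp add: m_assoc) (simp add: m_assoc[symmetric] vt_pe)
  then show ?thesis
  proof (cases "x = u")
    case True
    then show ?thesis using p q r Vert by (intro disjI2 exI conjI) (auto simp: m_assoc[symmetric] vt_pe x vpath_rng)
  next
    case False
    then show ?thesis using \<open>gm g \<otimes> (pe u p \<otimes> gp v q) = vt x \<otimes> vt u \<otimes> (pe u p \<otimes> gp v q)\<close> vt_vt x p q vpath_rng by simp
  qed
next
  case (Edge e)
  then have e: "e \<in> arcs E" using g by (auto simp: lpa_gens_def)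
  show ?thesis
  proof (cases "head E e = u")
    case True
    then show ?thesis using p q r e Edge
      by (intro disjI2 exI[of _ "tail E e"] exI[of _ "e # p"] exI[of _ v] exI[of _ q] conjI) (auto simp: m_assoc)
  next
    case False
    have "gm g \<otimes> (pe u p \<otimes> gp v q) = ed e \<otimes> vt (head E e) \<otimes> (vt u \<otimes> pe u p \<otimes> gp v q)"
      using Edge p q e by (simp add: ed_vt vt_pe)
    also have "\<dots> = ed e \<otimes> (vt (head E e) \<otimes> vt u) \<otimes> (pe u p \<otimes> gp v q)"
      using p q e vpath_rng by (simp add: m_assoc)
    finally show ?thesis using False e p q vpath_rng by (simp add: vt_vt)
  qed
next
  case (Ghost e)
  then have e: "e \<in> arcs E" using g by (auto simp: lpa_gens_def)
  show ?thesis
  proof (cases p)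
    case Nil
    have u: "u \<in> verts E" using p vpath_rng by auto
    have gvq: "pe u p \<otimes> gp v q = gp v q" using Nil r vt_gp[OF q] by simp
    show ?thesis
    proof (cases "tail E e = u")
      case True
      have vq: "vpath E v (q @ [e])" using q r Nil True e by (simp add: vpath_append[OF wf_digraph])
      have "gp v (q @ [e]) = vt (head E e) \<otimes> gh e \<otimes> gp v q" using gp_append[OF vq] by simp
      then have "gm g \<otimes> (pe u p \<otimes> gp v q) = pe (head E e) [] \<otimes> gp v (q @ [e])"
        using gvq Ghost e q by (simp add: vt_gh m_assoc[symmetric])
      then show ?thesis using vq e Nil Ghost
        by (intro disjI2 exI[of _ "head E e"] exI[of _ "[]"] exI[of _ v] exI[of _ "q @ [e]"] conjI) (auto simp: rng_append)
    next
      case False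
      have "gh e \<otimes> gp v q = (gh e \<otimes> vt (tail E e)) \<otimes> (vt u \<otimes> gp v q)" using vt_gp[OF q] r Nil gh_vt e by simp
      also have "\<dots> = gh e \<otimes> (vt (tail E e) \<otimes> vt u) \<otimes> gp v q" using e u q by (simp add: m_assoc)
      finally show ?thesis using False e u q Ghost gvq by (simp add: vt_vt)
    qed
  next
    case (Cons f p')
    have f: "f \<in> arcs E" "vpath E (head E f) p'" using p Cons by auto
    have "gm g \<otimes> (pe u p \<otimes> gp v q) = gh e \<otimes> ed f \<otimes> pe (head E f) p' \<otimes> gp v q"
      using Cons Ghost e f q by (simp add: m_assoc)
    also have "\<dots> = (if e = f then pe (head E f) p' \<otimes> gp v q else \<zero>)"
      using e f q by (simp add: ck1 vt_pe)
    finally show ?thesis using Cons f q r Ghost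
      by (cases "e = f") (intro disjI2 exI[of _ "head E f"] exI[of _ p'] exI[of _ v] exI[of _ q] conjI, auto)
  qed
qed

lemma word_monomial:
  assumes "w \<in> lists (lpa_gens E)" "w \<noteq> []"
  shows "foldr (\<lambda>g a. gm g \<otimes> a) w \<one> = \<zero> \<or>
    (\<exists>u p v q. vpath E u p \<and> vpath E v q \<and> rng E u p = rng E v q \<and>
      foldr (\<lambda>g a. gm g \<otimes> a) w \<one> = pe u p \<otimes> gp v q \<and>
      int (length p) - int (length q) = sum_list (map gen_deg w))"
  using assms
proof (induction w rule: list.induct)
  case (Cons g w)
  have gg: "g \<in> lpa_gens E" using Cons.prems by simp
  have gc: "gm g \<in> carrier R" by (rule grade_carrier[OF gm_grade[OF gg]])
  show ?case
  proof (cases "w = []")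
    case True
    have g: "g \<in> lpa_gens E" using Cons.prems by simp
    \<comment> \<open>A single generator equals its product with a vertex x, and x is a trivial
      monomial. The induction starts here because the unit is a sum of monomials rather than
      one.\<close>
    obtain x where x: "x \<in> verts E" "gm g \<otimes> vt x = gm g"
    proof (cases g)
      case (Vert v) then show ?thesis using that[of v] g vt_vt by (auto simp: lpa_gens_def)
    next
      case (Edge e) then show ?thesis using that[of "head E e"] g ed_vt by (auto simp: lpa_gens_def)
    next
      case (Ghost e) then show ?thesis using that[of "tail E e"] g gh_vt by (auto simp: lpa_gens_def)
    qed
    have "gm g \<otimes> (pe x [] \<otimes> gp x []) = gm g" using x vt_vt by simp
    then show ?thesis using gen_monomial[OF g, of x "[]" x "[]"] x True gc by simp
  next
    case False
    then consider "foldr (\<lambda>g a. gm g \<otimes> a) w \<one> = \<zero>" | u p v q where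
      "vpath E u p" "vpath E v q" "rng E u p = rng E v q" "foldr (\<lambda>g a. gm g \<otimes> a) w \<one> = pe u p \<otimes> gp v q"
      "int (length p) - int (length q) = sum_list (map gen_deg w)"
      using Cons by fastforce
    then show ?thesis
    proof cases
      case 1 then show ?thesis using gc by simp
    next
      case 2
      have g: "g \<in> lpa_gens E" using Cons.prems by simp
      show ?thesis
      proof (cases "gm g \<otimes> (pe u p \<otimes> gp v q) = \<zero>")
        case True then show ?thesis using 2(4) by simp
      next
        case False
        then obtain u' p' v' q' where "vpath E u' p'" "vpath E v' q'" "rng E u' p' = rng E v' q'"
          "gm g \<otimes> (pe u p \<otimes> gp v q) = pe u' p' \<otimes> gp v' q'"
          "int (length p') - int (length q') = gen_deg g + int (length p) - int (length q)"
          using gen_monomial[OF g 2(1,2,3)] by blast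
        then show ?thesis using 2(4,5)
          by (intro disjI2 exI[of _ u'] exI[of _ p'] exI[of _ v'] exI[of _ q']) simp
      qed
    qed
  qed
qed simp

lemma monomials_span:
  assumes H: "subgroup H (add_monoid R)"
    and mono: "\<And>z u p v q. \<lbrakk>z \<in> Z; vpath E u p; vpath E v q; rng E u p = rng E v q;
      int (length p) - int (length q) = n\<rbrakk> \<Longrightarrow> z \<otimes> (pe u p \<otimes> gp v q) \<in> H"
  shows "grade R n \<subseteq> H"
proof (rule words_span[OF H])
  fix z w assume z: "z \<in> Z" and w: "w \<in> lists (lpa_gens E)" "w \<noteq> []" "sum_list (map gen_deg w) = n"
  have "\<zero> \<in> H" using subgroup.one_closed[OF H] by simp
  then show "z \<otimes> foldr (\<lambda>g a. gm g \<otimes> a) w \<one> \<in> H"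
    using word_monomial[OF w(1,2)] mono[OF z] w(3) Z_carrier[OF z] by auto
qed

end

section \<open>Refinement of bases along paths\<close>

lemma count_image_mset_set: "finite A \<Longrightarrow> count (image_mset f (mset_set A)) b = card {a \<in> A. f a = b}"
proof (induction A rule: finite_induct)
  case (insert x F)
  have "{a \<in> insert x F. f a = b} = (if f x = b then insert x {a \<in> F. f a = b} else {a \<in> F. f a = b})" by auto
  then show ?case using insert by simp
qed simp

locale vbased = lpa R Z E gm + based R M I x "\<lambda>i. gm (Vert (v i))" d
  for R :: "('k, 'r, 'm) gmodule_scheme" (structure) and Z and E :: "('v, 'e) pre_digraph" and gm
    and M :: "('r, 'a) gmodule" (structure) and I :: "'i set" and x :: "'i \<Rightarrow> 'a" and v :: "'i \<Rightarrow> 'v" and d +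
  assumes vI: "i \<in> I \<Longrightarrow> v i \<in> verts E"
begin

text \<open>
  Repeated use of the relation \<open>v = \<Sum> e e*\<close> replaces \<open>x\<^sub>i\<close> by the elements \<open>p* x\<^sub>i\<close>. The length of \<open>p\<close> is
  \<open>d\<^sub>i + N\<close>, so that all new elements have degree \<open>- N\<close>, apart from those that end in a sink.
\<close>

definition refI :: "int \<Rightarrow> ('i \<times> 'e list) set" where
  "refI N = Sigma I (\<lambda>i. paths E (nat (d i + N)) (v i))"

definition refx :: "'i \<times> 'e list \<Rightarrow> 'a" where
  "refx = (\<lambda>p. gp (v (fst p)) (snd p) \<odot>\<^bsub>M\<^esub> x (fst p))"

definition reft :: "'i \<times> 'e list \<Rightarrow> 'r \<times> int" where
  "reft = (\<lambda>p. (vt (rng E (v (fst p)) (snd p)), - int (length (snd p)) + d (fst p)))"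

lemma ref_gbasis: "gbasis R M (refI N) refx (\<lambda>p. fst (reft p)) (\<lambda>p. snd (reft p))"
  using gbasis_refine[OF gbasis idec_paths[OF vI], of "\<lambda>i. nat (d i + N)"]
  unfolding refI_def refx_def reft_def by simp

lemma ref_zbased: "zbased R Z M (refI N) refx reft"
  by (intro zbased.intro based.intro based_axioms.intro ref_gbasis zring_axioms gmod_axioms)

text \<open>For long a the product a* p is 0 or the ghost of a remainder a'', and then a* p q* is
  the ghost of q followed by a''. It annihilates \<open>x i\<close> unless q starts at
  \<open>v i\<close>; in that case it gives a refined basis element.\<close>

lemma monomial_refinement:
  assumes z: "z \<in> Z" and i: "i \<in> I" and w: "w \<in> verts E"
    and p: "vpath E u p" and q: "vpath E u' q" and r: "rng E u p = rng E u' q"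
    and l: "int (length p) - int (length q) = k - d i"
    and N: "int (length p) \<le> k + N" "0 \<le> d i + N" and a: "a \<in> paths E (nat (k + N)) w"
  shows "gp w a \<odot>\<^bsub>M\<^esub> ((z \<otimes> (pe u p \<otimes> gp u' q)) \<odot>\<^bsub>M\<^esub> x i)
    \<in> zsp R Z M (refI N) refx reft (vt (rng E w a), - int (length a) + k)"
proof -
  interpret B: zbased R Z M "refI N" refx reft by (rule ref_zbased)
  have a': "vpath E w a" "length a = nat (k + N) \<or> length a < nat (k + N) \<and> out_arcs E (rng E w a) = {}"
    using a paths_iff[OF w] by auto
  have zc: "z \<in> carrier R" using z Z_carrier by auto
  have xi: "x i \<in> carrier M" using x_carrier i by auto
  have c: "gp w a \<in> carrier R" "pe u p \<in> carrier R" "gp u' q \<in> carrier R" using a' p q by auto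
  have eq: "gp w a \<odot>\<^bsub>M\<^esub> ((z \<otimes> (pe u p \<otimes> gp u' q)) \<odot>\<^bsub>M\<^esub> x i)
    = z \<odot>\<^bsub>M\<^esub> ((gp w a \<otimes> pe u p \<otimes> gp u' q) \<odot>\<^bsub>M\<^esub> x i)"
  proof -
    have "gp w a \<otimes> (z \<otimes> (pe u p \<otimes> gp u' q)) = z \<otimes> (gp w a \<otimes> pe u p \<otimes> gp u' q)"
      using Z_central[OF z c(1)] zc c by (simp add: R.m_assoc[symmetric])
    then show ?thesis using zc c xi by (simp add: smult_assoc[symmetric])
  qed
  have "length p \<le> length a \<or> out_arcs E (rng E w a) = {}" using a'(2) N(1) by linarith
  from gp_pe[OF a'(1) p this] consider "gp w a \<otimes> pe u p = \<zero>" |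
    a'' where "w = u" "a = p @ a''" "gp w a \<otimes> pe u p = gp (rng E u p) a''" by blast
  then show ?thesis
  proof cases
    case 1
    then have "gp w a \<odot>\<^bsub>M\<^esub> ((z \<otimes> (pe u p \<otimes> gp u' q)) \<odot>\<^bsub>M\<^esub> x i) = \<zero>\<^bsub>M\<^esub>"
      unfolding eq using c zc xi by simp
    then show ?thesis using B.zsp_zero by simp
  next
    case 2
    have va: "vpath E (rng E u p) a''" using a'(1) 2 by (simp add: vpath_append[OF wf_digraph])
    have vqa: "vpath E u' (q @ a'')" using q va r by (simp add: vpath_append[OF wf_digraph])
    have "gp w a \<otimes> pe u p \<otimes> gp u' q = gp u' (q @ a'')"
      using 2 gp_append[OF vqa] r by simp
    then have eq2: "gp w a \<odot>\<^bsub>M\<^esub> ((z \<otimes> (pe u p \<otimes> gp u' q)) \<odot>\<^bsub>M\<^esub> x i) = z \<odot>\<^bsub>M\<^esub> (gp u' (q @ a'') \<odot>\<^bsub>M\<^esub> x i)"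
      using eq by simp
    have u': "u' \<in> verts E" using q vpath_rng by auto
    show ?thesis
    proof (cases "u' = v i")
      case False
      have "gp u' (q @ a'') \<odot>\<^bsub>M\<^esub> x i = (gp u' (q @ a'') \<otimes> vt u') \<odot>\<^bsub>M\<^esub> (vt (v i) \<odot>\<^bsub>M\<^esub> x i)"
        using gp_vt[OF vqa] e_x[OF i] by simp
      also have "\<dots> = (gp u' (q @ a'') \<otimes> (vt u' \<otimes> vt (v i))) \<odot>\<^bsub>M\<^esub> x i"
        using gp_closed[OF vqa] u' vI[OF i] xi by (simp add: smult_assoc[symmetric] R.m_assoc)
      also have "\<dots> = \<zero>\<^bsub>M\<^esub>" using vt_vt[OF u' vI[OF i]] False gp_closed[OF vqa] xi by simp
      finally show ?thesis unfolding eq2 using B.zsp_zero zc by simp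
    next
      case True
      have la: "int (length a) = int (length p) + int (length a'')" using 2 by simp
      \<comment> \<open>As |p| - |q| = k - \<open>d i\<close>, the length k + N of a turns into the
        length \<open>d i\<close> + N prescribed for the refinement of \<open>x i\<close>. If a is
        shorter, it ends in a sink, and so does q followed by a''.\<close>
      have "length (q @ a'') = nat (d i + N) \<or>
        length (q @ a'') < nat (d i + N) \<and> out_arcs E (rng E u' (q @ a'')) = {}"
        using a'(2) la l N r 2 by (auto simp: rng_append)
      then have mem: "(i, q @ a'') \<in> refI N"
        unfolding refI_def using i vqa True paths_iff[OF vI[OF i]] by auto
      have t: "reft (i, q @ a'') = (vt (rng E w a), - int (length a) + k)"
        unfolding reft_def using True r 2 la l by (simp add: rng_append)
      have "refx (i, q @ a'') = gp u' (q @ a'') \<odot>\<^bsub>M\<^esub> x i" unfolding refx_def using True by simp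
      then show ?thesis unfolding eq2 using B.zsp_smult[OF B.zsp_x[OF mem] z] t by simp
    qed
  qed
qed

text \<open>
  A homogeneous element becomes, after multiplication with long ghost paths, a scalar combination
  of a fine enough basis: this reduces the module theory of the algebra to linear algebra over \<open>Z\<close>.
\<close>

lemma eventually_refinement:
  assumes m: "m \<in> grade M k" and w: "w \<in> verts E"
  shows "\<forall>\<^sub>F N in at_top. \<forall>a\<in>paths E (nat (k + N)) w.
    gp w a \<odot>\<^bsub>M\<^esub> m \<in> zsp R Z M (refI N) refx reft (vt (rng E w a), - int (length a) + k)"
proof -
  \<comment> \<open>The elements with this property form a subgroup, because two eventual statements
    hold simultaneously for large N. It therefore suffices to treat monomials applied to the
    \<open>x i\<close>.\<close>
  define P where "P = (\<lambda>m. \<forall>\<^sub>F N in at_top. \<forall>a\<in>paths E (nat (k + N)) w.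
    gp w a \<odot>\<^bsub>M\<^esub> m \<in> zsp R Z M (refI N) refx reft (vt (rng E w a), - int (length a) + k))"
  have gc: "gp w a \<in> carrier R" if "a \<in> paths E n w" for a n using that paths_iff[OF w] by auto
  let ?H = "{m \<in> carrier M. P m}"
  have m1: "\<ominus> \<one> \<in> Z" using Z_neg[OF Z_one] .
  have neg: "\<ominus>\<^bsub>M\<^esub> m = (\<ominus> \<one>) \<odot>\<^bsub>M\<^esub> m" if "m \<in> carrier M" for m
    using that smult_neg_l[of "\<one>" m] smult_one by simp
  have H: "subgroup ?H (add_monoid M)"
  proof (rule add_subgroupI[OF M.abelian_group_axioms])
    have "gp w a \<odot>\<^bsub>M\<^esub> \<zero>\<^bsub>M\<^esub> \<in> zsp R Z M (refI N) refx reft (vt (rng E w a), - int (length a) + k)"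
      if "a \<in> paths E (nat (k + N)) w" for a N
      using zbased.zsp_zero[OF ref_zbased] gc[OF that] by simp
    then show "\<zero>\<^bsub>M\<^esub> \<in> ?H" unfolding P_def by simp
  next
    fix m n assume mn: "m \<in> ?H" "n \<in> ?H"
    then have "P m" "P n" by auto
    then have "P (m \<oplus>\<^bsub>M\<^esub> n)"
      unfolding P_def
    proof eventually_elim
      case (elim N)
      then show ?case using zbased.zsp_add[OF ref_zbased] mn gc by (auto simp: smult_r_distr)
    qed
    then show "m \<oplus>\<^bsub>M\<^esub> n \<in> ?H" using mn by simp
  next
    fix m assume m: "m \<in> ?H"
    then have "P m" by auto
    then have "P (\<ominus>\<^bsub>M\<^esub> m)"
      unfolding P_def
    proof eventually_elim
      case (elim N)
      show ?case
      proof
        fix a assume a: "a \<in> paths E (nat (k + N)) w"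
        have "gp w a \<odot>\<^bsub>M\<^esub> (\<ominus>\<^bsub>M\<^esub> m) = (\<ominus> \<one>) \<odot>\<^bsub>M\<^esub> (gp w a \<odot>\<^bsub>M\<^esub> m)"
          using m gc[OF a] Z_central[OF m1, of "gp w a"] Z_carrier[OF m1]
          by (simp add: neg smult_assoc[symmetric])
        then show "gp w a \<odot>\<^bsub>M\<^esub> (\<ominus>\<^bsub>M\<^esub> m) \<in> zsp R Z M (refI N) refx reft (vt (rng E w a), - int (length a) + k)"
          using zbased.zsp_smult[OF ref_zbased _ m1] elim a by simp
      qed
    qed
    then show "\<exists>y\<in>?H. y \<oplus>\<^bsub>M\<^esub> m = \<zero>\<^bsub>M\<^esub>" using m M.l_neg by (intro bexI[of _ "\<ominus>\<^bsub>M\<^esub> m"]) auto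
  qed auto
  have step: "r \<odot>\<^bsub>M\<^esub> x i \<in> ?H" if r: "r \<in> grade R (k - d i)" and i: "i \<in> I" for r i
  proof -
    let ?G = "{r \<in> carrier R. r \<odot>\<^bsub>M\<^esub> x i \<in> ?H}"
    note xi = x_carrier[OF i]
    have "grade R (k - d i) \<subseteq> ?G"
    proof (rule monomials_span)
      show "subgroup ?G (add_monoid R)"
      proof (rule add_subgroupI[OF R.abelian_group_axioms])
        fix a b assume "a \<in> ?G" "b \<in> ?G"
        then show "a \<oplus> b \<in> ?G"
          using add_subgroupD(3)[OF H M.abelian_group_axioms, of "a \<odot>\<^bsub>M\<^esub> x i" "b \<odot>\<^bsub>M\<^esub> x i"] xi
          by (simp add: smult_l_distr)
      next
        fix a assume a: "a \<in> ?G"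
        then have "(\<ominus> a) \<odot>\<^bsub>M\<^esub> x i \<in> ?H"
          using add_subgroupD(4)[OF H M.abelian_group_axioms, of "a \<odot>\<^bsub>M\<^esub> x i"] xi by (simp add: smult_neg_l)
        then show "\<exists>b\<in>?G. b \<oplus> a = \<zero>" using a by (intro bexI[of _ "\<ominus> a"]) (auto simp: R.l_neg)
      qed (use add_subgroupD(2)[OF H M.abelian_group_axioms] xi in auto)
    next
      fix z u p u' q assume z: "z \<in> Z" "vpath E u p" "vpath E u' q" "rng E u p = rng E u' q"
        "int (length p) - int (length q) = k - d i"
      have c: "z \<otimes> (pe u p \<otimes> gp u' q) \<in> carrier R" using z Z_carrier by simp
      \<comment> \<open>The required N are those for which k + N is at least the length of p and the
        prescribed length \<open>d i\<close> + N is nonnegative.\<close>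
      have "P ((z \<otimes> (pe u p \<otimes> gp u' q)) \<odot>\<^bsub>M\<^esub> x i)"
        unfolding P_def
        using eventually_ge_at_top[of "int (length p) - k"] eventually_ge_at_top[of "- d i"]
      proof eventually_elim
        case (elim N)
        then show ?case by (intro ballI monomial_refinement[OF z(1) i w z(2-5)]) auto
      qed
      then show "z \<otimes> (pe u p \<otimes> gp u' q) \<in> ?G" using c xi smult_closed by simp
    qed
    then show ?thesis using r by blast
  qed
  have mc: "m \<in> carrier M" using m mgrade_carrier by auto
  have "(\<Oplus>\<^bsub>M\<^esub>i\<in>I. co m i \<odot>\<^bsub>M\<^esub> x i) \<in> ?H"
    by (rule M.finsum_in_subgroup[OF H]) (use step co_grade[OF m] in blast)
  then have "P m" using lin_co[OF mc] unfolding lin_def by simp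
  then show ?thesis unfolding P_def .
qed

lemma refx_grade: "refx (i, a) = gp (v i) a \<odot>\<^bsub>M\<^esub> x i"
  unfolding refx_def by simp

end

section \<open>Vertex bases of projective modules, and cancellation\<close>

context lpa
begin

definition vtm :: "('v \<times> int) multiset \<Rightarrow> ('r \<times> int) multiset" where
  "vtm T = image_mset (\<lambda>t. (vt (fst t), snd t)) T"

definition vmset :: "('v \<times> int) multiset \<Rightarrow> bool" where
  "vmset T \<longleftrightarrow> (\<forall>t\<in>#T. fst t \<in> verts E)"

lemma vtm_add: "vtm (T + U) = vtm T + vtm U" unfolding vtm_def by simp

lemma vmset_add [simp]: "vmset (T + U) \<longleftrightarrow> vmset T \<and> vmset U" unfolding vmset_def by auto

lemma vtm_idem: "vmset T \<Longrightarrow> t \<in># vtm T \<Longrightarrow> gidem R (fst t)"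
  unfolding vtm_def vmset_def using vt_gidem by auto

lemma vbasedI:
  assumes "gmod R M" "gbasis R M I x (\<lambda>i. vt (v i)) d" "\<And>i. i \<in> I \<Longrightarrow> v i \<in> verts E"
  shows "vbased R Z E gm M I x v d"
  using assms by (intro vbased.intro based.intro based_axioms.intro vbased_axioms.intro lpa_axioms) auto

text \<open>P is a retract of a finite sum of shifted copies of R. After decomposing 1 into vertices
  and refining along long paths, the idempotent \<iota> \<pi> has a scalar matrix, and
  \<open>retract_gbasis\<close> applies.\<close>

lemma fgp_vertex_basis:
  assumes P: "gr_fgp R (P :: ('r, 'a) gmodule)"
  obtains T where "vmset T" "hbas R P (vtm T)"
proof -
  have gP: "gmod R P" using P gmod_of_graded unfolding gr_fgp_def by blast
  interpret P: gmod R P by (rule gP)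
  obtain J :: "'a set" and \<alpha> \<iota> \<pi> where i: "\<iota> \<in> gr_hom R P (gr_free R J \<alpha>)" and p: "\<pi> \<in> gr_hom R (gr_free R J \<alpha>) P"
    and ip: "\<And>y. y \<in> carrier P \<Longrightarrow> \<pi> (\<iota> y) = y"
    using P unfolding gr_fgp_def gr_projective_def by blast
  obtain S where S: "S \<subseteq> carrier P" "finite S"
    "\<And>y. y \<in> carrier P \<Longrightarrow> \<exists>c \<in> S \<rightarrow> carrier R. y = (\<Oplus>\<^bsub>P\<^esub>s \<in> S. c s \<odot>\<^bsub>P\<^esub> s)"
    using P unfolding gr_fgp_def fin_generated_def by blast
  have ic: "\<iota> y \<in> carrier (gr_free R J \<alpha>)" if "y \<in> carrier P" for y using gr_homD(1)[OF i] that by auto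
  \<comment> \<open>Only coordinates used by the finitely many generators occur in the image of
    \<iota>, which cuts the free module down to a finite one.\<close>
  define J0 where "J0 = (\<Union>s\<in>S. {j. \<iota> s j \<noteq> \<zero>})"
  have "finite {j. \<iota> s j \<noteq> \<zero>} \<and> {j. \<iota> s j \<noteq> \<zero>} \<subseteq> J" if "s \<in> S" for s
    using ic[of s] S(1) that unfolding gr_free_def by auto
  then have J0: "finite J0" "J0 \<subseteq> J" using S(2) unfolding J0_def by blast+
  have iR: "\<iota> y j \<in> carrier R" if "y \<in> carrier P" for y j using ic[OF that] unfolding gr_free_def by simp
  have iadd: "\<iota> (y \<oplus>\<^bsub>P\<^esub> y') j = \<iota> y j \<oplus> \<iota> y' j" if "y \<in> carrier P" "y' \<in> carrier P" for y y' j
    using gr_homD(2)[OF i that] unfolding gr_free_def by simp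
  have ismult: "\<iota> (a \<odot>\<^bsub>P\<^esub> y) j = a \<otimes> \<iota> y j" if "a \<in> carrier R" "y \<in> carrier P" for a y j
    using gr_homD(3)[OF i that] unfolding gr_free_def by simp
  have supp: "\<iota> y j = \<zero>" if y: "y \<in> carrier P" and j: "j \<notin> J0" for y j
  proof -
    obtain c where c: "c \<in> S \<rightarrow> carrier R" "y = (\<Oplus>\<^bsub>P\<^esub>s \<in> S. c s \<odot>\<^bsub>P\<^esub> s)" using S(3)[OF y] by blast
    have cs: "c s \<in> carrier R" "s \<in> carrier P" if "s \<in> S" for s using c(1) S(1) that by auto
    have "\<iota> y j = (\<Oplus>s\<in>S. \<iota> (c s \<odot>\<^bsub>P\<^esub> s) j)"
      unfolding c(2)
      by (rule finsum_hom[where h="\<lambda>y. \<iota> y j", OF P.M.abelian_group_axioms R.abelian_group_axioms])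
        (use iR iadd cs P.smult_closed in auto)
    also have "\<dots> = \<zero>"
      by (rule R.finsum_eq_zero) (use ismult cs j in \<open>auto simp: J0_def\<close>)
    finally show ?thesis .
  qed
  \<comment> \<open>The part of the free module over \<open>J0\<close>, as a standard module: the
    basis element at j has degree - \<alpha> j.\<close>
  define M where "M = std R J0 (\<lambda>_. \<one>) (\<lambda>j. - \<alpha> j)"
  have gM: "gmod R M" and bM: "gbasis R M J0 (\<lambda>i j. if j = i then \<one> else \<zero>) (\<lambda>_. \<one>) (\<lambda>j. - \<alpha> j)"
    unfolding M_def using gmod_std[OF J0(1)] gbasis_std[OF J0(1)] one_gidem by auto
  have Mc: "carrier M \<subseteq> carrier (gr_free R J \<alpha>)"
  proof
    fix f assume f: "f \<in> carrier M"
    have "{j. f j \<noteq> \<zero>} \<subseteq> J0" using f unfolding M_def by auto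
    moreover have "f j \<in> carrier R" for j using f unfolding M_def by (cases "j \<in> J0") auto
    ultimately show "f \<in> carrier (gr_free R J \<alpha>)"
      using finite_subset[OF _ J0(1)] J0(2) unfolding gr_free_def by auto
  qed
  have Mg: "grade M n \<subseteq> grade (gr_free R J \<alpha>) n" for n
  proof
    fix f assume f: "f \<in> grade M n"
    have sup: "{j. f j \<noteq> \<zero>} \<subseteq> J0" using f unfolding M_def by auto
    have "f j \<in> grade R (\<alpha> j + n)" for j
      using f unfolding M_def by (cases "j \<in> J0") (auto simp: add.commute)
    then show "f \<in> grade (gr_free R J \<alpha>) n"
      using sup finite_subset[OF sup J0(1)] J0(2) unfolding gr_free_def by auto
  qed
  have i': "\<iota> \<in> gr_hom R P M"
  proof (rule gr_homI)
    show "\<iota> y \<in> carrier M" if "y \<in> carrier P" for y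
      using iR[OF that] supp[OF that] unfolding M_def by auto
    show "\<iota> y \<in> grade M n" if y: "y \<in> grade P n" for y n
    proof -
      have "\<iota> y j \<in> grade R (\<alpha> j + n)" for j using gr_homD(4)[OF i y] unfolding gr_free_def by simp
      then have "\<iota> y j \<in> grade R (n - - \<alpha> j)" for j by (simp add: add.commute)
      then show ?thesis using supp[OF P.mgrade_carrier[OF y]] iR[OF P.mgrade_carrier[OF y]] unfolding M_def by auto
    qed
  qed (use iadd ismult in \<open>auto simp: M_def fun_eq_iff\<close>)
  have p': "\<pi> \<in> gr_hom R M P"
  proof (rule gr_homI)
    fix f assume "f \<in> carrier M"
    then show "\<pi> f \<in> carrier P" using Mc gr_homD(1)[OF p] by auto
  next
    fix f g assume "f \<in> carrier M" "g \<in> carrier M"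
    then show "\<pi> (f \<oplus>\<^bsub>M\<^esub> g) = \<pi> f \<oplus>\<^bsub>P\<^esub> \<pi> g"
      using Mc gr_homD(2)[OF p, of f g] by (auto simp: M_def gr_free_def)
  next
    fix a f assume "a \<in> carrier R" "f \<in> carrier M"
    then show "\<pi> (a \<odot>\<^bsub>M\<^esub> f) = a \<odot>\<^bsub>P\<^esub> \<pi> f"
      using Mc gr_homD(3)[OF p, of a f] by (auto simp: M_def gr_free_def)
  next
    fix n f assume "f \<in> grade M n"
    then show "\<pi> f \<in> grade P n" using Mg gr_homD(4)[OF p] by blast
  qed
  interpret M: gmod R M by (rule gM)
  \<comment> \<open>Each copy of R is split into the left ideals of the vertices.\<close>
  obtain x where bx: "gbasis R M (J0 \<times> verts E) x (\<lambda>q. vt (snd q)) (\<lambda>q. 0 + - \<alpha> (fst q))"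
    using M.gbasis_refine[OF bM, of "\<lambda>_. verts E" "\<lambda>_. vt" "\<lambda>_. vt" "\<lambda>_. vt" "\<lambda>_ _. 0"] idec_one by blast
  interpret B: vbased R Z E gm M "J0 \<times> verts E" x snd "\<lambda>q. 0 + - \<alpha> (fst q)"
    by (rule vbasedI[OF gM bx]) auto
  let ?I = "J0 \<times> verts E" and ?d = "\<lambda>q. 0 + - \<alpha> (fst q)"
  have "\<forall>\<^sub>F N in at_top. \<forall>q\<in>?I. \<forall>a\<in>paths E (nat (?d q + N)) (snd q).
      gp (snd q) a \<odot>\<^bsub>M\<^esub> \<iota> (\<pi> (x q)) \<in> zsp R Z M (B.refI N) B.refx B.reft (vt (rng E (snd q) a), - int (length a) + ?d q)"
  proof (rule eventually_ball_finite[OF B.fin], rule ballI)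
    fix q assume q: "q \<in> ?I"
    have "\<iota> (\<pi> (x q)) \<in> grade M (?d q)" using gr_homD(4)[OF i'] gr_homD(4)[OF p'] B.x_grade[OF q] by blast
    then show "\<forall>\<^sub>F N in at_top. \<forall>a\<in>paths E (nat (?d q + N)) (snd q).
      gp (snd q) a \<odot>\<^bsub>M\<^esub> \<iota> (\<pi> (x q)) \<in> zsp R Z M (B.refI N) B.refx B.reft (vt (rng E (snd q) a), - int (length a) + ?d q)"
      by (rule B.eventually_refinement) (use q in auto)
  qed
  \<comment> \<open>One N serves all of the finitely many basis elements.\<close>
  then obtain N where N: "\<And>q a. q \<in> ?I \<Longrightarrow> a \<in> paths E (nat (?d q + N)) (snd q) \<Longrightarrow>
      gp (snd q) a \<odot>\<^bsub>M\<^esub> \<iota> (\<pi> (x q)) \<in> zsp R Z M (B.refI N) B.refx B.reft (vt (rng E (snd q) a), - int (length a) + ?d q)"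
    using eventually_happens[OF _] trivial_limit_at_top_linorder by (metis (mono_tags, lifting) eventually_at_top_linorder order_refl)
  interpret Z: zbased R Z M "B.refI N" B.refx B.reft by (rule B.ref_zbased)
  have sp: "\<iota> (\<pi> (B.refx k)) \<in> zsp R Z M (B.refI N) B.refx B.reft (B.reft k)" if k: "k \<in> B.refI N" for k
  proof -
    obtain q a where qa: "k = (q, a)" "q \<in> ?I" "a \<in> paths E (nat (?d q + N)) (snd q)"
      using k unfolding B.refI_def by auto
    have "snd q \<in> verts E" using qa by auto
    then have gc: "gp (snd q) a \<in> carrier R" using qa(3) paths_iff by auto
    have xq: "x q \<in> carrier M" using B.x_carrier qa(2) by auto
    have pq: "\<pi> (x q) \<in> carrier P" using gr_homD(1)[OF p'] xq by auto
    \<comment> \<open>Refined basis elements are multiples of \<open>x q\<close> by ghost paths, and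
      \<iota> \<pi> is R-linear, so the statement about \<open>x q\<close> covers them.\<close>
    have "\<iota> (\<pi> (B.refx k)) = gp (snd q) a \<odot>\<^bsub>M\<^esub> \<iota> (\<pi> (x q))"
      unfolding qa(1) B.refx_grade using gr_homD(3)[OF p' gc xq] gr_homD(3)[OF i' gc pq] by simp
    then show ?thesis using N[OF qa(2,3)] unfolding B.reft_def qa(1) by simp
  qed
  obtain S' where S': "S' \<subseteq> B.refI N" "gbasis R P S' (\<lambda>i. \<pi> (B.refx i)) (\<lambda>i. fst (B.reft i)) (\<lambda>i. snd (B.reft i))"
    by (rule Z.retract_gbasis[OF gP i' p' ip sp])
  let ?t = "\<lambda>p. (rng E (snd (fst p)) (snd p), - int (length (snd p)) + ?d (fst p))"
  have rv: "fst (?t k) \<in> verts E" if k: "k \<in> S'" for k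
  proof -
    have "k \<in> B.refI N" using S'(1) k by auto
    then have "snd k \<in> paths E (nat (?d (fst k) + N)) (snd (fst k))" "snd (fst k) \<in> verts E"
      unfolding B.refI_def by auto
    then show ?thesis using paths_iff vpath_rng by auto
  qed
  have finS': "finite S'" using S'(2) gbasis_typeD by blast
  show ?thesis
  proof (rule that[of "image_mset ?t (mset_set S')"])
    show "vmset (image_mset ?t (mset_set S'))" unfolding vmset_def using rv finS' by auto
    show "hbas R P (vtm (image_mset ?t (mset_set S')))"
      using P.hbasI[OF S'(2)] unfolding vtm_def B.reft_def by (simp add: image_mset.compositionality comp_def)
  qed
qed

text \<open>The number of elements of type \<theta> in the level N refinement of a basis of vertex
  type T (\<open>card_ref\<close>). Being defined from T without a module, it is visibly
  additive.\<close>

definition cnt :: "int \<Rightarrow> 'r \<times> int \<Rightarrow> ('v \<times> int) multiset \<Rightarrow> nat" where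
  "cnt N \<theta> T = (\<Sum>t\<in>#T. card {p \<in> paths E (nat (snd t + N)) (fst t). (vt (rng E (fst t) p), - int (length p) + snd t) = \<theta>})"

lemma cnt_add: "cnt N \<theta> (T + U) = cnt N \<theta> T + cnt N \<theta> U"
  unfolding cnt_def by simp

lemma hbas_vbased:
  assumes M: "gmod R M" and T: "vmset T" "hbas R M (vtm T)"
  obtains I :: "nat set" and x v d where "vbased R Z E gm M I x v d" "T = image_mset (\<lambda>i. (v i, d i)) (mset_set I)"
proof -
  interpret M: gmod R M by fact
  obtain I :: "nat set" and t where I: "finite I" "T = image_mset t (mset_set I)" using finite_mset_index by blast
  have "vtm T = image_mset (\<lambda>i. (vt (fst (t i)), snd (t i))) (mset_set I)"
    unfolding I(2) vtm_def by (simp add: image_mset.compositionality comp_def)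
  then obtain x where "gbasis R M I x (\<lambda>i. vt (fst (t i))) (\<lambda>i. snd (t i))"
    by (rule M.hbasE[OF T(2) I(1)])
  then have "vbased R Z E gm M I x (\<lambda>i. fst (t i)) (\<lambda>i. snd (t i))"
    by (rule vbasedI[OF M]) (use T(1) I in \<open>auto simp: vmset_def\<close>)
  then show ?thesis by (rule that) (use I in simp)
qed

end

lemma (in vbased) card_ref:
  "card {p \<in> refI N. reft p = \<theta>} = cnt N \<theta> (image_mset (\<lambda>i. (v i, d i)) (mset_set I))"
proof -
  have "{p \<in> refI N. reft p = \<theta>} = Sigma I (\<lambda>i. {p \<in> paths E (nat (d i + N)) (v i). (vt (rng E (v i) p), - int (length p) + d i) = \<theta>})"
    unfolding refI_def reft_def by auto
  then have "card {p \<in> refI N. reft p = \<theta>} = (\<Sum>i\<in>I. card {p \<in> paths E (nat (d i + N)) (v i). (vt (rng E (v i) p), - int (length p) + d i) = \<theta>})"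
    using fin finite_paths by (simp add: card_SigmaI)
  also have "\<dots> = cnt N \<theta> (image_mset (\<lambda>i. (v i, d i)) (mset_set I))"
    unfolding cnt_def by (simp add: image_mset.compositionality comp_def sum_unfold_sum_mset)
  finally show ?thesis .
qed

text \<open>A basis element is fixed by its idempotent, so it is zero if the idempotent is. Such
  types are removed because \<open>card_type_le\<close> compares only the numbers of nonzero
  types.\<close>

lemma (in gmod) hbas_drop_zero:
  assumes "hbas R M T" shows "hbas R M (filter_mset (\<lambda>t. fst t \<noteq> \<zero>\<^bsub>R\<^esub>) T)"
proof -
  obtain I :: "nat set" and x e d where b: "gbasis R M I x e d" and T: "T = image_mset (\<lambda>i. (e i, d i)) (mset_set I)"
    using assms unfolding hbas_def by blast
  interpret B: based R M I x e d by (intro based.intro based_axioms.intro gmod_axioms b)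
  let ?I = "{i \<in> I. e i \<noteq> \<zero>\<^bsub>R\<^esub>}"
  have x0: "x i = \<zero>\<^bsub>M\<^esub>" if "i \<in> I - ?I" for i
    using that B.e_x[of i] B.x_carrier[of i] by simp
  have sum: "(\<Oplus>\<^bsub>M\<^esub>i\<in>I. r i \<odot>\<^bsub>M\<^esub> x i) = (\<Oplus>\<^bsub>M\<^esub>i\<in>?I. r i \<odot>\<^bsub>M\<^esub> x i)" if r: "r \<in> I \<rightarrow> carrier R" for r
  proof (rule M.add.finprod_mono_neutral_cong_right[OF B.fin])
    show "\<And>i. i \<in> I - ?I \<Longrightarrow> r i \<odot>\<^bsub>M\<^esub> x i = \<zero>\<^bsub>M\<^esub>" using x0 r by (simp add: Pi_iff)
    show "(\<lambda>i. r i \<odot>\<^bsub>M\<^esub> x i) \<in> I \<rightarrow> carrier M" using r B.x_carrier smult_closed by auto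
  qed auto
  have "gbasis R M ?I x e d"
  proof (rule gbasisI)
    fix n m assume m: "m \<in> grade M n"
    then have mc: "m \<in> carrier M" using mgrade_carrier by auto
    have "m = (\<Oplus>\<^bsub>M\<^esub>i\<in>?I. B.co m i \<odot>\<^bsub>M\<^esub> x i)"
      using sum[of "B.co m"] B.lin_co[OF mc] B.co_closed[OF mc] unfolding B.lin_def by auto
    then show "\<exists>r. (\<forall>i\<in>?I. r i \<in> grade R (n - d i)) \<and> m = (\<Oplus>\<^bsub>M\<^esub>i\<in>?I. r i \<odot>\<^bsub>M\<^esub> x i)"
      using B.co_grade[OF m] by (intro exI[of _ "B.co m"]) auto
  next
    fix r i assume r: "r \<in> ?I \<rightarrow> carrier R" "(\<Oplus>\<^bsub>M\<^esub>i\<in>?I. r i \<odot>\<^bsub>M\<^esub> x i) = \<zero>\<^bsub>M\<^esub>" "i \<in> ?I"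
    let ?s = "\<lambda>i. if i \<in> ?I then r i else \<zero>\<^bsub>R\<^esub>"
    have s: "?s \<in> I \<rightarrow> carrier R" using r(1) by auto
    have "(\<Oplus>\<^bsub>M\<^esub>i\<in>?I. ?s i \<odot>\<^bsub>M\<^esub> x i) = (\<Oplus>\<^bsub>M\<^esub>i\<in>?I. r i \<odot>\<^bsub>M\<^esub> x i)"
      by (rule M.finsum_cong'[OF refl]) (use r(1) B.x_carrier smult_closed in auto)
    then have "(\<Oplus>\<^bsub>M\<^esub>i\<in>I. ?s i \<odot>\<^bsub>M\<^esub> x i) = \<zero>\<^bsub>M\<^esub>" using sum[OF s] r(2) by simp
    then have "?s i \<otimes>\<^bsub>R\<^esub> e i = \<zero>\<^bsub>R\<^esub>" using gbasis_indepD[OF b s] r(3) by blast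
    then show "r i \<otimes>\<^bsub>R\<^esub> e i = \<zero>\<^bsub>R\<^esub>" using r(3) by simp
  qed (use B.fin B.idem B.x_grade B.e_x in auto)
  moreover have "filter_mset (\<lambda>t. fst t \<noteq> \<zero>\<^bsub>R\<^esub>) T = image_mset (\<lambda>i. (e i, d i)) (mset_set ?I)"
    unfolding T filter_mset_image_mset using filter_mset_mset_set[OF B.fin] by (simp add: comp_def)
  ultimately show ?thesis using hbasI by simp
qed

context lpa
begin

text \<open>For large N each of the two refined bases lies in the scalar spans of the other, type by
  type, so the dimension count applies in both directions.\<close>

lemma Cls_eq_cnt:
  assumes T: "vmset T" and U: "vmset U" and M: "gmod R M" "hbas R M (vtm T)" "hbas R M (vtm U)"
  obtains N where "\<And>\<theta>. fst \<theta> \<noteq> \<zero> \<Longrightarrow> cnt N \<theta> T = cnt N \<theta> U"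
proof -
  obtain I :: "nat set" and x v d where B: "vbased R Z E gm M I x v d" and TI: "T = image_mset (\<lambda>i. (v i, d i)) (mset_set I)"
    using hbas_vbased[OF M(1) T M(2)] by blast
  obtain J :: "nat set" and y w k where C: "vbased R Z E gm M J y w k" and UJ: "U = image_mset (\<lambda>i. (w i, k i)) (mset_set J)"
    using hbas_vbased[OF M(1) U M(3)] by blast
  interpret B: vbased R Z E gm M I x v d by (rule B)
  interpret C: vbased R Z E gm M J y w k by (rule C)
  have 1: "\<forall>\<^sub>F N in at_top. \<forall>j\<in>J. \<forall>a\<in>paths E (nat (k j + N)) (w j).
      gp (w j) a \<odot>\<^bsub>M\<^esub> y j \<in> zsp R Z M (B.refI N) B.refx B.reft (vt (rng E (w j) a), - int (length a) + k j)"
    by (rule eventually_ball_finite[OF C.fin]) (use B.eventually_refinement C.x_grade C.vI in blast)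
  have 2: "\<forall>\<^sub>F N in at_top. \<forall>j\<in>I. \<forall>a\<in>paths E (nat (d j + N)) (v j).
      gp (v j) a \<odot>\<^bsub>M\<^esub> x j \<in> zsp R Z M (C.refI N) C.refx C.reft (vt (rng E (v j) a), - int (length a) + d j)"
    by (rule eventually_ball_finite[OF B.fin]) (use C.eventually_refinement B.x_grade B.vI in blast)
  obtain N where N: "\<forall>j\<in>J. \<forall>a\<in>paths E (nat (k j + N)) (w j).
      gp (w j) a \<odot>\<^bsub>M\<^esub> y j \<in> zsp R Z M (B.refI N) B.refx B.reft (vt (rng E (w j) a), - int (length a) + k j)"
    "\<forall>j\<in>I. \<forall>a\<in>paths E (nat (d j + N)) (v j).
      gp (v j) a \<odot>\<^bsub>M\<^esub> x j \<in> zsp R Z M (C.refI N) C.refx C.reft (vt (rng E (v j) a), - int (length a) + d j)"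
    using eventually_happens[OF eventually_conj[OF 1 2]] by auto
  interpret ZB: zbased R Z M "B.refI N" B.refx B.reft by (rule B.ref_zbased)
  interpret ZC: zbased R Z M "C.refI N" C.refx C.reft by (rule C.ref_zbased)
  have a: "C.refx p \<in> zsp R Z M (B.refI N) B.refx B.reft (C.reft p)" if "p \<in> C.refI N" for p
    using that N(1) unfolding C.refI_def by (auto simp: C.refx_def C.reft_def)
  have b: "B.refx p \<in> zsp R Z M (C.refI N) C.refx C.reft (B.reft p)" if "p \<in> B.refI N" for p
    using that N(2) unfolding B.refI_def by (auto simp: B.refx_def B.reft_def)
  show ?thesis
  proof (rule that)
    fix \<theta> :: "'r \<times> int" assume nz: "fst \<theta> \<noteq> \<zero>"
    show "cnt N \<theta> T = cnt N \<theta> U"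
      unfolding TI UJ B.card_ref[symmetric] C.card_ref[symmetric]
      using ZB.card_type_le[OF C.ref_gbasis a nz] ZC.card_type_le[OF B.ref_gbasis b nz] by (rule order_antisym[OF _ _, rotated])
  qed
qed

text \<open>The type multiset of a refined basis depends on the numbers \<open>cnt\<close> alone;
  modules with equal counts at one level therefore have bases of equal type.\<close>

lemma hbas_cnt:
  assumes T: "vmset T" and M: "gmod R M" "hbas R M (vtm T)"
  obtains W where "hbas R M W" "\<And>\<theta>. count W \<theta> = (if fst \<theta> = \<zero> then 0 else cnt N \<theta> T)"
proof -
  obtain I :: "nat set" and x v d where B: "vbased R Z E gm M I x v d" and TI: "T = image_mset (\<lambda>i. (v i, d i)) (mset_set I)"
    using hbas_vbased[OF M(1) T M(2)] by blast
  interpret B: vbased R Z E gm M I x v d by (rule B)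
  let ?W = "image_mset B.reft (mset_set (B.refI N))"
  have "finite (B.refI N)" using B.ref_gbasis gbasis_typeD by blast
  then have "count ?W \<theta> = cnt N \<theta> T" for \<theta>
    by (simp add: count_image_mset_set B.card_ref TI)
  moreover have "hbas R M ?W" using B.hbasI[OF B.ref_gbasis] by simp
  ultimately show ?thesis using that[OF B.hbas_drop_zero] by simp
qed

text \<open>At a common level N the counts of T + W and U + W agree, and as natural numbers they
  allow the count of W to be cancelled. Representatives for T and U then have bases of one and the
  same type.\<close>

theorem Cls_cancel:
  assumes T: "vmset T" and U: "vmset U" and W: "vmset W" and ab: "(a :: 'r) \<noteq> b"
    and eq: "Cls R (vtm (T + W)) = Cls R (vtm (U + W))"
  shows "Cls R (vtm T) = Cls R (vtm U)"
proof -
  have ne: "Cls R (vtm X) \<noteq> {}" if "vmset X" for X using Cls_nonempty[OF ab vtm_idem[OF that]] by blast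
  obtain M where M: "M \<in> Cls R (vtm (T + W))" using ne[of "T + W"] T W by auto
  then have "gmod R M" "hbas R M (vtm (T + W))" "hbas R M (vtm (U + W))" using Cls_gmod eq by blast+
  then obtain N where N: "\<And>\<theta>. fst \<theta> \<noteq> \<zero> \<Longrightarrow> cnt N \<theta> (T + W) = cnt N \<theta> (U + W)"
    using Cls_eq_cnt[of "T + W" "U + W" M] T U W by auto
  obtain P where "P \<in> Cls R (vtm T)" using ne[OF T] by blast
  then have P: "gmod R P" "hbas R P (vtm T)" using Cls_gmod by blast+
  obtain Q where "Q \<in> Cls R (vtm U)" using ne[OF U] by blast
  then have Q: "gmod R Q" "hbas R Q (vtm U)" using Cls_gmod by blast+
  obtain X where X: "hbas R P X" "\<And>\<theta>. count X \<theta> = (if fst \<theta> = \<zero> then 0 else cnt N \<theta> T)"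
    using hbas_cnt[OF T P] by blast
  obtain Y where Y: "hbas R Q Y" "\<And>\<theta>. count Y \<theta> = (if fst \<theta> = \<zero> then 0 else cnt N \<theta> U)"
    using hbas_cnt[OF U Q] by blast
  have "X = Y" by (rule multiset_eqI) (use X(2) Y(2) N cnt_add in auto)
  then have "gr_class R P = gr_class R Q" using gr_class_eq_Cls[OF P(1) X(1)] gr_class_eq_Cls[OF Q(1) Y(1)] by simp
  then show ?thesis using gr_class_eq_Cls[OF P] gr_class_eq_Cls[OF Q] by simp
qed

end

text \<open>Identifies the subgroups of the factor group behind the tensor product with those of its
  additive monoid, two records with the same operations.\<close>

lemma subgroup_record_cong:
  assumes "carrier G = carrier H" "monoid.mult G = monoid.mult H" "\<one>\<^bsub>G\<^esub> = \<one>\<^bsub>H\<^esub>"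
  shows "subgroup K G \<longleftrightarrow> subgroup K H"
proof -
  have "inv\<^bsub>G\<^esub> x = inv\<^bsub>H\<^esub> x" for x unfolding m_inv_def using assms by simp
  then show ?thesis unfolding subgroup_def using assms by simp
qed

section \<open>Base change and graded K-theory\<close>

locale tensor = gmod R P + S: grring S
  for R :: "('k, 'r, 'm) gmodule_scheme" (structure) and S :: "('k, 's, 'n) gmodule_scheme"
    and P :: "('r, 'a) gmodule" and \<psi> :: "'r \<Rightarrow> 's" +
  assumes hom: "\<psi> \<in> ring_hom R S" and graded: "a \<in> grade R n \<Longrightarrow> \<psi> a \<in> grade S n"
begin

abbreviation "G \<equiv> free_Abelian_group (carrier S \<times> carrier P)"
abbreviation "N \<equiv> generate G (tensor_relators R S \<psi> P)"
abbreviation "T \<equiv> gr_tensor R S \<psi> P"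

definition q :: "('s \<times> 'a \<Rightarrow>\<^sub>0 int) \<Rightarrow> ('s \<times> 'a \<Rightarrow>\<^sub>0 int) set" where "q x = N #>\<^bsub>G\<^esub> x"
definition h :: "'s \<Rightarrow> ('s \<times> 'a \<Rightarrow>\<^sub>0 int) \<Rightarrow> ('s \<times> 'a \<Rightarrow>\<^sub>0 int)" where
  "h t = frag_extend (\<lambda>(s, p). frag_of (t \<otimes>\<^bsub>S\<^esub> s, p))"
definition tens :: "'s \<Rightarrow> 'a \<Rightarrow> ('s \<times> 'a \<Rightarrow>\<^sub>0 int) set" where "tens s p = q (frag_of (s, p))"

lemma psi_closed [simp]: "a \<in> carrier R \<Longrightarrow> \<psi> a \<in> carrier S"
  and psi_add: "a \<in> carrier R \<Longrightarrow> b \<in> carrier R \<Longrightarrow> \<psi> (a \<oplus> b) = \<psi> a \<oplus>\<^bsub>S\<^esub> \<psi> b"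
  and psi_mult: "a \<in> carrier R \<Longrightarrow> b \<in> carrier R \<Longrightarrow> \<psi> (a \<otimes> b) = \<psi> a \<otimes>\<^bsub>S\<^esub> \<psi> b"
  using hom by (auto simp: ring_hom_def)

lemma psi_zero: "\<psi> \<zero> = \<zero>\<^bsub>S\<^esub>"
  using psi_add[of \<zero> \<zero>] by (metis S.add.l_cancel_one' psi_closed R.zero_closed R.r_zero)

lemma T_simps: "carrier T = q ` carrier G" "\<zero>\<^bsub>T\<^esub> = N" "add T = monoid.mult (G Mod N)"
  "t \<odot>\<^bsub>T\<^esub> X = (\<Union>x\<in>X. q (h t x))"
  "grade T n = generate (G Mod N) {tens s p | s p i j. s \<in> grade S i \<and> p \<in> grade P j \<and> i + j = n}"
  unfolding gr_tensor_def Let_def q_def h_def tens_def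
  by (simp_all add: carrier_FactGroup del: carrier_free_Abelian_group_iff)

lemma comm_G: "comm_group G" by (rule abelian_free_Abelian_group)

lemma minus_G: "x \<in> carrier G \<Longrightarrow> y \<in> carrier G \<Longrightarrow> x - y \<in> carrier G"
  using keys_diff[of x y] by auto

lemma frag_G: "s \<in> carrier S \<Longrightarrow> p \<in> carrier P \<Longrightarrow> frag_of (s, p) \<in> carrier G"
  by simp

lemma relators_G: "tensor_relators R S \<psi> P \<subseteq> carrier G"
proof
  fix x assume "x \<in> tensor_relators R S \<psi> P"
  then consider s s' p where "x = frag_of (s \<oplus>\<^bsub>S\<^esub> s', p) - frag_of (s, p) - frag_of (s', p)"
      "s \<in> carrier S" "s' \<in> carrier S" "p \<in> carrier P"
    | s p p' where "x = frag_of (s, p \<oplus>\<^bsub>P\<^esub> p') - frag_of (s, p) - frag_of (s, p')"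
      "s \<in> carrier S" "p \<in> carrier P" "p' \<in> carrier P"
    | s r p where "x = frag_of (s \<otimes>\<^bsub>S\<^esub> \<psi> r, p) - frag_of (s, r \<odot>\<^bsub>P\<^esub> p)"
      "s \<in> carrier S" "r \<in> carrier R" "p \<in> carrier P"
    unfolding tensor_relators_def by blast
  then show "x \<in> carrier G"
  proof cases
    case 1 then show ?thesis by (simp only: 1(1)) (intro minus_G frag_G, auto)
  next
    case 2 then show ?thesis by (simp only: 2(1)) (intro minus_G frag_G, auto)
  next
    case 3 then show ?thesis by (simp only: 3(1)) (intro minus_G frag_G, auto simp: smult_closed)
  qed
qed

lemma subgroup_N: "subgroup N G"
  by (rule group.generate_is_subgroup[OF _ relators_G]) simp

lemma normal_N: "N \<lhd> G"
  by (rule comm_group.subgroup_imp_normal[OF comm_G subgroup_N])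

lemma comm_quot: "comm_group (G Mod N)"
  by (rule comm_group.abelian_FactGroup[OF comm_G subgroup_N])

lemma q_add: "x \<in> carrier G \<Longrightarrow> y \<in> carrier G \<Longrightarrow> q (x + y) = q x \<oplus>\<^bsub>T\<^esub> q y"
  using normal.r_coset_hom_Mod[OF normal_N] unfolding q_def T_simps hom_def by auto

lemma q_zero: "x \<in> N \<Longrightarrow> q x = \<zero>\<^bsub>T\<^esub>"
  using group.coset_join2[OF _ _ subgroup_N] subgroup.subset[OF subgroup_N] unfolding q_def T_simps by auto

lemma abelian_T: "abelian_group T"
proof -
  interpret Q: comm_group "G Mod N" by (rule comm_quot)
  have c: "carrier T = carrier (G Mod N)" unfolding T_simps(1) carrier_FactGroup q_def ..
  show ?thesis
  proof (rule abelian_groupI)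
    fix X assume "X \<in> carrier T"
    then show "\<exists>Y\<in>carrier T. Y \<oplus>\<^bsub>T\<^esub> X = \<zero>\<^bsub>T\<^esub>"
      using Q.l_inv_ex[of X] unfolding c T_simps(2,3) by simp
  qed (use Q.m_closed Q.one_closed Q.m_assoc Q.m_comm Q.l_one in \<open>auto simp: c T_simps(2,3) simp del: mult_FactGroup\<close>)
qed

sublocale T: abelian_group T by (rule abelian_T)

lemma q_closed [simp]: "x \<in> carrier G \<Longrightarrow> q x \<in> carrier T"
  unfolding T_simps by blast

lemma q_eqI: assumes "x \<in> carrier G" "y \<in> carrier G" "x - y \<in> N" shows "q x = q y"
proof -
  have "x - y \<in> carrier G" using subgroup.subset[OF subgroup_N] assms(3) by blast
  then have "q ((x - y) + y) = q (x - y) \<oplus>\<^bsub>T\<^esub> q y" using assms(2) by (rule q_add)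
  then show ?thesis using q_zero[OF assms(3)] q_closed[OF assms(2)] by simp
qed

lemma tens_closed [simp]: "s \<in> carrier S \<Longrightarrow> p \<in> carrier P \<Longrightarrow> tens s p \<in> carrier T"
  unfolding tens_def by (rule q_closed) simp

lemma plus_G: "x \<in> carrier G \<Longrightarrow> y \<in> carrier G \<Longrightarrow> x + y \<in> carrier G"
  using keys_add[of x y] by auto

lemma relator_N: "x \<in> tensor_relators R S \<psi> P \<Longrightarrow> x \<in> N"
  by (rule generate.incl)

lemma tens_add_l:
  assumes "s \<in> carrier S" "s' \<in> carrier S" "p \<in> carrier P"
  shows "tens (s \<oplus>\<^bsub>S\<^esub> s') p = tens s p \<oplus>\<^bsub>T\<^esub> tens s' p"
proof -
  have "frag_of (s \<oplus>\<^bsub>S\<^esub> s', p) - frag_of (s, p) - frag_of (s', p) \<in> tensor_relators R S \<psi> P"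
    using assms unfolding tensor_relators_def by blast
  then have "q (frag_of (s \<oplus>\<^bsub>S\<^esub> s', p)) = q (frag_of (s, p) + frag_of (s', p))"
    using assms relator_N by (intro q_eqI plus_G frag_G) (auto simp: diff_diff_eq)
  then show ?thesis unfolding tens_def using q_add assms by simp
qed

lemma tens_add_r:
  assumes "s \<in> carrier S" "p \<in> carrier P" "p' \<in> carrier P"
  shows "tens s (p \<oplus>\<^bsub>P\<^esub> p') = tens s p \<oplus>\<^bsub>T\<^esub> tens s p'"
proof -
  have "frag_of (s, p \<oplus>\<^bsub>P\<^esub> p') - frag_of (s, p) - frag_of (s, p') \<in> tensor_relators R S \<psi> P"
    using assms unfolding tensor_relators_def by blast
  then have "q (frag_of (s, p \<oplus>\<^bsub>P\<^esub> p')) = q (frag_of (s, p) + frag_of (s, p'))"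
    using assms relator_N by (intro q_eqI plus_G frag_G) (auto simp: diff_diff_eq)
  then show ?thesis unfolding tens_def using q_add assms by simp
qed

lemma tens_balanced:
  assumes "s \<in> carrier S" "r \<in> carrier R" "p \<in> carrier P"
  shows "tens (s \<otimes>\<^bsub>S\<^esub> \<psi> r) p = tens s (r \<odot>\<^bsub>P\<^esub> p)"
proof -
  have "frag_of (s \<otimes>\<^bsub>S\<^esub> \<psi> r, p) - frag_of (s, r \<odot>\<^bsub>P\<^esub> p) \<in> tensor_relators R S \<psi> P"
    using assms unfolding tensor_relators_def by blast
  then show ?thesis unfolding tens_def using assms relator_N by (intro q_eqI frag_G) (auto simp: smult_closed)
qed

lemma h_G: "t \<in> carrier S \<Longrightarrow> x \<in> carrier G \<Longrightarrow> h t x \<in> carrier G"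
proof -
  assume t: "t \<in> carrier S" and x: "x \<in> carrier G"
  have "Poly_Mapping.keys x \<subseteq> carrier S \<times> carrier P" using x by simp
  then show ?thesis
  proof (induction rule: frag_induction)
    case zero then show ?case by (simp add: h_def)
  next
    case (one a) then show ?case using t by (cases a) (simp add: h_def)
  next
    case (diff a b)
    then show ?case using minus_G[of "h t a" "h t b"] by (simp add: h_def frag_extend_diff)
  qed
qed

lemma h_add: "h t (x + y) = h t x + h t y" and h_diff: "h t (x - y) = h t x - h t y"
  unfolding h_def by (simp_all add: frag_extend_add frag_extend_diff)

text \<open>Multiplication by t on the first factor maps relators to relators, hence preserves the
  subgroup they generate. This makes the scalar action on cosets well defined.\<close>

lemma h_N: assumes t: "t \<in> carrier S" and x: "x \<in> N" shows "h t x \<in> N"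
proof -
  interpret G: comm_group G by (rule comm_G)
  have "N \<subseteq> {x \<in> carrier G. h t x \<in> N}"
  proof (rule G.generate_subgroup_incl)
    show "subgroup {x \<in> carrier G. h t x \<in> N} G"
    proof (rule G.subgroupI)
      have "h t 0 \<in> N" using subgroup.one_closed[OF subgroup_N] by (simp add: h_def)
      then show "{x \<in> carrier G. h t x \<in> N} \<noteq> {}" by (auto intro!: exI[of _ 0])
    next
      fix a assume a: "a \<in> {x \<in> carrier G. h t x \<in> N}"
      then have aG: "a \<in> carrier G" by blast
      have "h t (- a) = - h t a" using h_diff[of t 0 a] by (simp add: h_def)
      moreover have "- h t a \<in> N" using subgroup.m_inv_closed[OF subgroup_N, of "h t a"] a h_G[OF t aG] by simp
      ultimately show "inv\<^bsub>G\<^esub> a \<in> {x \<in> carrier G. h t x \<in> N}" using a by simp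
    next
      fix a b assume ab: "a \<in> {x \<in> carrier G. h t x \<in> N}" "b \<in> {x \<in> carrier G. h t x \<in> N}"
      then have "a + b \<in> carrier G" by (intro plus_G) auto
      then show "a \<otimes>\<^bsub>G\<^esub> b \<in> {x \<in> carrier G. h t x \<in> N}"
        using ab subgroup.m_closed[OF subgroup_N, of "h t a" "h t b"] by (simp add: h_add)
    qed auto
    have "h t x \<in> tensor_relators R S \<psi> P" if "x \<in> tensor_relators R S \<psi> P" for x
    proof -
      from that consider s s' p where "x = frag_of (s \<oplus>\<^bsub>S\<^esub> s', p) - frag_of (s, p) - frag_of (s', p)"
          "s \<in> carrier S" "s' \<in> carrier S" "p \<in> carrier P"
        | s p p' where "x = frag_of (s, p \<oplus>\<^bsub>P\<^esub> p') - frag_of (s, p) - frag_of (s, p')"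
          "s \<in> carrier S" "p \<in> carrier P" "p' \<in> carrier P"
        | s r p where "x = frag_of (s \<otimes>\<^bsub>S\<^esub> \<psi> r, p) - frag_of (s, r \<odot>\<^bsub>P\<^esub> p)"
          "s \<in> carrier S" "r \<in> carrier R" "p \<in> carrier P"
        unfolding tensor_relators_def by blast
      then show ?thesis
      proof cases
        case 1
        have "h t x = frag_of (t \<otimes>\<^bsub>S\<^esub> s \<oplus>\<^bsub>S\<^esub> t \<otimes>\<^bsub>S\<^esub> s', p) - frag_of (t \<otimes>\<^bsub>S\<^esub> s, p) - frag_of (t \<otimes>\<^bsub>S\<^esub> s', p)"
          unfolding 1(1) using 1 t by (simp add: h_diff) (simp add: h_def S.r_distr)
        moreover have "t \<otimes>\<^bsub>S\<^esub> s \<in> carrier S" "t \<otimes>\<^bsub>S\<^esub> s' \<in> carrier S" using 1 t by auto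
        ultimately show ?thesis using 1 unfolding tensor_relators_def by blast
      next
        case 2
        have "h t x = frag_of (t \<otimes>\<^bsub>S\<^esub> s, p \<oplus>\<^bsub>P\<^esub> p') - frag_of (t \<otimes>\<^bsub>S\<^esub> s, p) - frag_of (t \<otimes>\<^bsub>S\<^esub> s, p')"
          unfolding 2(1) by (simp add: h_diff) (simp add: h_def)
        moreover have "t \<otimes>\<^bsub>S\<^esub> s \<in> carrier S" using 2 t by auto
        ultimately show ?thesis using 2 unfolding tensor_relators_def by blast
      next
        case 3
        have "h t x = frag_of (t \<otimes>\<^bsub>S\<^esub> s \<otimes>\<^bsub>S\<^esub> \<psi> r, p) - frag_of (t \<otimes>\<^bsub>S\<^esub> s, r \<odot>\<^bsub>P\<^esub> p)"
          unfolding 3(1) using 3 t by (simp add: h_diff) (simp add: h_def S.m_assoc)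
        moreover have "t \<otimes>\<^bsub>S\<^esub> s \<in> carrier S" using 3 t by auto
        ultimately show ?thesis using 3 unfolding tensor_relators_def by blast
      qed
    qed
    then show "tensor_relators R S \<psi> P \<subseteq> {x \<in> carrier G. h t x \<in> N}"
      using relators_G relator_N by blast
  qed
  then show ?thesis using x by blast
qed

text \<open>In \<open>gr_tensor\<close> the action is a union over the representatives of a coset;
  by \<open>h_N\<close> they all contribute the same coset.\<close>

lemma smult_q: assumes t: "t \<in> carrier S" and x: "x \<in> carrier G" shows "t \<odot>\<^bsub>T\<^esub> q x = q (h t x)"
proof -
  interpret G: comm_group G by (rule comm_G)
  have "q (h t y) = q (h t x)" if y: "y \<in> q x" for y
  proof -
    have yG: "y \<in> carrier G"
      using subgroup.elemrcos_carrier[OF subgroup_N G.is_group x] y unfolding q_def by blast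
    have "y \<otimes>\<^bsub>G\<^esub> inv\<^bsub>G\<^esub> x \<in> N"
      using subgroup.rcos_module_imp[OF subgroup_N G.is_group x] y unfolding q_def by blast
    then have "y - x \<in> N" using x by simp
    then have "h t y - h t x \<in> N" using h_N[OF t] h_diff by metis
    then show ?thesis by (rule q_eqI[OF h_G[OF t yG] h_G[OF t x]])
  qed
  moreover have "x \<in> q x" unfolding q_def by (rule G.rcos_self[OF x subgroup_N])
  ultimately show ?thesis unfolding T_simps by blast
qed

lemma smult_tens: "t \<in> carrier S \<Longrightarrow> s \<in> carrier S \<Longrightarrow> p \<in> carrier P \<Longrightarrow> t \<odot>\<^bsub>T\<^esub> tens s p = tens (t \<otimes>\<^bsub>S\<^esub> s) p"
  unfolding tens_def by (subst smult_q) (auto simp: h_def)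

lemma T_cases: assumes "X \<in> carrier T" obtains x where "x \<in> carrier G" "X = q x"
  using assms unfolding T_simps by blast

lemma tsmult_closed: "t \<in> carrier S \<Longrightarrow> X \<in> carrier T \<Longrightarrow> t \<odot>\<^bsub>T\<^esub> X \<in> carrier T"
  by (erule T_cases) (simp add: smult_q h_G del: carrier_free_Abelian_group_iff)

lemma tsmult_r_distr:
  assumes "t \<in> carrier S" "X \<in> carrier T" "Y \<in> carrier T"
  shows "t \<odot>\<^bsub>T\<^esub> (X \<oplus>\<^bsub>T\<^esub> Y) = t \<odot>\<^bsub>T\<^esub> X \<oplus>\<^bsub>T\<^esub> t \<odot>\<^bsub>T\<^esub> Y"
proof -
  obtain x where x: "x \<in> carrier G" "X = q x" by (rule T_cases[OF assms(2)])
  obtain y where y: "y \<in> carrier G" "Y = q y" by (rule T_cases[OF assms(3)])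
  show ?thesis
    unfolding x(2) y(2) q_add[OF x(1) y(1), symmetric] smult_q[OF assms(1) plus_G[OF x(1) y(1)]]
      smult_q[OF assms(1) x(1)] smult_q[OF assms(1) y(1)] h_add
    by (rule q_add[OF h_G[OF assms(1) x(1)] h_G[OF assms(1) y(1)]])
qed

lemma tensor_induct:
  assumes H: "subgroup H (add_monoid T)" and "\<And>s p. s \<in> carrier S \<Longrightarrow> p \<in> carrier P \<Longrightarrow> tens s p \<in> H"
  shows "carrier T \<subseteq> H"
proof
  fix X assume "X \<in> carrier T"
  then obtain x where x: "x \<in> carrier G" "X = q x" by (rule T_cases)
  note HD = add_subgroupD[OF H abelian_T]
  have "Poly_Mapping.keys x \<subseteq> carrier S \<times> carrier P" using x by simp
  then have "x \<in> carrier G \<and> q x \<in> H"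
  proof (induction rule: frag_induction)
    case zero
    then show ?case using q_zero[of 0] subgroup.one_closed[OF subgroup_N] HD(2) by simp
  next
    case (one a) then show ?case using assms(2) unfolding tens_def by (cases a) auto
  next
    case (diff a b)
    then have G: "a \<in> carrier G" "b \<in> carrier G" "a - b \<in> carrier G" using minus_G by blast+
    have "q ((a - b) + b) = q (a - b) \<oplus>\<^bsub>T\<^esub> q b" by (rule q_add[OF G(3,2)])
    then have "q (a - b) = q a \<oplus>\<^bsub>T\<^esub> (\<ominus>\<^bsub>T\<^esub> q b)"
      using q_closed[OF G(3)] q_closed[OF G(2)] by (simp add: T.a_assoc T.r_neg)
    then show ?case using G(3) diff HD(3)[OF _ HD(4)] by simp
  qed
  then show "X \<in> H" using x(2) by simp
qed

lemma additive_subgroup_eq: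
  assumes "\<And>X. X \<in> carrier T \<Longrightarrow> f X \<in> carrier T" "\<And>X. X \<in> carrier T \<Longrightarrow> g X \<in> carrier T"
    and f: "\<And>X Y. X \<in> carrier T \<Longrightarrow> Y \<in> carrier T \<Longrightarrow> f (X \<oplus>\<^bsub>T\<^esub> Y) = f X \<oplus>\<^bsub>T\<^esub> f Y"
    and g: "\<And>X Y. X \<in> carrier T \<Longrightarrow> Y \<in> carrier T \<Longrightarrow> g (X \<oplus>\<^bsub>T\<^esub> Y) = g X \<oplus>\<^bsub>T\<^esub> g Y"
    and t: "\<And>s p. s \<in> carrier S \<Longrightarrow> p \<in> carrier P \<Longrightarrow> f (tens s p) = g (tens s p)"
    and X: "X \<in> carrier T"
  shows "f X = g X"
proof -
  have z: "k \<zero>\<^bsub>T\<^esub> = \<zero>\<^bsub>T\<^esub>" if "\<And>X. X \<in> carrier T \<Longrightarrow> k X \<in> carrier T"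
    "\<And>X Y. X \<in> carrier T \<Longrightarrow> Y \<in> carrier T \<Longrightarrow> k (X \<oplus>\<^bsub>T\<^esub> Y) = k X \<oplus>\<^bsub>T\<^esub> k Y" for k
    using that(2)[of "\<zero>\<^bsub>T\<^esub>" "\<zero>\<^bsub>T\<^esub>"] that(1)[of "\<zero>\<^bsub>T\<^esub>"] by simp
  have "subgroup {X \<in> carrier T. f X = g X} (add_monoid T)"
  proof (rule add_subgroupI[OF abelian_T])
    show "\<zero>\<^bsub>T\<^esub> \<in> {X \<in> carrier T. f X = g X}" using z[of f] z[of g] assms by simp
  next
    fix X assume X: "X \<in> {X \<in> carrier T. f X = g X}"
    have k: "k (\<ominus>\<^bsub>T\<^esub> X) = \<ominus>\<^bsub>T\<^esub> k X" if "\<And>X. X \<in> carrier T \<Longrightarrow> k X \<in> carrier T"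
      "\<And>X Y. X \<in> carrier T \<Longrightarrow> Y \<in> carrier T \<Longrightarrow> k (X \<oplus>\<^bsub>T\<^esub> Y) = k X \<oplus>\<^bsub>T\<^esub> k Y" for k
    proof -
      have "k (\<ominus>\<^bsub>T\<^esub> X) \<oplus>\<^bsub>T\<^esub> k X = \<zero>\<^bsub>T\<^esub>" using that(2)[of "\<ominus>\<^bsub>T\<^esub> X" X] X z[OF that] by (simp add: T.l_neg)
      then show ?thesis using T.minus_equality that(1) X by simp
    qed
    show "\<exists>Y\<in>{X \<in> carrier T. f X = g X}. Y \<oplus>\<^bsub>T\<^esub> X = \<zero>\<^bsub>T\<^esub>"
      using X k[of f] k[of g] assms by (intro bexI[of _ "\<ominus>\<^bsub>T\<^esub> X"]) (auto simp: T.l_neg)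
  qed (use f g in auto)
  then show ?thesis using tensor_induct[of "{X \<in> carrier T. f X = g X}"] t X by auto
qed

lemma tens_smult_one: assumes "X \<in> carrier T" shows "\<one>\<^bsub>S\<^esub> \<odot>\<^bsub>T\<^esub> X = X"
  by (rule additive_subgroup_eq[where g="\<lambda>X. X", OF _ _ _ _ _ assms])
    (auto simp: tsmult_closed tsmult_r_distr smult_tens)

lemma tens_smult_assoc:
  assumes "a \<in> carrier S" "b \<in> carrier S" "X \<in> carrier T"
  shows "(a \<otimes>\<^bsub>S\<^esub> b) \<odot>\<^bsub>T\<^esub> X = a \<odot>\<^bsub>T\<^esub> (b \<odot>\<^bsub>T\<^esub> X)"
  by (rule additive_subgroup_eq[where g="\<lambda>X. a \<odot>\<^bsub>T\<^esub> (b \<odot>\<^bsub>T\<^esub> X)", OF _ _ _ _ _ assms(3)])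
    (use assms in \<open>auto simp: tsmult_closed tsmult_r_distr smult_tens S.m_assoc\<close>)

lemma tens_smult_l_distr:
  assumes "a \<in> carrier S" "b \<in> carrier S" "X \<in> carrier T"
  shows "(a \<oplus>\<^bsub>S\<^esub> b) \<odot>\<^bsub>T\<^esub> X = a \<odot>\<^bsub>T\<^esub> X \<oplus>\<^bsub>T\<^esub> b \<odot>\<^bsub>T\<^esub> X"
  by (rule additive_subgroup_eq[where g="\<lambda>X. a \<odot>\<^bsub>T\<^esub> X \<oplus>\<^bsub>T\<^esub> b \<odot>\<^bsub>T\<^esub> X", OF _ _ _ _ _ assms(3)])
    (use assms in \<open>auto simp: tsmult_closed tsmult_r_distr smult_tens S.l_distr tens_add_l T.a_ac\<close>)

lemma gens_T: "{tens s p | s p i j. s \<in> grade S i \<and> p \<in> grade P j \<and> i + j = n} \<subseteq> carrier (G Mod N)"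
proof -
  have "carrier T = carrier (G Mod N)" unfolding T_simps(1) carrier_FactGroup q_def ..
  then show ?thesis using S.grade_carrier mgrade_carrier by auto
qed

lemma subgroup_T: "subgroup H (G Mod N) \<longleftrightarrow> subgroup H (add_monoid T)"
proof (rule subgroup_record_cong)
  show "carrier (G Mod N) = carrier (add_monoid T)" unfolding carrier_FactGroup q_def[symmetric] by (simp add: T_simps(1))
qed (simp_all add: T_simps(2,3))

lemma tgrade_subgroup: "subgroup (grade T n) (add_monoid T)"
  unfolding subgroup_T[symmetric] T_simps(5)
  by (rule group.generate_is_subgroup[OF comm_group.axioms(2)[OF comm_quot] gens_T])

lemma tgrade_le:
  assumes "subgroup H (add_monoid T)"
    and "\<And>s p i j. s \<in> grade S i \<Longrightarrow> p \<in> grade P j \<Longrightarrow> i + j = n \<Longrightarrow> tens s p \<in> H"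
  shows "grade T n \<subseteq> H"
  unfolding T_simps(5)
  by (rule group.generate_subgroup_incl[OF comm_group.axioms(2)[OF comm_quot]])
    (use assms subgroup_T in auto)

lemma tens_grade: "s \<in> grade S i \<Longrightarrow> p \<in> grade P j \<Longrightarrow> i + j = n \<Longrightarrow> tens s p \<in> grade T n"
  unfolding T_simps(5) by (rule generate.incl) blast

lemma preimage_subgroup:
  assumes H: "subgroup H (add_monoid T)" and "abelian_group A"
    and f: "\<And>a. a \<in> carrier A \<Longrightarrow> f a \<in> carrier T"
    and add: "\<And>a b. a \<in> carrier A \<Longrightarrow> b \<in> carrier A \<Longrightarrow> f (a \<oplus>\<^bsub>A\<^esub> b) = f a \<oplus>\<^bsub>T\<^esub> f b"
  shows "subgroup {a \<in> carrier A. f a \<in> H} (add_monoid A)"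
proof -
  interpret A: abelian_group A by fact
  note HD = add_subgroupD[OF H abelian_T]
  have f0: "f \<zero>\<^bsub>A\<^esub> = \<zero>\<^bsub>T\<^esub>" using add[of "\<zero>\<^bsub>A\<^esub>" "\<zero>\<^bsub>A\<^esub>"] f[of "\<zero>\<^bsub>A\<^esub>"] by simp
  show ?thesis
  proof (rule add_subgroupI[OF assms(2)])
    fix a assume a: "a \<in> {a \<in> carrier A. f a \<in> H}"
    have "f (\<ominus>\<^bsub>A\<^esub> a) \<oplus>\<^bsub>T\<^esub> f a = \<zero>\<^bsub>T\<^esub>" using add[of "\<ominus>\<^bsub>A\<^esub> a" a] a f0 by (simp add: A.l_neg)
    then have "f (\<ominus>\<^bsub>A\<^esub> a) = \<ominus>\<^bsub>T\<^esub> f a" using T.minus_equality[of "f (\<ominus>\<^bsub>A\<^esub> a)" "f a"] a f by simp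
    then show "\<exists>b\<in>{a \<in> carrier A. f a \<in> H}. b \<oplus>\<^bsub>A\<^esub> a = \<zero>\<^bsub>A\<^esub>"
      using a HD(4) by (intro bexI[of _ "\<ominus>\<^bsub>A\<^esub> a"]) (auto simp: A.l_neg)
  qed (use f0 HD add in auto)
qed

lemma gmod_tensor: "gmod S T"
proof (rule gmodI[OF S.grring_axioms abelian_T])
  fix a m X n assume a: "a \<in> grade S m" and X: "X \<in> grade T n"
  have ac: "a \<in> carrier S" using a S.grade_carrier by auto
  have "grade T n \<subseteq> {X \<in> carrier T. a \<odot>\<^bsub>T\<^esub> X \<in> grade T (m + n)}"
  proof (rule tgrade_le)
    show "subgroup {X \<in> carrier T. a \<odot>\<^bsub>T\<^esub> X \<in> grade T (m + n)} (add_monoid T)"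
      by (rule preimage_subgroup[OF tgrade_subgroup abelian_T]) (use ac tsmult_closed tsmult_r_distr in auto)
    fix s p i j assume sp: "s \<in> grade S i" "p \<in> grade P j" "i + j = n"
    then have "tens (a \<otimes>\<^bsub>S\<^esub> s) p \<in> grade T (m + n)"
      by (intro tens_grade[OF S.grade_mult[OF a sp(1)] sp(2)]) simp
    then show "tens s p \<in> {X \<in> carrier T. a \<odot>\<^bsub>T\<^esub> X \<in> grade T (m + n)}"
      using sp ac S.grade_carrier mgrade_carrier by (simp add: smult_tens)
  qed
  then show "a \<odot>\<^bsub>T\<^esub> X \<in> grade T (m + n)" using X by blast
next
  fix H assume H: "subgroup H (add_monoid T)" "\<And>n. grade T n \<subseteq> H"
  \<comment> \<open>Tensors of two homogeneous elements lie in H by assumption. For homogeneous s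
    the second factor is made arbitrary; afterwards the first factor is treated through its
    components.\<close>
  have 1: "tens s p \<in> H" if s: "s \<in> grade S i" and p: "p \<in> carrier P" for s i p
  proof -
    have sc: "s \<in> carrier S" using s S.grade_carrier by auto
    have "carrier P \<subseteq> {p \<in> carrier P. tens s p \<in> H}"
    proof (rule homgen)
      show "subgroup {p \<in> carrier P. tens s p \<in> H} (add_monoid P)"
        by (rule preimage_subgroup[OF H(1)]) (use sc tens_add_r M.abelian_group_axioms in auto)
      show "grade P n \<subseteq> {p \<in> carrier P. tens s p \<in> H}" for n
        using tens_grade[OF s _ refl] H(2) mgrade_carrier by blast
    qed
    then show ?thesis using p by blast
  qed
  have 2: "tens s p \<in> H" if s: "s \<in> carrier S" and p: "p \<in> carrier P" for s p
  proof -
    have sub: "subgroup {s \<in> carrier S. tens s p \<in> H} (add_monoid S)"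
      by (rule preimage_subgroup[OF H(1)]) (use p tens_add_l S.abelian_group_axioms in auto)
    have "(\<Oplus>\<^bsub>S\<^esub>n\<in>{n. S.proj n s \<noteq> \<zero>\<^bsub>S\<^esub>}. S.proj n s) \<in> {s \<in> carrier S. tens s p \<in> H}"
      by (rule S.finsum_in_subgroup[OF sub]) (use 1[OF S.proj_props(1)[OF s] p] S.proj_closed[OF s] in auto)
    then show ?thesis using S.proj_props(3)[OF s] by simp
  qed
  show "carrier T \<subseteq> H" by (rule tensor_induct[OF H(1) 2])
qed (use tsmult_closed tsmult_r_distr tens_smult_one tens_smult_assoc tens_smult_l_distr tgrade_subgroup in auto)

end

text \<open>A balanced biadditive map extends to the free abelian group and kills the relators. It
  serves to construct functionals on the tensor product, which prove independence there.\<close>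

lemma (in tensor) tensor_universal:
  assumes "abelian_group A" and f: "\<And>s p. s \<in> carrier S \<Longrightarrow> p \<in> carrier P \<Longrightarrow> f s p \<in> carrier A"
    and l: "\<And>s s' p. s \<in> carrier S \<Longrightarrow> s' \<in> carrier S \<Longrightarrow> p \<in> carrier P \<Longrightarrow> f (s \<oplus>\<^bsub>S\<^esub> s') p = f s p \<oplus>\<^bsub>A\<^esub> f s' p"
    and r: "\<And>s p p'. s \<in> carrier S \<Longrightarrow> p \<in> carrier P \<Longrightarrow> p' \<in> carrier P \<Longrightarrow> f s (p \<oplus>\<^bsub>P\<^esub> p') = f s p \<oplus>\<^bsub>A\<^esub> f s p'"
    and b: "\<And>s r p. s \<in> carrier S \<Longrightarrow> r \<in> carrier R \<Longrightarrow> p \<in> carrier P \<Longrightarrow> f (s \<otimes>\<^bsub>S\<^esub> \<psi> r) p = f s (r \<odot>\<^bsub>P\<^esub> p)"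
  obtains g where "\<And>X. X \<in> carrier T \<Longrightarrow> g X \<in> carrier A"
    "\<And>X Y. X \<in> carrier T \<Longrightarrow> Y \<in> carrier T \<Longrightarrow> g (X \<oplus>\<^bsub>T\<^esub> Y) = g X \<oplus>\<^bsub>A\<^esub> g Y"
    "\<And>s p. s \<in> carrier S \<Longrightarrow> p \<in> carrier P \<Longrightarrow> g (tens s p) = f s p"
proof -
  interpret A: abelian_group A by fact
  interpret G: comm_group G by (rule comm_G)
  obtain k where k: "k \<in> Group.hom G (add_monoid A)"
    and kf: "\<And>x. x \<in> carrier S \<times> carrier P \<Longrightarrow> k (frag_of x) = (\<lambda>(s, p). f s p) x"
  proof (rule comm_group.free_Abelian_group_universal[OF A.a_comm_group, of "\<lambda>(s, p). f s p" "carrier S \<times> carrier P"])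
    show "(\<lambda>(s, p). f s p) ` (carrier S \<times> carrier P) \<subseteq> carrier (add_monoid A)" using f by auto
    fix k assume "k \<in> Group.hom G (add_monoid A)" "\<And>x. x \<in> carrier S \<times> carrier P \<Longrightarrow> k (frag_of x) = (\<lambda>(s, p). f s p) x"
    then show thesis using that by blast
  qed
  interpret k: group_hom G "add_monoid A" k
    using k A.a_group G.is_group by (simp add: group_hom_def group_hom_axioms_def)
  have kc: "k x \<in> carrier A" if "x \<in> carrier G" for x using k.hom_closed[OF that] by simp
  have kadd: "k (x + y) = k x \<oplus>\<^bsub>A\<^esub> k y" if "x \<in> carrier G" "y \<in> carrier G" for x y using k.hom_mult[OF that] by simp
  have kd: "k x = k y \<Longrightarrow> k (x - y) = \<zero>\<^bsub>A\<^esub>" if xy: "x \<in> carrier G" "y \<in> carrier G" for x y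
  proof -
    assume e: "k x = k y"
    have "k ((x - y) + y) = k (x - y) \<oplus>\<^bsub>A\<^esub> k y" by (rule kadd[OF minus_G[OF xy] xy(2)])
    then show ?thesis using e kc[OF minus_G[OF xy]] kc[OF xy(2)] by simp
  qed
  have kS: "k (frag_of (s, p)) = f s p" if "s \<in> carrier S" "p \<in> carrier P" for s p using kf that by auto
  have "k x = \<zero>\<^bsub>A\<^esub>" if "x \<in> tensor_relators R S \<psi> P" for x
  proof -
    from that consider s s' p where "x = frag_of (s \<oplus>\<^bsub>S\<^esub> s', p) - (frag_of (s, p) + frag_of (s', p))"
        "s \<in> carrier S" "s' \<in> carrier S" "p \<in> carrier P"
      | s p p' where "x = frag_of (s, p \<oplus>\<^bsub>P\<^esub> p') - (frag_of (s, p) + frag_of (s, p'))"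
        "s \<in> carrier S" "p \<in> carrier P" "p' \<in> carrier P"
      | s r p where "x = frag_of (s \<otimes>\<^bsub>S\<^esub> \<psi> r, p) - frag_of (s, r \<odot>\<^bsub>P\<^esub> p)"
        "s \<in> carrier S" "r \<in> carrier R" "p \<in> carrier P"
      unfolding tensor_relators_def diff_diff_eq by blast
    then show ?thesis
    proof cases
      case 1
      then show ?thesis using kadd[OF frag_G frag_G] kS l
        by (simp only: 1(1)) (rule kd[OF frag_G plus_G[OF frag_G frag_G]], auto)
    next
      case 2
      then show ?thesis using kadd[OF frag_G frag_G] kS r
        by (simp only: 2(1)) (rule kd[OF frag_G plus_G[OF frag_G frag_G]], auto)
    next
      case 3
      then show ?thesis using kS b smult_closed
        by (simp only: 3(1)) (rule kd[OF frag_G frag_G], auto)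
    qed
  qed
  then have "tensor_relators R S \<psi> P \<subseteq> kernel G (add_monoid A) k"
    using relators_G unfolding kernel_def by (auto simp del: carrier_free_Abelian_group_iff)
  then have "N \<subseteq> kernel G (add_monoid A) k"
    by (rule G.generate_subgroup_incl[OF _ k.subgroup_kernel])
  then obtain g where g: "g \<in> Group.hom (G Mod N) (add_monoid A)" "\<And>x. x \<in> carrier G \<Longrightarrow> g (N #>\<^bsub>G\<^esub> x) = k x"
    using k.FactGroup_universal_kernel[OF normal_N] by blast
  have gq: "g (q x) = k x" if "x \<in> carrier G" for x using g(2)[OF that] unfolding q_def .
  show ?thesis
  proof (rule that)
    fix X assume "X \<in> carrier T"
    then obtain x where x: "x \<in> carrier G" "X = q x" by (rule T_cases)
    then show "g X \<in> carrier A" using gq kc by simp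
    fix Y assume "Y \<in> carrier T"
    then obtain y where y: "y \<in> carrier G" "Y = q y" by (rule T_cases)
    show "g (X \<oplus>\<^bsub>T\<^esub> Y) = g X \<oplus>\<^bsub>A\<^esub> g Y"
      unfolding x(2) y(2) q_add[OF x(1) y(1), symmetric] gq[OF plus_G[OF x(1) y(1)]] gq[OF x(1)] gq[OF y(1)]
      by (rule kadd[OF x(1) y(1)])
  next
    fix s p assume "s \<in> carrier S" "p \<in> carrier P"
    then show "g (tens s p) = f s p" unfolding tens_def using gq[OF frag_G] kS by simp
  qed
qed

text \<open>Balancing moves the coordinates p_i of p to the left factor: s \<otimes> p is the
  combination of the 1 \<otimes> \<open>x i\<close> with coefficients s \<psi>(p_i).\<close>

lemma (in tensor) gbasis_tensor:
  assumes b: "gbasis R P I x e d"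
  shows "gbasis S T I (\<lambda>i. tens \<one>\<^bsub>S\<^esub> (x i)) (\<lambda>i. \<psi> (e i)) d"
proof -
  interpret B: based R P I x e d by (intro based.intro based_axioms.intro gmod_axioms b)
  interpret T: gmod S T by (rule gmod_tensor)
  let ?x = "\<lambda>i. tens \<one>\<^bsub>S\<^esub> (x i)"
  have xT: "?x i \<in> carrier T" if "i \<in> I" for i using B.x_carrier that by simp
  have tx: "t \<odot>\<^bsub>T\<^esub> ?x i = tens t (x i)" if "i \<in> I" "t \<in> carrier S" for t i
    using that B.x_carrier smult_tens[of t "\<one>\<^bsub>S\<^esub>" "x i"] by simp
  have expand: "tens s p = (\<Oplus>\<^bsub>T\<^esub>i\<in>I. (s \<otimes>\<^bsub>S\<^esub> \<psi> (B.co p i)) \<odot>\<^bsub>T\<^esub> ?x i)" if s: "s \<in> carrier S" and p: "p \<in> carrier P" for s p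
  proof -
    have cx: "B.co p i \<odot>\<^bsub>P\<^esub> x i \<in> carrier P" if "i \<in> I" for i using B.co_closed[OF p that] B.x_carrier[OF that] smult_closed by blast
    have "tens s p = tens s (\<Oplus>\<^bsub>P\<^esub>i\<in>I. B.co p i \<odot>\<^bsub>P\<^esub> x i)" using B.lin_co[OF p] unfolding B.lin_def by simp
    also have "\<dots> = (\<Oplus>\<^bsub>T\<^esub>i\<in>I. tens s (B.co p i \<odot>\<^bsub>P\<^esub> x i))"
      by (rule finsum_hom[OF M.abelian_group_axioms abelian_T]) (use s cx tens_add_r in auto)
    also have "\<dots> = (\<Oplus>\<^bsub>T\<^esub>i\<in>I. (s \<otimes>\<^bsub>S\<^esub> \<psi> (B.co p i)) \<odot>\<^bsub>T\<^esub> ?x i)"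
      by (rule T.finsum_cong'[OF refl])
        (use s B.co_closed[OF p] B.x_carrier in \<open>auto simp: tx tens_balanced[symmetric]\<close>)
    finally show ?thesis .
  qed
  show ?thesis
  proof (rule gbasisI[OF B.fin])
    fix i assume i: "i \<in> I"
    show "gidem S (\<psi> (e i))"
      unfolding gidem_def using graded[OF gidemD(2)[OF B.idem[OF i]]] psi_mult[symmetric] B.e_carrier[OF i] B.e_idem[OF i] by simp
    show "?x i \<in> grade T (d i)" by (rule tens_grade[OF S.grade_one B.x_grade[OF i]]) simp
    show "\<psi> (e i) \<odot>\<^bsub>T\<^esub> ?x i = ?x i"
      using tx[OF i, of "\<psi> (e i)"] tens_balanced[of "\<one>\<^bsub>S\<^esub>" "e i" "x i"] B.e_carrier[OF i] B.x_carrier[OF i] B.e_x[OF i] by simp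
  next
    fix n m assume m: "m \<in> grade T n"
    let ?H = "{m \<in> carrier T. \<exists>r. (\<forall>i\<in>I. r i \<in> grade S (n - d i)) \<and> m = (\<Oplus>\<^bsub>T\<^esub>i\<in>I. r i \<odot>\<^bsub>T\<^esub> ?x i)}"
    have rT: "(\<lambda>i. r i \<odot>\<^bsub>T\<^esub> ?x i) \<in> I \<rightarrow> carrier T" if "\<forall>i\<in>I. r i \<in> grade S (n - d i)" for r
      using that xT S.grade_carrier T.smult_closed by blast
    have radd: "(\<Oplus>\<^bsub>T\<^esub>i\<in>I. (r i \<oplus>\<^bsub>S\<^esub> s i) \<odot>\<^bsub>T\<^esub> ?x i) = (\<Oplus>\<^bsub>T\<^esub>i\<in>I. r i \<odot>\<^bsub>T\<^esub> ?x i) \<oplus>\<^bsub>T\<^esub> (\<Oplus>\<^bsub>T\<^esub>i\<in>I. s i \<odot>\<^bsub>T\<^esub> ?x i)"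
      if r: "\<forall>i\<in>I. r i \<in> grade S (n - d i)" and s: "\<forall>i\<in>I. s i \<in> grade S (n - d i)" for r s
    proof -
      have "(\<Oplus>\<^bsub>T\<^esub>i\<in>I. (r i \<oplus>\<^bsub>S\<^esub> s i) \<odot>\<^bsub>T\<^esub> ?x i) = (\<Oplus>\<^bsub>T\<^esub>i\<in>I. r i \<odot>\<^bsub>T\<^esub> ?x i \<oplus>\<^bsub>T\<^esub> s i \<odot>\<^bsub>T\<^esub> ?x i)"
      proof (rule T.finsum_cong'[OF refl])
        fix i assume i: "i \<in> I"
        have "r i \<in> carrier S" "s i \<in> carrier S" using r s i S.grade_carrier by blast+
        then show "(r i \<oplus>\<^bsub>S\<^esub> s i) \<odot>\<^bsub>T\<^esub> ?x i = r i \<odot>\<^bsub>T\<^esub> ?x i \<oplus>\<^bsub>T\<^esub> s i \<odot>\<^bsub>T\<^esub> ?x i"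
          using xT[OF i] by (rule T.smult_l_distr)
      qed (use rT[OF r] rT[OF s] in \<open>auto simp: Pi_iff\<close>)
      then show ?thesis using T.finsum_addf[OF rT[OF r] rT[OF s]] by simp
    qed
    have "grade T n \<subseteq> ?H"
    proof (rule tgrade_le)
      show "subgroup ?H (add_monoid T)"
      proof (rule add_subgroupI[OF abelian_T])
        have "(\<Oplus>\<^bsub>T\<^esub>i\<in>I. \<zero>\<^bsub>S\<^esub> \<odot>\<^bsub>T\<^esub> ?x i) = \<zero>\<^bsub>T\<^esub>" by (rule T.finsum_eq_zero) (use xT in simp)
        then show "\<zero>\<^bsub>T\<^esub> \<in> ?H" by (auto intro!: exI[of _ "\<lambda>_. \<zero>\<^bsub>S\<^esub>"])
      next
        fix a b assume "a \<in> ?H" "b \<in> ?H"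
        then obtain r s where rs: "\<forall>i\<in>I. r i \<in> grade S (n - d i)" "a = (\<Oplus>\<^bsub>T\<^esub>i\<in>I. r i \<odot>\<^bsub>T\<^esub> ?x i)"
          "\<forall>i\<in>I. s i \<in> grade S (n - d i)" "b = (\<Oplus>\<^bsub>T\<^esub>i\<in>I. s i \<odot>\<^bsub>T\<^esub> ?x i)" and ab: "a \<in> carrier T" "b \<in> carrier T" by blast
        have "a \<oplus>\<^bsub>T\<^esub> b = (\<Oplus>\<^bsub>T\<^esub>i\<in>I. (r i \<oplus>\<^bsub>S\<^esub> s i) \<odot>\<^bsub>T\<^esub> ?x i)" using radd[OF rs(1,3)] rs(2,4) by simp
        moreover have "\<forall>i\<in>I. r i \<oplus>\<^bsub>S\<^esub> s i \<in> grade S (n - d i)" using rs(1,3) S.grade_add by blast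
        ultimately show "a \<oplus>\<^bsub>T\<^esub> b \<in> ?H"
          by (intro CollectI conjI exI[of _ "\<lambda>i. r i \<oplus>\<^bsub>S\<^esub> s i"] T.a_closed[OF ab]) auto
      next
        fix a assume a: "a \<in> ?H"
        then obtain r where r: "\<forall>i\<in>I. r i \<in> grade S (n - d i)" "a = (\<Oplus>\<^bsub>T\<^esub>i\<in>I. r i \<odot>\<^bsub>T\<^esub> ?x i)" by blast
        let ?s = "\<lambda>i. \<ominus>\<^bsub>S\<^esub> r i"
        have s: "\<forall>i\<in>I. ?s i \<in> grade S (n - d i)" using r(1) S.grade_neg by blast
        have "(\<Oplus>\<^bsub>T\<^esub>i\<in>I. ?s i \<odot>\<^bsub>T\<^esub> ?x i) \<oplus>\<^bsub>T\<^esub> a = (\<Oplus>\<^bsub>T\<^esub>i\<in>I. (?s i \<oplus>\<^bsub>S\<^esub> r i) \<odot>\<^bsub>T\<^esub> ?x i)"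
          unfolding r(2) by (rule radd[OF s r(1), symmetric])
        also have "\<dots> = \<zero>\<^bsub>T\<^esub>"
        proof (rule T.finsum_eq_zero)
          fix j assume j: "j \<in> I"
          have "r j \<in> carrier S" using r(1) j S.grade_carrier by blast
          then show "(\<ominus>\<^bsub>S\<^esub> r j \<oplus>\<^bsub>S\<^esub> r j) \<odot>\<^bsub>T\<^esub> ?x j = \<zero>\<^bsub>T\<^esub>" using xT[OF j] by (simp add: S.l_neg)
        qed
        finally show "\<exists>y\<in>?H. y \<oplus>\<^bsub>T\<^esub> a = \<zero>\<^bsub>T\<^esub>"
          by (rule bexI) (intro CollectI conjI T.finsum_closed[OF rT[OF s]] exI[of _ ?s] s refl)
      qed auto
      fix s p i j assume sp: "s \<in> grade S i" "p \<in> grade P j" "i + j = n"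
      have c: "s \<in> carrier S" "p \<in> carrier P" using sp S.grade_carrier mgrade_carrier by auto
      have "s \<otimes>\<^bsub>S\<^esub> \<psi> (B.co p k) \<in> grade S (n - d k)" if k: "k \<in> I" for k
        by (rule S.grade_mult'[OF sp(1) graded[OF B.co_grade[OF sp(2) k]]]) (use sp(3) in simp)
      then show "tens s p \<in> ?H"
        by (intro CollectI conjI tens_closed[OF c] exI[of _ "\<lambda>k. s \<otimes>\<^bsub>S\<^esub> \<psi> (B.co p k)"] expand[OF c] ballI)
    qed
    then show "\<exists>r. (\<forall>i\<in>I. r i \<in> grade S (n - d i)) \<and> m = (\<Oplus>\<^bsub>T\<^esub>i\<in>I. r i \<odot>\<^bsub>T\<^esub> ?x i)" using m by blast
  next
    fix r i assume r: "r \<in> I \<rightarrow> carrier S" "(\<Oplus>\<^bsub>T\<^esub>i\<in>I. r i \<odot>\<^bsub>T\<^esub> ?x i) = \<zero>\<^bsub>T\<^esub>" and i: "i \<in> I"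
    have rc: "r j \<in> carrier S" if "j \<in> I" for j using r(1) that by auto
    \<comment> \<open>The i-th coordinate functional s \<otimes> p \<mapsto> s \<psi>(p_i); applied
      to a relation it isolates the i-th coefficient.\<close>
    obtain g where g: "\<And>X. X \<in> carrier T \<Longrightarrow> g X \<in> carrier S"
      "\<And>X Y. X \<in> carrier T \<Longrightarrow> Y \<in> carrier T \<Longrightarrow> g (X \<oplus>\<^bsub>T\<^esub> Y) = g X \<oplus>\<^bsub>S\<^esub> g Y"
      "\<And>s p. s \<in> carrier S \<Longrightarrow> p \<in> carrier P \<Longrightarrow> g (tens s p) = s \<otimes>\<^bsub>S\<^esub> \<psi> (B.co p i)"
    proof (rule tensor_universal[of S "\<lambda>s p. s \<otimes>\<^bsub>S\<^esub> \<psi> (B.co p i)"])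
    qed (use i B.co_closed in \<open>auto simp: S.l_distr S.r_distr psi_add B.co_add B.co_smult psi_mult S.m_assoc S.abelian_group_axioms\<close>)
    have "g (\<Oplus>\<^bsub>T\<^esub>j\<in>I. r j \<odot>\<^bsub>T\<^esub> ?x j) = (\<Oplus>\<^bsub>S\<^esub>j\<in>I. g (r j \<odot>\<^bsub>T\<^esub> ?x j))"
      by (rule finsum_hom[OF abelian_T S.abelian_group_axioms]) (use g rc xT T.smult_closed in auto)
    also have "\<dots> = g (r i \<odot>\<^bsub>T\<^esub> ?x i)"
    proof (rule S.finsum_eq_single[OF B.fin i])
      show "g (r i \<odot>\<^bsub>T\<^esub> ?x i) \<in> carrier S" using g(1) T.smult_closed[OF rc[OF i] xT[OF i]] by blast
      fix j assume j: "j \<in> I" "j \<noteq> i"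
      show "g (r j \<odot>\<^bsub>T\<^esub> ?x j) = \<zero>\<^bsub>S\<^esub>"
        using tx[OF j(1) rc[OF j(1)]] g(3)[OF rc[OF j(1)] B.x_carrier[OF j(1)]] B.co_x[OF i j(1)] j psi_zero rc by simp
    qed
    also have "\<dots> = r i \<otimes>\<^bsub>S\<^esub> \<psi> (e i)"
      using tx[OF i rc[OF i]] g(3)[OF rc[OF i] B.x_carrier[OF i]] B.co_x[OF i i] by simp
    finally have "g \<zero>\<^bsub>T\<^esub> = r i \<otimes>\<^bsub>S\<^esub> \<psi> (e i)" using r(2) by simp
    moreover have "g \<zero>\<^bsub>T\<^esub> = \<zero>\<^bsub>S\<^esub>" using g(2)[of "\<zero>\<^bsub>T\<^esub>" "\<zero>\<^bsub>T\<^esub>"] g(1)[of "\<zero>\<^bsub>T\<^esub>"] by simp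
    ultimately show "r i \<otimes>\<^bsub>S\<^esub> \<psi> (e i) = \<zero>\<^bsub>S\<^esub>" by simp
  qed
qed

text \<open>
  The pair \<open>(v, d)\<close> stands for \<open>R v (- d)\<close>, so the shift by \<open>n\<close> lowers \<open>d\<close>.
\<close>

definition sh :: "int \<Rightarrow> ('v \<times> int) multiset \<Rightarrow> ('v \<times> int) multiset" where
  "sh n T = image_mset (\<lambda>t. (fst t, snd t - n)) T"

lemma sh_add [simp]: "sh n (T + U) = sh n T + sh n U" unfolding sh_def by simp
lemma sh_empty [simp]: "sh n {#} = {#}" unfolding sh_def by simp

section \<open>The graded K-group in terms of multisets of vertices and degrees\<close>

locale lpa_nontriv = lpa R Z E gm
  for R :: "('k, 'r, 'm) gmodule_scheme" (structure) and Z and E :: "('v, 'e) pre_digraph" and gm +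
  assumes nontriv: "\<exists>a b :: 'r. a \<noteq> b"
begin

definition V :: "('v \<times> int) multiset \<Rightarrow> 'r fgp set" where "V T = Cls R (vtm T)"

definition K :: "('v \<times> int) multiset \<Rightarrow> ('v \<times> int) multiset \<Rightarrow> 'r K0_elem" where
  "K T U = gc_class (Vgr R) (V T) (V U)"

lemma V_nonempty: "vmset T \<Longrightarrow> V T \<noteq> {}"
  unfolding V_def using nontriv Cls_nonempty vtm_idem by metis

lemma vmset_empty [simp]: "vmset {#}" unfolding vmset_def by simp
lemma vmset_sh [simp]: "vmset (sh n T) \<longleftrightarrow> vmset T" unfolding vmset_def sh_def by auto

lemma V_mult: "vmset T \<Longrightarrow> vmset U \<Longrightarrow> monoid.mult (Vgr R) (V T) (V U) = V (T + U)"
  using V_nonempty[of T] V_nonempty[of U] Vgr_mult_Cls unfolding V_def vtm_add by blast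

lemma V_one: "\<one>\<^bsub>Vgr R\<^esub> = V {#}"
  unfolding V_def Vgr_one_Cls vtm_def by simp

lemma V_shift: "vmset T \<Longrightarrow> Vgr_shift R n (V T) = V (sh n T)"
  using V_nonempty[of T] Vgr_shift_Cls[of "vtm T" n] unfolding V_def vtm_def sh_def
  by (simp add: image_mset.compositionality comp_def)

lemma gr_class_V:
  assumes "gmod R M" "hbas R M (vtm T)" shows "gr_class R M = V T"
  unfolding V_def by (rule gr_class_eq_Cls[OF assms])

text \<open>Every finitely generated graded projective module has a vertex basis, so its class is
  some \<open>V T\<close>; conversely \<open>V T\<close> is nonempty and is the class of each of its
  members.\<close>

lemma V_carrier: "carrier (Vgr R) = V ` {T. vmset T}"
proof -
  have "gr_class R P \<in> V ` {T. vmset T}" if P: "gr_fgp R P" for P :: "'r fgp"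
  proof -
    obtain T where "vmset T" "hbas R P (vtm T)" using fgp_vertex_basis[OF P] by blast
    moreover have "gmod R P" using P gmod_of_graded unfolding gr_fgp_def by blast
    ultimately show ?thesis using gr_class_V by blast
  qed
  moreover have "V T \<in> gr_class R ` {P :: 'r fgp. gr_fgp R P}" if T: "vmset T" for T
  proof -
    obtain P where P: "P \<in> V T" using V_nonempty[OF T] by blast
    then have "gmod R P" "hbas R P (vtm T)" using Cls_gmod unfolding V_def by blast+
    then have "gr_class R P = V T" by (rule gr_class_V)
    moreover have "gr_fgp R P" using P unfolding V_def Cls_def by blast
    ultimately show ?thesis by (intro image_eqI[of _ _ P]) simp_all
  qed
  ultimately show ?thesis unfolding Vgr_def by auto
qed

lemma V_in_carrier: "vmset T \<Longrightarrow> V T \<in> carrier (Vgr R)"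
  unfolding V_carrier by blast

lemma V_cong_add:
  assumes "vmset T" "vmset U" "vmset W" "V T = V U" shows "V (T + W) = V (U + W)"
  using V_mult[OF assms(1,3)] V_mult[OF assms(2,3)] assms(4) by simp

lemma V_cancel:
  assumes "vmset T" "vmset U" "vmset W" "V (T + W) = V (U + W)" shows "V T = V U"
  using nontriv Cls_cancel[OF assms(1-3)] assms(4) unfolding V_def by blast

lemma gc_rel_V:
  assumes "vmset T" "vmset U"
  shows "(A, B) \<in> gc_class (Vgr R) (V T) (V U) \<longleftrightarrow>
    (\<exists>T' U'. vmset T' \<and> vmset U' \<and> A = V T' \<and> B = V U' \<and> V (T + U') = V (T' + U))"
proof
  assume "(A, B) \<in> gc_class (Vgr R) (V T) (V U)"
  then have c: "A \<in> carrier (Vgr R)" "B \<in> carrier (Vgr R)"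
    and "\<exists>t\<in>carrier (Vgr R). V T \<otimes>\<^bsub>Vgr R\<^esub> B \<otimes>\<^bsub>Vgr R\<^esub> t = A \<otimes>\<^bsub>Vgr R\<^esub> V U \<otimes>\<^bsub>Vgr R\<^esub> t"
    unfolding gc_class_def gc_rel_def by auto
  then obtain T' U' W where v: "vmset T'" "vmset U'" "A = V T'" "B = V U'" "vmset W"
    and "V T \<otimes>\<^bsub>Vgr R\<^esub> B \<otimes>\<^bsub>Vgr R\<^esub> V W = A \<otimes>\<^bsub>Vgr R\<^esub> V U \<otimes>\<^bsub>Vgr R\<^esub> V W"
    unfolding V_carrier by auto
  then have "V (T + U' + W) = V (T' + U + W)" using assms by (simp add: V_mult)
  then have "V (T + U') = V (T' + U)" using V_cancel[of "T + U'" "T' + U" W] assms v by simp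
  then show "\<exists>T' U'. vmset T' \<and> vmset U' \<and> A = V T' \<and> B = V U' \<and> V (T + U') = V (T' + U)" using v by blast
next
  assume "\<exists>T' U'. vmset T' \<and> vmset U' \<and> A = V T' \<and> B = V U' \<and> V (T + U') = V (T' + U)"
  then obtain T' U' where v: "vmset T'" "vmset U'" "A = V T'" "B = V U'" "V (T + U') = V (T' + U)" by blast
  \<comment> \<open>The neutral class serves as auxiliary summand.\<close>
  have eq: "V T \<otimes>\<^bsub>Vgr R\<^esub> B \<otimes>\<^bsub>Vgr R\<^esub> V {#} = A \<otimes>\<^bsub>Vgr R\<^esub> V U \<otimes>\<^bsub>Vgr R\<^esub> V {#}"
    unfolding v(3,4) using assms v(1,2,5) by (simp add: V_mult)
  have cA: "A \<in> carrier (Vgr R)" and cB: "B \<in> carrier (Vgr R)"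
    unfolding v(3,4) by (rule V_in_carrier[OF v(1)], rule V_in_carrier[OF v(2)])
  have "((V T, V U), (A, B)) \<in> gc_rel (Vgr R)"
    unfolding gc_rel_def mem_Collect_eq prod.case
    by (intro conjI bexI[where x="V {#}"] eq cA cB V_in_carrier assms vmset_empty)
  then show "(A, B) \<in> gc_class (Vgr R) (V T) (V U)"
    unfolding gc_class_def by blast
qed

lemma K_eqI:
  assumes v: "vmset T" "vmset U" "vmset T'" "vmset U'" and eq: "V (T + U') = V (T' + U)"
  shows "K T U = K T' U'"
proof -
  have sub: "K T U \<subseteq> K T' U'"
    if v: "vmset T" "vmset U" "vmset T'" "vmset U'" and eq: "V (T + U') = V (T' + U)" for T U T' U'
  proof
    fix p assume p: "p \<in> K T U"
    obtain A B where AB: "p = (A, B)" by fastforce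
    from p[unfolded AB K_def gc_rel_V[OF v(1,2)]] obtain X Y where X: "vmset X" "vmset Y" "A = V X" "B = V Y" "V (T + Y) = V (X + U)"
      by (elim exE conjE)
    \<comment> \<open>Transitivity: U is added so that both given equations become applicable, and
      is cancelled at the end.\<close>
    have "V (T' + Y + U) = V (T' + U + Y)" by (simp add: ac_simps)
    also have "\<dots> = V (T + U' + Y)" by (rule V_cong_add[OF _ _ _ eq[symmetric]]) (use v X(1,2) in simp_all)
    also have "\<dots> = V (T + Y + U')" by (simp add: ac_simps)
    also have "\<dots> = V (X + U + U')" by (rule V_cong_add[OF _ _ _ X(5)]) (use v X(1,2) in simp_all)
    also have "\<dots> = V (X + U' + U)" by (simp add: ac_simps)
    finally have "V (T' + Y) = V (X + U')" by (rule V_cancel[rotated -1]) (use v X(1,2) in simp_all)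
    then show "p \<in> K T' U'"
      unfolding K_def AB gc_rel_V[OF v(3,4)] by (intro exI[of _ X] exI[of _ Y] conjI X(1-4))
  qed
  show ?thesis using sub[OF v eq] sub[OF v(3,4,1,2) eq[symmetric]] by blast
qed

lemma K_self: "vmset T \<Longrightarrow> vmset U \<Longrightarrow> (V T, V U) \<in> K T U"
  unfolding K_def gc_rel_V by (intro exI[of _ T] exI[of _ U]) simp

lemma K_eqD:
  assumes "vmset T" "vmset U" "vmset T'" "vmset U'" "K T U = K T' U'"
  shows "V (T + U') = V (T' + U)"
proof -
  have "(V T', V U') \<in> K T U" using K_self assms by simp
  from this[unfolded K_def gc_rel_V[OF assms(1,2)]]
  obtain X Y where X: "vmset X" "vmset Y" "V T' = V X" "V U' = V Y" "V (T + Y) = V (X + U)"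
    by (elim exE conjE)
  have "V (T + U') = V (U' + T)" by (simp add: ac_simps)
  also have "\<dots> = V (Y + T)" by (rule V_cong_add[OF _ _ _ X(4)]) (use assms(1-4) X(1,2) in simp_all)
  also have "\<dots> = V (T + Y)" by (simp add: ac_simps)
  also have "\<dots> = V (X + U)" by (rule X(5))
  also have "\<dots> = V (T' + U)" by (rule V_cong_add[OF _ _ _ X(3)[symmetric]]) (use assms(1-4) X(1,2) in simp_all)
  finally show ?thesis .
qed

lemma K_mem:
  assumes "(A, B) \<in> K T U" "vmset T" "vmset U"
  obtains T' U' where "vmset T'" "vmset U'" "A = V T'" "B = V U'" "K T' U' = K T U"
proof -
  from assms(1)[unfolded K_def gc_rel_V[OF assms(2,3)]]
  obtain T' U' where X: "vmset T'" "vmset U'" "A = V T'" "B = V U'" "V (T + U') = V (T' + U)"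
    by (elim exE conjE)
  show ?thesis by (rule that[OF X(1-4)], rule K_eqI) (use X assms in simp_all)
qed

definition GC where "GC = group_completion (Vgr R)"

lemma GC_carrier: "carrier GC = {K T U | T U. vmset T \<and> vmset U}"
  unfolding GC_def group_completion_def quotient_def V_carrier K_def gc_class_def by auto

text \<open>The sum in the group completion is a union over all pairs of representatives; it
  collapses because each pair gives the same formal difference.\<close>

lemma GC_mult:
  assumes v: "vmset T" "vmset U" "vmset T'" "vmset U'"
  shows "K T U \<otimes>\<^bsub>GC\<^esub> K T' U' = K (T + T') (U + U')"
proof -
  have c: "gc_class (Vgr R) (a \<otimes>\<^bsub>Vgr R\<^esub> c) (b \<otimes>\<^bsub>Vgr R\<^esub> d) = K (T + T') (U + U')"
    if ab: "(a, b) \<in> K T U" and cd: "(c, d) \<in> K T' U'" for a b c d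
  proof -
    obtain A B where A: "vmset A" "vmset B" "a = V A" "b = V B" "K A B = K T U" by (rule K_mem[OF ab v(1,2)])
    obtain C D where C: "vmset C" "vmset D" "c = V C" "d = V D" "K C D = K T' U'" by (rule K_mem[OF cd v(3,4)])
    have e: "V (A + U) = V (T + B)" "V (C + U') = V (T' + D)"
      by (rule K_eqD[OF A(1,2) v(1,2) A(5)], rule K_eqD[OF C(1,2) v(3,4) C(5)])
    have m: "vmset (A + U)" "vmset (C + U')" "vmset (T + B)" "vmset (T' + D)" using A(1,2) C(1,2) v by simp_all
    have "V (A + C + (U + U')) = V (A + U + (C + U'))" by (simp add: ac_simps)
    also have "\<dots> = V (T + B + (T' + D))" unfolding V_mult[OF m(1,2), symmetric] V_mult[OF m(3,4), symmetric] e ..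
    also have "\<dots> = V (T + T' + (B + D))" by (simp add: ac_simps)
    finally have "K (A + C) (B + D) = K (T + T') (U + U')"
      by (rule K_eqI[rotated -1]) (use A(1,2) C(1,2) v in simp_all)
    moreover have "gc_class (Vgr R) (a \<otimes>\<^bsub>Vgr R\<^esub> c) (b \<otimes>\<^bsub>Vgr R\<^esub> d) = K (A + C) (B + D)"
      unfolding K_def A(3,4) C(3,4) V_mult[OF A(1) C(1)] V_mult[OF A(2) C(2)] ..
    ultimately show ?thesis by simp
  qed
  have "(\<Union>(a, b)\<in>K T U. \<Union>(c, d)\<in>K T' U'. gc_class (Vgr R) (a \<otimes>\<^bsub>Vgr R\<^esub> c) (b \<otimes>\<^bsub>Vgr R\<^esub> d)) = K (T + T') (U + U')"
    using c K_self[OF v(1,2)] K_self[OF v(3,4)] by fast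
  then show ?thesis unfolding GC_def group_completion_def by simp
qed

lemma GC_one: "\<one>\<^bsub>GC\<^esub> = K {#} {#}"
  unfolding GC_def group_completion_def K_def V_one by simp

lemma GC_comm_monoid: "comm_monoid GC"
proof (rule comm_monoidI)
  have cases: thesis if "x \<in> carrier GC" "\<And>T U. vmset T \<Longrightarrow> vmset U \<Longrightarrow> x = K T U \<Longrightarrow> thesis" for x thesis
    using that unfolding GC_carrier by blast
  have KC: "K T U \<in> carrier GC" if "vmset T" "vmset U" for T U
    using that unfolding GC_carrier by blast
  show "\<one>\<^bsub>GC\<^esub> \<in> carrier GC" unfolding GC_one by (rule KC) simp_all
  fix x assume "x \<in> carrier GC"
  then obtain T U where x: "vmset T" "vmset U" "x = K T U" by (rule cases)
  show "\<one>\<^bsub>GC\<^esub> \<otimes>\<^bsub>GC\<^esub> x = x" unfolding GC_one x(3) using x(1,2) by (simp add: GC_mult)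
  fix y assume "y \<in> carrier GC"
  then obtain T' U' where y: "vmset T'" "vmset U'" "y = K T' U'" by (rule cases)
  show "x \<otimes>\<^bsub>GC\<^esub> y \<in> carrier GC" unfolding x(3) y(3) GC_mult[OF x(1,2) y(1,2)]
    by (rule KC) (use x(1,2) y(1,2) in simp_all)
  show "x \<otimes>\<^bsub>GC\<^esub> y = y \<otimes>\<^bsub>GC\<^esub> x"
    unfolding x(3) y(3) GC_mult[OF x(1,2) y(1,2)] GC_mult[OF y(1,2) x(1,2)] by (simp add: add.commute)
  fix z assume "z \<in> carrier GC"
  then obtain A B where z: "vmset A" "vmset B" "z = K A B" by (rule cases)
  show "x \<otimes>\<^bsub>GC\<^esub> y \<otimes>\<^bsub>GC\<^esub> z = x \<otimes>\<^bsub>GC\<^esub> (y \<otimes>\<^bsub>GC\<^esub> z)"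
    unfolding x(3) y(3) z(3) using x(1,2) y(1,2) z(1,2) by (simp add: GC_mult add.assoc)
qed

lemma K0gr_shift_K:
  assumes v: "vmset T" "vmset U"
  shows "K0gr_shift R n (K T U) = K (sh n T) (sh n U)"
proof -
  have "gc_class (Vgr R) (Vgr_shift R n A) (Vgr_shift R n B) = K (sh n T) (sh n U)" if AB: "(A, B) \<in> K T U" for A B
  proof -
    obtain X Y where X: "vmset X" "vmset Y" "A = V X" "B = V Y" "K X Y = K T U" by (rule K_mem[OF AB v])
    have e: "V (X + U) = V (T + Y)" by (rule K_eqD[OF X(1,2) v X(5)])
    have m: "vmset (X + U)" "vmset (T + Y)" using X(1,2) v by simp_all
    have "V (sh n (X + U)) = V (sh n (T + Y))" unfolding V_shift[OF m(1), symmetric] V_shift[OF m(2), symmetric] e ..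
    then have "K (sh n X) (sh n Y) = K (sh n T) (sh n U)" by (intro K_eqI) (use X(1,2) v in simp_all)
    then show ?thesis unfolding X(3,4) V_shift[OF X(1)] V_shift[OF X(2)] K_def by simp
  qed
  then show ?thesis unfolding K0gr_shift_def using K_self[OF v] by fast
qed

lemma K0gr_simps: "carrier (K0gr R) = carrier GC" "add (K0gr R) = monoid.mult GC"
  unfolding K0gr_def GC_def Let_def by simp_all

lemma K_carrier [simp]: "vmset T \<Longrightarrow> vmset U \<Longrightarrow> K T U \<in> carrier (K0gr R)"
  unfolding K0gr_simps GC_carrier by (intro CollectI exI[of _ T] exI[of _ U]) simp

lemma K0gr_cases:
  assumes "X \<in> carrier (K0gr R)" obtains T U where "vmset T" "vmset U" "X = K T U"
  using assms unfolding K0gr_simps GC_carrier by blast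

lemma K0gr_add: "vmset T \<Longrightarrow> vmset U \<Longrightarrow> vmset T' \<Longrightarrow> vmset U' \<Longrightarrow>
    K T U \<oplus>\<^bsub>K0gr R\<^esub> K T' U' = K (T + T') (U + U')"
  unfolding K0gr_simps by (rule GC_mult)

text \<open>The product over the support of a monomial has a single factor with exponent 1, so x^n
  acts as the shift by n.\<close>

lemma K0gr_smult_single:
  assumes v: "vmset T" "vmset U"
  shows "Poly_Mapping.single n 1 \<odot>\<^bsub>K0gr R\<^esub> K T U = K (sh n T) (sh n U)"
proof -
  interpret comm_monoid GC by (rule GC_comm_monoid)
  have c: "K (sh n T) (sh n U) \<in> carrier GC" using K_carrier[of "sh n T" "sh n U"] v unfolding K0gr_simps by simp
  have p: "x [^]\<^bsub>GC\<^esub> (1 :: int) = x" if "x \<in> carrier GC" for x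
    using that by (simp add: int_pow_def2)
  have "finprod GC (\<lambda>k. K0gr_shift R k (K T U) [^]\<^bsub>GC\<^esub> Poly_Mapping.lookup (Poly_Mapping.single n (1 :: int)) k) {n}
      = K (sh n T) (sh n U)"
    using c p[OF c] by (subst finprod_insert) (auto simp: K0gr_shift_K[OF v])
  then show ?thesis unfolding K0gr_def Let_def GC_def[symmetric] by simp
qed

lemma K0gr_class_K:
  assumes "gmod R M" "hbas R M (vtm T)" "vmset T" shows "K0gr_class R M = K T {#}"
  unfolding K0gr_class_def gr_class_V[OF assms(1,2)] K_def V_one ..

lemma K0gr_pos_K: "K0gr_pos R = {K T {#} | T. vmset T}"
  unfolding K0gr_pos_def V_carrier K_def V_one by auto

end

section \<open>The presented algebra\<close>

locale freealg = cring K for K :: "('k, 'c) ring_scheme" (structure) +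
  fixes X :: "'g set"
begin

abbreviation "A \<equiv> free_algebra K X"
abbreviation mo :: "'g list \<Rightarrow> 'g list \<Rightarrow> 'k" where "mo \<equiv> word_monom K"

text \<open>The product of \<open>free_algebra\<close>, detached from the support conditions, so
  that its value at a word can be studied by induction on the word.\<close>

definition conv :: "('g list \<Rightarrow> 'k) \<Rightarrow> ('g list \<Rightarrow> 'k) \<Rightarrow> 'g list \<Rightarrow> 'k" where
  "conv f g w = (\<Oplus>i\<in>{..length w}. f (take i w) \<otimes> g (drop i w))"

lemma A_simps:
  "carrier A = {f. (\<forall>w. f w \<in> carrier K) \<and> finite {w. f w \<noteq> \<zero>} \<and> {w. f w \<noteq> \<zero>} \<subseteq> lists X}"
  "f \<otimes>\<^bsub>A\<^esub> g = conv f g" "\<one>\<^bsub>A\<^esub> = mo []" "\<zero>\<^bsub>A\<^esub> = (\<lambda>_. \<zero>)" "f \<oplus>\<^bsub>A\<^esub> g = (\<lambda>w. f w \<oplus> g w)"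
  "c \<odot>\<^bsub>A\<^esub> f = (\<lambda>w. c \<otimes> f w)"
  unfolding free_algebra_def word_monom_def conv_def by (simp_all add: fun_eq_iff)

lemma conv_Nil: "f [] \<in> carrier K \<Longrightarrow> g [] \<in> carrier K \<Longrightarrow> conv f g [] = f [] \<otimes> g []"
  unfolding conv_def by simp

text \<open>Separates the cut before the first letter from the other cuts. In those the first letter
  belongs to f, which is replaced by its derivative u \<mapsto> f (x # u).\<close>

lemma conv_Cons:
  assumes "\<And>w. f w \<in> carrier K" "\<And>w. g w \<in> carrier K"
  shows "conv f g (x # w) = conv (\<lambda>u. f (x # u)) g w \<oplus> f [] \<otimes> g (x # w)"
  unfolding conv_def using assms by (simp add: finsum_Suc2 del: finsum_Suc)

lemma conv_closed:
  assumes "\<And>w. f w \<in> carrier K" "\<And>w. g w \<in> carrier K"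
  shows "conv f g w \<in> carrier K"
  unfolding conv_def using assms by (intro finsum_closed) auto

lemma conv_add_l:
  assumes "\<And>w. f w \<in> carrier K" "\<And>w. f' w \<in> carrier K" "\<And>w. g w \<in> carrier K"
  shows "conv (\<lambda>w. f w \<oplus> f' w) g w = conv f g w \<oplus> conv f' g w"
  unfolding conv_def using assms by (simp add: l_distr finsum_addf Pi_def)

lemma conv_add_r:
  assumes "\<And>w. f w \<in> carrier K" "\<And>w. f' w \<in> carrier K" "\<And>w. g w \<in> carrier K"
  shows "conv g (\<lambda>w. f w \<oplus> f' w) w = conv g f w \<oplus> conv g f' w"
  unfolding conv_def using assms by (simp add: r_distr finsum_addf Pi_def)

lemma conv_smult_l:
  assumes "\<And>w. f w \<in> carrier K" "\<And>w. g w \<in> carrier K" "c \<in> carrier K"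
  shows "conv (\<lambda>w. c \<otimes> f w) g w = c \<otimes> conv f g w"
  unfolding conv_def using assms by (simp add: finsum_rdistr m_assoc Pi_def)

lemma conv_smult_r:
  assumes "\<And>w. f w \<in> carrier K" "\<And>w. g w \<in> carrier K" "c \<in> carrier K"
  shows "conv f (\<lambda>w. c \<otimes> g w) w = c \<otimes> conv f g w"
  unfolding conv_def using assms by (simp add: finsum_rdistr m_lcomm Pi_def)

lemma conv_zero_l: "(\<And>w. g w \<in> carrier K) \<Longrightarrow> conv (\<lambda>_. \<zero>) g w = \<zero>"
  unfolding conv_def by (rule finsum_eq_zero) simp

text \<open>Induction on the word for all f at once, since the recursion replaces f by its
  derivative; this avoids reindexing a double sum.\<close>

lemma conv_assoc:
  assumes "\<And>w. f w \<in> carrier K" "\<And>w. g w \<in> carrier K" "\<And>w. h w \<in> carrier K"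
  shows "conv (conv f g) h w = conv f (conv g h) w"
  using assms(1)
proof (induction w arbitrary: f)
  case Nil
  then show ?case using assms by (simp add: conv_Nil conv_closed m_assoc)
next
  case (Cons x w)
  let ?fx = "\<lambda>u. f (x # u)" and ?gx = "\<lambda>u. g (x # u)"
  note c = Cons.prems assms(2,3)
  have e: "conv f g (x # u) = conv ?fx g u \<oplus> f [] \<otimes> ?gx u" for u
    by (rule conv_Cons[OF c(1,2)])
  have "conv (conv f g) h (x # w) = conv (\<lambda>u. conv f g (x # u)) h w \<oplus> conv f g [] \<otimes> h (x # w)"
    by (rule conv_Cons) (use c conv_closed in auto)
  also have "conv (\<lambda>u. conv f g (x # u)) h w = conv (conv ?fx g) h w \<oplus> f [] \<otimes> conv ?gx h w"
    unfolding e using c conv_closed by (simp add: conv_add_l conv_smult_l)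
  also have "conv (conv ?fx g) h w = conv ?fx (conv g h) w" by (rule Cons.IH) (use c in auto)
  also have "conv f g [] = f [] \<otimes> g []" using c by (simp add: conv_Nil)
  finally have "conv (conv f g) h (x # w)
    = conv ?fx (conv g h) w \<oplus> f [] \<otimes> conv ?gx h w \<oplus> f [] \<otimes> g [] \<otimes> h (x # w)" .
  moreover have "conv f (conv g h) (x # w) = conv ?fx (conv g h) w \<oplus> f [] \<otimes> conv g h (x # w)"
    by (rule conv_Cons) (use c conv_closed in auto)
  moreover have "conv g h (x # w) = conv ?gx h w \<oplus> g [] \<otimes> h (x # w)"
    by (rule conv_Cons) (use c in auto)
  ultimately show ?case using c conv_closed[of "?fx" "conv g h" w] conv_closed[of g h] conv_closed[of ?gx h w]
    by (simp add: r_distr m_assoc a_assoc)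
qed

lemma mo_closed: "mo u w \<in> carrier K"
  unfolding word_monom_def by simp

lemma conv_mo_Nil: "(\<And>w. g w \<in> carrier K) \<Longrightarrow> conv (mo []) g = g"
proof
  fix w assume g: "\<And>w. g w \<in> carrier K"
  show "conv (mo []) g w = g w"
  proof (cases w)
    case Nil then show ?thesis using g by (simp add: conv_Nil mo_closed) (simp add: word_monom_def)
  next
    case (Cons x u)
    have "(\<lambda>u. mo [] (x # u)) = (\<lambda>_. \<zero>)" unfolding word_monom_def by auto
    then show ?thesis using g Cons by (simp add: conv_Cons mo_closed conv_zero_l) (simp add: word_monom_def)
  qed
qed

lemma conv_mo_Cons:
  assumes "\<And>w. g w \<in> carrier K"
  shows "conv (mo (x # u)) g w = (case w of [] \<Rightarrow> \<zero> | y # w' \<Rightarrow> if y = x then conv (mo u) g w' else \<zero>)"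
proof (cases w)
  case Nil then show ?thesis using assms by (simp add: conv_Nil mo_closed) (simp add: word_monom_def)
next
  case (Cons y w')
  have 1: "(\<lambda>v. mo (x # u) (y # v)) = (if y = x then mo u else (\<lambda>_. \<zero>))" unfolding word_monom_def by auto
  have 2: "mo (x # u) [] = \<zero>" unfolding word_monom_def by simp
  show ?thesis using assms Cons conv_closed[of "mo u" g w', OF mo_closed assms] by (simp add: conv_Cons mo_closed 1 2 conv_zero_l)
qed

lemma conv_mo_mo: "conv (mo u) (mo v) = mo (u @ v)"
proof (induction u)
  case Nil then show ?case by (simp add: conv_mo_Nil mo_closed)
next
  case (Cons x u)
  show ?case
  proof
    fix w show "conv (mo (x # u)) (mo v) w = mo ((x # u) @ v) w"
      using Cons by (cases w) (simp_all add: conv_mo_Cons mo_closed, simp_all add: word_monom_def)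
  qed
qed

lemma conv_mo_Nil_r: "(\<And>w. f w \<in> carrier K) \<Longrightarrow> conv f (mo []) = f"
proof
  fix w assume "\<And>w. f w \<in> carrier K"
  then show "conv f (mo []) w = f w"
  proof (induction w arbitrary: f)
    case Nil then show ?case by (simp add: conv_Nil mo_closed) (simp add: word_monom_def)
  next
    case (Cons x w)
    then show ?case by (simp add: conv_Cons mo_closed) (simp add: word_monom_def)
  qed
qed

lemma A_val: "f \<in> carrier A \<Longrightarrow> f w \<in> carrier K"
  unfolding A_simps by simp

lemma A_supp: "f \<in> carrier A \<Longrightarrow> finite {w. f w \<noteq> \<zero>}" "f \<in> carrier A \<Longrightarrow> f w \<noteq> \<zero> \<Longrightarrow> w \<in> lists X"
  unfolding A_simps by auto

lemma conv_supp:
  assumes "\<And>w. f w \<in> carrier K" "\<And>w. g w \<in> carrier K" "conv f g w \<noteq> \<zero>"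
  obtains u v where "w = u @ v" "f u \<noteq> \<zero>" "g v \<noteq> \<zero>"
proof -
  have "\<exists>i\<in>{..length w}. f (take i w) \<otimes> g (drop i w) \<noteq> \<zero>"
    using assms(3) finsum_eq_zero[of "{..length w}" "\<lambda>i. f (take i w) \<otimes> g (drop i w)"] unfolding conv_def by blast
  then obtain i where "f (take i w) \<otimes> g (drop i w) \<noteq> \<zero>" by blast
  then have "f (take i w) \<noteq> \<zero>" "g (drop i w) \<noteq> \<zero>" using assms by auto
  then show ?thesis using that[of "take i w" "drop i w"] by simp
qed

lemma conv_A: assumes "f \<in> carrier A" "g \<in> carrier A" shows "conv f g \<in> carrier A"
proof -
  have sub: "{w. conv f g w \<noteq> \<zero>} \<subseteq> (\<lambda>(u, v). u @ v) ` ({w. f w \<noteq> \<zero>} \<times> {w. g w \<noteq> \<zero>})"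
  proof
    fix w assume "w \<in> {w. conv f g w \<noteq> \<zero>}"
    then have "conv f g w \<noteq> \<zero>" by simp
    then obtain u v where "w = u @ v" "f u \<noteq> \<zero>" "g v \<noteq> \<zero>"
      by (rule conv_supp[OF A_val[OF assms(1)] A_val[OF assms(2)]])
    then show "w \<in> (\<lambda>(u, v). u @ v) ` ({w. f w \<noteq> \<zero>} \<times> {w. g w \<noteq> \<zero>})" by auto
  qed
  then have "finite {w. conv f g w \<noteq> \<zero>}" using A_supp(1) assms by (meson finite_SigmaI finite_imageI finite_subset)
  moreover have "{w. conv f g w \<noteq> \<zero>} \<subseteq> lists X"
    using sub A_supp(2)[OF assms(1)] A_supp(2)[OF assms(2)] by fastforce
  ultimately show ?thesis using conv_closed A_val assms unfolding A_simps(1) by blast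
qed

lemma A_add: assumes "f \<in> carrier A" "g \<in> carrier A" shows "(\<lambda>w. f w \<oplus> g w) \<in> carrier A"
proof -
  have "{w. f w \<oplus> g w \<noteq> \<zero>} \<subseteq> {w. f w \<noteq> \<zero>} \<union> {w. g w \<noteq> \<zero>}" by auto
  moreover have "finite ({w. f w \<noteq> \<zero>} \<union> {w. g w \<noteq> \<zero>})" "{w. f w \<noteq> \<zero>} \<union> {w. g w \<noteq> \<zero>} \<subseteq> lists X"
    using assms unfolding A_simps by auto
  ultimately have "finite {w. f w \<oplus> g w \<noteq> \<zero>}" "{w. f w \<oplus> g w \<noteq> \<zero>} \<subseteq> lists X"
    using finite_subset by blast+
  then show ?thesis using A_val[OF assms(1)] A_val[OF assms(2)] unfolding A_simps(1) by simp
qed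

lemma A_map:
  assumes "f \<in> carrier A" "\<And>w. F w \<in> carrier K" "\<And>w. f w = \<zero> \<Longrightarrow> F w = \<zero>"
  shows "F \<in> carrier A"
proof -
  have sub: "{w. F w \<noteq> \<zero>} \<subseteq> {w. f w \<noteq> \<zero>}" using assms(3) by auto
  moreover have "finite {w. f w \<noteq> \<zero>}" "{w. f w \<noteq> \<zero>} \<subseteq> lists X" using assms(1) unfolding A_simps by auto
  ultimately show ?thesis using assms(2) finite_subset[OF sub] unfolding A_simps(1) by blast
qed

lemma mo_A: "u \<in> lists X \<Longrightarrow> mo u \<in> carrier A"
proof -
  assume u: "u \<in> lists X"
  have "{w. mo u w \<noteq> \<zero>} \<subseteq> {u}" unfolding word_monom_def by auto
  then show ?thesis using u mo_closed finite_subset[of _ "{u}"] unfolding A_simps(1) by blast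
qed

lemma ring_A: "ring A"
proof (rule ringI)
  show "abelian_group A"
  proof (rule abelian_groupI)
    show "\<zero>\<^bsub>A\<^esub> \<in> carrier A" unfolding A_simps by simp
    fix f assume f: "f \<in> carrier A"
    show "\<exists>g\<in>carrier A. g \<oplus>\<^bsub>A\<^esub> f = \<zero>\<^bsub>A\<^esub>"
      by (rule bexI[of _ "\<lambda>w. \<ominus> f w"], simp add: A_simps(4,5) l_neg A_val[OF f])
        (rule A_map[OF f], use A_val[OF f] in auto)
  qed (auto simp: A_simps(4,5) A_add a_ac A_val)
  show "monoid A"
  proof (rule monoidI)
    fix f g h assume "f \<in> carrier A" "g \<in> carrier A" "h \<in> carrier A"
    then show "f \<otimes>\<^bsub>A\<^esub> g \<otimes>\<^bsub>A\<^esub> h = f \<otimes>\<^bsub>A\<^esub> (g \<otimes>\<^bsub>A\<^esub> h)"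
      by (simp add: A_simps(2) fun_eq_iff conv_assoc A_val)
  qed (auto simp: A_simps(2,3) conv_A mo_A conv_mo_Nil conv_mo_Nil_r A_val)
qed (auto simp: A_simps(2,5) conv_add_l conv_add_r A_val)

sublocale A: ring A by (rule ring_A)

lemma smult_A: "c \<in> carrier K \<Longrightarrow> f \<in> carrier A \<Longrightarrow> c \<odot>\<^bsub>A\<^esub> f \<in> carrier A"
  unfolding A_simps(6) by (rule A_map[where f=f]) (auto simp: A_val)

lemma smult_mult_l: "c \<in> carrier K \<Longrightarrow> f \<in> carrier A \<Longrightarrow> g \<in> carrier A \<Longrightarrow> (c \<odot>\<^bsub>A\<^esub> f) \<otimes>\<^bsub>A\<^esub> g = c \<odot>\<^bsub>A\<^esub> (f \<otimes>\<^bsub>A\<^esub> g)"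
  by (simp add: A_simps(2,6) fun_eq_iff conv_smult_l A_val)

lemma smult_mult_r: "c \<in> carrier K \<Longrightarrow> f \<in> carrier A \<Longrightarrow> g \<in> carrier A \<Longrightarrow> f \<otimes>\<^bsub>A\<^esub> (c \<odot>\<^bsub>A\<^esub> g) = c \<odot>\<^bsub>A\<^esub> (f \<otimes>\<^bsub>A\<^esub> g)"
  by (simp add: A_simps(2,6) fun_eq_iff conv_smult_r A_val)

lemma mo_mult: "mo u \<otimes>\<^bsub>A\<^esub> mo v = mo (u @ v)"
  unfolding A_simps(2) by (rule conv_mo_mo)

text \<open>f is the sum of its monomials. As only words in the support of f have to be treated,
  properties of this support, such as a fixed degree or the absence of the empty word, are at
  hand.\<close>

lemma A_span:
  assumes f: "f \<in> carrier A" and H: "subgroup H (add_monoid A)"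
    and mo: "\<And>c u. c \<in> carrier K \<Longrightarrow> u \<in> lists X \<Longrightarrow> f u \<noteq> \<zero> \<Longrightarrow> c \<odot>\<^bsub>A\<^esub> mo u \<in> H"
  shows "f \<in> H"
proof -
  note HD = add_subgroupD[OF H A.abelian_group_axioms]
  \<comment> \<open>The induction runs over functions h that are supported in a finite subset S of
    the support of f.\<close>
  have ind: "finite S \<Longrightarrow> (\<And>u. u \<in> S \<Longrightarrow> f u \<noteq> \<zero>) \<Longrightarrow> h \<in> carrier A \<Longrightarrow> {u. h u \<noteq> \<zero>} \<subseteq> S \<Longrightarrow> h \<in> H" for S h
  proof (induction S arbitrary: h rule: finite_induct)
    case empty
    then have "h = \<zero>\<^bsub>A\<^esub>" unfolding A_simps by auto
    then show ?case using HD(2) by simp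
  next
    case (insert u S)
    let ?h = "\<lambda>w. if w = u then \<zero> else h w"
    have hA: "?h \<in> carrier A" by (rule A_map[OF insert.prems(2)]) (use A_val[OF insert.prems(2)] in auto)
    have "?h \<in> H" by (rule insert.IH) (use insert hA in auto)
    moreover have "h u \<odot>\<^bsub>A\<^esub> mo u \<in> H"
      by (rule mo) (use A_val[OF insert.prems(2)] A_supp(2)[OF f] insert.prems(1) in auto)
    moreover have "h = ?h \<oplus>\<^bsub>A\<^esub> h u \<odot>\<^bsub>A\<^esub> mo u"
      unfolding A_simps(5,6) word_monom_def using A_val[OF insert.prems(2)] by (auto simp: fun_eq_iff)
    ultimately show ?case using HD(3)[of ?h "h u \<odot>\<^bsub>A\<^esub> mo u"] by simp
  qed
  show ?thesis by (rule ind[OF A_supp(1)[OF f] _ f]) simp_all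
qed

end

section \<open>The Leavitt path algebra as a graded quotient\<close>

locale lpa_field = field K + E?: fin_digraph E
  for K :: "('k, 'c) ring_scheme" (structure) and E :: "('v, 'e) pre_digraph"

sublocale lpa_field \<subseteq> freealg K "lpa_gens E"
  by unfold_locales

context lpa_field
begin

abbreviation "L \<equiv> leavitt_path_algebra K E"

definition J where "J = Idl\<^bsub>A\<^esub> (lpa_relators K E)"
abbreviation "Q \<equiv> A Quot J"
definition q where "q f = J +>\<^bsub>A\<^esub> f"
definition Ap where "Ap = {f \<in> carrier A. f [] = \<zero>}"
definition u1 where "u1 = (\<Oplus>\<^bsub>A\<^esub>v\<in>verts E. mo [Vert v])"

abbreviation deg :: "('v, 'e) lpa_gen list \<Rightarrow> int" where "deg w \<equiv> sum_list (map gen_deg w)"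

definition homog :: "int \<Rightarrow> (('v, 'e) lpa_gen list \<Rightarrow> 'k) \<Rightarrow> bool" where
  "homog n f \<longleftrightarrow> (\<forall>w. f w \<noteq> \<zero> \<longrightarrow> deg w = n)"

definition hp :: "int \<Rightarrow> (('v, 'e) lpa_gen list \<Rightarrow> 'k) \<Rightarrow> ('v, 'e) lpa_gen list \<Rightarrow> 'k" where
  "hp n f = (\<lambda>w. if deg w = n then f w else \<zero>)"

lemma L_simps:
  "carrier L = q ` Ap" "monoid.mult L = monoid.mult Q" "\<one>\<^bsub>L\<^esub> = q u1" "\<zero>\<^bsub>L\<^esub> = \<zero>\<^bsub>Q\<^esub>" "add L = add Q"
  "c \<odot>\<^bsub>L\<^esub> X = (\<Union>f\<in>X. q (c \<odot>\<^bsub>A\<^esub> f))" "grade L n = q ` {f \<in> Ap. homog n f}"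
  unfolding leavitt_path_algebra_def Let_def q_def J_def Ap_def u1_def homog_def by simp_all

lemma gens [simp]:
  "v \<in> verts E \<Longrightarrow> Vert v \<in> lpa_gens E" "e \<in> arcs E \<Longrightarrow> Edge e \<in> lpa_gens E" "e \<in> arcs E \<Longrightarrow> Ghost e \<in> lpa_gens E"
  unfolding lpa_gens_def by auto

lemma homog_mo: "deg u = n \<Longrightarrow> homog n (mo u)"
  unfolding homog_def word_monom_def by simp

lemma homog_zero: "homog n \<zero>\<^bsub>A\<^esub>" unfolding homog_def A_simps by simp

lemma homog_add: "f \<in> carrier A \<Longrightarrow> g \<in> carrier A \<Longrightarrow> homog n f \<Longrightarrow> homog n g \<Longrightarrow> homog n (f \<oplus>\<^bsub>A\<^esub> g)"
  unfolding homog_def A_simps using A_val by (metis l_zero r_zero zero_closed)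

lemma homog_smult: "f \<in> carrier A \<Longrightarrow> c \<in> carrier K \<Longrightarrow> homog n f \<Longrightarrow> homog n (c \<odot>\<^bsub>A\<^esub> f)"
  unfolding homog_def A_simps using r_null by (metis (no_types, lifting))

lemma neg_A: "f \<in> carrier A \<Longrightarrow> \<ominus>\<^bsub>A\<^esub> f = (\<lambda>w. \<ominus> f w)"
proof (rule A.minus_equality)
  assume f: "f \<in> carrier A"
  show "(\<lambda>w. \<ominus> f w) \<oplus>\<^bsub>A\<^esub> f = \<zero>\<^bsub>A\<^esub>" unfolding A_simps using A_val[OF f] by (simp add: l_neg)
  show "(\<lambda>w. \<ominus> f w) \<in> carrier A" by (rule A_map[OF f]) (use A_val[OF f] in auto)
qed

lemma homog_neg: "f \<in> carrier A \<Longrightarrow> homog n f \<Longrightarrow> homog n (\<ominus>\<^bsub>A\<^esub> f)"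
  by (auto simp: neg_A homog_def) (metis minus_zero)

lemma homog_mult:
  assumes "f \<in> carrier A" "g \<in> carrier A" "homog m f" "homog n g" shows "homog (m + n) (f \<otimes>\<^bsub>A\<^esub> g)"
  unfolding homog_def
proof (intro allI impI)
  fix w assume "(f \<otimes>\<^bsub>A\<^esub> g) w \<noteq> \<zero>"
  then have "conv f g w \<noteq> \<zero>" unfolding A_simps .
  then obtain u v where "w = u @ v" "f u \<noteq> \<zero>" "g v \<noteq> \<zero>" by (rule conv_supp[OF A_val[OF assms(1)] A_val[OF assms(2)]])
  then show "deg w = m + n" using assms(3,4) unfolding homog_def by simp
qed

lemma homog_subgroup: "subgroup {f \<in> carrier A. homog n f} (add_monoid A)"
proof (rule add_subgroupI[OF A.abelian_group_axioms])
  fix f assume f: "f \<in> {f \<in> carrier A. homog n f}"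
  then show "\<exists>g\<in>{f \<in> carrier A. homog n f}. g \<oplus>\<^bsub>A\<^esub> f = \<zero>\<^bsub>A\<^esub>"
    by (intro bexI[of _ "\<ominus>\<^bsub>A\<^esub> f"]) (auto simp: A.l_neg homog_neg)
qed (auto simp: homog_zero homog_add)

lemma homog_finsum: "(\<And>i. i \<in> S \<Longrightarrow> f i \<in> carrier A \<and> homog n (f i)) \<Longrightarrow> homog n (finsum A f S)"
  using A.finsum_in_subgroup[OF homog_subgroup, of f S n] by auto

text \<open>Both sides of each relation have the same degree, which is why the ideal generated by
  the relators is graded.\<close>

lemma relators_homog: "r \<in> lpa_relators K E \<Longrightarrow> r \<in> carrier A \<and> (\<exists>n. homog n r)"
proof -
  have mm: "mo u \<ominus>\<^bsub>A\<^esub> mo v \<in> carrier A \<and> (\<exists>n. homog n (mo u \<ominus>\<^bsub>A\<^esub> mo v))"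
    if "u \<in> lists (lpa_gens E)" "v \<in> lists (lpa_gens E)" "deg u = deg v" for u v
  proof -
    have A: "mo u \<in> carrier A" "\<ominus>\<^bsub>A\<^esub> mo v \<in> carrier A" using that mo_A by auto
    have "homog (deg v) (mo u \<oplus>\<^bsub>A\<^esub> \<ominus>\<^bsub>A\<^esub> mo v)"
      by (rule homog_add[OF A]) (use that in \<open>auto intro: homog_neg homog_mo mo_A\<close>)
    then show ?thesis using A A.a_closed unfolding A.minus_eq by blast
  qed
  have m0: "mo u \<ominus>\<^bsub>A\<^esub> \<zero>\<^bsub>A\<^esub> \<in> carrier A \<and> (\<exists>n. homog n (mo u \<ominus>\<^bsub>A\<^esub> \<zero>\<^bsub>A\<^esub>))" if "u \<in> lists (lpa_gens E)" for u
    using that mo_A homog_mo by (auto simp: A.minus_eq)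
  assume r: "r \<in> lpa_relators K E"
  consider u v where "u \<in> verts E" "v \<in> verts E" "r = mo [Vert u, Vert v] \<ominus>\<^bsub>A\<^esub> (if u = v then mo [Vert u] else \<zero>\<^bsub>A\<^esub>)"
    | e where "e \<in> arcs E" "r = mo [Vert (tail E e), Edge e] \<ominus>\<^bsub>A\<^esub> mo [Edge e]"
    | e where "e \<in> arcs E" "r = mo [Edge e, Vert (head E e)] \<ominus>\<^bsub>A\<^esub> mo [Edge e]"
    | e where "e \<in> arcs E" "r = mo [Vert (head E e), Ghost e] \<ominus>\<^bsub>A\<^esub> mo [Ghost e]"
    | e where "e \<in> arcs E" "r = mo [Ghost e, Vert (tail E e)] \<ominus>\<^bsub>A\<^esub> mo [Ghost e]"
    | v where "v \<in> verts E" "r = (\<Oplus>\<^bsub>A\<^esub>e \<in> {e \<in> arcs E. tail E e = v}. mo [Edge e, Ghost e]) \<ominus>\<^bsub>A\<^esub> mo [Vert v]"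
    | e f where "e \<in> arcs E" "f \<in> arcs E" "r = mo [Ghost e, Edge f] \<ominus>\<^bsub>A\<^esub> (if e = f then mo [Vert (head E e)] else \<zero>\<^bsub>A\<^esub>)"
    using r unfolding lpa_relators_def Let_def by blast
  then show ?thesis
  proof cases
    case 1 then show ?thesis using mm[of "[Vert u, Vert v]" "[Vert u]"] m0[of "[Vert u, Vert v]"] by (cases "u = v") simp_all
  next
    case 2 then show ?thesis using mm[of "[Vert (tail E e), Edge e]" "[Edge e]"] by simp
  next
    case 3 then show ?thesis using mm[of "[Edge e, Vert (head E e)]" "[Edge e]"] by simp
  next
    case 4 then show ?thesis using mm[of "[Vert (head E e), Ghost e]" "[Ghost e]"] by simp
  next
    case 5 then show ?thesis using mm[of "[Ghost e, Vert (tail E e)]" "[Ghost e]"] by simp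
  next
    case 6
    let ?s = "\<Oplus>\<^bsub>A\<^esub>e \<in> {e \<in> arcs E. tail E e = v}. mo [Edge e, Ghost e]"
    have s: "?s \<in> carrier A" "homog 0 ?s"
      by (auto intro!: A.finsum_closed homog_finsum mo_A homog_mo)
    then have "homog 0 (?s \<ominus>\<^bsub>A\<^esub> mo [Vert v])"
      unfolding A.minus_eq using 6 by (intro homog_add homog_neg homog_mo mo_A A.a_inv_closed) auto
    then show ?thesis using s 6 mo_A by auto
  next
    case 7 then show ?thesis using mm[of "[Ghost e, Edge f]" "[Vert (head E e)]"] m0[of "[Ghost e, Edge f]"] by (cases "e = f") simp_all
  qed
qed

lemma relators_A: "lpa_relators K E \<subseteq> carrier A" using relators_homog by blast

lemma ideal_J: "ideal J A" unfolding J_def by (rule A.genideal_ideal[OF relators_A])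

sublocale J: ideal J A by (rule ideal_J)
sublocale Q: ring Q by (rule J.quotient_is_ring)

lemma relator_J: "r \<in> lpa_relators K E \<Longrightarrow> r \<in> J"
  unfolding J_def using A.genideal_self[OF relators_A] by blast

lemma hp_closed: "f \<in> carrier A \<Longrightarrow> hp n f \<in> carrier A"
  by (rule A_map[of f]) (auto simp: hp_def A_val)

lemma hp_homog: "homog n (hp n f)" unfolding homog_def hp_def by simp

lemma hp_of_homog: "homog m f \<Longrightarrow> hp n f = (if n = m then f else \<zero>\<^bsub>A\<^esub>)"
  unfolding homog_def hp_def A_simps by (simp add: fun_eq_iff) metis

lemma hp_add: "f \<in> carrier A \<Longrightarrow> g \<in> carrier A \<Longrightarrow> hp n (f \<oplus>\<^bsub>A\<^esub> g) = hp n f \<oplus>\<^bsub>A\<^esub> hp n g"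
  unfolding hp_def A_simps by (auto simp: fun_eq_iff A_val)

lemma hp_mult_l:
  assumes f: "f \<in> carrier A" and g: "g \<in> carrier A" and h: "homog m g"
  shows "hp n (f \<otimes>\<^bsub>A\<^esub> g) = hp (n - m) f \<otimes>\<^bsub>A\<^esub> g"
proof
  fix w
  have "deg w = deg (take i w) + deg (drop i w)" for i
    by (metis append_take_drop_id map_append sum_list_append)
  then have d: "g (drop i w) \<noteq> \<zero> \<Longrightarrow> deg w = deg (take i w) + m" for i using h unfolding homog_def by metis
  have v: "f u \<in> carrier K" "g u \<in> carrier K" for u using A_val f g by auto
  show "hp n (f \<otimes>\<^bsub>A\<^esub> g) w = (hp (n - m) f \<otimes>\<^bsub>A\<^esub> g) w"
  proof (cases "deg w = n")
    case True
    have "f (take i w) \<otimes> g (drop i w) = hp (n - m) f (take i w) \<otimes> g (drop i w)" for i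
      using d[of i] True v by (cases "g (drop i w) = \<zero>") (auto simp: hp_def)
    then have "conv f g w = conv (hp (n - m) f) g w" unfolding conv_def by simp
    then show ?thesis using True unfolding A_simps by (simp add: hp_def)
  next
    case False
    have "hp (n - m) f (take i w) \<otimes> g (drop i w) = \<zero>" for i
      using d[of i] False v by (cases "g (drop i w) = \<zero>") (auto simp: hp_def)
    then have "conv (hp (n - m) f) g w = \<zero>" unfolding conv_def by (simp add: finsum_eq_zero)
    then show ?thesis using False unfolding A_simps by (simp add: hp_def)
  qed
qed

lemma hp_mult_r:
  assumes f: "f \<in> carrier A" and g: "g \<in> carrier A" and h: "homog m g"
  shows "hp n (g \<otimes>\<^bsub>A\<^esub> f) = g \<otimes>\<^bsub>A\<^esub> hp (n - m) f"
proof
  fix w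
  have "deg w = deg (take i w) + deg (drop i w)" for i
    by (metis append_take_drop_id map_append sum_list_append)
  then have d: "g (take i w) \<noteq> \<zero> \<Longrightarrow> deg w = m + deg (drop i w)" for i using h unfolding homog_def by metis
  have v: "f u \<in> carrier K" "g u \<in> carrier K" for u using A_val f g by auto
  show "hp n (g \<otimes>\<^bsub>A\<^esub> f) w = (g \<otimes>\<^bsub>A\<^esub> hp (n - m) f) w"
  proof (cases "deg w = n")
    case True
    have "g (take i w) \<otimes> f (drop i w) = g (take i w) \<otimes> hp (n - m) f (drop i w)" for i
      using d[of i] True v by (cases "g (take i w) = \<zero>") (auto simp: hp_def)
    then have "conv g f w = conv g (hp (n - m) f) w" unfolding conv_def by simp
    then show ?thesis using True unfolding A_simps by (simp add: hp_def)
  next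
    case False
    have "g (take i w) \<otimes> hp (n - m) f (drop i w) = \<zero>" for i
      using d[of i] False v by (cases "g (take i w) = \<zero>") (auto simp: hp_def)
    then have "conv g (hp (n - m) f) w = \<zero>" unfolding conv_def by (simp add: finsum_eq_zero)
    then show ?thesis using False unfolding A_simps by (simp add: hp_def)
  qed
qed

lemma J_subgroup: "subgroup J (add_monoid A)" using J.a_subgroup by simp

lemma hp_neg: "f \<in> carrier A \<Longrightarrow> hp n (\<ominus>\<^bsub>A\<^esub> f) = \<ominus>\<^bsub>A\<^esub> hp n f"
  by (simp add: neg_A hp_closed) (auto simp: hp_def fun_eq_iff)

text \<open>J is a graded ideal: the elements all of whose homogeneous parts lie in J form an ideal,
  and it contains the homogeneous relators.\<close>

lemma hp_J: assumes "f \<in> J" shows "hp n f \<in> J"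
proof -
  let ?J = "{f \<in> carrier A. \<forall>n. hp n f \<in> J}"
  note JD = add_subgroupD[OF J_subgroup A.abelian_group_axioms]
  have Hsub: "subgroup {a \<in> carrier A. \<forall>n. F n a \<in> J} (add_monoid A)"
    if add: "\<And>n a b. a \<in> carrier A \<Longrightarrow> b \<in> carrier A \<Longrightarrow> F n (a \<oplus>\<^bsub>A\<^esub> b) = F n a \<oplus>\<^bsub>A\<^esub> F n b"
      and neg: "\<And>n a. a \<in> carrier A \<Longrightarrow> F n (\<ominus>\<^bsub>A\<^esub> a) = \<ominus>\<^bsub>A\<^esub> F n a"
      and zero: "\<And>n. F n \<zero>\<^bsub>A\<^esub> = \<zero>\<^bsub>A\<^esub>" for F :: "int \<Rightarrow> _ \<Rightarrow> _"
  proof (rule add_subgroupI[OF A.abelian_group_axioms])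
    fix a assume "a \<in> {a \<in> carrier A. \<forall>n. F n a \<in> J}"
    then show "\<exists>b\<in>{a \<in> carrier A. \<forall>n. F n a \<in> J}. b \<oplus>\<^bsub>A\<^esub> a = \<zero>\<^bsub>A\<^esub>"
      using neg JD(4) by (intro bexI[of _ "\<ominus>\<^bsub>A\<^esub> a"]) (auto simp: A.l_neg)
  qed (use add zero JD in auto)
  have hp0: "hp n \<zero>\<^bsub>A\<^esub> = \<zero>\<^bsub>A\<^esub>" for n unfolding hp_def A_simps by auto
  have sub: "subgroup ?J (add_monoid A)" by (rule Hsub) (auto simp: hp_add hp_neg hp0)
  have J': "ideal ?J A"
  proof (rule idealI[OF ring_A])
    show "subgroup ?J (add_monoid A)" by (rule sub)
  next
    fix f a assume f: "f \<in> ?J" and a: "a \<in> carrier A"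
    then have fA: "f \<in> carrier A" by blast
    \<comment> \<open>The homogeneous parts of a product are easy to compute if one factor is
      homogeneous, so a is reduced to monomials.\<close>
    have "a \<in> {a \<in> carrier A. \<forall>n. hp n (a \<otimes>\<^bsub>A\<^esub> f) \<in> J}"
    proof (rule A_span[OF a])
      show "subgroup {a \<in> carrier A. \<forall>n. hp n (a \<otimes>\<^bsub>A\<^esub> f) \<in> J} (add_monoid A)"
        by (rule Hsub) (use fA in \<open>auto simp: A.l_distr hp_add hp_neg hp0 A.l_minus\<close>)
      fix c u assume c: "c \<in> carrier K" and u: "u \<in> lists (lpa_gens E)"
      have cm: "c \<odot>\<^bsub>A\<^esub> mo u \<in> carrier A" using smult_A[OF c mo_A[OF u]] .
      have "homog (deg u) (c \<odot>\<^bsub>A\<^esub> mo u)" by (rule homog_smult[OF mo_A[OF u] c homog_mo]) simp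
      then show "c \<odot>\<^bsub>A\<^esub> mo u \<in> {a \<in> carrier A. \<forall>n. hp n (a \<otimes>\<^bsub>A\<^esub> f) \<in> J}"
        using hp_mult_r[OF fA cm] f cm J.I_l_closed by auto
    qed
    then show "a \<otimes>\<^bsub>A\<^esub> f \<in> ?J" using a fA by auto
    have "a \<in> {a \<in> carrier A. \<forall>n. hp n (f \<otimes>\<^bsub>A\<^esub> a) \<in> J}"
    proof (rule A_span[OF a])
      show "subgroup {a \<in> carrier A. \<forall>n. hp n (f \<otimes>\<^bsub>A\<^esub> a) \<in> J} (add_monoid A)"
        by (rule Hsub) (use fA in \<open>auto simp: A.r_distr hp_add hp_neg hp0 A.r_minus\<close>)
      fix c u assume c: "c \<in> carrier K" and u: "u \<in> lists (lpa_gens E)"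
      have cm: "c \<odot>\<^bsub>A\<^esub> mo u \<in> carrier A" using smult_A[OF c mo_A[OF u]] .
      have "homog (deg u) (c \<odot>\<^bsub>A\<^esub> mo u)" by (rule homog_smult[OF mo_A[OF u] c homog_mo]) simp
      then show "c \<odot>\<^bsub>A\<^esub> mo u \<in> {a \<in> carrier A. \<forall>n. hp n (f \<otimes>\<^bsub>A\<^esub> a) \<in> J}"
        using hp_mult_l[OF fA cm] f cm J.I_r_closed by auto
    qed
    then show "f \<otimes>\<^bsub>A\<^esub> a \<in> ?J" using a fA by auto
  qed
  have "r \<in> ?J" if r: "r \<in> lpa_relators K E" for r
  proof -
    obtain m where m: "homog m r" "r \<in> carrier A" using relators_homog[OF r] by blast
    then show ?thesis using hp_of_homog[OF m(1)] relator_J[OF r] JD(2) by simp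
  qed
  then have "J \<subseteq> ?J" unfolding J_def[of] using A.genideal_minimal[OF J'] by (auto simp: J_def)
  then show ?thesis using assms by blast
qed

lemma q_hom: "q \<in> ring_hom A Q"
  using J.rcos_ring_hom unfolding q_def[abs_def] .

lemma q_add: "f \<in> carrier A \<Longrightarrow> g \<in> carrier A \<Longrightarrow> q (f \<oplus>\<^bsub>A\<^esub> g) = q f \<oplus>\<^bsub>Q\<^esub> q g"
  and q_mult: "f \<in> carrier A \<Longrightarrow> g \<in> carrier A \<Longrightarrow> q (f \<otimes>\<^bsub>A\<^esub> g) = q f \<otimes>\<^bsub>Q\<^esub> q g"
  and q_closed [simp]: "f \<in> carrier A \<Longrightarrow> q f \<in> carrier Q"
  using q_hom unfolding ring_hom_def by auto

lemma q_eq_iff: "f \<in> carrier A \<Longrightarrow> g \<in> carrier A \<Longrightarrow> q f = q g \<longleftrightarrow> f \<ominus>\<^bsub>A\<^esub> g \<in> J"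
  using A.quotient_eq_iff_same_a_r_cos[OF ideal_J] unfolding q_def by simp

lemma q_zero: "q \<zero>\<^bsub>A\<^esub> = \<zero>\<^bsub>Q\<^esub>"
  using q_add[of "\<zero>\<^bsub>A\<^esub>" "\<zero>\<^bsub>A\<^esub>"] q_closed[of "\<zero>\<^bsub>A\<^esub>"] by simp

lemma q_finsum: "(\<And>i. i \<in> S \<Longrightarrow> f i \<in> carrier A) \<Longrightarrow> q (finsum A f S) = (\<Oplus>\<^bsub>Q\<^esub>i\<in>S. q (f i))"
  by (rule finsum_hom[OF A.abelian_group_axioms Q.abelian_group_axioms]) (auto simp: q_add)

lemma scalar_smult: "c \<in> carrier K \<Longrightarrow> f \<in> carrier A \<Longrightarrow> c \<odot>\<^bsub>A\<^esub> f = (c \<odot>\<^bsub>A\<^esub> \<one>\<^bsub>A\<^esub>) \<otimes>\<^bsub>A\<^esub> f"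
  by (simp add: smult_mult_l)

text \<open>The scalar action on the quotient is a union over a coset. It is well defined because
  multiplying by c is multiplying by the element c 1 of A, and J is an ideal.\<close>

lemma q_smult:
  assumes c: "c \<in> carrier K" and f: "f \<in> carrier A" shows "c \<odot>\<^bsub>L\<^esub> q f = q (c \<odot>\<^bsub>A\<^esub> f)"
proof -
  have "q (c \<odot>\<^bsub>A\<^esub> g) = q (c \<odot>\<^bsub>A\<^esub> f)" if g: "g \<in> q f" for g
  proof -
    have gA: "g \<in> carrier A" using g f J.a_elemrcos_carrier unfolding q_def by blast
    have "q f = q g" using J.a_repr_independence'[OF g[unfolded q_def] f] unfolding q_def .
    then show ?thesis
      unfolding scalar_smult[OF c gA] scalar_smult[OF c f] q_mult[OF smult_A[OF c A.one_closed] gA]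
        q_mult[OF smult_A[OF c A.one_closed] f] by simp
  qed
  moreover have "f \<in> q f" unfolding q_def by (rule J.a_rcos_self[OF f])
  ultimately show ?thesis unfolding L_simps by blast
qed

end

context lpa_field
begin

lemma Ap_A: "f \<in> Ap \<Longrightarrow> f \<in> carrier A" unfolding Ap_def by simp

lemma Ap_subgroup: "subgroup Ap (add_monoid A)"
proof (rule add_subgroupI[OF A.abelian_group_axioms])
  fix f assume f: "f \<in> Ap"
  then show "\<exists>g\<in>Ap. g \<oplus>\<^bsub>A\<^esub> f = \<zero>\<^bsub>A\<^esub>"
    by (intro bexI[of _ "\<ominus>\<^bsub>A\<^esub> f"]) (simp add: Ap_def A.l_neg, insert neg_A[of f] A.a_inv_closed[of f], auto simp: Ap_def)
qed (auto simp: Ap_def A_simps(4,5) A_add A.zero_closed[unfolded A_simps(4)])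

lemma Ap_add: "f \<in> Ap \<Longrightarrow> g \<in> Ap \<Longrightarrow> f \<oplus>\<^bsub>A\<^esub> g \<in> Ap"
  and Ap_neg: "f \<in> Ap \<Longrightarrow> \<ominus>\<^bsub>A\<^esub> f \<in> Ap" and Ap_zero: "\<zero>\<^bsub>A\<^esub> \<in> Ap"
  using add_subgroupD[OF Ap_subgroup A.abelian_group_axioms] by auto

lemma Ap_mult: "f \<in> Ap \<Longrightarrow> g \<in> Ap \<Longrightarrow> f \<otimes>\<^bsub>A\<^esub> g \<in> Ap"
  using A.m_closed[of f g] unfolding Ap_def A_simps by (auto simp: conv_Nil)

lemma Ap_smult: "c \<in> carrier K \<Longrightarrow> f \<in> Ap \<Longrightarrow> c \<odot>\<^bsub>A\<^esub> f \<in> Ap"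
  using smult_A[of c f] unfolding Ap_def A_simps(6) by auto

lemma Ap_mo: "w \<in> lists (lpa_gens E) \<Longrightarrow> w \<noteq> [] \<Longrightarrow> mo w \<in> Ap"
  unfolding Ap_def using mo_A[of w] by (auto simp: word_monom_def)

lemma Ap_hp: "f \<in> Ap \<Longrightarrow> hp n f \<in> Ap"
  unfolding Ap_def using hp_closed by (auto simp: hp_def)

lemma u1_Ap: "u1 \<in> Ap"
  unfolding u1_def by (rule A.finsum_in_subgroup[OF Ap_subgroup]) (auto intro: Ap_mo)

lemma u1_homog: "homog 0 u1"
  unfolding u1_def by (rule homog_finsum) (auto intro: mo_A homog_mo)

lemma L_cases: assumes "X \<in> carrier L" obtains f where "f \<in> Ap" "X = q f"
  using assms unfolding L_simps by blast

lemma q_L: "f \<in> Ap \<Longrightarrow> q f \<in> carrier L" unfolding L_simps by blast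

lemma L_Q: "X \<in> carrier L \<Longrightarrow> X \<in> carrier Q"
  by (erule L_cases) (simp add: Ap_A)

definition gm :: "('v, 'e) lpa_gen \<Rightarrow> (('v, 'e) lpa_gen list \<Rightarrow> 'k) set" where "gm g = q (mo [g])"

lemma gm_L: "g \<in> lpa_gens E \<Longrightarrow> gm g \<in> carrier L"
  unfolding gm_def by (rule q_L) (auto intro: Ap_mo)

lemma gm_Q: "g \<in> lpa_gens E \<Longrightarrow> gm g \<in> carrier Q"
  using gm_L L_Q by blast

lemma q_mo_Cons: "g \<in> lpa_gens E \<Longrightarrow> w \<in> lists (lpa_gens E) \<Longrightarrow> q (mo (g # w)) = gm g \<otimes>\<^bsub>Q\<^esub> q (mo w)"
  unfolding gm_def using q_mult[of "mo [g]" "mo w"] mo_mult[of "[g]" w] mo_A by simp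

lemma q_mo2: "g \<in> lpa_gens E \<Longrightarrow> h \<in> lpa_gens E \<Longrightarrow> q (mo [g, h]) = gm g \<otimes>\<^bsub>Q\<^esub> gm h"
  using q_mo_Cons[of g "[h]"] unfolding gm_def by simp

lemma q_relator: "f \<ominus>\<^bsub>A\<^esub> g \<in> lpa_relators K E \<Longrightarrow> f \<in> carrier A \<Longrightarrow> g \<in> carrier A \<Longrightarrow> q f = q g"
  using q_eq_iff relator_J by blast

lemma gm_vt_vt:
  assumes "u \<in> verts E" "v \<in> verts E"
  shows "gm (Vert u) \<otimes>\<^bsub>Q\<^esub> gm (Vert v) = (if u = v then gm (Vert u) else \<zero>\<^bsub>Q\<^esub>)"
proof -
  have "mo [Vert u, Vert v] \<ominus>\<^bsub>A\<^esub> (if u = v then mo [Vert u] else \<zero>\<^bsub>A\<^esub>) \<in> lpa_relators K E"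
    using assms unfolding lpa_relators_def Let_def by blast
  then have "q (mo [Vert u, Vert v]) = q (if u = v then mo [Vert u] else \<zero>\<^bsub>A\<^esub>)"
    by (rule q_relator) (use assms mo_A in auto)
  then show ?thesis using assms q_mo2[of "Vert u" "Vert v"] q_zero by (cases "u = v") (simp_all add: gm_def[symmetric])
qed

lemma gm_vt_ed:
  assumes "e \<in> arcs E" shows "gm (Vert (tail E e)) \<otimes>\<^bsub>Q\<^esub> gm (Edge e) = gm (Edge e)"
proof -
  have "mo [Vert (tail E e), Edge e] \<ominus>\<^bsub>A\<^esub> mo [Edge e] \<in> lpa_relators K E"
    using assms unfolding lpa_relators_def Let_def by blast
  then have "q (mo [Vert (tail E e), Edge e]) = q (mo [Edge e])"
    by (rule q_relator) (use assms mo_A in auto)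
  then show ?thesis using assms q_mo2 unfolding gm_def[symmetric] by simp
qed

lemma gm_ed_vt:
  assumes "e \<in> arcs E" shows "gm (Edge e) \<otimes>\<^bsub>Q\<^esub> gm (Vert (head E e)) = gm (Edge e)"
proof -
  have "mo [Edge e, Vert (head E e)] \<ominus>\<^bsub>A\<^esub> mo [Edge e] \<in> lpa_relators K E"
    using assms unfolding lpa_relators_def Let_def by blast
  then have "q (mo [Edge e, Vert (head E e)]) = q (mo [Edge e])"
    by (rule q_relator) (use assms mo_A in auto)
  then show ?thesis using assms q_mo2 unfolding gm_def[symmetric] by simp
qed

lemma gm_vt_gh:
  assumes "e \<in> arcs E" shows "gm (Vert (head E e)) \<otimes>\<^bsub>Q\<^esub> gm (Ghost e) = gm (Ghost e)"
proof -
  have "mo [Vert (head E e), Ghost e] \<ominus>\<^bsub>A\<^esub> mo [Ghost e] \<in> lpa_relators K E"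
    using assms unfolding lpa_relators_def Let_def by blast
  then have "q (mo [Vert (head E e), Ghost e]) = q (mo [Ghost e])"
    by (rule q_relator) (use assms mo_A in auto)
  then show ?thesis using assms q_mo2 unfolding gm_def[symmetric] by simp
qed

lemma gm_gh_vt:
  assumes "e \<in> arcs E" shows "gm (Ghost e) \<otimes>\<^bsub>Q\<^esub> gm (Vert (tail E e)) = gm (Ghost e)"
proof -
  have "mo [Ghost e, Vert (tail E e)] \<ominus>\<^bsub>A\<^esub> mo [Ghost e] \<in> lpa_relators K E"
    using assms unfolding lpa_relators_def Let_def by blast
  then have "q (mo [Ghost e, Vert (tail E e)]) = q (mo [Ghost e])"
    by (rule q_relator) (use assms mo_A in auto)
  then show ?thesis using assms q_mo2 unfolding gm_def[symmetric] by simp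
qed

lemma gm_ck1:
  assumes "e \<in> arcs E" "f \<in> arcs E"
  shows "gm (Ghost e) \<otimes>\<^bsub>Q\<^esub> gm (Edge f) = (if e = f then gm (Vert (head E e)) else \<zero>\<^bsub>Q\<^esub>)"
proof -
  have "mo [Ghost e, Edge f] \<ominus>\<^bsub>A\<^esub> (if e = f then mo [Vert (head E e)] else \<zero>\<^bsub>A\<^esub>) \<in> lpa_relators K E"
    using assms unfolding lpa_relators_def Let_def by blast
  then have "q (mo [Ghost e, Edge f]) = q (if e = f then mo [Vert (head E e)] else \<zero>\<^bsub>A\<^esub>)"
    by (rule q_relator) (use assms mo_A in auto)
  then show ?thesis using assms q_mo2[of "Ghost e" "Edge f"] q_zero by (cases "e = f") (simp_all add: gm_def[symmetric])
qed

lemma gm_ck2: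
  assumes "v \<in> verts E" "out_arcs E v \<noteq> {}"
  shows "(\<Oplus>\<^bsub>Q\<^esub>e\<in>out_arcs E v. gm (Edge e) \<otimes>\<^bsub>Q\<^esub> gm (Ghost e)) = gm (Vert v)"
proof -
  have "(\<Oplus>\<^bsub>A\<^esub>e \<in> {e \<in> arcs E. tail E e = v}. mo [Edge e, Ghost e]) \<ominus>\<^bsub>A\<^esub> mo [Vert v] \<in> lpa_relators K E"
    using assms unfolding lpa_relators_def Let_def out_arcs_def by blast
  then have "q (\<Oplus>\<^bsub>A\<^esub>e \<in> {e \<in> arcs E. tail E e = v}. mo [Edge e, Ghost e]) = q (mo [Vert v])"
    by (rule q_relator) (rule A.finsum_closed, rule Pi_I, rule mo_A, simp, rule mo_A, simp add: assms)
  moreover have "q (\<Oplus>\<^bsub>A\<^esub>e \<in> {e \<in> arcs E. tail E e = v}. mo [Edge e, Ghost e])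
      = (\<Oplus>\<^bsub>Q\<^esub>e \<in> {e \<in> arcs E. tail E e = v}. q (mo [Edge e, Ghost e]))"
    by (rule q_finsum) (rule mo_A, simp)
  moreover have "\<dots> = (\<Oplus>\<^bsub>Q\<^esub>e\<in>out_arcs E v. gm (Edge e) \<otimes>\<^bsub>Q\<^esub> gm (Ghost e))"
    by (rule Q.finsum_cong') (use gm_Q in \<open>auto simp: q_mo2 out_arcs_def\<close>)
  ultimately show ?thesis unfolding gm_def[of "Vert v"] by simp
qed

lemma q_u1: "q u1 = (\<Oplus>\<^bsub>Q\<^esub>v\<in>verts E. gm (Vert v))"
  unfolding u1_def gm_def by (rule q_finsum) (auto intro: mo_A)

lemma u1_l:
  assumes "x \<in> verts E" "a \<in> carrier Q" "gm (Vert x) \<otimes>\<^bsub>Q\<^esub> a = a" shows "q u1 \<otimes>\<^bsub>Q\<^esub> a = a"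
proof -
  have "q u1 \<otimes>\<^bsub>Q\<^esub> a = (\<Oplus>\<^bsub>Q\<^esub>v\<in>verts E. gm (Vert v) \<otimes>\<^bsub>Q\<^esub> a)"
    unfolding q_u1 by (rule Q.finsum_ldistr) (use assms gm_Q in auto)
  also have "\<dots> = gm (Vert x) \<otimes>\<^bsub>Q\<^esub> a"
  proof (rule Q.finsum_eq_single)
    fix v assume v: "v \<in> verts E" "v \<noteq> x"
    have "gm (Vert v) \<otimes>\<^bsub>Q\<^esub> a = gm (Vert v) \<otimes>\<^bsub>Q\<^esub> gm (Vert x) \<otimes>\<^bsub>Q\<^esub> a"
      using assms v gm_Q by (simp add: Q.m_assoc)
    then show "gm (Vert v) \<otimes>\<^bsub>Q\<^esub> a = \<zero>\<^bsub>Q\<^esub>" using gm_vt_vt[OF v(1) assms(1)] v assms(2) by simp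
  qed (use assms gm_Q in auto)
  finally show ?thesis using assms by simp
qed

lemma u1_r:
  assumes "x \<in> verts E" "a \<in> carrier Q" "a \<otimes>\<^bsub>Q\<^esub> gm (Vert x) = a" shows "a \<otimes>\<^bsub>Q\<^esub> q u1 = a"
proof -
  have "a \<otimes>\<^bsub>Q\<^esub> q u1 = (\<Oplus>\<^bsub>Q\<^esub>v\<in>verts E. a \<otimes>\<^bsub>Q\<^esub> gm (Vert v))"
    unfolding q_u1 by (rule Q.finsum_rdistr) (use assms gm_Q in auto)
  also have "\<dots> = a \<otimes>\<^bsub>Q\<^esub> gm (Vert x)"
  proof (rule Q.finsum_eq_single)
    fix v assume v: "v \<in> verts E" "v \<noteq> x"
    have "a \<otimes>\<^bsub>Q\<^esub> gm (Vert v) = a \<otimes>\<^bsub>Q\<^esub> (gm (Vert x) \<otimes>\<^bsub>Q\<^esub> gm (Vert v))"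
      using assms v gm_Q by (simp add: Q.m_assoc[symmetric])
    then show "a \<otimes>\<^bsub>Q\<^esub> gm (Vert v) = \<zero>\<^bsub>Q\<^esub>" using gm_vt_vt[OF assms(1) v(1)] v assms(2) by simp
  qed (use assms gm_Q in auto)
  finally show ?thesis using assms by simp
qed

lemma u1_gm:
  assumes g: "g \<in> lpa_gens E" shows "q u1 \<otimes>\<^bsub>Q\<^esub> gm g = gm g" "gm g \<otimes>\<^bsub>Q\<^esub> q u1 = gm g"
proof -
  have "\<exists>x\<in>verts E. gm (Vert x) \<otimes>\<^bsub>Q\<^esub> gm g = gm g" "\<exists>x\<in>verts E. gm g \<otimes>\<^bsub>Q\<^esub> gm (Vert x) = gm g"
  proof -
    show "\<exists>x\<in>verts E. gm (Vert x) \<otimes>\<^bsub>Q\<^esub> gm g = gm g"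
    proof (cases g)
      case (Vert v) then show ?thesis using g gm_vt_vt[of v v] by (intro bexI[of _ "v"]) (auto simp: lpa_gens_def)
    next
      case (Edge e) then show ?thesis using g gm_vt_ed[of e] by (intro bexI[of _ "tail E e"]) (auto simp: lpa_gens_def)
    next
      case (Ghost e) then show ?thesis using g gm_vt_gh[of e] by (intro bexI[of _ "head E e"]) (auto simp: lpa_gens_def)
    qed
    show "\<exists>x\<in>verts E. gm g \<otimes>\<^bsub>Q\<^esub> gm (Vert x) = gm g"
    proof (cases g)
      case (Vert v) then show ?thesis using g gm_vt_vt[of v v] by (intro bexI[of _ "v"]) (auto simp: lpa_gens_def)
    next
      case (Edge e) then show ?thesis using g gm_ed_vt[of e] by (intro bexI[of _ "head E e"]) (auto simp: lpa_gens_def)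
    next
      case (Ghost e) then show ?thesis using g gm_gh_vt[of e] by (intro bexI[of _ "tail E e"]) (auto simp: lpa_gens_def)
    qed
  qed
  then obtain x y where x: "x \<in> verts E" "gm (Vert x) \<otimes>\<^bsub>Q\<^esub> gm g = gm g"
    and y: "y \<in> verts E" "gm g \<otimes>\<^bsub>Q\<^esub> gm (Vert y) = gm g" by (elim bexE)
  show "q u1 \<otimes>\<^bsub>Q\<^esub> gm g = gm g" by (rule u1_l[OF x(1) gm_Q[OF g] x(2)])
  show "gm g \<otimes>\<^bsub>Q\<^esub> q u1 = gm g" by (rule u1_r[OF y(1) gm_Q[OF g] y(2)])
qed

text \<open>The sum of the vertices fixes every generator on both sides, so it acts as a unit on all
  words that have a first and a last letter; the empty word is excluded by
  \<open>Ap\<close>.\<close>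

lemma u1_q:
  assumes f: "f \<in> Ap" shows "q u1 \<otimes>\<^bsub>Q\<^esub> q f = q f" "q f \<otimes>\<^bsub>Q\<^esub> q u1 = q f"
proof -
  have fA: "f \<in> carrier A" and f0: "f [] = \<zero>" using f unfolding Ap_def by auto
  have uQ: "q u1 \<in> carrier Q" using u1_Ap Ap_A by simp
  have "f \<in> {f \<in> carrier A. q u1 \<otimes>\<^bsub>Q\<^esub> q f = q f}"
  proof (rule A_span[OF fA])
    show "subgroup {f \<in> carrier A. q u1 \<otimes>\<^bsub>Q\<^esub> q f = q f} (add_monoid A)"
      by (rule additive_eq_subgroup[OF A.abelian_group_axioms Q.abelian_group_axioms]) (use uQ in \<open>auto simp: q_add Q.r_distr\<close>)
    fix c u assume c: "c \<in> carrier K" and u: "u \<in> lists (lpa_gens E)" and "f u \<noteq> \<zero>"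
    then obtain g w where gw: "u = g # w" "g \<in> lpa_gens E" "w \<in> lists (lpa_gens E)" using f0 by (cases u) auto
    have cw: "c \<odot>\<^bsub>A\<^esub> mo w \<in> carrier A" using smult_A[OF c mo_A[OF gw(3)]] .
    have "c \<odot>\<^bsub>A\<^esub> mo u = mo [g] \<otimes>\<^bsub>A\<^esub> (c \<odot>\<^bsub>A\<^esub> mo w)"
      using smult_mult_r[OF c, of "mo [g]" "mo w"] mo_A gw mo_mult[of "[g]" w] by simp
    then have "q (c \<odot>\<^bsub>A\<^esub> mo u) = gm g \<otimes>\<^bsub>Q\<^esub> q (c \<odot>\<^bsub>A\<^esub> mo w)" using q_mult[OF _ cw, of "mo [g]"] mo_A gw unfolding gm_def by simp
    then have "q u1 \<otimes>\<^bsub>Q\<^esub> q (c \<odot>\<^bsub>A\<^esub> mo u) = q (c \<odot>\<^bsub>A\<^esub> mo u)"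
      using u1_gm(1)[OF gw(2)] gm_Q[OF gw(2)] cw uQ by (simp add: Q.m_assoc[symmetric])
    then show "c \<odot>\<^bsub>A\<^esub> mo u \<in> {f \<in> carrier A. q u1 \<otimes>\<^bsub>Q\<^esub> q f = q f}" using smult_A[OF c mo_A[OF u]] by simp
  qed
  then show "q u1 \<otimes>\<^bsub>Q\<^esub> q f = q f" by simp
  have "f \<in> {f \<in> carrier A. q f \<otimes>\<^bsub>Q\<^esub> q u1 = q f}"
  proof (rule A_span[OF fA])
    show "subgroup {f \<in> carrier A. q f \<otimes>\<^bsub>Q\<^esub> q u1 = q f} (add_monoid A)"
      by (rule additive_eq_subgroup[OF A.abelian_group_axioms Q.abelian_group_axioms]) (use uQ in \<open>auto simp: q_add Q.l_distr\<close>)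
    fix c u assume c: "c \<in> carrier K" and u: "u \<in> lists (lpa_gens E)" and "f u \<noteq> \<zero>"
    then obtain g w where gw: "u = w @ [g]" "g \<in> lpa_gens E" "w \<in> lists (lpa_gens E)" using f0 by (cases u rule: rev_cases) auto
    have cw: "c \<odot>\<^bsub>A\<^esub> mo w \<in> carrier A" using smult_A[OF c mo_A[OF gw(3)]] .
    have "c \<odot>\<^bsub>A\<^esub> mo u = (c \<odot>\<^bsub>A\<^esub> mo w) \<otimes>\<^bsub>A\<^esub> mo [g]"
      using smult_mult_l[OF c, of "mo w" "mo [g]"] mo_A gw mo_mult[of w "[g]"] by simp
    then have "q (c \<odot>\<^bsub>A\<^esub> mo u) = q (c \<odot>\<^bsub>A\<^esub> mo w) \<otimes>\<^bsub>Q\<^esub> gm g" using q_mult[OF cw, of "mo [g]"] mo_A gw unfolding gm_def by simp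
    then have "q (c \<odot>\<^bsub>A\<^esub> mo u) \<otimes>\<^bsub>Q\<^esub> q u1 = q (c \<odot>\<^bsub>A\<^esub> mo u)"
      using u1_gm(2)[OF gw(2)] gm_Q[OF gw(2)] cw uQ by (simp add: Q.m_assoc)
    then show "c \<odot>\<^bsub>A\<^esub> mo u \<in> {f \<in> carrier A. q f \<otimes>\<^bsub>Q\<^esub> q u1 = q f}" using smult_A[OF c mo_A[OF u]] by simp
  qed
  then show "q f \<otimes>\<^bsub>Q\<^esub> q u1 = q f" by simp
qed

lemma abelian_L: "abelian_group L"
proof (rule abelian_groupI)
  fix X Y assume "X \<in> carrier L" "Y \<in> carrier L"
  then obtain f g where "f \<in> Ap" "X = q f" "g \<in> Ap" "Y = q g" by (metis L_cases)
  then show "X \<oplus>\<^bsub>L\<^esub> Y \<in> carrier L"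
    unfolding L_simps(5) using q_add Ap_A q_L[OF Ap_add] by simp
next
  show "\<zero>\<^bsub>L\<^esub> \<in> carrier L" using q_L[OF Ap_zero] q_zero unfolding L_simps(4) by simp
next
  fix X assume "X \<in> carrier L"
  then obtain f where f: "f \<in> Ap" "X = q f" by (rule L_cases)
  then show "\<exists>Y\<in>carrier L. Y \<oplus>\<^bsub>L\<^esub> X = \<zero>\<^bsub>L\<^esub>"
    using q_L[OF Ap_neg[OF f(1)]] q_add[of "\<ominus>\<^bsub>A\<^esub> f" f] Ap_A A.l_neg q_zero unfolding L_simps(4,5)
    by (intro bexI[of _ "q (\<ominus>\<^bsub>A\<^esub> f)"]) simp_all
qed (auto simp: L_simps(4,5) L_Q Q.a_ac)

lemma ring_L: "ring L"
proof (rule ringI[OF abelian_L])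
  show "monoid L"
  proof (rule monoidI)
    fix X Y assume "X \<in> carrier L" "Y \<in> carrier L"
    then obtain f g where "f \<in> Ap" "X = q f" "g \<in> Ap" "Y = q g" by (metis L_cases)
    then show "X \<otimes>\<^bsub>L\<^esub> Y \<in> carrier L"
      unfolding L_simps(2) using q_mult Ap_A q_L[OF Ap_mult] by metis
  next
    show "\<one>\<^bsub>L\<^esub> \<in> carrier L" using q_L[OF u1_Ap] unfolding L_simps(3) .
  next
    fix X assume "X \<in> carrier L"
    then obtain f where f: "f \<in> Ap" "X = q f" by (rule L_cases)
    show "\<one>\<^bsub>L\<^esub> \<otimes>\<^bsub>L\<^esub> X = X" "X \<otimes>\<^bsub>L\<^esub> \<one>\<^bsub>L\<^esub> = X" unfolding L_simps(2,3) f(2) using u1_q[OF f(1)] by simp_all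
  qed (auto simp: L_simps(2) L_Q Q.m_assoc)
qed (auto simp: L_simps(2,5) L_Q Q.l_distr Q.r_distr)

sublocale L: ring L by (rule ring_L)

lemma finsum_L: "F \<in> S \<rightarrow> carrier L \<Longrightarrow> finsum L F S = finsum Q F S"
  by (rule finsum_hom[where h="\<lambda>a. a", OF abelian_L Q.abelian_group_axioms]) (auto simp: L_Q L_simps(5))

lemma Lgrade_subgroup: "subgroup (grade L n) (add_monoid L)"
proof (rule add_subgroupI[OF abelian_L])
  show "grade L n \<subseteq> carrier L" unfolding L_simps by blast
  show "\<zero>\<^bsub>L\<^esub> \<in> grade L n" unfolding L_simps using Ap_zero homog_zero q_zero by (metis (mono_tags, lifting) image_eqI mem_Collect_eq)
next
  fix X Y assume "X \<in> grade L n" "Y \<in> grade L n"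
  then obtain f g where f: "f \<in> Ap" "X = q f" "homog n f" and g: "g \<in> Ap" "Y = q g" "homog n g" unfolding L_simps by blast
  have "f \<oplus>\<^bsub>A\<^esub> g \<in> {f \<in> Ap. homog n f}" using homog_add Ap_add Ap_A f g by blast
  moreover have "X \<oplus>\<^bsub>L\<^esub> Y = q (f \<oplus>\<^bsub>A\<^esub> g)" unfolding L_simps using q_add Ap_A f g by simp
  ultimately show "X \<oplus>\<^bsub>L\<^esub> Y \<in> grade L n" unfolding L_simps(7) by blast
next
  fix X assume "X \<in> grade L n"
  then obtain f where f: "f \<in> Ap" "X = q f" "homog n f" unfolding L_simps by blast
  have "\<ominus>\<^bsub>A\<^esub> f \<in> {f \<in> Ap. homog n f}" using homog_neg Ap_neg Ap_A f by blast
  moreover have "q (\<ominus>\<^bsub>A\<^esub> f) \<oplus>\<^bsub>L\<^esub> X = \<zero>\<^bsub>L\<^esub>"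
    unfolding L_simps using q_add[of "\<ominus>\<^bsub>A\<^esub> f" f] Ap_A f A.l_neg q_zero by simp
  ultimately show "\<exists>Y\<in>grade L n. Y \<oplus>\<^bsub>L\<^esub> X = \<zero>\<^bsub>L\<^esub>" unfolding L_simps(7) by blast
qed

lemma hp_sum:
  assumes f: "f \<in> carrier A"
  shows "f = (\<Oplus>\<^bsub>A\<^esub>n\<in>deg ` {w. f w \<noteq> \<zero>}. hp n f)"
proof
  fix w
  let ?D = "deg ` {w. f w \<noteq> \<zero>}"
  have fD: "finite ?D" using A_supp(1)[OF f] by simp
  have "(\<Oplus>\<^bsub>A\<^esub>n\<in>?D. hp n f) w = (\<Oplus>n\<in>?D. hp n f w)"
    by (rule finsum_hom[where h="\<lambda>f. f w", OF A.abelian_group_axioms abelian_group_axioms])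
      (auto simp: A_val hp_closed[OF f] A_simps(5))
  also have "\<dots> = f w"
  proof (cases "f w = \<zero>")
    case True then show ?thesis by (intro trans[OF finsum_eq_zero]) (auto simp: hp_def)
  next
    case False
    have "(\<Oplus>n\<in>?D. hp n f w) = hp (deg w) f w"
      by (rule finsum_eq_single[OF fD]) (use False A_val[OF f] in \<open>auto simp: hp_def\<close>)
    then show ?thesis by (simp add: hp_def)
  qed
  finally show "f w = (\<Oplus>\<^bsub>A\<^esub>n\<in>?D. hp n f) w" by simp
qed

definition lp :: "int \<Rightarrow> (('v, 'e) lpa_gen list \<Rightarrow> 'k) set \<Rightarrow> (('v, 'e) lpa_gen list \<Rightarrow> 'k) set" where
  "lp n X = q (hp n (SOME f. f \<in> Ap \<and> q f = X))"

text \<open>Two representatives differ by an element of J, whose homogeneous parts lie in J again;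
  so the choice in \<open>lp\<close> does not affect the result.\<close>

lemma lp_q: assumes f: "f \<in> Ap" shows "lp n (q f) = q (hp n f)"
proof -
  let ?g = "SOME g. g \<in> Ap \<and> q g = q f"
  have g: "?g \<in> Ap \<and> q ?g = q f" by (rule someI[of _ f]) (use f in simp)
  then have A: "?g \<in> carrier A" "f \<in> carrier A" using f Ap_A by auto
  have "hp n (?g \<ominus>\<^bsub>A\<^esub> f) \<in> J" by (rule hp_J) (use g A q_eq_iff in blast)
  then have "hp n ?g \<ominus>\<^bsub>A\<^esub> hp n f \<in> J" using A by (simp add: A.minus_eq hp_add hp_neg)
  then show ?thesis unfolding lp_def using q_eq_iff[OF hp_closed[OF A(1)] hp_closed[OF A(2)]] by simp
qed

lemma grring_L: "grring L"
proof (intro grring.intro grring_axioms.intro ring_L Lgrade_subgroup)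
  fix X m Y n assume "X \<in> grade L m" "Y \<in> grade L n"
  then obtain f g where f: "f \<in> Ap" "X = q f" "homog m f" and g: "g \<in> Ap" "Y = q g" "homog n g" unfolding L_simps by blast
  have "f \<otimes>\<^bsub>A\<^esub> g \<in> {f \<in> Ap. homog (m + n) f}" using homog_mult Ap_mult Ap_A f g by blast
  moreover have "X \<otimes>\<^bsub>L\<^esub> Y = q (f \<otimes>\<^bsub>A\<^esub> g)" unfolding L_simps using q_mult Ap_A f g by simp
  ultimately show "X \<otimes>\<^bsub>L\<^esub> Y \<in> grade L (m + n)" unfolding L_simps(7) by blast
next
  show "\<one>\<^bsub>L\<^esub> \<in> grade L 0" unfolding L_simps using u1_Ap u1_homog by blast
next
  fix X assume X: "X \<in> carrier L"
  then obtain f where f: "f \<in> Ap" "X = q f" by (rule L_cases)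
  have fA: "f \<in> carrier A" using f Ap_A by auto
  let ?D = "deg ` {w. f w \<noteq> \<zero>}"
  have fin: "finite ?D" using A_supp(1)[OF fA] by simp
  have out: "lp n X = \<zero>\<^bsub>L\<^esub>" if "n \<notin> ?D" for n
  proof -
    have "f w = \<zero>" if "deg w = n" for w using that \<open>n \<notin> ?D\<close> by blast
    then have "hp n f = \<zero>\<^bsub>A\<^esub>" unfolding hp_def A_simps by auto
    then show ?thesis unfolding f(2) lp_q[OF f(1)] L_simps using q_zero by simp
  qed
  then have sub: "{n. lp n X \<noteq> \<zero>\<^bsub>L\<^esub>} \<subseteq> ?D" by blast
  have lpL: "lp n Y \<in> grade L n" if "Y \<in> carrier L" for n Y
  proof -
    obtain g where g: "g \<in> Ap" "Y = q g" using \<open>Y \<in> carrier L\<close> by (rule L_cases)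
    show ?thesis unfolding g(2) lp_q[OF g(1)] L_simps using Ap_hp[OF g(1)] hp_homog by blast
  qed
  have gL: "grade L n \<subseteq> carrier L" for n unfolding L_simps by blast
  show "\<exists>!f. (\<forall>n. f n \<in> grade L n) \<and> finite {n. f n \<noteq> \<zero>\<^bsub>L\<^esub>} \<and> X = (\<Oplus>\<^bsub>L\<^esub>n\<in>{n. f n \<noteq> \<zero>\<^bsub>L\<^esub>}. f n)"
  proof (rule ex1_grade_decompI[where p=lp, OF abelian_L Lgrade_subgroup lpL _ _ _ _ X])
    fix n Y Z assume "Y \<in> carrier L" "Z \<in> carrier L"
    then obtain g h where g: "g \<in> Ap" "Y = q g" and h: "h \<in> Ap" "Z = q h" by (metis L_cases)
    have s: "Y \<oplus>\<^bsub>L\<^esub> Z = q (g \<oplus>\<^bsub>A\<^esub> h)" unfolding g h L_simps using q_add g h Ap_A by simp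
    show "lp n (Y \<oplus>\<^bsub>L\<^esub> Z) = lp n Y \<oplus>\<^bsub>L\<^esub> lp n Z"
      unfolding s lp_q[OF Ap_add[OF g(1) h(1)]] unfolding g(2) h(2) lp_q[OF g(1)] lp_q[OF h(1)] L_simps
      using q_add hp_add hp_closed Ap_A g(1) h(1) by simp
  next
    fix n m Y assume "Y \<in> grade L m"
    then obtain g where g: "g \<in> Ap" "Y = q g" "homog m g" unfolding L_simps by blast
    show "lp n Y = (if n = m then Y else \<zero>\<^bsub>L\<^esub>)"
      unfolding g(2) lp_q[OF g(1)] hp_of_homog[OF g(3)] L_simps using q_zero by simp
  next
    show "finite {n. lp n X \<noteq> \<zero>\<^bsub>L\<^esub>}" by (rule finite_subset[OF sub fin])
    have "X = q (\<Oplus>\<^bsub>A\<^esub>n\<in>?D. hp n f)" using hp_sum[OF fA] f(2) by simp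
    also have "\<dots> = (\<Oplus>\<^bsub>Q\<^esub>n\<in>?D. q (hp n f))" by (rule q_finsum) (rule hp_closed[OF fA])
    also have "\<dots> = (\<Oplus>\<^bsub>Q\<^esub>n\<in>?D. lp n X)" unfolding f(2) lp_q[OF f(1)] ..
    also have "\<dots> = (\<Oplus>\<^bsub>L\<^esub>n\<in>?D. lp n X)" by (rule finsum_L[symmetric]) (use lpL[OF X] gL in blast)
    also have "\<dots> = (\<Oplus>\<^bsub>L\<^esub>n\<in>{n. lp n X \<noteq> \<zero>\<^bsub>L\<^esub>}. lp n X)"
      by (rule L.add.finprod_mono_neutral_cong_right[OF fin sub]) (use lpL[OF X] gL in auto)
    finally show "X = (\<Oplus>\<^bsub>L\<^esub>n\<in>{n. lp n X \<noteq> \<zero>\<^bsub>L\<^esub>}. lp n X)" .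
  qed
qed

sublocale L: grring L by (rule grring_L)

text \<open>The scalar c as an element of the algebra, whose unit is the sum of the vertices. These
  elements form the set Z of the abstract interface.\<close>

definition zc :: "'k \<Rightarrow> (('v, 'e) lpa_gen list \<Rightarrow> 'k) set" where "zc c = c \<odot>\<^bsub>L\<^esub> \<one>\<^bsub>L\<^esub>"

lemma zc_q: "c \<in> carrier K \<Longrightarrow> zc c = q (c \<odot>\<^bsub>A\<^esub> u1)"
  unfolding zc_def L_simps(3) by (rule q_smult) (use u1_Ap Ap_A in auto)

lemma zc_mult_q:
  assumes c: "c \<in> carrier K" and f: "f \<in> Ap"
  shows "zc c \<otimes>\<^bsub>L\<^esub> q f = q (c \<odot>\<^bsub>A\<^esub> f)" "q f \<otimes>\<^bsub>L\<^esub> zc c = q (c \<odot>\<^bsub>A\<^esub> f)"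
proof -
  have A: "f \<in> carrier A" "u1 \<in> carrier A" using f u1_Ap Ap_A by auto
  note cA = smult_A[OF c A(1)] smult_A[OF c A(2)]
  have "zc c \<otimes>\<^bsub>L\<^esub> q f = q (c \<odot>\<^bsub>A\<^esub> (u1 \<otimes>\<^bsub>A\<^esub> f))"
    unfolding zc_q[OF c] L_simps(2) q_mult[OF cA(2) A(1), symmetric] smult_mult_l[OF c A(2,1)] ..
  also have "\<dots> = c \<odot>\<^bsub>L\<^esub> q (u1 \<otimes>\<^bsub>A\<^esub> f)" by (rule q_smult[symmetric, OF c]) (use A in simp)
  also have "q (u1 \<otimes>\<^bsub>A\<^esub> f) = q f" using q_mult[OF A(2,1)] u1_q(1)[OF f] by simp
  also have "c \<odot>\<^bsub>L\<^esub> q f = q (c \<odot>\<^bsub>A\<^esub> f)" by (rule q_smult[OF c A(1)])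
  finally show "zc c \<otimes>\<^bsub>L\<^esub> q f = q (c \<odot>\<^bsub>A\<^esub> f)" .
  have "q f \<otimes>\<^bsub>L\<^esub> zc c = q (c \<odot>\<^bsub>A\<^esub> (f \<otimes>\<^bsub>A\<^esub> u1))"
    unfolding zc_q[OF c] L_simps(2) q_mult[OF A(1) cA(2), symmetric] smult_mult_r[OF c A(1,2)] ..
  also have "\<dots> = c \<odot>\<^bsub>L\<^esub> q (f \<otimes>\<^bsub>A\<^esub> u1)" by (rule q_smult[symmetric, OF c]) (use A in simp)
  also have "q (f \<otimes>\<^bsub>A\<^esub> u1) = q f" using q_mult[OF A(1,2)] u1_q(2)[OF f] by simp
  also have "c \<odot>\<^bsub>L\<^esub> q f = q (c \<odot>\<^bsub>A\<^esub> f)" by (rule q_smult[OF c A(1)])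
  finally show "q f \<otimes>\<^bsub>L\<^esub> zc c = q (c \<odot>\<^bsub>A\<^esub> f)" .
qed

lemma smult_L: "c \<in> carrier K \<Longrightarrow> X \<in> carrier L \<Longrightarrow> c \<odot>\<^bsub>L\<^esub> X = zc c \<otimes>\<^bsub>L\<^esub> X"
  by (erule L_cases) (simp add: zc_mult_q q_smult Ap_A)

lemma zc_central: "c \<in> carrier K \<Longrightarrow> X \<in> carrier L \<Longrightarrow> zc c \<otimes>\<^bsub>L\<^esub> X = X \<otimes>\<^bsub>L\<^esub> zc c"
  by (erule L_cases) (simp add: zc_mult_q)

lemma zc_grade: "c \<in> carrier K \<Longrightarrow> zc c \<in> grade L 0"
  unfolding zc_q L_simps(7) using Ap_smult[OF _ u1_Ap] homog_smult[OF Ap_A[OF u1_Ap] _ u1_homog] by blast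

lemma zc_closed: "c \<in> carrier K \<Longrightarrow> zc c \<in> carrier L"
  using zc_grade L.grade_carrier by blast

lemma zc_add: "c \<in> carrier K \<Longrightarrow> c' \<in> carrier K \<Longrightarrow> zc (c \<oplus> c') = zc c \<oplus>\<^bsub>L\<^esub> zc c'"
proof -
  assume c: "c \<in> carrier K" "c' \<in> carrier K"
  have u: "u1 \<in> carrier A" using u1_Ap Ap_A by auto
  have "(c \<oplus> c') \<odot>\<^bsub>A\<^esub> u1 = c \<odot>\<^bsub>A\<^esub> u1 \<oplus>\<^bsub>A\<^esub> c' \<odot>\<^bsub>A\<^esub> u1"
    unfolding A_simps using c A_val[OF u] by (simp add: l_distr)
  then show ?thesis unfolding L_simps(5) using c q_add[OF smult_A[OF c(1) u] smult_A[OF c(2) u]] by (simp add: zc_q)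
qed

lemma zc_mult: "c \<in> carrier K \<Longrightarrow> c' \<in> carrier K \<Longrightarrow> zc (c \<otimes> c') = zc c \<otimes>\<^bsub>L\<^esub> zc c'"
proof -
  assume c: "c \<in> carrier K" "c' \<in> carrier K"
  have u: "u1 \<in> carrier A" using u1_Ap Ap_A by auto
  have "(c \<otimes> c') \<odot>\<^bsub>A\<^esub> u1 = c \<odot>\<^bsub>A\<^esub> (c' \<odot>\<^bsub>A\<^esub> u1)"
    unfolding A_simps using c A_val[OF u] by (simp add: m_assoc)
  then show ?thesis using c zc_mult_q(1)[OF c(1) Ap_smult[OF c(2) u1_Ap]] by (simp add: zc_q)
qed

lemma zc_one: "zc \<one> = \<one>\<^bsub>L\<^esub>"
proof -
  have "\<one> \<odot>\<^bsub>A\<^esub> u1 = u1" unfolding A_simps using A_val[OF Ap_A[OF u1_Ap]] by simp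
  then show ?thesis by (simp add: zc_q L_simps(3))
qed

lemma zc_zero: "zc \<zero> = \<zero>\<^bsub>L\<^esub>"
  using zc_add[of \<zero> \<zero>] zc_closed[of \<zero>] by simp

lemma q_word:
  "w \<in> lists (lpa_gens E) \<Longrightarrow> w \<noteq> [] \<Longrightarrow> q (mo w) = foldr (\<lambda>g a. gm g \<otimes>\<^bsub>L\<^esub> a) w \<one>\<^bsub>L\<^esub>"
proof (induction w rule: list.induct)
  case (Cons g w)
  show ?case
  proof (cases "w = []")
    case True then show ?thesis using Cons.prems gm_L by (simp add: gm_def)
  next
    case False then show ?thesis using Cons q_mo_Cons[of g w] by (simp add: L_simps(2))
  qed
qed simp

lemma lpa_L: "lpa L (zc ` carrier K) E gm"
proof (intro lpa.intro zring.intro grring_L zring_axioms.intro lpa_axioms.intro fin_digraph_axioms)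
  fix a assume a: "a \<in> zc ` carrier K" "a \<noteq> \<zero>\<^bsub>L\<^esub>"
  then obtain c where c: "c \<in> carrier K" "a = zc c" by blast
  then have "c \<noteq> \<zero>" using a(2) zc_zero by auto
  then have "c \<in> Units K" using c field_Units by auto
  then obtain c' where c': "c' \<in> carrier K" "c \<otimes> c' = \<one>" unfolding Units_def by blast
  then have "a \<otimes>\<^bsub>L\<^esub> zc c' = \<one>\<^bsub>L\<^esub>" unfolding c(2) using zc_mult[OF c(1) c'(1)] zc_one by simp
  then show "\<exists>b\<in>zc ` carrier K. a \<otimes>\<^bsub>L\<^esub> b = \<one>\<^bsub>L\<^esub>" using c' by blast
next
  fix a assume "a \<in> zc ` carrier K"
  then obtain c where c: "c \<in> carrier K" "a = zc c" by blast
  have "zc (\<ominus> c) \<oplus>\<^bsub>L\<^esub> zc c = \<zero>\<^bsub>L\<^esub>" using zc_add[of "\<ominus> c" c] c zc_zero by (simp add: l_neg)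
  then have "\<ominus>\<^bsub>L\<^esub> a = zc (\<ominus> c)" using L.minus_equality[of "zc (\<ominus> c)" "zc c"] zc_closed c by simp
  then show "\<ominus>\<^bsub>L\<^esub> a \<in> zc ` carrier K" using c by auto
next
  show "\<zero>\<^bsub>L\<^esub> \<in> zc ` carrier K" "\<one>\<^bsub>L\<^esub> \<in> zc ` carrier K" using zc_zero zc_one by (metis image_eqI zero_closed, metis image_eqI one_closed)
  show "zc ` carrier K \<subseteq> grade L 0" using zc_grade by blast
next
  fix a b assume "a \<in> zc ` carrier K" "b \<in> zc ` carrier K"
  then obtain c d where "c \<in> carrier K" "a = zc c" "d \<in> carrier K" "b = zc d" by blast
  then show "a \<oplus>\<^bsub>L\<^esub> b \<in> zc ` carrier K" "a \<otimes>\<^bsub>L\<^esub> b \<in> zc ` carrier K"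
    using zc_add zc_mult by (metis a_closed image_eqI, metis m_closed image_eqI)
next
  fix g assume g: "g \<in> lpa_gens E"
  have "mo [g] \<in> Ap" "homog (gen_deg g) (mo [g])" using g by (auto intro: Ap_mo homog_mo)
  then show "gm g \<in> grade L (gen_deg g)" unfolding gm_def L_simps by blast
next
  fix v assume v: "v \<in> verts E" "out_arcs E v \<noteq> {}"
  have "(\<Oplus>\<^bsub>L\<^esub>e\<in>out_arcs E v. gm (Edge e) \<otimes>\<^bsub>L\<^esub> gm (Ghost e)) = (\<Oplus>\<^bsub>Q\<^esub>e\<in>out_arcs E v. gm (Edge e) \<otimes>\<^bsub>L\<^esub> gm (Ghost e))"
    by (rule finsum_L) (auto intro!: L.m_closed gm_L)
  then show "(\<Oplus>\<^bsub>L\<^esub>e\<in>out_arcs E v. gm (Edge e) \<otimes>\<^bsub>L\<^esub> gm (Ghost e)) = gm (Vert v)"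
    using gm_ck2[OF v] unfolding L_simps(2) by simp
next
  have "(\<Oplus>\<^bsub>L\<^esub>v\<in>verts E. gm (Vert v)) = (\<Oplus>\<^bsub>Q\<^esub>v\<in>verts E. gm (Vert v))" by (rule finsum_L) (auto intro: gm_L)
  then show "\<one>\<^bsub>L\<^esub> = (\<Oplus>\<^bsub>L\<^esub>v\<in>verts E. gm (Vert v))" using q_u1 unfolding L_simps(3) by simp
next
  fix H n assume H: "subgroup H (add_monoid L)"
    and w: "\<And>z w. \<lbrakk>z \<in> zc ` carrier K; w \<in> lists (lpa_gens E); w \<noteq> []; deg w = n\<rbrakk>
      \<Longrightarrow> z \<otimes>\<^bsub>L\<^esub> foldr (\<lambda>g a. gm g \<otimes>\<^bsub>L\<^esub> a) w \<one>\<^bsub>L\<^esub> \<in> H"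
  note HD = add_subgroupD[OF H abelian_L]
  show "grade L n \<subseteq> H"
  proof
    fix X assume "X \<in> grade L n"
    then obtain f where f: "f \<in> Ap" "X = q f" "homog n f" unfolding L_simps by blast
    \<comment> \<open>Membership in \<open>Ap\<close> is carried along so that all classes stay
      inside the carrier of the algebra.\<close>
    have "f \<in> {f \<in> carrier A. f \<in> Ap \<and> q f \<in> H}"
    proof (rule A_span[OF Ap_A[OF f(1)]])
      show "subgroup {f \<in> carrier A. f \<in> Ap \<and> q f \<in> H} (add_monoid A)"
      proof (rule add_subgroupI[OF A.abelian_group_axioms])
        show "\<zero>\<^bsub>A\<^esub> \<in> {f \<in> carrier A. f \<in> Ap \<and> q f \<in> H}" using HD(2) Ap_zero q_zero L_simps(4) by simp
      next
        fix a b assume "a \<in> {f \<in> carrier A. f \<in> Ap \<and> q f \<in> H}" "b \<in> {f \<in> carrier A. f \<in> Ap \<and> q f \<in> H}"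
        then show "a \<oplus>\<^bsub>A\<^esub> b \<in> {f \<in> carrier A. f \<in> Ap \<and> q f \<in> H}"
          using HD(3)[of "q a" "q b"] Ap_add q_add[of a b] L_simps(5) by simp
      next
        fix a assume a: "a \<in> {f \<in> carrier A. f \<in> Ap \<and> q f \<in> H}"
        then have aA: "a \<in> carrier A" "a \<in> Ap" "q a \<in> H" by auto
        have "q (\<ominus>\<^bsub>A\<^esub> a) \<oplus>\<^bsub>L\<^esub> q a = \<zero>\<^bsub>L\<^esub>"
          unfolding L_simps(4,5) using q_add[of "\<ominus>\<^bsub>A\<^esub> a" a] aA(1) q_zero by (simp add: A.l_neg)
        then have "q (\<ominus>\<^bsub>A\<^esub> a) = \<ominus>\<^bsub>L\<^esub> q a"
          using L.minus_equality[of "q (\<ominus>\<^bsub>A\<^esub> a)" "q a"] q_L[OF Ap_neg[OF aA(2)]] q_L[OF aA(2)] by simp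
        then show "\<exists>b\<in>{f \<in> carrier A. f \<in> Ap \<and> q f \<in> H}. b \<oplus>\<^bsub>A\<^esub> a = \<zero>\<^bsub>A\<^esub>"
          using HD(4)[OF aA(3)] aA Ap_neg[OF aA(2)] by (intro bexI[of _ "\<ominus>\<^bsub>A\<^esub> a"]) (auto simp: A.l_neg)
      qed auto
      fix c u assume c: "c \<in> carrier K" and u: "u \<in> lists (lpa_gens E)" and fu: "f u \<noteq> \<zero>"
      \<comment> \<open>An element of \<open>Ap\<close> has no empty word in its support, and
        homogeneity fixes the degree of every word there.\<close>
      have u0: "u \<noteq> []" "deg u = n" using fu f(1,3) unfolding Ap_def homog_def by auto
      have "zc c \<otimes>\<^bsub>L\<^esub> q (mo u) \<in> H" using w[of "zc c" u] c u u0 q_word[OF u u0(1)] by simp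
      then have "q (c \<odot>\<^bsub>A\<^esub> mo u) \<in> H" using zc_mult_q(1)[OF c Ap_mo[OF u u0(1)]] by simp
      then show "c \<odot>\<^bsub>A\<^esub> mo u \<in> {f \<in> carrier A. f \<in> Ap \<and> q f \<in> H}"
        using Ap_smult[OF c Ap_mo[OF u u0(1)]] Ap_A by blast
    qed
    then show "X \<in> H" using f(2) by simp
  qed
qed (auto simp: L_simps(2,4) gm_vt_vt gm_vt_ed gm_ed_vt gm_vt_gh gm_gh_vt gm_ck1 simp: zc_central[unfolded L_simps(2)])

end

section \<open>Homomorphisms out of the Leavitt path algebra\<close>

locale leavitt_family = S: grring S
  for S :: "('l, 's, 'm) gmodule_scheme" and E :: "('v, 'e) pre_digraph" +
  fixes \<gamma> :: "('v, 'e) lpa_gen \<Rightarrow> 's"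
  assumes g_grade: "g \<in> lpa_gens E \<Longrightarrow> \<gamma> g \<in> grade S (gen_deg g)"
    and g_vt_vt: "u \<in> verts E \<Longrightarrow> v \<in> verts E \<Longrightarrow>
      \<gamma> (Vert u) \<otimes>\<^bsub>S\<^esub> \<gamma> (Vert v) = (if u = v then \<gamma> (Vert u) else \<zero>\<^bsub>S\<^esub>)"
    and g_vt_ed: "e \<in> arcs E \<Longrightarrow> \<gamma> (Vert (tail E e)) \<otimes>\<^bsub>S\<^esub> \<gamma> (Edge e) = \<gamma> (Edge e)"
    and g_ed_vt: "e \<in> arcs E \<Longrightarrow> \<gamma> (Edge e) \<otimes>\<^bsub>S\<^esub> \<gamma> (Vert (head E e)) = \<gamma> (Edge e)"
    and g_vt_gh: "e \<in> arcs E \<Longrightarrow> \<gamma> (Vert (head E e)) \<otimes>\<^bsub>S\<^esub> \<gamma> (Ghost e) = \<gamma> (Ghost e)"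
    and g_gh_vt: "e \<in> arcs E \<Longrightarrow> \<gamma> (Ghost e) \<otimes>\<^bsub>S\<^esub> \<gamma> (Vert (tail E e)) = \<gamma> (Ghost e)"
    and g_ck2: "v \<in> verts E \<Longrightarrow> out_arcs E v \<noteq> {} \<Longrightarrow>
      (\<Oplus>\<^bsub>S\<^esub>e\<in>out_arcs E v. \<gamma> (Edge e) \<otimes>\<^bsub>S\<^esub> \<gamma> (Ghost e)) = \<gamma> (Vert v)"
    and g_ck1: "e \<in> arcs E \<Longrightarrow> f \<in> arcs E \<Longrightarrow>
      \<gamma> (Ghost e) \<otimes>\<^bsub>S\<^esub> \<gamma> (Edge f) = (if e = f then \<gamma> (Vert (head E e)) else \<zero>\<^bsub>S\<^esub>)"
    and g_one: "(\<Oplus>\<^bsub>S\<^esub>v\<in>verts E. \<gamma> (Vert v)) = \<one>\<^bsub>S\<^esub>"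

locale lpa_rep = lpa_field K E + leavitt_family S E \<gamma>
  for K :: "('k, 'c) ring_scheme" (structure) and E :: "('v, 'e) pre_digraph"
    and S :: "('l, 's, 'm) gmodule_scheme" and \<gamma> +
  fixes \<sigma> :: "'k \<Rightarrow> 's"
  assumes s_grade: "c \<in> carrier K \<Longrightarrow> \<sigma> c \<in> grade S 0"
    and s_add: "c \<in> carrier K \<Longrightarrow> d \<in> carrier K \<Longrightarrow> \<sigma> (c \<oplus> d) = \<sigma> c \<oplus>\<^bsub>S\<^esub> \<sigma> d"
    and s_mult: "c \<in> carrier K \<Longrightarrow> d \<in> carrier K \<Longrightarrow> \<sigma> (c \<otimes> d) = \<sigma> c \<otimes>\<^bsub>S\<^esub> \<sigma> d"
    and s_one: "\<sigma> \<one> = \<one>\<^bsub>S\<^esub>"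
    and s_central: "c \<in> carrier K \<Longrightarrow> a \<in> carrier S \<Longrightarrow> \<sigma> c \<otimes>\<^bsub>S\<^esub> a = a \<otimes>\<^bsub>S\<^esub> \<sigma> c"
begin

definition wd where "wd w = foldr (\<lambda>g a. \<gamma> g \<otimes>\<^bsub>S\<^esub> a) w \<one>\<^bsub>S\<^esub>"
definition ev where "ev f = (\<Oplus>\<^bsub>S\<^esub>w\<in>{w. f w \<noteq> \<zero>}. \<sigma> (f w) \<otimes>\<^bsub>S\<^esub> wd w)"
text \<open>Every element of the algebra has a representative without constant term;
  \<open>ev_J\<close> makes the value independent of the choice.\<close>

definition lift_hom where "lift_hom X = ev (SOME f. f \<in> Ap \<and> q f = X)"

lemma s_closed [simp]: "c \<in> carrier K \<Longrightarrow> \<sigma> c \<in> carrier S"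
  using s_grade S.grade_carrier by blast

lemma s_zero: "\<sigma> \<zero> = \<zero>\<^bsub>S\<^esub>"
  using s_add[of \<zero> \<zero>] s_closed[of \<zero>] by simp

lemma g_closed [simp]: "g \<in> lpa_gens E \<Longrightarrow> \<gamma> g \<in> carrier S"
  using g_grade S.grade_carrier by blast

lemma wd_grade: "w \<in> lists (lpa_gens E) \<Longrightarrow> wd w \<in> grade S (deg w)"
proof (induction w rule: list.induct)
  case Nil then show ?case using S.grade_one by (simp add: wd_def)
next
  case (Cons g w)
  then show ?case using S.grade_mult[of "\<gamma> g" "gen_deg g" "wd w" "deg w"] g_grade[of g] by (simp add: wd_def)
qed

lemma wd_closed [simp]: "w \<in> lists (lpa_gens E) \<Longrightarrow> wd w \<in> carrier S"
  using wd_grade S.grade_carrier by blast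

lemma wd_simps: "wd [] = \<one>\<^bsub>S\<^esub>" "wd (g # w) = \<gamma> g \<otimes>\<^bsub>S\<^esub> wd w"
  unfolding wd_def by simp_all

lemma wd_append: "u \<in> lists (lpa_gens E) \<Longrightarrow> v \<in> lists (lpa_gens E) \<Longrightarrow> wd (u @ v) = wd u \<otimes>\<^bsub>S\<^esub> wd v"
proof (induction u rule: list.induct)
  case (Cons g u)
  then have "g \<in> lpa_gens E" "u \<in> lists (lpa_gens E)" by auto
  then show ?case using Cons by (simp add: wd_simps S.m_assoc)
qed (simp add: wd_simps)

text \<open>Lets the evaluations of several functions be compared as sums over one common finite set
  of words.\<close>

lemma ev_superset:
  assumes f: "f \<in> carrier A" and B: "finite B" "B \<subseteq> lists (lpa_gens E)" "{w. f w \<noteq> \<zero>} \<subseteq> B"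
  shows "ev f = (\<Oplus>\<^bsub>S\<^esub>w\<in>B. \<sigma> (f w) \<otimes>\<^bsub>S\<^esub> wd w)"
  unfolding ev_def
proof (rule S.add.finprod_mono_neutral_cong_left[OF B(1,3)])
  show "\<sigma> (f w) \<otimes>\<^bsub>S\<^esub> wd w = \<zero>\<^bsub>S\<^esub>" if "w \<in> B - {w. f w \<noteq> \<zero>}" for w
  proof -
    have "wd w \<in> carrier S" using that B(2) by (intro wd_closed) blast
    then show ?thesis using that by (simp add: s_zero)
  qed
  have "\<sigma> (f w) \<otimes>\<^bsub>S\<^esub> wd w \<in> carrier S" if "w \<in> B" for w
    using B(2) A_val[OF f] that by (intro S.m_closed s_closed wd_closed) auto
  then show "(\<lambda>w. \<sigma> (f w) \<otimes>\<^bsub>S\<^esub> wd w) \<in> B \<rightarrow> carrier S" by blast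
qed simp

lemma ev_grade: assumes f: "f \<in> carrier A" and h: "homog n f" shows "ev f \<in> grade S n"
  unfolding ev_def
proof (rule S.grade_finsum, rule Pi_I)
  fix w assume "w \<in> {w. f w \<noteq> \<zero>}"
  then have "w \<in> lists (lpa_gens E)" "deg w = n" using A_supp(2)[OF f] h unfolding homog_def by auto
  then show "\<sigma> (f w) \<otimes>\<^bsub>S\<^esub> wd w \<in> grade S n"
    using S.grade_mult[OF s_grade[OF A_val[OF f]] wd_grade[of w], of w] by simp
qed

lemma ev_closed [simp]: "f \<in> carrier A \<Longrightarrow> ev f \<in> carrier S"
  unfolding ev_def using A_supp A_val by (intro S.finsum_closed Pi_I S.m_closed s_closed wd_closed) auto

lemma ev_add: assumes f: "f \<in> carrier A" and g: "g \<in> carrier A" shows "ev (f \<oplus>\<^bsub>A\<^esub> g) = ev f \<oplus>\<^bsub>S\<^esub> ev g"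
proof -
  let ?B = "{w. f w \<noteq> \<zero>} \<union> {w. g w \<noteq> \<zero>}"
  have B: "finite ?B" "?B \<subseteq> lists (lpa_gens E)" using A_supp[OF f] A_supp[OF g] by auto
  have c: "\<sigma> (f w) \<otimes>\<^bsub>S\<^esub> wd w \<in> carrier S" "\<sigma> (g w) \<otimes>\<^bsub>S\<^esub> wd w \<in> carrier S" if "w \<in> ?B" for w
  proof -
    have "w \<in> lists (lpa_gens E)" using that B(2) by blast
    then show "\<sigma> (f w) \<otimes>\<^bsub>S\<^esub> wd w \<in> carrier S" "\<sigma> (g w) \<otimes>\<^bsub>S\<^esub> wd w \<in> carrier S"
      using A_val[OF f] A_val[OF g] by (auto intro!: S.m_closed)
  qed
  have "ev (f \<oplus>\<^bsub>A\<^esub> g) = (\<Oplus>\<^bsub>S\<^esub>w\<in>?B. \<sigma> ((f \<oplus>\<^bsub>A\<^esub> g) w) \<otimes>\<^bsub>S\<^esub> wd w)"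
    by (rule ev_superset[OF A.a_closed[OF f g] B]) (auto simp: A_simps(5))
  also have "\<dots> = (\<Oplus>\<^bsub>S\<^esub>w\<in>?B. \<sigma> (f w) \<otimes>\<^bsub>S\<^esub> wd w \<oplus>\<^bsub>S\<^esub> \<sigma> (g w) \<otimes>\<^bsub>S\<^esub> wd w)"
  proof (rule S.finsum_cong'[OF refl])
    show "(\<lambda>w. \<sigma> (f w) \<otimes>\<^bsub>S\<^esub> wd w \<oplus>\<^bsub>S\<^esub> \<sigma> (g w) \<otimes>\<^bsub>S\<^esub> wd w) \<in> ?B \<rightarrow> carrier S" using c by blast
    fix w assume "w \<in> ?B"
    then have "wd w \<in> carrier S" using B(2) wd_closed by blast
    then show "\<sigma> ((f \<oplus>\<^bsub>A\<^esub> g) w) \<otimes>\<^bsub>S\<^esub> wd w = \<sigma> (f w) \<otimes>\<^bsub>S\<^esub> wd w \<oplus>\<^bsub>S\<^esub> \<sigma> (g w) \<otimes>\<^bsub>S\<^esub> wd w"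
      unfolding A_simps(5) using A_val[OF f] A_val[OF g] by (simp add: s_add S.l_distr)
  qed
  also have "\<dots> = (\<Oplus>\<^bsub>S\<^esub>w\<in>?B. \<sigma> (f w) \<otimes>\<^bsub>S\<^esub> wd w) \<oplus>\<^bsub>S\<^esub> (\<Oplus>\<^bsub>S\<^esub>w\<in>?B. \<sigma> (g w) \<otimes>\<^bsub>S\<^esub> wd w)"
    by (rule S.finsum_addf) (use c in blast)+
  also have "\<dots> = ev f \<oplus>\<^bsub>S\<^esub> ev g"
    using ev_superset[OF f B] ev_superset[OF g B] by simp
  finally show ?thesis .
qed

lemma ev_monom:
  assumes c: "c \<in> carrier K" and u: "u \<in> lists (lpa_gens E)" shows "ev (c \<odot>\<^bsub>A\<^esub> mo u) = \<sigma> c \<otimes>\<^bsub>S\<^esub> wd u"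
proof -
  have "ev (c \<odot>\<^bsub>A\<^esub> mo u) = (\<Oplus>\<^bsub>S\<^esub>w\<in>{u}. \<sigma> ((c \<odot>\<^bsub>A\<^esub> mo u) w) \<otimes>\<^bsub>S\<^esub> wd w)"
    by (rule ev_superset[OF smult_A[OF c mo_A[OF u]]]) (use u c in \<open>auto simp: A_simps(6) word_monom_def\<close>)
  then show ?thesis using c u by (simp add: A_simps(6) word_monom_def)
qed

lemma one_smult: "f \<in> carrier A \<Longrightarrow> \<one> \<odot>\<^bsub>A\<^esub> f = f"
  unfolding A_simps(6) using A_val by simp

lemma ev_mo: "u \<in> lists (lpa_gens E) \<Longrightarrow> ev (mo u) = wd u"
  using ev_monom[of \<one> u] one_smult[OF mo_A, of u] by (simp add: s_one)

lemmas eq_sub = additive_eq_subgroup[OF A.abelian_group_axioms S.abelian_group_axioms]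

text \<open>Both factors are reduced to monomials, the second one while the first is a fixed
  monomial. There the scalar \<sigma> d of the second factor is moved past a word, because it is
  central.\<close>

lemma ev_mult: assumes f: "f \<in> carrier A" and g: "g \<in> carrier A" shows "ev (f \<otimes>\<^bsub>A\<^esub> g) = ev f \<otimes>\<^bsub>S\<^esub> ev g"
proof -
  have 1: "ev ((c \<odot>\<^bsub>A\<^esub> mo u) \<otimes>\<^bsub>A\<^esub> g) = ev (c \<odot>\<^bsub>A\<^esub> mo u) \<otimes>\<^bsub>S\<^esub> ev g" if c: "c \<in> carrier K" and u: "u \<in> lists (lpa_gens E)" for c u
  proof -
    have cu: "c \<odot>\<^bsub>A\<^esub> mo u \<in> carrier A" using smult_A[OF c mo_A[OF u]] .
    have "g \<in> {g \<in> carrier A. ev ((c \<odot>\<^bsub>A\<^esub> mo u) \<otimes>\<^bsub>A\<^esub> g) = ev (c \<odot>\<^bsub>A\<^esub> mo u) \<otimes>\<^bsub>S\<^esub> ev g}"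
    proof (rule A_span[OF g])
      show "subgroup {g \<in> carrier A. ev ((c \<odot>\<^bsub>A\<^esub> mo u) \<otimes>\<^bsub>A\<^esub> g) = ev (c \<odot>\<^bsub>A\<^esub> mo u) \<otimes>\<^bsub>S\<^esub> ev g} (add_monoid A)"
        by (rule eq_sub) (use cu in \<open>auto simp: A.r_distr ev_add S.r_distr\<close>)
      fix d v assume d: "d \<in> carrier K" and v: "v \<in> lists (lpa_gens E)"
      have uv: "u @ v \<in> lists (lpa_gens E)" using u v by simp
      have dv: "d \<odot>\<^bsub>A\<^esub> mo v \<in> carrier A" using smult_A[OF d mo_A[OF v]] .
      have "(c \<odot>\<^bsub>A\<^esub> mo u) \<otimes>\<^bsub>A\<^esub> (d \<odot>\<^bsub>A\<^esub> mo v) = c \<odot>\<^bsub>A\<^esub> (d \<odot>\<^bsub>A\<^esub> mo (u @ v))"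
        using smult_mult_l[OF c mo_A[OF u] dv] smult_mult_r[OF d mo_A[OF u] mo_A[OF v]] mo_mult by simp
      also have "\<dots> = (c \<otimes> d) \<odot>\<^bsub>A\<^esub> mo (u @ v)"
        unfolding A_simps(6) using c d mo_closed by (simp add: m_assoc)
      finally have "ev ((c \<odot>\<^bsub>A\<^esub> mo u) \<otimes>\<^bsub>A\<^esub> (d \<odot>\<^bsub>A\<^esub> mo v)) = \<sigma> (c \<otimes> d) \<otimes>\<^bsub>S\<^esub> wd (u @ v)"
        using ev_monom[OF _ uv, of "c \<otimes> d"] c d by simp
      also have "\<dots> = \<sigma> c \<otimes>\<^bsub>S\<^esub> (\<sigma> d \<otimes>\<^bsub>S\<^esub> wd u) \<otimes>\<^bsub>S\<^esub> wd v"
        using c d u v by (simp add: s_mult wd_append S.m_assoc)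
      also have "\<sigma> d \<otimes>\<^bsub>S\<^esub> wd u = wd u \<otimes>\<^bsub>S\<^esub> \<sigma> d" using s_central d u by simp
      also have "\<sigma> c \<otimes>\<^bsub>S\<^esub> (wd u \<otimes>\<^bsub>S\<^esub> \<sigma> d) \<otimes>\<^bsub>S\<^esub> wd v = (\<sigma> c \<otimes>\<^bsub>S\<^esub> wd u) \<otimes>\<^bsub>S\<^esub> (\<sigma> d \<otimes>\<^bsub>S\<^esub> wd v)"
        using c d u v by (simp add: S.m_assoc)
      finally show "d \<odot>\<^bsub>A\<^esub> mo v \<in> {g \<in> carrier A. ev ((c \<odot>\<^bsub>A\<^esub> mo u) \<otimes>\<^bsub>A\<^esub> g) = ev (c \<odot>\<^bsub>A\<^esub> mo u) \<otimes>\<^bsub>S\<^esub> ev g}"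
        using dv ev_monom[OF c u] ev_monom[OF d v] by simp
    qed
    then show ?thesis by simp
  qed
  have "f \<in> {f \<in> carrier A. ev (f \<otimes>\<^bsub>A\<^esub> g) = ev f \<otimes>\<^bsub>S\<^esub> ev g}"
  proof (rule A_span[OF f])
    show "subgroup {f \<in> carrier A. ev (f \<otimes>\<^bsub>A\<^esub> g) = ev f \<otimes>\<^bsub>S\<^esub> ev g} (add_monoid A)"
      by (rule eq_sub) (use g in \<open>auto simp: A.l_distr ev_add S.l_distr\<close>)
  qed (use 1 smult_A mo_A in simp)
  then show ?thesis by simp
qed

lemma ev_zero: "ev \<zero>\<^bsub>A\<^esub> = \<zero>\<^bsub>S\<^esub>"
  using ev_add[of "\<zero>\<^bsub>A\<^esub>" "\<zero>\<^bsub>A\<^esub>"] ev_closed[of "\<zero>\<^bsub>A\<^esub>"] by simp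

lemma ev_diff: assumes f: "f \<in> carrier A" and g: "g \<in> carrier A"
  shows "ev (f \<ominus>\<^bsub>A\<^esub> g) = \<zero>\<^bsub>S\<^esub> \<longleftrightarrow> ev f = ev g"
proof -
  have "ev (f \<ominus>\<^bsub>A\<^esub> g) \<oplus>\<^bsub>S\<^esub> ev g = ev f"
    using ev_add[of "f \<ominus>\<^bsub>A\<^esub> g" g] f g by (simp add: A.minus_eq A.a_assoc A.l_neg)
  moreover have "f \<ominus>\<^bsub>A\<^esub> g \<in> carrier A" using f g by simp
  ultimately show ?thesis using ev_closed f g S.add.r_cancel_one by (metis S.l_zero)
qed

lemma ev_finsum: "(\<And>i. i \<in> B \<Longrightarrow> f i \<in> carrier A) \<Longrightarrow> ev (finsum A f B) = (\<Oplus>\<^bsub>S\<^esub>i\<in>B. ev (f i))"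
  by (rule finsum_hom[OF A.abelian_group_axioms S.abelian_group_axioms]) (auto simp: ev_add)

lemma ev_relator: assumes r: "r \<in> lpa_relators K E" shows "ev r = \<zero>\<^bsub>S\<^esub>"
proof -
  have mm: "ev (mo u \<ominus>\<^bsub>A\<^esub> mo v) = \<zero>\<^bsub>S\<^esub>"
    if "u \<in> lists (lpa_gens E)" "v \<in> lists (lpa_gens E)" "wd u = wd v" for u v
    using ev_diff[OF mo_A[OF that(1)] mo_A[OF that(2)]] ev_mo that by simp
  have m0: "ev (mo u \<ominus>\<^bsub>A\<^esub> \<zero>\<^bsub>A\<^esub>) = \<zero>\<^bsub>S\<^esub>" if "u \<in> lists (lpa_gens E)" "wd u = \<zero>\<^bsub>S\<^esub>" for u
    using ev_diff[OF mo_A[OF that(1)] A.zero_closed] ev_mo ev_zero that by simp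
  consider u v where "u \<in> verts E" "v \<in> verts E" "r = mo [Vert u, Vert v] \<ominus>\<^bsub>A\<^esub> (if u = v then mo [Vert u] else \<zero>\<^bsub>A\<^esub>)"
    | e where "e \<in> arcs E" "r = mo [Vert (tail E e), Edge e] \<ominus>\<^bsub>A\<^esub> mo [Edge e]"
    | e where "e \<in> arcs E" "r = mo [Edge e, Vert (head E e)] \<ominus>\<^bsub>A\<^esub> mo [Edge e]"
    | e where "e \<in> arcs E" "r = mo [Vert (head E e), Ghost e] \<ominus>\<^bsub>A\<^esub> mo [Ghost e]"
    | e where "e \<in> arcs E" "r = mo [Ghost e, Vert (tail E e)] \<ominus>\<^bsub>A\<^esub> mo [Ghost e]"
    | v where "v \<in> verts E" "out_arcs E v \<noteq> {}" "r = (\<Oplus>\<^bsub>A\<^esub>e \<in> out_arcs E v. mo [Edge e, Ghost e]) \<ominus>\<^bsub>A\<^esub> mo [Vert v]"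
    | e f where "e \<in> arcs E" "f \<in> arcs E" "r = mo [Ghost e, Edge f] \<ominus>\<^bsub>A\<^esub> (if e = f then mo [Vert (head E e)] else \<zero>\<^bsub>A\<^esub>)"
    using r unfolding lpa_relators_def Let_def out_arcs_def by blast
  then show ?thesis
  proof cases
    case 1 then show ?thesis using mm[of "[Vert u, Vert v]" "[Vert u]"] m0[of "[Vert u, Vert v]"] g_vt_vt[of u v]
      by (cases "u = v") (simp_all add: wd_simps)
  next
    case 2 then show ?thesis using mm[of "[Vert (tail E e), Edge e]" "[Edge e]"] g_vt_ed by (simp add: wd_simps)
  next
    case 3 then show ?thesis using mm[of "[Edge e, Vert (head E e)]" "[Edge e]"] g_ed_vt by (simp add: wd_simps)
  next
    case 4 then show ?thesis using mm[of "[Vert (head E e), Ghost e]" "[Ghost e]"] g_vt_gh by (simp add: wd_simps)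
  next
    case 5 then show ?thesis using mm[of "[Ghost e, Vert (tail E e)]" "[Ghost e]"] g_gh_vt by (simp add: wd_simps)
  next
    case 6
    have m: "mo [Edge e, Ghost e] \<in> carrier A" if "e \<in> out_arcs E v" for e by (rule mo_A) (use that in simp)
    have "ev (\<Oplus>\<^bsub>A\<^esub>e \<in> out_arcs E v. mo [Edge e, Ghost e]) = (\<Oplus>\<^bsub>S\<^esub>e \<in> out_arcs E v. ev (mo [Edge e, Ghost e]))"
      by (rule ev_finsum) (rule m)
    also have "\<dots> = (\<Oplus>\<^bsub>S\<^esub>e\<in>out_arcs E v. \<gamma> (Edge e) \<otimes>\<^bsub>S\<^esub> \<gamma> (Ghost e))"
      by (rule S.finsum_cong') (auto simp: ev_mo wd_simps)
    also have "\<dots> = ev (mo [Vert v])" using g_ck2[OF 6(1,2)] 6(1) by (simp add: ev_mo wd_simps)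
    finally show ?thesis unfolding 6(3)
      by (subst ev_diff) (rule A.finsum_closed, rule Pi_I, rule m, assumption, rule mo_A, simp add: 6)
  next
    case 7 then show ?thesis using mm[of "[Ghost e, Edge f]" "[Vert (head E e)]"] m0[of "[Ghost e, Edge f]"] g_ck1[of e f]
      by (cases "e = f") (simp_all add: wd_simps)
  qed
qed

lemma ev_J: "f \<in> J \<Longrightarrow> ev f = \<zero>\<^bsub>S\<^esub>"
proof -
  have "ideal {f \<in> carrier A. ev f = \<zero>\<^bsub>S\<^esub>} A"
  proof (rule idealI[OF ring_A])
    show "subgroup {f \<in> carrier A. ev f = \<zero>\<^bsub>S\<^esub>} (add_monoid A)"
      by (rule eq_sub) (auto simp: ev_add)
  qed (auto simp: ev_mult)
  then have "J \<subseteq> {f \<in> carrier A. ev f = \<zero>\<^bsub>S\<^esub>}"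
    unfolding J_def by (rule A.genideal_minimal) (use ev_relator relators_A in auto)
  then show "f \<in> J \<Longrightarrow> ev f = \<zero>\<^bsub>S\<^esub>" by blast
qed

lemma lift_q: assumes f: "f \<in> Ap" shows "lift_hom (q f) = ev f"
proof -
  let ?g = "SOME g. g \<in> Ap \<and> q g = q f"
  have g: "?g \<in> Ap \<and> q ?g = q f" by (rule someI[of _ f]) (use f in simp)
  then have A: "?g \<in> carrier A" "f \<in> carrier A" using f Ap_A by auto
  have "?g \<ominus>\<^bsub>A\<^esub> f \<in> J" using g q_eq_iff[OF A] by simp
  then show ?thesis unfolding lift_hom_def using ev_J ev_diff[OF A] by blast
qed

lemma lift_ring_hom: "lift_hom \<in> ring_hom L S"
proof (rule ring_hom_memI)
  fix X assume "X \<in> carrier L"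
  then obtain f where f: "f \<in> Ap" "X = q f" by (rule L_cases)
  then show "lift_hom X \<in> carrier S" using lift_q Ap_A by simp
  fix Y assume "Y \<in> carrier L"
  then obtain g where g: "g \<in> Ap" "Y = q g" by (rule L_cases)
  have A: "f \<in> carrier A" "g \<in> carrier A" using f g Ap_A by auto
  show "lift_hom (X \<otimes>\<^bsub>L\<^esub> Y) = lift_hom X \<otimes>\<^bsub>S\<^esub> lift_hom Y"
    using lift_q[OF Ap_mult[OF f(1) g(1)]] lift_q f g ev_mult[OF A] unfolding L_simps q_mult[OF A] by simp
  show "lift_hom (X \<oplus>\<^bsub>L\<^esub> Y) = lift_hom X \<oplus>\<^bsub>S\<^esub> lift_hom Y"
    using lift_q[OF Ap_add[OF f(1) g(1)]] lift_q f g ev_add[OF A] unfolding L_simps q_add[OF A] by simp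
next
  have "ev u1 = (\<Oplus>\<^bsub>S\<^esub>v\<in>verts E. ev (mo [Vert v]))" unfolding u1_def by (rule ev_finsum) (rule mo_A, simp)
  also have "\<dots> = (\<Oplus>\<^bsub>S\<^esub>v\<in>verts E. \<gamma> (Vert v))" by (rule S.finsum_cong') (auto simp: ev_mo wd_simps)
  finally show "lift_hom \<one>\<^bsub>L\<^esub> = \<one>\<^bsub>S\<^esub>" unfolding L_simps lift_q[OF u1_Ap] g_one .
qed

lemma lift_gm: "g \<in> lpa_gens E \<Longrightarrow> lift_hom (gm g) = \<gamma> g"
  unfolding gm_def using lift_q[OF Ap_mo, of "[g]"] ev_mo[of "[g]"] by (simp add: wd_simps)

lemma lift_grade: "X \<in> grade L n \<Longrightarrow> lift_hom X \<in> grade S n"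
  unfolding L_simps using lift_q ev_grade Ap_A by force

lemma lift_smult: "c \<in> carrier K \<Longrightarrow> X \<in> carrier L \<Longrightarrow> lift_hom (c \<odot>\<^bsub>L\<^esub> X) = \<sigma> c \<otimes>\<^bsub>S\<^esub> lift_hom X"
proof (erule L_cases)
  fix f assume c: "c \<in> carrier K" and f: "f \<in> Ap" "X = q f"
  \<comment> \<open>A scalar multiple is a product with the constant c times the empty word. This
    factor need not lie in \<open>Ap\<close>, but \<open>ev\<close> is multiplicative on all of
    A.\<close>
  have "ev (c \<odot>\<^bsub>A\<^esub> f) = ev ((c \<odot>\<^bsub>A\<^esub> mo []) \<otimes>\<^bsub>A\<^esub> f)"
    using scalar_smult[OF c Ap_A[OF f(1)]] unfolding A_simps(3) by simp
  also have "\<dots> = \<sigma> c \<otimes>\<^bsub>S\<^esub> ev f"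
    using c f Ap_A ev_monom[OF c, of "[]"] mo_A[of "[]"] smult_A[of c "mo []"] by (subst ev_mult) (simp_all add: wd_simps)
  finally show "lift_hom (c \<odot>\<^bsub>L\<^esub> X) = \<sigma> c \<otimes>\<^bsub>S\<^esub> lift_hom X"
    using f q_smult[OF c Ap_A[OF f(1)]] lift_q Ap_smult[OF c f(1)] by simp
qed

end

section \<open>Decompositions of idempotents and equalities of classes\<close>

context ring
begin

lemma finsum_mult_orth:
  assumes "finite P" "finite P'"
    and c: "\<And>p. p \<in> P \<Longrightarrow> a p \<in> carrier R \<and> b p \<in> carrier R" "\<And>p. p \<in> P' \<Longrightarrow> c p \<in> carrier R \<and> d p \<in> carrier R"
    and 0: "\<And>p p'. p \<in> P \<Longrightarrow> p' \<in> P' \<Longrightarrow> b p \<otimes> c p' = \<zero>"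
  shows "(\<Oplus>p\<in>P. a p \<otimes> b p) \<otimes> (\<Oplus>p\<in>P'. c p \<otimes> d p) = \<zero>"
proof -
  have "(a p \<otimes> b p) \<otimes> (\<Oplus>p'\<in>P'. c p' \<otimes> d p') = \<zero>" if p: "p \<in> P" for p
  proof -
    have "(a p \<otimes> b p) \<otimes> (\<Oplus>p'\<in>P'. c p' \<otimes> d p') = (\<Oplus>p'\<in>P'. (a p \<otimes> b p) \<otimes> (c p' \<otimes> d p'))"
      by (rule finsum_rdistr) (use assms p in auto)
    also have "\<dots> = \<zero>"
    proof (rule finsum_eq_zero)
      fix p' assume p': "p' \<in> P'"
      have "(a p \<otimes> b p) \<otimes> (c p' \<otimes> d p') = a p \<otimes> (b p \<otimes> c p') \<otimes> d p'" using c(1)[OF p] c(2)[OF p'] by (simp add: m_assoc)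
      then show "(a p \<otimes> b p) \<otimes> (c p' \<otimes> d p') = \<zero>" using 0[OF p p'] c(1)[OF p] c(2)[OF p'] by simp
    qed
    finally show ?thesis .
  qed
  moreover have "(\<Oplus>p\<in>P. a p \<otimes> b p) \<otimes> (\<Oplus>p\<in>P'. c p \<otimes> d p) = (\<Oplus>p\<in>P. (a p \<otimes> b p) \<otimes> (\<Oplus>p\<in>P'. c p \<otimes> d p))"
    by (rule finsum_ldistr) (use assms in \<open>auto intro!: finsum_closed\<close>)
  ultimately show ?thesis by (simp add: finsum_eq_zero)
qed

text \<open>A matrix product in which the inner factors b c form a diagonal matrix of idempotents,
  and these are absorbed by a.\<close>

lemma finsum_mult_delta:
  assumes fin: "finite P"
    and c: "\<And>p. p \<in> P \<Longrightarrow> a p \<in> carrier R \<and> b p \<in> carrier R \<and> c p \<in> carrier R \<and> d p \<in> carrier R"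
    and delta: "\<And>p p'. p \<in> P \<Longrightarrow> p' \<in> P \<Longrightarrow> b p \<otimes> c p' = (if p = p' then u p else \<zero>)"
    and au: "\<And>p. p \<in> P \<Longrightarrow> a p \<otimes> u p = a p"
  shows "(\<Oplus>p\<in>P. a p \<otimes> b p) \<otimes> (\<Oplus>p\<in>P. c p \<otimes> d p) = (\<Oplus>p\<in>P. a p \<otimes> d p)"
proof -
  have "(\<Oplus>p\<in>P. a p \<otimes> b p) \<otimes> (\<Oplus>p\<in>P. c p \<otimes> d p) = (\<Oplus>p\<in>P. (a p \<otimes> b p) \<otimes> (\<Oplus>p\<in>P. c p \<otimes> d p))"
    by (rule finsum_ldistr) (use fin c in \<open>auto intro!: finsum_closed\<close>)
  also have "\<dots> = (\<Oplus>p\<in>P. a p \<otimes> d p)"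
  proof (rule finsum_cong'[OF refl])
    fix p assume p: "p \<in> P"
    have x: "(a p \<otimes> b p) \<otimes> (c p' \<otimes> d p') = a p \<otimes> (b p \<otimes> c p') \<otimes> d p'" if "p' \<in> P" for p'
      using c[OF p] c[OF that] by (simp add: m_assoc)
    have "(a p \<otimes> b p) \<otimes> (\<Oplus>p'\<in>P. c p' \<otimes> d p') = (\<Oplus>p'\<in>P. (a p \<otimes> b p) \<otimes> (c p' \<otimes> d p'))"
      by (rule finsum_rdistr) (use fin c p in auto)
    also have "\<dots> = (a p \<otimes> b p) \<otimes> (c p \<otimes> d p)"
    proof (rule finsum_eq_single[OF fin p])
      show "(a p \<otimes> b p) \<otimes> (c p' \<otimes> d p') = \<zero>" if "p' \<in> P" "p' \<noteq> p" for p'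
        using x[OF that(1)] delta[OF p that(1)] that(2) c[OF p] c[OF that(1)] by simp
    qed (use c p in simp)
    also have "\<dots> = a p \<otimes> d p" using x[OF p] delta[OF p p] au[OF p] by simp
    finally show "(a p \<otimes> b p) \<otimes> (\<Oplus>p'\<in>P. c p' \<otimes> d p') = a p \<otimes> d p" .
  qed (use c in auto)
  finally show ?thesis .
qed

end

lemma image_mset_Sigma:
  assumes "finite I" "\<And>i. i \<in> I \<Longrightarrow> finite (J i)"
  shows "image_mset f (mset_set (Sigma I J)) = (\<Sum>i\<in>I. image_mset (\<lambda>j. f (i, j)) (mset_set (J i)))"
  using assms
proof (induction I rule: finite_induct)
  case (insert i I)
  have "Sigma (insert i I) J = Pair i ` J i \<union> Sigma I J" by auto
  moreover have "Pair i ` J i \<inter> Sigma I J = {}" using insert.hyps by auto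
  ultimately have "mset_set (Sigma (insert i I) J) = mset_set (Pair i ` J i) + mset_set (Sigma I J)"
    using insert by (simp add: mset_set_Union finite_SigmaI)
  also have "mset_set (Pair i ` J i) = image_mset (Pair i) (mset_set (J i))"
    by (rule image_mset_mset_set[symmetric]) (simp add: inj_on_def)
  finally show ?case using insert by (simp add: image_mset.compositionality comp_def)
qed simp

text \<open>The relations between the a and b do not mention the idempotent; restricting the indices
  only replaces it by a partial sum.\<close>

lemma idec_subset:
  assumes "idec R e J a b u g" "K \<subseteq> J"
  shows "idec R (\<Oplus>\<^bsub>R\<^esub>j\<in>K. a j \<otimes>\<^bsub>R\<^esub> b j) K a b u g"
  using assms finite_subset[OF assms(2)] unfolding idec_def by (auto simp: subset_iff)

context lpa_nontriv
begin

text \<open>A representative N of the common class has bases of both types and is isomorphic to M,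
  so the second basis can be transported to M. In this way an equality in \<open>Vgr\<close> yields
  actual elements of M.\<close>

lemma V_eq_hbas:
  assumes "gmod R M" "hbas R M (vtm T)" "vmset T" "vmset U" "V T = V U"
  shows "hbas R M (vtm U)"
proof -
  obtain N where N: "N \<in> V T" using V_nonempty[OF assms(3)] by blast
  have NU: "gmod R N" "hbas R N (vtm U)" using N assms(5) Cls_gmod unfolding V_def by blast+
  have iso: "gr_iso R M N" using N gr_class_V[OF assms(1,2)] unfolding gr_class_def by blast
  obtain I :: "nat set" and x e d where b: "gbasis R M I x e d" and T: "vtm T = image_mset (\<lambda>i. (e i, d i)) (mset_set I)"
    using assms(2) unfolding hbas_def by blast
  obtain y where y: "gbasis R N I y e d" using gbasis_iso[OF assms(1) NU(1) b iso] .
  have iso': "gr_iso R N M" by (rule gbasis_imp_iso[OF NU(1) assms(1) y b])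
  obtain J :: "nat set" and x' e' d' where b': "gbasis R N J x' e' d'" and U: "vtm U = image_mset (\<lambda>i. (e' i, d' i)) (mset_set J)"
    using NU(2) unfolding hbas_def by blast
  obtain y' where "gbasis R M J y' e' d'" using gbasis_iso[OF NU(1) assms(1) b' iso'] .
  then show ?thesis unfolding U by (rule gmod.hbasI[OF assms(1)])
qed

lemma hbas_corner_vt: "v \<in> verts E \<Longrightarrow> hbas R (corner R (vt v)) (vtm {#(v, 0)#})"
  using gmod.hbasI[OF gmod_corner[OF vt_gidem] gbasis_corner_single[OF vt_gidem], of v "()"]
  by (simp add: vtm_def)

text \<open>The edge e contributes the left ideal of its range shifted by 1, hence the degree - 1 in
  the convention for pairs (v, d).\<close>

definition outm :: "'v \<Rightarrow> ('v \<times> int) multiset" where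
  "outm v = image_mset (\<lambda>e. (head E e, - 1)) (mset_set (out_arcs E v))"

definition allm :: "('v \<times> int) multiset" where
  "allm = image_mset (\<lambda>v. (v, 0)) (mset_set (verts E))"

lemma vmset_single [simp]: "vmset {#t#} \<longleftrightarrow> fst t \<in> verts E" unfolding vmset_def by simp

lemma finite_out [simp]: "finite (out_arcs E v)" unfolding out_arcs_def by simp

lemma vmset_outm [simp]: "vmset (outm v)"
  unfolding vmset_def outm_def by auto

lemma vmset_allm [simp]: "vmset allm"
  unfolding vmset_def allm_def by auto

lemma V_outm:
  assumes v: "v \<in> verts E" "out_arcs E v \<noteq> {}" shows "V {#(v, 0)#} = V (outm v)"
proof -
  note g = gmod_corner[OF vt_gidem[OF v(1)]]
  have "hbas R (corner R (vt v)) (vtm (outm v))"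
    using gmod.hbasI[OF g idec_gbasis_corner[OF idec_out[OF v]]]
    by (simp add: vtm_def outm_def image_mset.compositionality comp_def)
  then show ?thesis using gr_class_V[OF g hbas_corner_vt[OF v(1)]] gr_class_V[OF g] by simp
qed

lemma regular: "gmod R (gr_regular R)" "hbas R (gr_regular R) (vtm allm)"
  using gmod_corner[OF one_gidem] gmod.hbasI[OF gmod_corner[OF one_gidem] idec_gbasis_corner[OF idec_one]]
  unfolding gr_regular_corner by (simp_all add: vtm_def allm_def image_mset.compositionality comp_def)

text \<open>A module with an empty basis is zero, and the idempotent v is an element of its own left
  ideal.\<close>

lemma vt_zeroI: assumes v: "v \<in> verts E" and "V {#(v, 0)#} = V {#}" shows "vt v = \<zero>"
proof -
  note g = gmod_corner[OF vt_gidem[OF v]]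
  interpret C: gmod R "corner R (vt v)" by (rule g)
  have "hbas R (corner R (vt v)) (vtm {#})" by (rule V_eq_hbas[OF g hbas_corner_vt[OF v]]) (use assms in auto)
  then obtain I :: "nat set" and x e d where b: "gbasis R (corner R (vt v)) I x e d"
    and "vtm {#} = image_mset (\<lambda>i. (e i, d i)) (mset_set I)"
    unfolding hbas_def by blast
  then have "I = {}" using gbasis_typeD(1)[OF b] by (simp add: vtm_def mset_set_empty_iff)
  moreover have "vt v \<in> grade (corner R (vt v)) 0" using v vt_vt vt_grade by simp
  ultimately obtain r where "vt v = (\<Oplus>\<^bsub>corner R (vt v)\<^esub>i\<in>{}. r i \<odot>\<^bsub>corner R (vt v)\<^esub> x i)"
    using gbasis_spanD[OF b, of "vt v" 0] by blast
  then show ?thesis using C.M.finsum_empty by simp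
qed

end

section \<open>Lifting a homomorphism of graded K-groups\<close>

locale k0_hom = R: lpa_nontriv R ZR E gE + S: lpa_nontriv S ZS F gF
  for R :: "('k, 'r, 'm) gmodule_scheme" and ZR and E :: "('v, 'e) pre_digraph" and gE
    and S :: "('k, 's, 'n) gmodule_scheme" and ZS and F :: "('w, 'f) pre_digraph" and gF +
  fixes \<phi> :: "'r K0_elem \<Rightarrow> 's K0_elem"
  assumes hom: "\<phi> \<in> laurent_module_hom (K0gr R) (K0gr S)"
    and pos: "\<phi> ` K0gr_pos R \<subseteq> K0gr_pos S"
    and unit: "\<phi> (K0gr_class R (gr_regular R)) = K0gr_class S (gr_regular S)"
begin

lemma phi_add: "X \<in> carrier (K0gr R) \<Longrightarrow> Y \<in> carrier (K0gr R) \<Longrightarrow> \<phi> (X \<oplus>\<^bsub>K0gr R\<^esub> Y) = \<phi> X \<oplus>\<^bsub>K0gr S\<^esub> \<phi> Y"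
  and phi_smult: "X \<in> carrier (K0gr R) \<Longrightarrow> \<phi> (q \<odot>\<^bsub>K0gr R\<^esub> X) = q \<odot>\<^bsub>K0gr S\<^esub> \<phi> X"
  and phi_closed: "X \<in> carrier (K0gr R) \<Longrightarrow> \<phi> X \<in> carrier (K0gr S)"
  using hom unfolding laurent_module_hom_def by auto

lemma phi_pos: assumes "R.vmset T" obtains U where "S.vmset U" "\<phi> (R.K T {#}) = S.K U {#}"
  using pos assms unfolding R.K0gr_pos_K S.K0gr_pos_K by blast

text \<open>A choice: \<phi> determines this multiset only up to isomorphism of the module that it
  describes.\<close>

definition tv :: "'v \<Rightarrow> ('w \<times> int) multiset" where
  "tv v = (SOME U. S.vmset U \<and> \<phi> (R.K {#(v, 0)#} {#}) = S.K U {#})"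

lemma tv: assumes "v \<in> verts E" shows "S.vmset (tv v)" "\<phi> (R.K {#(v, 0)#} {#}) = S.K (tv v) {#}"
proof -
  obtain U where "S.vmset U \<and> \<phi> (R.K {#(v, 0)#} {#}) = S.K U {#}"
    using phi_pos[of "{#(v, 0)#}"] assms by auto
  then have "S.vmset (tv v) \<and> \<phi> (R.K {#(v, 0)#} {#}) = S.K (tv v) {#}"
    unfolding tv_def by (rule someI)
  then show "S.vmset (tv v)" "\<phi> (R.K {#(v, 0)#} {#}) = S.K (tv v) {#}" by auto
qed

text \<open>The extension of \<open>tv\<close> that respects sums and shifts; a pair (v, d) is (v,
  0) shifted by - d.\<close>

definition tau :: "('v \<times> int) multiset \<Rightarrow> ('w \<times> int) multiset" where
  "tau T = (\<Sum>t\<in>#T. sh (- snd t) (tv (fst t)))"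

lemma tau_add: "tau (T + U) = tau T + tau U" unfolding tau_def by simp
lemma tau_single: "tau {#t#} = sh (- snd t) (tv (fst t))" unfolding tau_def by simp
lemma tau_empty: "tau {#} = {#}" unfolding tau_def by simp

text \<open>Induction on the multiset. The action of the monomial x^(-d) reduces a pair (v, d) to
  (v, 0), where the choice \<open>tv\<close> applies.\<close>

lemma tau: "R.vmset T \<Longrightarrow> S.vmset (tau T) \<and> \<phi> (R.K T {#}) = S.K (tau T) {#}"
proof (induction T)
  case empty
  obtain U where U: "S.vmset U" "\<phi> (R.K {#} {#}) = S.K U {#}" using phi_pos[of "{#}"] by auto
  \<comment> \<open>The image of 0 is idempotent for addition, so U and U + U have the same class,
    and U cancels.\<close>
  have "S.K U {#} = S.K U {#} \<oplus>\<^bsub>K0gr S\<^esub> S.K U {#}"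
    using phi_add[of "R.K {#} {#}" "R.K {#} {#}"] R.K0gr_add[of "{#}" "{#}" "{#}" "{#}"] U by simp
  also have "\<dots> = S.K (U + U) {#}" using S.K0gr_add[of U "{#}" U "{#}"] U by simp
  finally have "S.V (U + {#}) = S.V (U + U + {#})" by (intro S.K_eqD) (use U in auto)
  then have "S.V ({#} + U) = S.V (U + U)" by simp
  then have "S.V {#} = S.V U" by (rule S.V_cancel[rotated -1]) (use U in auto)
  then have "S.K U {#} = S.K {#} {#}" by (intro S.K_eqI) (use U in auto)
  then show ?case using U by (simp add: tau_empty)
next
  case (add t T)
  obtain v d where t: "t = (v, d)" by fastforce
  have v: "v \<in> verts E" and T: "R.vmset T" using add.prems t unfolding R.vmset_def by auto
  have e: "sh (- d) {#(v, 0 :: int)#} = {#(v, d)#}" unfolding sh_def by simp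
  have "R.K {#(v, d)#} {#} = Poly_Mapping.single (- d) 1 \<odot>\<^bsub>K0gr R\<^esub> R.K {#(v, 0)#} {#}"
    using R.K0gr_smult_single[of "{#(v, 0)#}" "{#}" "- d"] v e by simp
  then have "\<phi> (R.K {#(v, d)#} {#}) = Poly_Mapping.single (- d) 1 \<odot>\<^bsub>K0gr S\<^esub> S.K (tv v) {#}"
    using phi_smult[OF R.K_carrier, of "{#(v, 0)#}" "{#}"] tv(2)[OF v] v by simp
  also have "\<dots> = S.K (sh (- d) (tv v)) {#}" using S.K0gr_smult_single[of "tv v" "{#}"] tv(1)[OF v] by simp
  finally have 1: "\<phi> (R.K {#t#} {#}) = S.K (tau {#t#}) {#}" unfolding tau_single t by simp
  have m: "S.vmset (tau {#t#})" unfolding tau_single t using tv(1)[OF v] by simp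
  have "R.K (add_mset t T) {#} = R.K {#t#} {#} \<oplus>\<^bsub>K0gr R\<^esub> R.K T {#}"
    using R.K0gr_add[of "{#t#}" "{#}" T "{#}"] T v t by simp
  then have "\<phi> (R.K (add_mset t T) {#}) = \<phi> (R.K {#t#} {#}) \<oplus>\<^bsub>K0gr S\<^esub> \<phi> (R.K T {#})"
    using phi_add[OF R.K_carrier R.K_carrier, of "{#t#}" "{#}" T "{#}"] T v t by simp
  also have "\<dots> = S.K (tau {#t#} + tau T) {#}"
    unfolding 1 using S.K0gr_add[of "tau {#t#}" "{#}" "tau T" "{#}"] m add.IH[OF T] by simp
  finally show ?case using tau_add[of "{#t#}" T] m add.IH[OF T] by simp
qed

lemma tau_cong: assumes "R.vmset T" "R.vmset U" "R.V T = R.V U" shows "S.V (tau T) = S.V (tau U)"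
proof -
  have "R.K T {#} = R.K U {#}" by (rule R.K_eqI) (use assms in auto)
  then have "S.K (tau T) {#} = S.K (tau U) {#}" using tau assms(1,2) by metis
  then have "S.V (tau T + {#}) = S.V (tau U + {#})" by (rule S.K_eqD[rotated -1]) (use tau assms in auto)
  then show ?thesis by simp
qed

text \<open>Additivity is applied to ([T] - [U]) + [U] = [T], where the images of [U] and [T] are
  already known.\<close>

lemma phi_K: assumes T: "R.vmset T" and U: "R.vmset U" shows "\<phi> (R.K T U) = S.K (tau T) (tau U)"
proof -
  obtain A B where AB: "S.vmset A" "S.vmset B" "\<phi> (R.K T U) = S.K A B"
    using S.K0gr_cases[OF phi_closed[OF R.K_carrier[OF T U]]] by blast
  have "R.K T U \<oplus>\<^bsub>K0gr R\<^esub> R.K U {#} = R.K T {#}"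
    using R.K0gr_add[OF T U U R.vmset_empty] R.K_eqI[of "T + U" U T "{#}"] T U by simp
  then have "S.K (tau T) {#} = S.K A B \<oplus>\<^bsub>K0gr S\<^esub> S.K (tau U) {#}"
    using phi_add[of "R.K T U" "R.K U {#}"] tau T U AB(3) by simp
  also have "\<dots> = S.K (A + tau U) B" using S.K0gr_add[OF AB(1,2), of "tau U" "{#}"] tau U by simp
  finally have "S.V (tau T + B) = S.V (A + tau U + {#})" by (intro S.K_eqD) (use tau T U AB in auto)
  then have "S.K A B = S.K (tau T) (tau U)" by (intro S.K_eqI) (use tau T U AB in simp_all)
  then show ?thesis using AB by simp
qed

lemma tau_allm: "S.V (tau R.allm) = S.V S.allm"
proof -
  have "\<phi> (R.K R.allm {#}) = S.K S.allm {#}"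
    using unit R.K0gr_class_K[OF R.regular] S.K0gr_class_K[OF S.regular] by simp
  then have "S.K (tau R.allm) {#} = S.K S.allm {#}" using tau[of R.allm] by simp
  then have "S.V (tau R.allm + {#}) = S.V (S.allm + {#})" by (rule S.K_eqD[rotated -1]) (use tau in auto)
  then show ?thesis by simp
qed

lemma tau_outm: assumes "v \<in> verts E" "out_arcs E v \<noteq> {}" shows "S.V (tv v) = S.V (tau (R.outm v))"
  using tau_cong[OF _ _ R.V_outm[OF assms]] assms by (simp add: tau_single sh_def)

end

context k0_hom
begin

definition tlist where "tlist v = (SOME l. mset l = tv v)"
text \<open>One index for each summand of the module chosen for v, tagged with v so that the index
  sets of different vertices are disjoint.\<close>

definition ix :: "'v \<Rightarrow> ('v \<times> nat) set" where "ix v = {v} \<times> {..<length (tlist v)}"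
definition tp :: "'v \<times> nat \<Rightarrow> 'w \<times> int" where "tp p = tlist (fst p) ! snd p"

lemma ix_mset: "image_mset tp (mset_set (ix v)) = tv v"
proof -
  have m: "mset (tlist v) = tv v" unfolding tlist_def using ex_mset[of "tv v"] by (rule someI_ex)
  have "mset_set (ix v) = image_mset (Pair v) (mset_set {..<length (tlist v)})"
    unfolding ix_def by (subst image_mset_mset_set) (auto simp: inj_on_def intro!: arg_cong[of _ _ mset_set])
  then have "image_mset tp (mset_set (ix v)) = image_mset ((!) (tlist v)) (mset_set {..<length (tlist v)})"
    by (simp add: image_mset.compositionality comp_def tp_def)
  also have "\<dots> = mset (tlist v)" by (metis map_nth mset_map mset_upt atLeast0LessThan)
  finally show ?thesis using m by simp
qed

lemma finite_ix [simp]: "finite (ix v)" unfolding ix_def by simp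

definition ut :: "'v \<times> nat \<Rightarrow> 's" where "ut p = gF (Vert (fst (tp p)))"

lemma ix_vtm: "S.vtm (sh n (tv v)) = image_mset (\<lambda>p. (ut p, snd (tp p) - n)) (mset_set (ix v))"
  unfolding ix_mset[symmetric] S.vtm_def sh_def ut_def by (simp add: image_mset.compositionality comp_def)

definition ixs :: "('v \<times> nat) set" where "ixs = (\<Union>v\<in>verts E. ix v)"

lemma ixs_Sigma: "ixs = Sigma (verts E) (\<lambda>v. {..<length (tlist v)})" unfolding ixs_def ix_def by auto

lemma tau_allm_eq: "tau R.allm = image_mset tp (mset_set ixs)"
proof -
  have "tau R.allm = (\<Sum>v\<in>verts E. tv v)"
    unfolding tau_def R.allm_def by (simp add: image_mset.compositionality comp_def sh_def sum_unfold_sum_mset)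
  also have "\<dots> = (\<Sum>v\<in>verts E. image_mset (\<lambda>j. tp (v, j)) (mset_set {..<length (tlist v)}))"
  proof (rule sum.cong[OF refl])
    fix v
    have "mset_set (ix v) = image_mset (Pair v) (mset_set {..<length (tlist v)})"
      unfolding ix_def by (subst image_mset_mset_set) (auto simp: inj_on_def intro!: arg_cong[of _ _ mset_set])
    then show "tv v = image_mset (\<lambda>j. tp (v, j)) (mset_set {..<length (tlist v)})"
      unfolding ix_mset[symmetric] by (simp add: image_mset.compositionality comp_def)
  qed
  also have "\<dots> = image_mset tp (mset_set ixs)"
    unfolding ixs_Sigma by (rule image_mset_Sigma[symmetric]) auto
  finally show ?thesis .
qed

text \<open>The regular module of S has vertex type \<open>S.allm\<close>, and the condition on
  units makes \<open>tau R.allm\<close> another type of it. \<open>hbasE\<close> imposes the index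
  set \<open>ixs\<close>, and a basis of S 1 amounts to a decomposition of the unit.\<close>

lemma idec_one_ixs: obtains r z where "idec S \<one>\<^bsub>S\<^esub> ixs r z ut (\<lambda>p. snd (tp p))"
proof -
  have v: "S.vmset (tau R.allm)" using tau[of R.allm] by simp
  have "hbas S (corner S \<one>\<^bsub>S\<^esub>) (S.vtm (tau R.allm))"
    using S.V_eq_hbas[OF S.regular S.vmset_allm v tau_allm[symmetric]] unfolding S.gr_regular_corner .
  moreover have "finite ixs" unfolding ixs_def by simp
  moreover have "S.vtm (tau R.allm) = image_mset (\<lambda>p. (ut p, snd (tp p))) (mset_set ixs)"
    unfolding tau_allm_eq S.vtm_def ut_def by (simp add: image_mset.compositionality comp_def)
  ultimately obtain z where "gbasis S (corner S \<one>\<^bsub>S\<^esub>) ixs z ut (\<lambda>p. snd (tp p))"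
    by (rule gmod.hbasE[OF S.gmod_corner[OF S.one_gidem]])
  then show ?thesis by (rule S.gbasis_corner_idec[OF S.one_gidem]) (rule that)
qed

definition out_ix :: "'v \<Rightarrow> ('e \<times> 'v \<times> nat) set" where
  "out_ix v = Sigma (out_arcs E v) (\<lambda>e. ix (head E e))"

text \<open>The left ideal S f has type \<open>tv v\<close>. By the relation at v it also has the
  type of the sum, over the outgoing edges, of the modules chosen for their ranges, shifted by
  1.\<close>

lemma idec_out_ix:
  assumes v: "v \<in> verts E" "out_arcs E v \<noteq> {}" and f: "idec S f (ix v) r z ut (\<lambda>p. snd (tp p))"
  obtains a y where "idec S f (out_ix v) a y (\<lambda>q. ut (snd q)) (\<lambda>q. snd (tp (snd q)) - 1)"
proof -
  have D: "dec S f (ix v) r z ut (\<lambda>p. snd (tp p))"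
    by (intro dec.intro dec_axioms.intro S.grring_axioms f)
  have fi: "gidem S f" by (rule dec.e_gidem[OF D])
  note g = S.gmod_corner[OF fi]
  have "hbas S (corner S f) (S.vtm (sh 0 (tv v)))"
    unfolding ix_vtm using gmod.hbasI[OF g S.idec_gbasis_corner[OF f]] by simp
  then have h: "hbas S (corner S f) (S.vtm (tv v))" unfolding sh_def by simp
  have m: "S.vmset (tau (R.outm v))" using tau[of "R.outm v"] by simp
  have "hbas S (corner S f) (S.vtm (tau (R.outm v)))"
    by (rule S.V_eq_hbas[OF g h tv(1)[OF v(1)] m tau_outm[OF v]])
  moreover have "finite (out_ix v)" unfolding out_ix_def by simp
  moreover have "S.vtm (tau (R.outm v)) = image_mset (\<lambda>q. (ut (snd q), snd (tp (snd q)) - 1)) (mset_set (out_ix v))"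
  proof -
    have "tau (R.outm v) = (\<Sum>e\<in>out_arcs E v. sh 1 (tv (head E e)))"
      unfolding tau_def R.outm_def by (simp add: image_mset.compositionality comp_def sum_unfold_sum_mset)
    moreover have "S.vtm (\<Sum>e\<in>B. sh 1 (tv (head E e))) = (\<Sum>e\<in>B. S.vtm (sh 1 (tv (head E e))))" for B
      by (induction B rule: infinite_finite_induct) (simp_all add: S.vtm_add, simp_all add: S.vtm_def)
    ultimately have "S.vtm (tau (R.outm v)) = (\<Sum>e\<in>out_arcs E v. S.vtm (sh 1 (tv (head E e))))" by simp
    then show ?thesis unfolding out_ix_def ix_vtm by (subst image_mset_Sigma) auto
  qed
  ultimately obtain y where "gbasis S (corner S f) (out_ix v) y (\<lambda>q. ut (snd q)) (\<lambda>q. snd (tp (snd q)) - 1)"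
    by (rule gmod.hbasE[OF g])
  then show ?thesis by (rule S.gbasis_corner_idec[OF fi]) (rule that)
qed

text \<open>At a vertex v that is not a sink the idempotent \<open>f v\<close> has two
  decompositions: (r, z) inherited from the unit, and (a, y) with one block for each outgoing edge.
  Edges and ghost edges translate between the block at the source and the decomposition (r, z) at
  the range.\<close>

lemma leavitt_family_exists:
  obtains \<gamma> r z where "leavitt_family S E \<gamma>"
    "\<And>v. v \<in> verts E \<Longrightarrow> idec S (\<gamma> (Vert v)) (ix v) r z ut (\<lambda>p. snd (tp p))"
proof -
  obtain r z where rz: "idec S \<one>\<^bsub>S\<^esub> ixs r z ut (\<lambda>p. snd (tp p))" by (rule idec_one_ixs)
  interpret B: dec S "\<one>\<^bsub>S\<^esub>" ixs r z ut "\<lambda>p. snd (tp p)"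
    by (intro dec.intro dec_axioms.intro S.grring_axioms rz)
  have sub: "ix v \<subseteq> ixs" if "v \<in> verts E" for v using that unfolding ixs_def by blast
  \<comment> \<open>The decomposition of the unit is cut into the blocks
    \<open>ix v\<close>.\<close>
  define f where "f v = (\<Oplus>\<^bsub>S\<^esub>p\<in>ix v. r p \<otimes>\<^bsub>S\<^esub> z p)" for v
  have fdec: "idec S (f v) (ix v) r z ut (\<lambda>p. snd (tp p))" if "v \<in> verts E" for v
    unfolding f_def by (rule idec_subset[OF rz sub[OF that]])
  have D: "dec S (f v) (ix v) r z ut (\<lambda>p. snd (tp p))" if "v \<in> verts E" for v
    by (intro dec.intro dec_axioms.intro S.grring_axioms fdec[OF that])
  have "\<exists>ay. idec S (f v) (out_ix v) (fst ay) (snd ay) (\<lambda>q. ut (snd q)) (\<lambda>q. snd (tp (snd q)) - 1)"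
    if v: "v \<in> {v \<in> verts E. out_arcs E v \<noteq> {}}" for v
  proof -
    obtain a y where "idec S (f v) (out_ix v) a y (\<lambda>q. ut (snd q)) (\<lambda>q. snd (tp (snd q)) - 1)"
      using idec_out_ix[OF _ _ fdec, of v] v by blast
    then show ?thesis by (intro exI[of _ "(a, y)"]) simp
  qed
  then have "\<forall>v\<in>{v \<in> verts E. out_arcs E v \<noteq> {}}. \<exists>ay.
      idec S (f v) (out_ix v) (fst ay) (snd ay) (\<lambda>q. ut (snd q)) (\<lambda>q. snd (tp (snd q)) - 1)" by blast
  from bchoice[OF this] obtain ay where ay: "\<And>v. v \<in> verts E \<Longrightarrow> out_arcs E v \<noteq> {} \<Longrightarrow>
      idec S (f v) (out_ix v) (fst (ay v)) (snd (ay v)) (\<lambda>q. ut (snd q)) (\<lambda>q. snd (tp (snd q)) - 1)"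
    by blast
  \<comment> \<open>The block of e in the second decomposition at the source of e.\<close>
  define a where "a e p = fst (ay (tail E e)) (e, p)" for e p
  define y where "y e p = snd (ay (tail E e)) (e, p)" for e p
  have DO: "dec S (f v) (out_ix v) (fst (ay v)) (snd (ay v)) (\<lambda>q. ut (snd q)) (\<lambda>q. snd (tp (snd q)) - 1)"
    if "v \<in> verts E" "out_arcs E v \<noteq> {}" for v
    by (intro dec.intro dec_axioms.intro S.grring_axioms ay that)
  have DE: "dec S (f (tail E e)) (out_ix (tail E e)) (fst (ay (tail E e))) (snd (ay (tail E e))) (\<lambda>q. ut (snd q)) (\<lambda>q. snd (tp (snd q)) - 1)"
    and oix: "\<And>p. p \<in> ix (head E e) \<Longrightarrow> (e, p) \<in> out_ix (tail E e)" if "e \<in> arcs E" for e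
  proof -
    have "out_arcs E (tail E e) \<noteq> {}" using that by (auto simp: out_arcs_def)
    then show "dec S (f (tail E e)) (out_ix (tail E e)) (fst (ay (tail E e))) (snd (ay (tail E e))) (\<lambda>q. ut (snd q)) (\<lambda>q. snd (tp (snd q)) - 1)"
      using DO that by simp
    show "(e, p) \<in> out_ix (tail E e)" if p: "p \<in> ix (head E e)" for p
      using \<open>e \<in> arcs E\<close> p unfolding out_ix_def by simp
  qed
  have c: "a e p \<in> carrier S" "y e p \<in> carrier S" "ut p \<in> carrier S" "r p \<in> carrier S" "z p \<in> carrier S"
    if "e \<in> arcs E" "p \<in> ix (head E e)" for e p
  proof -
    have "p \<in> ixs" using that sub[of "head E e"] by auto
    then show "a e p \<in> carrier S" "y e p \<in> carrier S" "ut p \<in> carrier S" "r p \<in> carrier S" "z p \<in> carrier S"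
      using dec.a_closed[OF DE[OF that(1)] oix[OF that]] dec.b_closed[OF DE[OF that(1)] oix[OF that]]
        B.u_closed B.a_closed B.b_closed unfolding a_def y_def by auto
  qed
  have cv: "r p \<in> carrier S" "z p \<in> carrier S" "ut p \<in> carrier S" if "v \<in> verts E" "p \<in> ix v" for v p
    using B.a_closed[of p] B.b_closed[of p] B.u_closed[of p] subsetD[OF sub that(2)] that(1) by auto
  have f_closed: "f v \<in> carrier S" if "v \<in> verts E" for v using dec.e_closed[OF D[OF that]] .
  \<comment> \<open>Right multiplication by \<open>h e\<close> reads off the coordinates m a in the
    block of e and puts them on the basis z of the left ideal at the range; the degrees 1 - d of a
    and d of z add up to 1.\<close>
  define h where "h e = (\<Oplus>\<^bsub>S\<^esub>p\<in>ix (head E e). a e p \<otimes>\<^bsub>S\<^esub> z p)" for e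
  \<comment> \<open>The way back: coordinates m r with respect to z are put on the block y; the
    degrees - d and d - 1 add up to - 1.\<close>
  define g where "g e = (\<Oplus>\<^bsub>S\<^esub>p\<in>ix (head E e). r p \<otimes>\<^bsub>S\<^esub> y e p)" for e
  have h_grade: "h e \<in> grade S 1" if e: "e \<in> arcs E" for e
    unfolding h_def
  proof (rule S.grade_finsum, rule Pi_I)
    fix p assume p: "p \<in> ix (head E e)"
    have "p \<in> ixs" using p sub[of "head E e"] e by auto
    then show "a e p \<otimes>\<^bsub>S\<^esub> z p \<in> grade S 1"
      using S.grade_mult'[OF dec.a_grade[OF DE[OF e] oix[OF e p]] B.b_grade, of p 1] unfolding a_def by simp
  qed
  have g_grade: "g e \<in> grade S (- 1)" if e: "e \<in> arcs E" for e
    unfolding g_def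
  proof (rule S.grade_finsum, rule Pi_I)
    fix p assume p: "p \<in> ix (head E e)"
    have "p \<in> ixs" using p sub[of "head E e"] e by auto
    then show "r p \<otimes>\<^bsub>S\<^esub> y e p \<in> grade S (- 1)"
      using S.grade_mult'[OF B.a_grade dec.b_grade[OF DE[OF e] oix[OF e p]], of p "- 1"] unfolding y_def by simp
  qed
  have hc: "h e \<in> carrier S" "g e \<in> carrier S" if "e \<in> arcs E" for e
    using h_grade g_grade that S.grade_carrier by blast+
  have ff: "f u \<otimes>\<^bsub>S\<^esub> f v = (if u = v then f u else \<zero>\<^bsub>S\<^esub>)" if u: "u \<in> verts E" and v: "v \<in> verts E" for u v
  proof (cases "u = v")
    case True
    then show ?thesis using S.gidemD(3)[OF dec.e_gidem[OF D[OF v]]] by simp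
  next
    case False
    have "f u \<otimes>\<^bsub>S\<^esub> f v = \<zero>\<^bsub>S\<^esub>"
      unfolding f_def
    proof (rule S.finsum_mult_orth)
      fix p p' assume p: "p \<in> ix u" "p' \<in> ix v"
      \<comment> \<open>The tags keep indices of different vertices apart, so the products z r
        vanish.\<close>
      then have "p \<noteq> p'" using False unfolding ix_def by auto
      then show "z p \<otimes>\<^bsub>S\<^esub> r p' = \<zero>\<^bsub>S\<^esub>" using B.b_a[of p p'] p sub u v by auto
    qed (use cv u v in auto)
    then show ?thesis using False by simp
  qed
  have fh: "f (tail E e) \<otimes>\<^bsub>S\<^esub> h e = h e" if e: "e \<in> arcs E" for e
  proof -
    have "f (tail E e) \<otimes>\<^bsub>S\<^esub> h e = (\<Oplus>\<^bsub>S\<^esub>p\<in>ix (head E e). f (tail E e) \<otimes>\<^bsub>S\<^esub> (a e p \<otimes>\<^bsub>S\<^esub> z p))"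
      unfolding h_def by (rule S.finsum_rdistr) (use f_closed c e in auto)
    also have "\<dots> = h e" unfolding h_def
    proof (rule S.finsum_cong'[OF refl])
      fix p assume p: "p \<in> ix (head E e)"
      have "f (tail E e) \<otimes>\<^bsub>S\<^esub> a e p = a e p" using dec.e_a[OF DE[OF e] oix[OF e p]] unfolding a_def .
      then show "f (tail E e) \<otimes>\<^bsub>S\<^esub> (a e p \<otimes>\<^bsub>S\<^esub> z p) = a e p \<otimes>\<^bsub>S\<^esub> z p"
        using c[OF e p] f_closed e by (simp add: S.m_assoc[symmetric])
    qed (use c e in auto)
    finally show ?thesis .
  qed
  have gf: "g e \<otimes>\<^bsub>S\<^esub> f (tail E e) = g e" if e: "e \<in> arcs E" for e
  proof -
    have "g e \<otimes>\<^bsub>S\<^esub> f (tail E e) = (\<Oplus>\<^bsub>S\<^esub>p\<in>ix (head E e). r p \<otimes>\<^bsub>S\<^esub> y e p \<otimes>\<^bsub>S\<^esub> f (tail E e))"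
      unfolding g_def by (rule S.finsum_ldistr) (use f_closed c e in auto)
    also have "\<dots> = g e" unfolding g_def
    proof (rule S.finsum_cong'[OF refl])
      fix p assume p: "p \<in> ix (head E e)"
      have "y e p \<otimes>\<^bsub>S\<^esub> f (tail E e) = y e p" using dec.b_e[OF DE[OF e] oix[OF e p]] unfolding y_def .
      then show "r p \<otimes>\<^bsub>S\<^esub> y e p \<otimes>\<^bsub>S\<^esub> f (tail E e) = r p \<otimes>\<^bsub>S\<^esub> y e p"
        using c[OF e p] f_closed e by (simp add: S.m_assoc)
    qed (use c e in auto)
    finally show ?thesis .
  qed
  have hf: "h e \<otimes>\<^bsub>S\<^esub> f (head E e) = h e" if e: "e \<in> arcs E" for e
  proof -
    have "h e \<otimes>\<^bsub>S\<^esub> f (head E e) = (\<Oplus>\<^bsub>S\<^esub>p\<in>ix (head E e). a e p \<otimes>\<^bsub>S\<^esub> z p \<otimes>\<^bsub>S\<^esub> f (head E e))"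
      unfolding h_def by (rule S.finsum_ldistr) (use f_closed c e in auto)
    also have "\<dots> = h e" unfolding h_def
    proof (rule S.finsum_cong'[OF refl])
      fix p assume p: "p \<in> ix (head E e)"
      have "z p \<otimes>\<^bsub>S\<^esub> f (head E e) = z p" using dec.b_e[OF D p] e by simp
      then show "a e p \<otimes>\<^bsub>S\<^esub> z p \<otimes>\<^bsub>S\<^esub> f (head E e) = a e p \<otimes>\<^bsub>S\<^esub> z p"
        using c[OF e p] f_closed e by (simp add: S.m_assoc)
    qed (use c e in auto)
    finally show ?thesis .
  qed
  have fg: "f (head E e) \<otimes>\<^bsub>S\<^esub> g e = g e" if e: "e \<in> arcs E" for e
  proof -
    have "f (head E e) \<otimes>\<^bsub>S\<^esub> g e = (\<Oplus>\<^bsub>S\<^esub>p\<in>ix (head E e). f (head E e) \<otimes>\<^bsub>S\<^esub> (r p \<otimes>\<^bsub>S\<^esub> y e p))"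
      unfolding g_def by (rule S.finsum_rdistr) (use f_closed c e in auto)
    also have "\<dots> = g e" unfolding g_def
    proof (rule S.finsum_cong'[OF refl])
      fix p assume p: "p \<in> ix (head E e)"
      have "f (head E e) \<otimes>\<^bsub>S\<^esub> r p = r p" using dec.e_a[OF D p] e by simp
      then show "f (head E e) \<otimes>\<^bsub>S\<^esub> (r p \<otimes>\<^bsub>S\<^esub> y e p) = r p \<otimes>\<^bsub>S\<^esub> y e p"
        using c[OF e p] f_closed e by (simp add: S.m_assoc[symmetric])
    qed (use c e in auto)
    finally show ?thesis .
  qed
  have gh: "g e \<otimes>\<^bsub>S\<^esub> h e' = (if e = e' then f (head E e) else \<zero>\<^bsub>S\<^esub>)" if e: "e \<in> arcs E" "e' \<in> arcs E" for e e'
  proof -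
    consider "tail E e \<noteq> tail E e'" | "tail E e = tail E e'" "e \<noteq> e'" | "e = e'" by blast
    then show ?thesis
    proof cases
      case 1
      \<comment> \<open>For different sources, inserting the orthogonal idempotents of the two
        sources gives 0.\<close>
      have "g e \<otimes>\<^bsub>S\<^esub> h e' = (g e \<otimes>\<^bsub>S\<^esub> f (tail E e)) \<otimes>\<^bsub>S\<^esub> (f (tail E e') \<otimes>\<^bsub>S\<^esub> h e')" using gf fh e by simp
      also have "\<dots> = g e \<otimes>\<^bsub>S\<^esub> (f (tail E e) \<otimes>\<^bsub>S\<^esub> f (tail E e')) \<otimes>\<^bsub>S\<^esub> h e'"
        using hc f_closed e by (simp add: S.m_assoc)
      also have "\<dots> = \<zero>\<^bsub>S\<^esub>" using ff[of "tail E e" "tail E e'"] 1 hc e by simp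
      finally show ?thesis using 1 by auto
    next
      case 2
      \<comment> \<open>Different edges with a common source occupy disjoint blocks of one
        decomposition.\<close>
      have "g e \<otimes>\<^bsub>S\<^esub> h e' = \<zero>\<^bsub>S\<^esub>" unfolding g_def h_def
      proof (rule S.finsum_mult_orth)
        fix p p' assume p: "p \<in> ix (head E e)" "p' \<in> ix (head E e')"
        show "y e p \<otimes>\<^bsub>S\<^esub> a e' p' = \<zero>\<^bsub>S\<^esub>"
          using dec.b_a[OF DE[OF e(1)] oix[OF e(1) p(1)], of "(e', p')"] oix[OF e(2) p(2)] 2 unfolding y_def a_def by simp
      qed (use c e in auto)
      then show ?thesis using 2 by simp
    next
      case 3
      \<comment> \<open>Within one block the products y a form the identity matrix, and what remains
        is the sum of the r z, the idempotent of the range.\<close>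
      have "g e \<otimes>\<^bsub>S\<^esub> h e = (\<Oplus>\<^bsub>S\<^esub>p\<in>ix (head E e). r p \<otimes>\<^bsub>S\<^esub> z p)" unfolding g_def h_def
      proof (rule S.finsum_mult_delta[where u=ut])
        fix p p' assume p: "p \<in> ix (head E e)" "p' \<in> ix (head E e)"
        show "y e p \<otimes>\<^bsub>S\<^esub> a e p' = (if p = p' then ut p else \<zero>\<^bsub>S\<^esub>)"
          using dec.b_a[OF DE[OF e(1)] oix[OF e(1) p(1)] oix[OF e(1) p(2)]] unfolding y_def a_def by simp
      next
        show "r p \<otimes>\<^bsub>S\<^esub> ut p = r p" if "p \<in> ix (head E e)" for p using dec.a_u[OF D that] e by simp
      qed (use c e in auto)
      then show ?thesis using 3 unfolding f_def by simp
    qed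
  qed
  have hg: "(\<Oplus>\<^bsub>S\<^esub>e\<in>out_arcs E v. h e \<otimes>\<^bsub>S\<^esub> g e) = f v" if v: "v \<in> verts E" "out_arcs E v \<noteq> {}" for v
  proof -
    \<comment> \<open>Here the products z r form the identity matrix, which leaves the block of e in
      the decomposition of \<open>f v\<close>; the blocks add up to \<open>f v\<close>.\<close>
    have 1: "h e \<otimes>\<^bsub>S\<^esub> g e = (\<Oplus>\<^bsub>S\<^esub>p\<in>ix (head E e). fst (ay v) (e, p) \<otimes>\<^bsub>S\<^esub> snd (ay v) (e, p))" if e: "e \<in> out_arcs E v" for e
    proof -
      have eA: "e \<in> arcs E" "tail E e = v" using e by auto
      have "h e \<otimes>\<^bsub>S\<^esub> g e = (\<Oplus>\<^bsub>S\<^esub>p\<in>ix (head E e). a e p \<otimes>\<^bsub>S\<^esub> y e p)" unfolding g_def h_def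
      proof (rule S.finsum_mult_delta[where u=ut])
        fix p p' assume p: "p \<in> ix (head E e)" "p' \<in> ix (head E e)"
        show "z p \<otimes>\<^bsub>S\<^esub> r p' = (if p = p' then ut p else \<zero>\<^bsub>S\<^esub>)"
          using dec.b_a[OF D p] eA by simp
      next
        show "a e p \<otimes>\<^bsub>S\<^esub> ut p = a e p" if "p \<in> ix (head E e)" for p
          using dec.a_u[OF DE[OF eA(1)] oix[OF eA(1) that]] unfolding a_def by simp
      qed (use c eA in auto)
      then show ?thesis unfolding a_def y_def eA(2) .
    qed
    have cl: "fst (ay v) (e, p) \<in> carrier S" "snd (ay v) (e, p) \<in> carrier S" if "e \<in> out_arcs E v" "p \<in> ix (head E e)" for e p
      using dec.a_closed[OF DO[OF v], of "(e, p)"] dec.b_closed[OF DO[OF v], of "(e, p)"] that unfolding out_ix_def by auto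
    have "(\<Oplus>\<^bsub>S\<^esub>e\<in>out_arcs E v. h e \<otimes>\<^bsub>S\<^esub> g e) =
        (\<Oplus>\<^bsub>S\<^esub>e\<in>out_arcs E v. \<Oplus>\<^bsub>S\<^esub>p\<in>ix (head E e). fst (ay v) (e, p) \<otimes>\<^bsub>S\<^esub> snd (ay v) (e, p))"
      by (rule S.finsum_cong'[OF refl _ 1]) (use cl in \<open>auto intro!: S.finsum_closed\<close>)
    also have "\<dots> = (\<Oplus>\<^bsub>S\<^esub>q\<in>out_ix v. fst (ay v) (fst q, snd q) \<otimes>\<^bsub>S\<^esub> snd (ay v) (fst q, snd q))"
      unfolding out_ix_def by (rule S.finsum_Sigma) (use cl in auto)
    also have "\<dots> = f v" using dec.e_eq[OF DO[OF v]] by simp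
    finally show ?thesis .
  qed
  have one: "(\<Oplus>\<^bsub>S\<^esub>v\<in>verts E. f v) = \<one>\<^bsub>S\<^esub>"
  proof -
    have v: "f v = (\<Oplus>\<^bsub>S\<^esub>i\<in>{..<length (tlist v)}. r (v, i) \<otimes>\<^bsub>S\<^esub> z (v, i))" if "v \<in> verts E" for v
    proof -
      have "ix v = Pair v ` {..<length (tlist v)}" unfolding ix_def by auto
      then show ?thesis unfolding f_def using S.finsum_reindex[of "\<lambda>p. r p \<otimes>\<^bsub>S\<^esub> z p" "Pair v" "{..<length (tlist v)}"] cv[OF that]
        by (simp add: inj_on_def Pi_def ix_def)
    qed
    have cl: "r (v, i) \<in> carrier S" "z (v, i) \<in> carrier S" if "v \<in> verts E" "i < length (tlist v)" for v i
      using cv[OF that(1), of "(v, i)"] that(2) unfolding ix_def by auto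
    have "(\<Oplus>\<^bsub>S\<^esub>v\<in>verts E. f v) = (\<Oplus>\<^bsub>S\<^esub>v\<in>verts E. \<Oplus>\<^bsub>S\<^esub>i\<in>{..<length (tlist v)}. r (v, i) \<otimes>\<^bsub>S\<^esub> z (v, i))"
      by (rule S.finsum_cong'[OF refl _ v]) (use cl in \<open>auto intro!: S.finsum_closed\<close>)
    also have "\<dots> = (\<Oplus>\<^bsub>S\<^esub>p\<in>ixs. r (fst p, snd p) \<otimes>\<^bsub>S\<^esub> z (fst p, snd p))"
      unfolding ixs_Sigma by (rule S.finsum_Sigma) (use cl in auto)
    also have "\<dots> = \<one>\<^bsub>S\<^esub>" using B.e_eq by simp
    finally show ?thesis .
  qed
  define \<gamma> where "\<gamma> = case_lpa_gen f h g"
  have "leavitt_family S E \<gamma>"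
  proof (intro leavitt_family.intro S.grring_axioms leavitt_family_axioms.intro)
    fix x assume x: "x \<in> lpa_gens E"
    show "\<gamma> x \<in> grade S (gen_deg x)"
    proof (cases x)
      case (Vert v) then show ?thesis using x S.gidemD(2)[OF dec.e_gidem[OF D[of v]]] unfolding \<gamma>_def by (auto simp: lpa_gens_def)
    qed (use x h_grade g_grade in \<open>auto simp: \<gamma>_def lpa_gens_def\<close>)
  qed (auto simp: \<gamma>_def ff fh hf fg gf gh hg one)
  then show ?thesis by (rule that) (use fdec in \<open>simp add: \<gamma>_def\<close>)
qed

end

section \<open>Injectivity of graded homomorphisms\<close>

lemma (in lpa) graded_kernel_trivial:
  assumes S: "ring S" and psi: "\<psi> \<in> ring_hom R S"
    and vt0: "\<And>v. v \<in> verts E \<Longrightarrow> \<psi> (vt v) = \<zero>\<^bsub>S\<^esub> \<Longrightarrow> vt v = \<zero>"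
    and a: "a \<in> grade R n" "\<psi> a = \<zero>\<^bsub>S\<^esub>"
  shows "a = \<zero>"
proof -
  interpret S: ring S by (rule S)
  have pm: "\<psi> (x \<otimes> y) = \<psi> x \<otimes>\<^bsub>S\<^esub> \<psi> y" and pc: "\<psi> x \<in> carrier S" if "x \<in> carrier R" "y \<in> carrier R" for x y
    using psi that unfolding ring_hom_def by auto
  have ac: "a \<in> carrier R" using a grade_carrier by blast
  \<comment> \<open>The ring as a module over itself with the vertices as basis, so that refinement
    applies to ring elements.\<close>
  interpret B: vbased R Z E gm "corner R \<one>" "verts E" vt "\<lambda>v. v" "\<lambda>_. 0"
    by (rule vbasedI[OF gmod_corner[OF one_gidem] idec_gbasis_corner[OF idec_one]])
  have "vt w \<otimes> a = \<zero>" if w: "w \<in> verts E" for w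
  proof -
    have "a \<in> grade (corner R \<one>) n" using a ac by simp
    from eventually_happens[OF B.eventually_refinement[OF this w]]
    obtain N where N: "\<And>p. p \<in> paths E (nat (n + N)) w \<Longrightarrow>
        gp w p \<odot>\<^bsub>corner R \<one>\<^esub> a \<in> zsp R Z (corner R \<one>) (B.refI N) B.refx B.reft (vt (rng E w p), - int (length p) + n)"
      by auto
    \<comment> \<open>The A are dual to the refined basis; they play the part of the paths q in the
      expansion into ghost paths q*.\<close>
    obtain A where A: "idec R \<one> (B.refI N) A B.refx (\<lambda>q. fst (B.reft q)) (\<lambda>q. snd (B.reft q))"
      using gbasis_corner_idec[OF one_gidem B.ref_gbasis] by blast
    interpret D: dec R \<one> "B.refI N" A B.refx "\<lambda>q. fst (B.reft q)" "\<lambda>q. snd (B.reft q)"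
      by (intro dec.intro dec_axioms.intro A grring_axioms)
    have gpa: "gp w p \<otimes> a = \<zero>" if p: "p \<in> paths E (nat (n + N)) w" for p
    proof -
      have gpc: "gp w p \<in> carrier R" using p paths_iff[OF w] by auto
      obtain c where c: "\<And>q. q \<in> B.refI N \<Longrightarrow> c q \<in> Z"
        and "\<And>q. q \<in> B.refI N \<Longrightarrow> c q \<noteq> \<zero> \<Longrightarrow> B.reft q = (vt (rng E w p), - int (length p) + n)"
        and eq0: "gp w p \<odot>\<^bsub>corner R \<one>\<^esub> a = (\<Oplus>\<^bsub>corner R \<one>\<^esub>q\<in>B.refI N. c q \<odot>\<^bsub>corner R \<one>\<^esub> B.refx q)"
        by (rule zspE[OF N[OF p]]) (rule that)
      have eq: "gp w p \<otimes> a = (\<Oplus>\<^bsub>corner R \<one>\<^esub>q\<in>B.refI N. c q \<otimes> B.refx q)" using eq0 by simp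
      have cc: "c q \<in> carrier R" if "q \<in> B.refI N" for q using c[OF that] Z_carrier by blast
      have eq': "gp w p \<otimes> a = (\<Oplus>q\<in>B.refI N. c q \<otimes> B.refx q)"
        unfolding eq by (subst finsum_corner) (use cc D.b_closed in auto)
      have "c q \<otimes> B.refx q = \<zero>" if q: "q \<in> B.refI N" for q
      proof (cases "c q = \<zero>")
        case True then show ?thesis using D.b_closed[OF q] by simp
      next
        case False
        have "gp w p \<otimes> a \<otimes> A q = (\<Oplus>q'\<in>B.refI N. c q' \<otimes> B.refx q' \<otimes> A q)"
          unfolding eq' by (rule finsum_ldistr) (use D.fin cc D.b_closed D.a_closed q in auto)
        also have "\<dots> = c q \<otimes> B.refx q \<otimes> A q"
          by (rule finsum_eq_single[OF D.fin q])
            (use cc D.b_closed D.a_closed D.u_closed[OF q] D.b_a q in \<open>auto simp: m_assoc\<close>)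
        also have "\<dots> = c q \<otimes> fst (B.reft q)" using cc D.b_closed D.a_closed D.b_a q by (simp add: m_assoc)
        finally have e: "gp w p \<otimes> a \<otimes> A q = c q \<otimes> fst (B.reft q)" .
        have uc: "fst (B.reft q) \<in> carrier R" using D.u_closed[OF q] .
        have "\<psi> (gp w p \<otimes> a \<otimes> A q) = \<zero>\<^bsub>S\<^esub>"
          using pm[of "gp w p \<otimes> a" "A q"] pm[of "gp w p" a] pc[of "gp w p"] pc[of "A q"] a(2) gpc ac D.a_closed[OF q] by simp
        then have 0: "\<psi> (c q) \<otimes>\<^bsub>S\<^esub> \<psi> (fst (B.reft q)) = \<zero>\<^bsub>S\<^esub>" unfolding e using pm[OF cc[OF q] uc] by simp
        obtain d where d: "d \<in> Z" "c q \<otimes> d = \<one>" using Z_inv[OF c[OF q] False] by blast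
        have dc: "d \<in> carrier R" using d Z_carrier by blast
        \<comment> \<open>The scalar \<open>c q\<close> is invertible, so if its product with the
          vertex is mapped to 0, then so is the vertex.\<close>
        have "fst (B.reft q) = d \<otimes> (c q \<otimes> fst (B.reft q))"
          using d Z_central[OF d(1) cc[OF q]] cc[OF q] uc dc by (simp add: m_assoc[symmetric])
        then have "\<psi> (fst (B.reft q)) = \<psi> d \<otimes>\<^bsub>S\<^esub> (\<psi> (c q) \<otimes>\<^bsub>S\<^esub> \<psi> (fst (B.reft q)))"
          using pm[OF dc, of "c q \<otimes> fst (B.reft q)"] pm[OF cc[OF q] uc] cc[OF q] uc by simp
        then have z: "\<psi> (fst (B.reft q)) = \<zero>\<^bsub>S\<^esub>" using 0 pc[OF dc dc] by simp
        have qv: "rng E (fst q) (snd q) \<in> verts E"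
          using q vpath_rng paths_iff unfolding B.refI_def by auto
        have "fst (B.reft q) = \<zero>" using vt0[OF qv] z unfolding B.reft_def by simp
        \<comment> \<open>A refined basis element is fixed by its idempotent, which is now known to
          vanish.\<close>
        then have "B.refx q = \<zero>" using D.u_b[OF q] D.b_closed[OF q] by simp
        then show ?thesis using cc[OF q] by simp
      qed
      then show ?thesis unfolding eq' by (rule finsum_eq_zero)
    qed
    have c: "gp w p \<in> carrier R" "pe w p \<in> carrier R" if "p \<in> paths E (nat (n + N)) w" for p
      using that paths_iff[OF w] by auto
    \<comment> \<open>Expanding w into paths of the length used above turns the vanishing of all p*
      a into w a = 0.\<close>
    have "vt w \<otimes> a = (\<Oplus>p\<in>paths E (nat (n + N)) w. pe w p \<otimes> gp w p \<otimes> a)"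
      unfolding vt_paths[OF w, of "nat (n + N)"] by (rule finsum_ldistr) (use finite_paths ac c w in auto)
    also have "\<dots> = \<zero>" by (rule finsum_eq_zero) (use gpa c ac in \<open>simp add: m_assoc\<close>)
    finally show ?thesis .
  qed
  moreover have "\<one> \<otimes> a = (\<Oplus>v\<in>verts E. vt v \<otimes> a)"
    unfolding one_vt by (rule finsum_ldistr) (use ac in auto)
  ultimately show ?thesis using ac by (simp add: finsum_eq_zero)
qed

text \<open>The images of the components of a kernel element are the components of 0, so each
  component lies in the kernel.\<close>

lemma (in grring) inj_on_graded:
  assumes S: "grring S" and psi: "\<psi> \<in> ring_hom R S" and gr: "\<And>a n. a \<in> grade R n \<Longrightarrow> \<psi> a \<in> grade S n"
    and ker: "\<And>a n. a \<in> grade R n \<Longrightarrow> \<psi> a = \<zero>\<^bsub>S\<^esub> \<Longrightarrow> a = \<zero>"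
  shows "inj_on \<psi> (carrier R)"
proof -
  interpret S: grring S by (rule S)
  have pa: "\<psi> (x \<oplus> y) = \<psi> x \<oplus>\<^bsub>S\<^esub> \<psi> y" and pc: "\<psi> x \<in> carrier S" if "x \<in> carrier R" "y \<in> carrier R" for x y
    using psi that unfolding ring_hom_def by auto
  have p0: "\<psi> \<zero> = \<zero>\<^bsub>S\<^esub>" using pa[of \<zero> \<zero>] pc[of \<zero> \<zero>] by simp
  have k: "a = \<zero>" if a: "a \<in> carrier R" "\<psi> a = \<zero>\<^bsub>S\<^esub>" for a
  proof -
    let ?B = "{n. proj n a \<noteq> \<zero>}"
    have "\<psi> a = \<psi> (\<Oplus>n\<in>?B. proj n a)" using proj_props(3)[OF a(1)] by simp
    also have "\<dots> = (\<Oplus>\<^bsub>S\<^esub>n\<in>?B. \<psi> (proj n a))"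
      by (rule finsum_hom[OF abelian_group_axioms S.abelian_group_axioms]) (use pc pa proj_closed[OF a(1)] in auto)
    finally have e: "\<zero>\<^bsub>S\<^esub> = (\<Oplus>\<^bsub>S\<^esub>n\<in>?B. \<psi> (proj n a))" using a(2) by simp
    have "\<psi> (proj n a) = \<zero>\<^bsub>S\<^esub>" for n
    proof -
      have "S.proj n \<zero>\<^bsub>S\<^esub> = \<psi> (proj n a)"
        by (rule S.proj_eqI[where A="?B"]) (use gr proj_props[OF a(1)] p0 e in auto)
      then show ?thesis using S.proj_grade[OF S.grade_zero, of n n] by simp
    qed
    then have "proj n a = \<zero>" for n using ker[OF proj_props(1)[OF a(1)]] by blast
    then show "a = \<zero>" using proj_props(3)[OF a(1)] by simp
  qed
  show ?thesis
  proof (rule inj_onI)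
    fix x y assume x: "x \<in> carrier R" and y: "y \<in> carrier R" and e: "\<psi> x = \<psi> y"
    have "\<psi> (x \<ominus> y) \<oplus>\<^bsub>S\<^esub> \<psi> y = \<psi> (x \<ominus> y \<oplus> y)" using pa[of "x \<ominus> y" y] x y by simp
    also have "x \<ominus> y \<oplus> y = x" using x y by (simp add: minus_eq a_assoc l_neg)
    finally have "\<psi> (x \<ominus> y) \<oplus>\<^bsub>S\<^esub> \<psi> y = \<zero>\<^bsub>S\<^esub> \<oplus>\<^bsub>S\<^esub> \<psi> y" using e pc y by simp
    then have "\<psi> (x \<ominus> y) = \<zero>\<^bsub>S\<^esub>" using pc[of "x \<ominus> y" y] pc[OF y y] x y by simp
    then have "x \<ominus> y = \<zero>" using k[of "x \<ominus> y"] x y by simp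
    then show "x = y" using x y by (metis \<open>x \<ominus> y \<oplus> y = x\<close> l_zero)
  qed
qed

section \<open>The induced map on graded K-groups\<close>

locale k0_lift = k0_hom R ZR E gE S ZS F gF \<phi>
  for R :: "('k, 'r, 'm) gmodule_scheme" and ZR and E :: "('v, 'e) pre_digraph" and gE
    and S :: "('k, 's, 'n) gmodule_scheme" and ZS and F :: "('w, 'f) pre_digraph" and gF and \<phi> +
  fixes \<psi> :: "'r \<Rightarrow> 's" and r z :: "'v \<times> nat \<Rightarrow> 's"
  assumes psi: "\<psi> \<in> ring_hom R S" and psi_grade: "a \<in> grade R n \<Longrightarrow> \<psi> a \<in> grade S n"
    and psi_vt: "v \<in> verts E \<Longrightarrow> idec S (\<psi> (gE (Vert v))) (ix v) r z ut (\<lambda>p. snd (tp p))"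
begin

text \<open>Base change turns a basis element over v into one over \<psi> v, and the decomposition
  of \<psi> v of type \<open>tv v\<close> refines it. The degrees add up to those prescribed by
  \<open>tau\<close>.\<close>

lemma hbas_tensor:
  assumes P: "gmod R P" and T: "R.vmset T" "hbas R P (R.vtm T)"
  shows "gmod S (gr_tensor R S \<psi> P)" "hbas S (gr_tensor R S \<psi> P) (S.vtm (tau T))"
proof -
  obtain I :: "nat set" and x v d where B: "vbased R ZR E gE P I x v d"
    and Te: "T = image_mset (\<lambda>i. (v i, d i)) (mset_set I)"
    using R.hbas_vbased[OF P T] by blast
  interpret B: vbased R ZR E gE P I x v d by (rule B)
  interpret T: tensor R S P \<psi>
    by (intro tensor.intro tensor_axioms.intro P S.grring_axioms psi psi_grade)
  show "gmod S T.T" by (rule T.gmod_tensor)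
  then interpret TM: gmod S T.T .
  have "gbasis S T.T (Sigma I (\<lambda>i. ix (v i))) (\<lambda>p. z (snd p) \<odot>\<^bsub>T.T\<^esub> T.tens \<one>\<^bsub>S\<^esub> (x (fst p)))
      (\<lambda>p. ut (snd p)) (\<lambda>p. snd (tp (snd p)) + d (fst p))"
    by (rule TM.gbasis_refine[OF T.gbasis_tensor[OF B.gbasis] psi_vt[OF B.vI]])
  then have h: "hbas S T.T (image_mset (\<lambda>p. (ut (snd p), snd (tp (snd p)) + d (fst p))) (mset_set (Sigma I (\<lambda>i. ix (v i)))))"
    by (rule TM.hbasI)
  have "tau T = (\<Sum>i\<in>I. sh (- d i) (tv (v i)))"
    unfolding tau_def Te by (simp add: image_mset.compositionality comp_def sum_unfold_sum_mset)
  moreover have "S.vtm (\<Sum>i\<in>B. sh (- d i) (tv (v i))) = (\<Sum>i\<in>B. S.vtm (sh (- d i) (tv (v i))))" for B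
    by (induction B rule: infinite_finite_induct) (simp_all add: S.vtm_add, simp_all add: S.vtm_def)
  ultimately have "S.vtm (tau T) = (\<Sum>i\<in>I. S.vtm (sh (- d i) (tv (v i))))" by simp
  also have "\<dots> = image_mset (\<lambda>p. (ut (snd p), snd (tp (snd p)) + d (fst p))) (mset_set (Sigma I (\<lambda>i. ix (v i))))"
    unfolding ix_vtm by (subst image_mset_Sigma) (use B.fin in auto)
  finally show "hbas S T.T (S.vtm (tau T))" using h by simp
qed

lemma Vgr_map_V: assumes T: "R.vmset T" shows "Vgr_map R S \<psi> (R.V T) = S.V (tau T)"
proof -
  have "gr_class S (gr_tensor R S \<psi> P) = S.V (tau T)" if "P \<in> R.V T" for P
  proof -
    have P: "gmod R P" "hbas R P (R.vtm T)" using that R.Cls_gmod unfolding R.V_def by blast+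
    show ?thesis by (rule S.gr_class_V) (rule hbas_tensor[OF P(1) T P(2)])+
  qed
  then show ?thesis unfolding Vgr_map_def using R.V_nonempty[OF T] by blast
qed

text \<open>All representatives (A, B) of X contribute the same formal difference, which
  \<open>phi_K\<close> identifies as the value of \<phi>.\<close>

lemma K0gr_map_eq: assumes "X \<in> carrier (K0gr R)" shows "K0gr_map R S \<psi> X = \<phi> X"
proof -
  obtain T U where X: "R.vmset T" "R.vmset U" "X = R.K T U" using assms by (rule R.K0gr_cases)
  have "gc_class (Vgr S) (Vgr_map R S \<psi> A) (Vgr_map R S \<psi> B) = \<phi> X" if AB: "(A, B) \<in> R.K T U" for A B
  proof -
    obtain T' U' where T': "R.vmset T'" "R.vmset U'" "A = R.V T'" "B = R.V U'" "R.K T' U' = R.K T U"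
      by (rule R.K_mem[OF AB X(1,2)])
    show ?thesis unfolding T'(3,4) Vgr_map_V[OF T'(1)] Vgr_map_V[OF T'(2)] S.K_def[symmetric]
      using phi_K[OF T'(1,2)] T'(5) X(3) by simp
  qed
  then show ?thesis unfolding K0gr_map_def X(3) using R.K_self[OF X(1,2)] X(3) by fast
qed

text \<open>If \<psi> v = 0, the zero idempotent has a decomposition of type \<open>tv v\<close> and
  also the empty one, so \<open>tv v\<close> has class 0. Thus \<phi> sends the class of v to 0, and
  injectivity makes the left ideal of v trivial.\<close>

lemma vt_faithful:
  assumes inj: "inj_on \<phi> (carrier (K0gr R))" and v: "v \<in> verts E" and 0: "\<psi> (gE (Vert v)) = \<zero>\<^bsub>S\<^esub>"
  shows "gE (Vert v) = \<zero>\<^bsub>R\<^esub>"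
proof (rule R.vt_zeroI[OF v])
  have z: "gidem S \<zero>\<^bsub>S\<^esub>" unfolding gidem_def by simp
  note g = S.gmod_corner[OF z]
  have "hbas S (corner S \<zero>\<^bsub>S\<^esub>) (S.vtm (sh 0 (tv v)))"
    unfolding ix_vtm using gmod.hbasI[OF g S.idec_gbasis_corner[OF psi_vt[OF v, unfolded 0]]] by simp
  then have "hbas S (corner S \<zero>\<^bsub>S\<^esub>) (S.vtm (tv v))" unfolding sh_def by simp
  moreover have "idec S \<zero>\<^bsub>S\<^esub> ({} :: nat set) undefined undefined undefined undefined" unfolding idec_def by simp
  then have "hbas S (corner S \<zero>\<^bsub>S\<^esub>) (S.vtm {#})"
    using gmod.hbasI[OF g S.idec_gbasis_corner] unfolding S.vtm_def by fastforce
  ultimately have "S.V (tv v) = S.V {#}" using S.gr_class_V[OF g] by blast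
  then have "S.K (tv v) {#} = S.K {#} {#}" by (intro S.K_eqI) (use tv(1)[OF v] in simp_all)
  then have "\<phi> (R.K {#(v, 0)#} {#}) = \<phi> (R.K {#} {#})" using tv(2)[OF v] tau[of "{#}"] tau_empty by simp
  then have "R.K {#(v, 0)#} {#} = R.K {#} {#}" by (rule inj_onD[OF inj]) (use v in auto)
  then have "R.V ({#(v, 0)#} + {#}) = R.V ({#} + {#})" by (rule R.K_eqD[rotated -1]) (use v in auto)
  then show "R.V {#(v, 0)#} = R.V {#}" by simp
qed

lemma psi_inj: assumes "inj_on \<phi> (carrier (K0gr R))" shows "inj_on \<psi> (carrier R)"
  by (rule R.inj_on_graded[OF S.grring_axioms psi psi_grade])
    (assumption, rule R.graded_kernel_trivial[OF S.ring_axioms psi vt_faithful[OF assms]])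

end

text \<open>The condition concerns the type of the elements. It is a type of sets and so has two
  members even when the algebra is zero.\<close>

lemma (in lpa_field) lpa_nontriv_L: "lpa_nontriv L (zc ` carrier K) E gm"
proof (intro lpa_nontriv.intro lpa_L lpa_nontriv_axioms.intro)
  show "\<exists>X Y :: (('v, 'e) lpa_gen list \<Rightarrow> 'k) set. X \<noteq> Y"
    by (intro exI[of _ "{}"] exI[of _ UNIV]) simp
qed

theorem corollary9p6:
  fixes K :: "('k, 'c) ring_scheme"
    and E :: "('v, 'e) pre_digraph"
    and F :: "('w, 'f) pre_digraph"
    and \<phi> :: "(('v, 'e) lpa_gen list \<Rightarrow> 'k) set K0_elem \<Rightarrow> (('w, 'f) lpa_gen list \<Rightarrow> 'k) set K0_elem"
  assumes "field K" and "fin_digraph E" and "fin_digraph F"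
    and "\<phi> \<in> laurent_module_hom (K0gr (leavitt_path_algebra K E)) (K0gr (leavitt_path_algebra K F))"
    and "\<phi> ` K0gr_pos (leavitt_path_algebra K E) \<subseteq> K0gr_pos (leavitt_path_algebra K F)"
    and "\<phi> (K0gr_class (leavitt_path_algebra K E) (gr_regular (leavitt_path_algebra K E))) =
      K0gr_class (leavitt_path_algebra K F) (gr_regular (leavitt_path_algebra K F))"
  shows "\<exists>\<psi> \<in> gr_alg_hom K (leavitt_path_algebra K E) (leavitt_path_algebra K F).
    (\<forall>X \<in> carrier (K0gr (leavitt_path_algebra K E)).
       K0gr_map (leavitt_path_algebra K E) (leavitt_path_algebra K F) \<psi> X = \<phi> X) \<and>
    (inj_on \<phi> (carrier (K0gr (leavitt_path_algebra K E))) \<longrightarrow>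
     inj_on \<psi> (carrier (leavitt_path_algebra K E)))"
proof -
  interpret E: lpa_field K E by (intro lpa_field.intro assms)
  interpret F: lpa_field K F by (intro lpa_field.intro assms)
  interpret k0_hom E.L "E.zc ` carrier K" E E.gm F.L "F.zc ` carrier K" F F.gm \<phi>
    by (intro k0_hom.intro k0_hom_axioms.intro E.lpa_nontriv_L F.lpa_nontriv_L assms)
  obtain \<gamma> r z where fam: "leavitt_family F.L E \<gamma>"
    and dec: "\<And>v. v \<in> verts E \<Longrightarrow> idec F.L (\<gamma> (Vert v)) (ix v) r z ut (\<lambda>p. snd (tp p))"
    by (rule leavitt_family_exists) (rule that)
  \<comment> \<open>The scalars of the source act through the scalars of the target, which makes the
    lifted homomorphism K-linear.\<close>
  interpret lift: lpa_rep K E F.L \<gamma> F.zc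
    by (intro lpa_rep.intro lpa_rep_axioms.intro E.lpa_field_axioms fam F.zc_grade F.zc_add F.zc_mult F.zc_one F.zc_central)
  interpret lift: k0_lift E.L "E.zc ` carrier K" E E.gm F.L "F.zc ` carrier K" F F.gm \<phi> lift.lift_hom r z
  proof (intro k0_lift.intro k0_lift_axioms.intro k0_hom_axioms lift.lift_ring_hom lift.lift_grade)
    fix v assume "v \<in> verts E"
    then show "idec F.L (lift.lift_hom (E.gm (Vert v))) (ix v) r z ut (\<lambda>p. snd (tp p))"
      using dec lift.lift_gm[of "Vert v"] by simp
  qed
  have "lift.lift_hom \<in> gr_alg_hom K E.L F.L"
    unfolding gr_alg_hom_def
  proof (intro CollectI conjI ballI allI lift.lift_ring_hom)
    fix c X assume c: "c \<in> carrier K" and X: "X \<in> carrier E.L"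
    have "lift.lift_hom X \<in> carrier F.L" by (rule ring_hom_closed[OF lift.lift_ring_hom X])
    then show "lift.lift_hom (c \<odot>\<^bsub>E.L\<^esub> X) = c \<odot>\<^bsub>F.L\<^esub> lift.lift_hom X"
      using lift.lift_smult[OF c X] F.smult_L[OF c] by simp
  qed (use lift.lift_grade in blast)
  then show ?thesis using lift.K0gr_map_eq lift.psi_inj by (intro bexI[of _ lift.lift_hom] conjI ballI impI)
qed

end
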